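(* Let $\{\xi_t\}_{t\ge0}$ be a stationary Markov process with invariant measure $\pi$ and normal infinitesimal generator $L$, let $g\in\mathbb{L}_0^2(\pi)$, $g\ne0$, let $\nu=\nu_g$ be the transition spectral measure associated with $L$ and $g$, and let $S_T(g)=\int_0^Tg(\xi_s)\,\mathrm{d}s$. Let $\mathbb{H}^-:=\{z\in\mathbb{C}:\Re(z)\le0\}$, and for $z\in\mathbb{H}^-$ let $(B_t^z)_{t\ge0}$ be standard planar Brownian motion in $\mathbb{C}$ started at $z$. Let $Z$ be a random point of $\mathbb{H}^-$ with distribution $\nu/\nu(\mathbb{H}^-)$, independent of the Brownian motion, and let $\tau_{\mathbb{H}^-}^Z:=\inf\{t\ge0:B_t^Z\notin\mathbb{H}^-\}$. Let $\alpha\in(0,2)$ and let $h$ be slowly varying at infinity. Then the following are equivalent: (i) $\mathrm{var}(S_T(g))\sim T^\alpha h(T)$ as $T\to\infty$; (ii) $\mathrm{P}\big\{B^Z_{\tau^Z_{\mathbb{H}^-}}\in(-\mathrm{i}x,\mathrm{i}x)\big\}\sim C(\alpha)x^{2-\alpha}h(1/x)/\nu(\mathbb{H}^-)$ as $x\to0^+$.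
   Context: $\{\xi_t\}_{t\ge0}$ is a stationary Markov process with values in a measurable space $(S,\mathcal{A})$ and stationary law $\pi$, progressively measurable with respect to a filtration $\{\mathcal{F}_t\}$ for which it satisfies the Markov property. The contraction semigroup $T_tg(x)=\mathbb{E}[g(\xi_t)\mid\xi_0=x]$ is assumed strongly continuous on $L^2(\pi)$; $T_t=e^{Lt}$ with $L$ the (possibly unbounded) infinitesimal generator, assumed normal, so its spectrum lies in $\{\Re(z)\le0\}$. $\mathbb{L}_0^2(\pi)$ is the set of real measurable $g$ with $\int g^2\mathrm{d}\pi<\infty$ and $\int g\,\mathrm{d}\pi=0$. The transition spectral measure $\nu=\nu_g$ is the finite measure on $\mathbb{H}^-$ given by the spectral theorem for $L$ and $g$; it satisfies $\mathrm{cov}(g(\xi_0),g(\xi_t))=\langle g,T_tg\rangle=\int_{\Re(z)\le0}e^{zt}\nu(\mathrm{d}z)$, $t\ge0$. $(-\mathrm{i}x,\mathrm{i}x)=\{\mathrm{i}y:|y|<x\}$. $C(\alpha):=\Gamma(1+\alpha)\sin(\alpha\pi/2)/[\pi(2-\alpha)]$. A continuous function $h:(0,\infty)\to(0,\infty)$ is slowly varying at infinity if $h(st)/h(t)\to1$ as $t\to\infty$ for every $s>0$. $a\sim b$ means that the ratio tends to $1$. *)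

theory Defs
  imports "HOL-Probability.Probability" "HOL-Library.Landau_Symbols"
begin

section \<open>The complex Hilbert space of square-integrable functions\<close>

text \<open>
  Elements of the Hilbert space are represented by measurable functions, identified up to
  almost-everywhere equality. Unbounded operators are represented by their graphs, which are
  closed under almost-everywhere equality in both components.
\<close>

definition cL2 :: "'s measure \<Rightarrow> ('s \<Rightarrow> complex) set" where
  "cL2 \<mu> = {f \<in> borel_measurable \<mu>. integrable \<mu> (\<lambda>x. (cmod (f x))\<^sup>2)}"

definition cL2_inner :: "'s measure \<Rightarrow> ('s \<Rightarrow> complex) \<Rightarrow> ('s \<Rightarrow> complex) \<Rightarrow> complex" where
  "cL2_inner \<mu> f k = (LINT x|\<mu>. f x * cnj (k x))"

definition cL2_norm :: "'s measure \<Rightarrow> ('s \<Rightarrow> complex) \<Rightarrow> real" where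
  "cL2_norm \<mu> f = sqrt (LINT x|\<mu>. (cmod (f x))\<^sup>2)"

definition L2_0 :: "'s measure \<Rightarrow> ('s \<Rightarrow> real) set" where
  "L2_0 \<mu> = {g \<in> borel_measurable \<mu>. integrable \<mu> (\<lambda>x. (g x)\<^sup>2) \<and> (LINT x|\<mu>. g x) = 0}"

type_synonym 's graph = "(('s \<Rightarrow> complex) \<times> ('s \<Rightarrow> complex)) set"

definition densely_defined :: "'s measure \<Rightarrow> 's graph \<Rightarrow> bool" where
  "densely_defined \<mu> G \<longleftrightarrow>
    (\<forall>f\<in>cL2 \<mu>. \<forall>e>0. \<exists>u\<in>Domain G. cL2_norm \<mu> (\<lambda>x. u x - f x) < e)"

definition closed_graph :: "'s measure \<Rightarrow> 's graph \<Rightarrow> bool" where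
  "closed_graph \<mu> G \<longleftrightarrow>
    (\<forall>u v f k. (\<forall>n::nat. (u n, v n) \<in> G) \<and> f \<in> cL2 \<mu> \<and> k \<in> cL2 \<mu> \<and>
      (\<lambda>n. cL2_norm \<mu> (\<lambda>x. u n x - f x)) \<longlonglongrightarrow> 0 \<and>
      (\<lambda>n. cL2_norm \<mu> (\<lambda>x. v n x - k x)) \<longlonglongrightarrow> 0 \<longrightarrow> (f, k) \<in> G)"

definition adjoint_graph :: "'s measure \<Rightarrow> 's graph \<Rightarrow> 's graph" where
  "adjoint_graph \<mu> G =
    {(f, k). f \<in> cL2 \<mu> \<and> k \<in> cL2 \<mu> \<and> (\<forall>(u, v)\<in>G. cL2_inner \<mu> v f = cL2_inner \<mu> u k)}"

definition normal_graph :: "'s measure \<Rightarrow> 's graph \<Rightarrow> bool" where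
  "normal_graph \<mu> G \<longleftrightarrow> densely_defined \<mu> G \<and> closed_graph \<mu> G \<and>
    G O adjoint_graph \<mu> G = adjoint_graph \<mu> G O G"

section \<open>Spectral resolutions\<close>

text \<open>
  The measurable space \<open>\<Sigma>\<close> supplies only the sets on which \<open>E\<close> is defined.
  Linearity of each \<open>E A\<close> and its compatibility with almost-everywhere equality
  follow from the symmetry clause.
\<close>

definition projection_valued_measure ::
  "'s measure \<Rightarrow> 'z measure \<Rightarrow> ('z set \<Rightarrow> ('s \<Rightarrow> complex) \<Rightarrow> 's \<Rightarrow> complex) \<Rightarrow> bool" where
  "projection_valued_measure \<mu> \<Sigma> E \<longleftrightarrow>
    (\<forall>A\<in>sets \<Sigma>. \<forall>f\<in>cL2 \<mu>. E A f \<in> cL2 \<mu>) \<and>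
    (\<forall>A\<in>sets \<Sigma>. \<forall>f\<in>cL2 \<mu>. \<forall>k\<in>cL2 \<mu>. cL2_inner \<mu> (E A f) k = cL2_inner \<mu> f (E A k)) \<and>
    (\<forall>A\<in>sets \<Sigma>. \<forall>B\<in>sets \<Sigma>. \<forall>f\<in>cL2 \<mu>. AE x in \<mu>. E (A \<inter> B) f x = E A (E B f) x) \<and>
    (\<forall>f\<in>cL2 \<mu>. AE x in \<mu>. E {} f x = 0) \<and>
    (\<forall>f\<in>cL2 \<mu>. AE x in \<mu>. E (space \<Sigma>) f x = f x) \<and>
    (\<forall>A. range A \<subseteq> sets \<Sigma> \<and> disjoint_family A \<longrightarrow>
      (\<forall>f\<in>cL2 \<mu>. \<forall>k\<in>cL2 \<mu>.
        (\<lambda>n::nat. cL2_inner \<mu> (E (A n) f) k) sums cL2_inner \<mu> (E (\<Union>n. A n) f) k))"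

definition pvm_measure ::
  "'s measure \<Rightarrow> 'z measure \<Rightarrow> ('z set \<Rightarrow> ('s \<Rightarrow> complex) \<Rightarrow> 's \<Rightarrow> complex)
    \<Rightarrow> ('s \<Rightarrow> complex) \<Rightarrow> 'z measure" where
  "pvm_measure \<mu> \<Sigma> E f =
    measure_of (space \<Sigma>) (sets \<Sigma>) (\<lambda>A. ennreal (Re (cL2_inner \<mu> (E A f) f)))"

text \<open>
  The integral of \<open>\<phi>\<close> against the complex measure mapping \<open>A\<close> to
  \<open>cL2_inner \<mu> (E A f) k\<close>, written out by polarization.
\<close>

definition pvm_integral ::
  "'s measure \<Rightarrow> 'z measure \<Rightarrow> ('z set \<Rightarrow> ('s \<Rightarrow> complex) \<Rightarrow> 's \<Rightarrow> complex)
    \<Rightarrow> ('z \<Rightarrow> complex) \<Rightarrow> ('s \<Rightarrow> complex) \<Rightarrow> ('s \<Rightarrow> complex) \<Rightarrow> complex" where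
  "pvm_integral \<mu> \<Sigma> E \<phi> f k =
    (1 / 4) * (\<Sum>j<4. \<i> ^ j * (LINT z|pvm_measure \<mu> \<Sigma> E (\<lambda>x. f x + \<i> ^ j * k x). \<phi> z))"

text \<open>
  The operator with graph \<open>G\<close> is the integral of the identity with respect to \<open>E\<close>.
  Since its domain is dense, testing against the domain determines its values; all
  the integrals involved converge absolutely there.
\<close>

definition spectral_resolution ::
  "'s measure \<Rightarrow> complex measure \<Rightarrow> 's graph
    \<Rightarrow> (complex set \<Rightarrow> ('s \<Rightarrow> complex) \<Rightarrow> 's \<Rightarrow> complex) \<Rightarrow> bool" where
  "spectral_resolution \<mu> \<Sigma> G E \<longleftrightarrow>
    projection_valued_measure \<mu> \<Sigma> E \<and>
    Domain G = {f \<in> cL2 \<mu>. integrable (pvm_measure \<mu> \<Sigma> E f) (\<lambda>z. (cmod z)\<^sup>2)} \<and>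
    (\<forall>(f, k)\<in>G. \<forall>u\<in>Domain G. cL2_inner \<mu> k u = pvm_integral \<mu> \<Sigma> E (\<lambda>z. z) f u)"

definition Hminus :: "complex set" where
  "Hminus = {z. Re z \<le> 0}"

definition Hminus_borel :: "complex measure" where
  "Hminus_borel = restrict_space borel Hminus"

text \<open>
  The generator of a contraction semigroup is dissipative, so if it is normal its spectrum,
  which carries the spectral resolution, is contained in \<open>Hminus\<close>.
\<close>

definition transition_spectral_measure ::
  "'s measure \<Rightarrow> 's graph \<Rightarrow> ('s \<Rightarrow> real) \<Rightarrow> complex measure \<Rightarrow> bool" where
  "transition_spectral_measure \<mu> G g \<nu> \<longleftrightarrow>
    (\<exists>E. spectral_resolution \<mu> Hminus_borel G E \<and>
      \<nu> = pvm_measure \<mu> Hminus_borel E (\<lambda>x. complex_of_real (g x)))"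

section \<open>Stationary Markov processes\<close>

text \<open>
  The state space with its \<open>\<sigma>\<close>-algebra and the stationary law are bundled in the
  measure \<open>\<pi>\<close>. Time is the nonnegative reals; only values of \<open>F\<close> and \<open>\<xi>\<close> at
  nonnegative times matter (any filtration extends by \<open>F 0\<close> to negative times).
\<close>

locale stationary_markov_process = prob_space M + filtration "space M" F
  for M :: "'a measure" and F :: "real \<Rightarrow> 'a measure" +
  fixes \<pi> :: "'s measure" and \<xi> :: "real \<Rightarrow> 'a \<Rightarrow> 's"
  assumes sub: "t \<ge> 0 \<Longrightarrow> subalgebra M (F t)"
    and progressive: "t \<ge> 0 \<Longrightarrow>
      (\<lambda>(s, \<omega>). \<xi> s \<omega>) \<in> measurable (restrict_space borel {0..t} \<Otimes>\<^sub>M F t) \<pi>"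
    and law: "t \<ge> 0 \<Longrightarrow> distr M \<pi> (\<xi> t) = \<pi>"
    and stationary: "\<lbrakk>finite J; J \<subseteq> {0..}; s \<ge> 0\<rbrakk> \<Longrightarrow>
      distr M (Pi\<^sub>M J (\<lambda>_. \<pi>)) (\<lambda>\<omega>. \<lambda>t\<in>J. \<xi> (s + t) \<omega>) =
      distr M (Pi\<^sub>M J (\<lambda>_. \<pi>)) (\<lambda>\<omega>. \<lambda>t\<in>J. \<xi> t \<omega>)"
    and markov: "\<lbrakk>s \<ge> 0; t \<ge> 0; A \<in> sets \<pi>\<rbrakk> \<Longrightarrow>
      AE \<omega> in M. real_cond_exp M (F s) (\<lambda>\<omega>. indicator A (\<xi> (s + t) \<omega>)) \<omega> =
        real_cond_exp M (vimage_algebra (space M) (\<xi> s) \<pi>)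
          (\<lambda>\<omega>. indicator A (\<xi> (s + t) \<omega>)) \<omega>"

text \<open>
  A version of the function mapping \<open>x\<close> to the conditional expectation of
  \<open>f (\<xi> t)\<close> given \<open>\<xi> 0 = x\<close>; it is unique up to \<open>\<pi>\<close>-null sets.
\<close>

definition transition_op ::
  "'a measure \<Rightarrow> 's measure \<Rightarrow> (real \<Rightarrow> 'a \<Rightarrow> 's) \<Rightarrow> real \<Rightarrow> ('s \<Rightarrow> complex) \<Rightarrow> 's \<Rightarrow> complex" where
  "transition_op M \<pi> \<xi> t f =
    (SOME u. u \<in> borel_measurable \<pi> \<and>
      (AE \<omega> in M. u (\<xi> 0 \<omega>) =
        Complex
          (real_cond_exp M (vimage_algebra (space M) (\<xi> 0) \<pi>) (\<lambda>\<omega>. Re (f (\<xi> t \<omega>))) \<omega>)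
          (real_cond_exp M (vimage_algebra (space M) (\<xi> 0) \<pi>) (\<lambda>\<omega>. Im (f (\<xi> t \<omega>))) \<omega>)))"

definition strongly_continuous ::
  "'s measure \<Rightarrow> (real \<Rightarrow> ('s \<Rightarrow> complex) \<Rightarrow> 's \<Rightarrow> complex) \<Rightarrow> bool" where
  "strongly_continuous \<mu> T \<longleftrightarrow>
    (\<forall>f\<in>cL2 \<mu>. ((\<lambda>t. cL2_norm \<mu> (\<lambda>x. T t f x - f x)) \<longlongrightarrow> 0) (at_right 0))"

definition generator ::
  "'s measure \<Rightarrow> (real \<Rightarrow> ('s \<Rightarrow> complex) \<Rightarrow> 's \<Rightarrow> complex) \<Rightarrow> 's graph" where
  "generator \<mu> T = {(f, k). f \<in> cL2 \<mu> \<and> k \<in> cL2 \<mu> \<and>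
    ((\<lambda>t. cL2_norm \<mu> (\<lambda>x. (T t f x - f x) / complex_of_real t - k x)) \<longlongrightarrow> 0) (at_right 0)}"

definition occupation_integral ::
  "(real \<Rightarrow> 'a \<Rightarrow> 's) \<Rightarrow> ('s \<Rightarrow> real) \<Rightarrow> real \<Rightarrow> 'a \<Rightarrow> real" where
  "occupation_integral \<xi> g T \<omega> = (LINT s:{0..T}|lborel. g (\<xi> s \<omega>))"

section \<open>Planar Brownian motion\<close>

definition process_events ::
  "'b measure \<Rightarrow> (real \<Rightarrow> 'b \<Rightarrow> 'c::topological_space) \<Rightarrow> 'b set set" where
  "process_events P X =
    sigma_sets (space P) {X t -` A \<inter> space P | t A. t \<ge> 0 \<and> A \<in> sets borel}"

definition brownian_motion :: "'b measure \<Rightarrow> (real \<Rightarrow> 'b \<Rightarrow> real) \<Rightarrow> bool" where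
  "brownian_motion P W \<longleftrightarrow> prob_space P \<and>
    (\<forall>t\<ge>0. W t \<in> borel_measurable P) \<and>
    (\<forall>\<omega>\<in>space P. W 0 \<omega> = 0 \<and> continuous_on {0..} (\<lambda>t. W t \<omega>)) \<and>
    (\<forall>s t. 0 \<le> s \<and> s < t \<longrightarrow>
      distributed P lborel (\<lambda>\<omega>. W t \<omega> - W s \<omega>) (normal_density 0 (sqrt (t - s)))) \<and>
    (\<forall>(n::nat) \<theta>. 0 \<le> \<theta> 0 \<and> mono \<theta> \<longrightarrow>
      prob_space.indep_vars P (\<lambda>_. borel) (\<lambda>i \<omega>. W (\<theta> (Suc i)) \<omega> - W (\<theta> i) \<omega>) {..<n})"

text \<open>Started at \<open>0\<close>; the motion started at \<open>z\<close> is \<open>\<lambda>t \<omega>. z + W t \<omega>\<close>.\<close>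

definition planar_brownian_motion :: "'b measure \<Rightarrow> (real \<Rightarrow> 'b \<Rightarrow> complex) \<Rightarrow> bool" where
  "planar_brownian_motion P W \<longleftrightarrow>
    brownian_motion P (\<lambda>t \<omega>. Re (W t \<omega>)) \<and> brownian_motion P (\<lambda>t \<omega>. Im (W t \<omega>)) \<and>
    prob_space.indep_set P
      (process_events P (\<lambda>t \<omega>. Re (W t \<omega>))) (process_events P (\<lambda>t \<omega>. Im (W t \<omega>)))"

definition exit_time :: "complex set \<Rightarrow> (real \<Rightarrow> complex) \<Rightarrow> ereal" where
  "exit_time D X = (INF t\<in>{t. t \<ge> 0 \<and> X t \<notin> D}. ereal t)"

text \<open>The exit time is almost surely finite in the case of interest.\<close>

definition exits_through :: "complex set \<Rightarrow> (real \<Rightarrow> complex) \<Rightarrow> complex set \<Rightarrow> bool" where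
  "exits_through D X I \<longleftrightarrow> exit_time D X < \<infinity> \<and> X (real_of_ereal (exit_time D X)) \<in> I"

definition imag_segment :: "real \<Rightarrow> complex set" where
  "imag_segment x = {\<i> * complex_of_real y | y. \<bar>y\<bar> < x}"

section \<open>Asymptotics\<close>

text \<open>Slow variation at infinity includes continuity and positivity on the positive half-line.\<close>

definition slowly_varying :: "(real \<Rightarrow> real) \<Rightarrow> bool" where
  "slowly_varying h \<longleftrightarrow> continuous_on {0<..} h \<and> (\<forall>t>0. h t > 0) \<and>
    (\<forall>s>0. ((\<lambda>t. h (s * t) / h t) \<longlongrightarrow> 1) at_top)"

definition Cconst :: "real \<Rightarrow> real" where
  "Cconst \<alpha> = Gamma (1 + \<alpha>) * sin (\<alpha> * pi / 2) / (pi * (2 - \<alpha>))"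

end

theory Submission
  imports Defs
begin

text \<open>
  Both asymptotics concern one finite measure \<open>\<mu>\<close> on the real line: the sweeping of \<open>\<nu>\<close> onto
  the imaginary axis, that is, \<open>\<nu> Hminus\<close> times the law of the height at which the Brownian
  motion leaves the half-plane. Three ingredients are combined.

  For \<open>r \<ge> 0\<close> the function \<open>exp (r * z)\<close> is holomorphic and bounded on \<open>Hminus\<close>, so by
  optional stopping its mean at the exit point is its value at the starting point. Hence the
  height has the characteristic function \<open>r \<mapsto> E (exp (r * Z))\<close>, \<open>r \<ge> 0\<close>, and this is the
  transform of \<open>\<nu>\<close> at time \<open>r\<close> divided by the mass (lemma \<open>exit_char\<close>). The proof stops the
  exponential martingale with exponents \<open>t > r\<close> in the two coordinates on dyadic grids, where
  independence of increments suffices, refines the grid, and lets \<open>t\<close> decrease to \<open>r\<close>; almost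
  sure finiteness of the exit time comes out as the case \<open>r = 0\<close>.

  The covariance of \<open>g (\<xi> 0)\<close> and \<open>g (\<xi> t)\<close> is the inner product of \<open>T t g\<close> with \<open>g\<close>, and this
  is the integral of \<open>exp (t * z)\<close> against \<open>\<nu>\<close> (lemma \<open>semigroup_spectral_formula\<close>). A
  resolution represents only the generator, so the semigroup has to be recovered from it: on
  the range of the projection of a small cell around \<open>c\<close> the generator is nearly
  multiplication by \<open>c\<close>, and composing many short time steps shows that the semigroup is
  nearly multiplication by \<open>exp (t * c)\<close>; the error is proportional to the diameter of the
  cells. Comparing with the exit law, the covariance function of the process is
  \<open>t \<mapsto> \<integral> cos (y * t)\<close> with respect to \<open>\<mu>\<close>. Therefore the variance of the integral up to time
  \<open>T\<close> is the integral of the Fejer kernel, \<open>2 * (1 - cos (y * T)) / y\<^sup>2\<close>, against \<open>\<mu>\<close> (lemma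
  \<open>variance_occupation_integral\<close>), while the exit probability is the \<open>\<mu>\<close>-mass of
  \<open>{y. \<bar>y\<bar> < x}\<close>, up to normalization.

  It remains to relate the growth of the Fejer transform of a measure to its mass near \<open>0\<close>
  (theorem \<open>fejer_transform_tauberian\<close>). The Fejer kernel oscillates, so both functions are
  compared with a transform that has a monotone kernel, \<open>\<integral> T\<^sup>2 / (1 + T\<^sup>2 * y\<^sup>2)\<close>. It is half
  the Laplace average of the Fejer transform and a weighted average of the masses, so regular
  variation passes from either function to it by dominated convergence with Potter bounds.
  Conversely, regular variation of this transform determines, through convexity in an
  auxiliary parameter, the limits of all moments of \<open>1 / (1 + T\<^sup>2 * y\<^sup>2)\<close> under a tilted law.
  They are the moments of a Beta law, hence the tilted laws converge weakly, and both the
  Fejer transform and the mass near \<open>0\<close> are integrals of fixed bounded, almost everywhere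
  continuous functions under these laws. So both have a limit after normalization, and the
  forward direction identifies the constants.
\<close>

section \<open>Slow variation and the Abelian argument\<close>

text \<open>
  In the logarithmic variable, slow variation says that the increments of \<open>ln \<circ> h \<circ> exp\<close> over
  each fixed length tend to \<open>0\<close>. Continuity makes the set of lengths in the unit interval that
  are controlled from time \<open>n\<close> on closed; by Baire's theorem one of these sets contains an
  interval. Differences of its points control all short increments, and finitely many fixed
  lengths then control the whole unit interval.
\<close>

lemma slowly_varying_log_uniform:
  fixes h :: "real \<Rightarrow> real"
  assumes sv: "slowly_varying h" and e: "\<epsilon> > 0"
  obtains X where "\<And>x u. X \<le> x \<Longrightarrow> 0 \<le> u \<Longrightarrow> u \<le> 1 \<Longrightarrow> \<bar>ln (h (exp (x + u))) - ln (h (exp x))\<bar> \<le> \<epsilon>"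
proof -
  define k where "k x = ln (h (exp x))" for x
  have hpos: "h t > 0" if "t > 0" for t using sv that by (auto simp: slowly_varying_def)
  have "continuous_on UNIV (\<lambda>x. h (exp x))"
    using sv unfolding slowly_varying_def
    by (intro continuous_on_compose2[of "{0<..}" h UNIV exp]) (auto intro!: continuous_intros)
  then have kc: "continuous_on UNIV k"
    unfolding k_def using hpos by (intro continuous_intros) (auto simp: less_imp_neq[symmetric])
  have klim: "((\<lambda>x. k (x + u) - k x) \<longlongrightarrow> 0) at_top" for u
  proof -
    have "((\<lambda>t. h (exp u * t) / h t) \<longlongrightarrow> 1) at_top"
      using sv by (auto simp: slowly_varying_def)
    then have "((\<lambda>x. h (exp u * exp x) / h (exp x)) \<longlongrightarrow> 1) at_top"
      by (rule filterlim_compose[OF _ exp_at_top])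
    then have "((\<lambda>x. ln (h (exp u * exp x) / h (exp x))) \<longlongrightarrow> ln 1) at_top"
      by (intro tendsto_intros) auto
    moreover have "ln (h (exp u * exp x) / h (exp x)) = k (x + u) - k x" for x
      unfolding k_def using hpos[of "exp x"] hpos[of "exp u * exp x"]
      by (subst ln_div) (auto simp: exp_add mult.commute)
    ultimately show ?thesis by simp
  qed
  define E where "E n = {u\<in>{0..1}. \<forall>x\<ge>real n. \<bar>k (x + u) - k x\<bar> \<le> \<epsilon> / 4}" for n
  have Ecl: "closed (E n)" for n
  proof -
    have "E n = {0..1} \<inter> (\<Inter>x\<in>{real n..}. {u. \<bar>k (x + u) - k x\<bar> \<le> \<epsilon> / 4})"
      by (auto simp: E_def)
    moreover have "closed {u. \<bar>k (x + u) - k x\<bar> \<le> \<epsilon> / 4}" for x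
      by (intro closed_Collect_le continuous_intros continuous_on_compose2[OF kc]) auto
    ultimately show ?thesis by (auto intro!: closed_Int closed_INT)
  qed
  have Ecov: "(\<Union>n. E n) = {0..1}"
  proof -
    have "\<exists>n. u \<in> E n" if u: "u \<in> {0..1}" for u
    proof -
      have "\<forall>\<^sub>F x in at_top. \<bar>k (x + u) - k x\<bar> < \<epsilon> / 4"
        using tendstoD[OF klim[of u], of "\<epsilon> / 4"] e by (simp add: dist_real_def)
      then obtain X where X: "\<And>x. x \<ge> X \<Longrightarrow> \<bar>k (x + u) - k x\<bar> < \<epsilon> / 4"
        by (auto simp: eventually_at_top_linorder)
      obtain n where "X \<le> real n" using real_arch_simple by blast
      then have "u \<in> E n" using u X unfolding E_def by (auto intro!: less_imp_le)
      then show ?thesis ..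
    qed
    then show ?thesis by (auto simp: E_def)
  qed
  have "\<exists>n. interior (E n) \<noteq> {}"
  proof (rule ccontr)
    assume a: "\<not> (\<exists>n. interior (E n) \<noteq> {})"
    have "euclidean interior_of \<Union>(range E) = {}"
    proof (rule Baire_category_alt)
      show "completely_metrizable_space (euclidean :: real topology) \<or>
         locally_compact_space (euclidean :: real topology) \<and> regular_space (euclidean :: real topology)"
        using completely_metrizable_space_euclidean by blast
    qed (use a Ecl in auto)
    then have "interior {0..1::real} = {}" using Ecov by (simp)
    then show False by (simp add: interior_atLeastAtMost_real)
  qed
  then obtain n a where "a \<in> interior (E n)" by auto
  then obtain d where d: "d > 0" "cball a d \<subseteq> E n"
    by (meson interior_subset open_contains_cball open_interior subset_trans)
  define d' where "d' = min d 1"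
  have aE: "a + u \<in> E n" if "0 \<le> u" "u \<le> d'" for u
    using d that by (auto simp: d'_def subset_eq dist_real_def)
  have a01: "0 \<le> a" "a \<le> 1" using aE[of 0] d by (auto simp: E_def d'_def)
  have small: "\<bar>k (x + u) - k x\<bar> \<le> \<epsilon> / 2" if "x \<ge> real n + 1" "0 \<le> u" "u \<le> d'" for x u
  proof -
    have 1: "\<bar>k (y + v) - k y\<bar> \<le> \<epsilon> / 4" if "v \<in> E n" "y \<ge> real n" for v y
      using that by (auto simp: E_def)
    have "\<bar>k x - k (x - a)\<bar> \<le> \<epsilon> / 4" "\<bar>k (x + u) - k (x - a)\<bar> \<le> \<epsilon> / 4"
      using 1[of "a + 0" "x - a"] 1[of "a + u" "x - a"] aE[of 0] aE[of u] that a01 by auto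
    then show ?thesis by linarith
  qed
  \<comment> \<open>A length in the unit interval is one of finitely many multiples of \<open>d'\<close> plus a rest below \<open>d'\<close>.\<close>
  define J where "J = nat \<lceil>1 / d'\<rceil>"
  have d'p: "d' > 0" using d by (simp add: d'_def)
  have "\<forall>\<^sub>F x in at_top. \<forall>j\<in>{..J}. \<bar>k (x + real j * d') - k x\<bar> < \<epsilon> / 2"
  proof (intro eventually_ball_finite ballI)
    fix j show "\<forall>\<^sub>F x in at_top. \<bar>k (x + real j * d') - k x\<bar> < \<epsilon> / 2"
      using tendstoD[OF klim[of "real j * d'"], of "\<epsilon> / 2"] e by (simp add: dist_real_def)
  qed simp
  then obtain X where X: "\<And>x j. x \<ge> X \<Longrightarrow> j \<le> J \<Longrightarrow> \<bar>k (x + real j * d') - k x\<bar> < \<epsilon> / 2"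
    by (auto simp: eventually_at_top_linorder)
  show ?thesis
  proof (rule that)
    fix x u :: real assume x: "max X (real n + 1) \<le> x" and u: "0 \<le> u" "u \<le> 1"
    define j where "j = nat \<lfloor>u / d'\<rfloor>"
    have j: "real j = of_int \<lfloor>u / d'\<rfloor>" using u d'p by (simp add: j_def)
    have j1: "real j * d' \<le> u" "u - real j * d' \<le> d'"
    proof -
      have "real j \<le> u / d'" "u / d' \<le> real j + 1" unfolding j by linarith+
      then show "real j * d' \<le> u" "u - real j * d' \<le> d'"
        using d'p by (auto simp: field_simps)
    qed
    have jJ: "j \<le> J"
      unfolding j_def J_def using u d'p
      by (intro nat_mono) (meson divide_right_mono floor_le_ceiling less_imp_le order_trans floor_mono)
    have "\<bar>k (x + real j * d') - k x\<bar> < \<epsilon> / 2" using X x jJ by auto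
    moreover have "\<bar>k ((x + real j * d') + (u - real j * d')) - k (x + real j * d')\<bar> \<le> \<epsilon> / 2"
      using x j1 d'p by (intro small) (auto intro: add_increasing2)
    moreover have "k ((x + real j * d') + (u - real j * d')) = k (x + u)" by simp
    ultimately have "\<bar>k (x + u) - k x\<bar> \<le> \<epsilon>" by linarith
    then show "\<bar>ln (h (exp (x + u))) - ln (h (exp x))\<bar> \<le> \<epsilon>" by (simp add: k_def)
  qed
qed

text \<open>
  Chaining the bound over unit steps makes \<open>ln \<circ> h \<circ> exp\<close> Lipschitz on a large scale with
  constant \<open>\<delta>\<close>, which is Potter's bound. It is stated with the sum of both powers so that the
  two orders of \<open>s\<close> and \<open>t\<close> need no distinction.
\<close>

lemma slowly_varying_Potter:
  fixes h :: "real \<Rightarrow> real"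
  assumes sv: "slowly_varying h" and d: "\<delta> > 0"
  obtains X where "X \<ge> 1" and "\<And>s t. X \<le> s \<Longrightarrow> X \<le> t \<Longrightarrow>
    h s \<le> exp \<delta> * ((s / t) powr \<delta> + (t / s) powr \<delta>) * h t"
proof -
  define k where "k x = ln (h (exp x))" for x
  have hpos: "h t > 0" if "t > 0" for t using sv that by (auto simp: slowly_varying_def)
  obtain X where X: "\<And>x u. X \<le> x \<Longrightarrow> 0 \<le> u \<Longrightarrow> u \<le> 1 \<Longrightarrow> \<bar>k (x + u) - k x\<bar> \<le> \<delta>"
    using slowly_varying_log_uniform[OF sv d] unfolding k_def by blast
  have nat_step: "\<bar>k (x + u) - k x\<bar> \<le> real n * \<delta>" if "X \<le> x" "0 \<le> u" "u \<le> real n" for x u n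
    using that(2,3)
  proof (induction n arbitrary: u)
    case (Suc n)
    show ?case
    proof (cases "u \<le> real n")
      case True
      then show ?thesis using Suc.IH[of u] Suc.prems d by (simp add: algebra_simps)
    next
      case False
      have "\<bar>k ((x + real n) + (u - real n)) - k (x + real n)\<bar> \<le> \<delta>"
        using False Suc.prems that(1) by (intro X) auto
      moreover have "\<bar>k (x + real n) - k x\<bar> \<le> real n * \<delta>" by (intro Suc.IH) auto
      ultimately show ?thesis by (simp add: algebra_simps)
    qed
  qed auto
  have lin: "\<bar>k y - k x\<bar> \<le> \<delta> + \<delta> * \<bar>y - x\<bar>" if "X \<le> x" "X \<le> y" for x y
  proof -
    have *: "\<bar>k y - k x\<bar> \<le> \<delta> + \<delta> * \<bar>y - x\<bar>" if "X \<le> x" "x \<le> y" for x y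
    proof -
      have "\<bar>k (x + (y - x)) - k x\<bar> \<le> real (nat \<lceil>y - x\<rceil>) * \<delta>"
        using that by (intro nat_step) auto
      also have "\<dots> \<le> (1 + \<bar>y - x\<bar>) * \<delta>"
        using that d by (intro mult_right_mono) (auto, linarith)
      finally show ?thesis by (simp add: algebra_simps)
    qed
    show ?thesis using *[of x y] *[of y x] that by (cases "x \<le> y") (auto simp: abs_minus_commute)
  qed
  show ?thesis
  proof (rule that)
    show "max 1 (exp X) \<ge> 1" by simp
    fix s t assume s: "max 1 (exp X) \<le> s" and t: "max 1 (exp X) \<le> t"
    have pos: "s > 0" "t > 0" using s t by auto
    have ge: "X \<le> ln s" "X \<le> ln t" using s t pos by (auto simp: ln_ge_iff)
    have "ln (h s) \<le> ln (h t) + (\<delta> + \<delta> * \<bar>ln s - ln t\<bar>)"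
      using lin[OF ge(2,1)] pos by (simp add: k_def)
    then have "exp (ln (h s)) \<le> exp (ln (h t) + (\<delta> + \<delta> * \<bar>ln s - ln t\<bar>))" by simp
    then have "h s \<le> h t * exp \<delta> * exp (\<delta> * \<bar>ln s - ln t\<bar>)"
      using hpos pos by (simp add: exp_add mult_ac)
    also have "exp (\<delta> * \<bar>ln s - ln t\<bar>) \<le> (s / t) powr \<delta> + (t / s) powr \<delta>"
    proof -
      have "(s / t) powr \<delta> = exp (\<delta> * (ln s - ln t))" "(t / s) powr \<delta> = exp (\<delta> * (ln t - ln s))"
        using pos by (auto simp: powr_def ln_div)
      then show ?thesis by (cases "ln s \<le> ln t") (auto simp: abs_if)
    qed
    finally show "h s \<le> exp \<delta> * ((s / t) powr \<delta> + (t / s) powr \<delta>) * h t"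
      using hpos pos by (simp add: mult_ac)
  qed
qed

text \<open>
  The Abelian half of Tauberian theory for averages over dilations: Potter's bound, and
  \<open>small\<close> for the arguments on which the asymptotics say nothing, give an integrable majorant,
  so limits and averages commute. The measure \<open>N\<close> and the dilation \<open>s\<close> are arbitrary because
  the lemma is applied with \<open>s u = u\<close> and with \<open>s \<theta> = 1 / \<theta>\<close>.
\<close>

lemma abelian_regular_variation:
  fixes f h :: "real \<Rightarrow> real" and s K :: "'n \<Rightarrow> real"
  assumes sv: "slowly_varying h" and d: "\<delta> > 0"
    and f[measurable]: "f \<in> borel_measurable borel" and fpos: "\<And>t. t > 0 \<Longrightarrow> 0 \<le> f t"
    and lim: "((\<lambda>t. f t / (t powr \<beta> * h t)) \<longlongrightarrow> D) at_top"
    and small: "\<And>X. \<exists>C. \<forall>t\<in>{0<..X}. f t \<le> C * t powr (\<beta> - \<delta>)"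
    and K[measurable]: "K \<in> borel_measurable N" and s[measurable]: "s \<in> borel_measurable N"
    and Kpos: "\<And>x. 0 \<le> K x" and spos: "\<And>x. K x \<noteq> 0 \<Longrightarrow> s x > 0"
    and i1: "integrable N (\<lambda>x. K x * s x powr (\<beta> - \<delta>))"
    and i2: "integrable N (\<lambda>x. K x * s x powr (\<beta> + \<delta>))"
  shows "((\<lambda>T. (LINT x|N. K x * f (s x * T)) / (T powr \<beta> * h T)) \<longlongrightarrow>
    D * (LINT x|N. K x * s x powr \<beta>)) at_top"
proof -
  have hpos: "h t > 0" if "t > 0" for t using sv that by (auto simp: slowly_varying_def)
  obtain X0 where X0: "X0 \<ge> 1" and pot: "\<And>s t. X0 \<le> s \<Longrightarrow> X0 \<le> t \<Longrightarrow>
    h s \<le> exp \<delta> * ((s / t) powr \<delta> + (t / s) powr \<delta>) * h t"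
    using slowly_varying_Potter[OF sv d] by blast
  have "\<forall>\<^sub>F t in at_top. f t / (t powr \<beta> * h t) < D + 1"
    using order_tendstoD(2)[OF lim, of "D + 1"] by simp
  then obtain X1 where X1: "\<And>t. t \<ge> X1 \<Longrightarrow> f t / (t powr \<beta> * h t) < D + 1"
    by (auto simp: eventually_at_top_linorder)
  define X where "X = max X0 X1"
  have X: "X \<ge> 1" "X \<ge> X0" "X \<ge> X1" using X0 by (auto simp: X_def)
  obtain C where C: "\<And>t. t \<in> {0<..X} \<Longrightarrow> f t \<le> C * t powr (\<beta> - \<delta>)" using small by blast
  have D0: "D + 1 > 0"
  proof -
    have "0 \<le> f X / (X powr \<beta> * h X)" using X fpos[of X] hpos[of X] by simp
    then show ?thesis using X1[of X] X by linarith
  qed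
  define A where "A = (D + 1) * exp \<delta>"
  define B where "B = \<bar>C\<bar> * exp \<delta> * (X powr \<delta> + X powr - \<delta>) / h X"
  have A0: "A \<ge> 0" "B \<ge> 0" using D0 hpos[of X] X by (auto simp: A_def B_def)
  \<comment> \<open>The majorant: arguments beyond \<open>X\<close> are governed by the asymptotics of \<open>f\<close>, smaller ones by \<open>small\<close> and a comparison of \<open>h X\<close> with \<open>h T\<close>.\<close>
  have bnd: "f (r * T) / (T powr \<beta> * h T) \<le> (A + B) * (r powr (\<beta> - \<delta>) + r powr (\<beta> + \<delta>))"
    if r: "r > 0" and T: "T \<ge> X" for r T
  proof (cases "r * T \<ge> X")
    case True
    have T0: "T > 0" using T X by simp
    have h0: "h T > 0" "h (r * T) > 0" using T0 r hpos by auto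
    have "f (r * T) \<le> (D + 1) * ((r * T) powr \<beta> * h (r * T))"
      using X1[of "r * T"] True X h0 r T0 by (simp add: divide_less_eq)
    also have "\<dots> \<le> (D + 1) * ((r * T) powr \<beta> * (exp \<delta> * ((r * T / T) powr \<delta> + (T / (r * T)) powr \<delta>) * h T))"
      using D0 True X T by (intro mult_left_mono pot) auto
    also have "\<dots> = A * (r powr \<beta> * (r powr \<delta> + r powr - \<delta>)) * (T powr \<beta> * h T)"
      using r T0 by (simp add: A_def powr_mult powr_divide powr_minus field_simps)
    also have "r powr \<beta> * (r powr \<delta> + r powr - \<delta>) = r powr (\<beta> - \<delta>) + r powr (\<beta> + \<delta>)"
      by (simp add: powr_add[symmetric] algebra_simps)
    finally have "f (r * T) / (T powr \<beta> * h T) \<le> A * (r powr (\<beta> - \<delta>) + r powr (\<beta> + \<delta>))"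
      using T0 h0 by (simp add: divide_le_eq)
    also have "\<dots> \<le> (A + B) * (r powr (\<beta> - \<delta>) + r powr (\<beta> + \<delta>))"
      using A0 by (intro mult_right_mono) auto
    finally show ?thesis .
  next
    case False
    have T0: "T > 0" using T X by simp
    have h0: "h T > 0" "h X > 0" using T0 X hpos by auto
    have "f (r * T) \<le> C * (r * T) powr (\<beta> - \<delta>)" using False r T0 by (intro C) auto
    also have "\<dots> \<le> \<bar>C\<bar> * (r * T) powr (\<beta> - \<delta>)" by (intro mult_right_mono) auto
    also have "\<dots> = \<bar>C\<bar> * r powr (\<beta> - \<delta>) * (T powr \<beta> * T powr - \<delta>)"
      using r T0 by (simp add: powr_mult powr_add[symmetric])
    also have "\<dots> \<le> \<bar>C\<bar> * r powr (\<beta> - \<delta>) * (T powr \<beta> * (exp \<delta> * (X powr \<delta> + X powr - \<delta>) / h X * h T))"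
    proof -
      have "h X \<le> exp \<delta> * ((X / T) powr \<delta> + (T / X) powr \<delta>) * h T"
        using X T by (intro pot) auto
      also have "(X / T) powr \<delta> + (T / X) powr \<delta> = X powr \<delta> * T powr - \<delta> + X powr -\<delta> * T powr \<delta>"
        using X T0 by (simp add: powr_divide powr_minus field_simps)
      also have "\<dots> \<le> (X powr \<delta> + X powr - \<delta>) * T powr \<delta>"
      proof -
        have "T powr - \<delta> \<le> T powr \<delta>" using T X d by (intro powr_mono) auto
        then show ?thesis by (simp add: distrib_right mult_left_mono)
      qed
      finally have "h X \<le> exp \<delta> * ((X powr \<delta> + X powr - \<delta>) * T powr \<delta>) * h T"
        using h0 by (simp add: mult_left_mono mult_right_mono)
      then have "T powr - \<delta> \<le> exp \<delta> * (X powr \<delta> + X powr - \<delta>) / h X * h T"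
        using h0 T0 by (simp add: powr_minus field_simps)
      then show ?thesis by (intro mult_left_mono) auto
    qed
    finally have "f (r * T) \<le> B * r powr (\<beta> - \<delta>) * (T powr \<beta> * h T)"
      by (simp add: B_def mult_ac)
    then have "f (r * T) / (T powr \<beta> * h T) \<le> B * r powr (\<beta> - \<delta>)"
      using T0 h0 by (simp add: divide_le_eq)
    also have "\<dots> \<le> (A + B) * (r powr (\<beta> - \<delta>) + r powr (\<beta> + \<delta>))"
      using A0 by (intro mult_mono) auto
    finally show ?thesis .
  qed
  have ptw: "((\<lambda>T. f (r * T) / (T powr \<beta> * h T)) \<longlongrightarrow> D * r powr \<beta>) at_top" if r: "r > 0" for r
  proof -
    have rT: "filterlim (\<lambda>T. r * T) at_top at_top"
      using r by (intro filterlim_tendsto_pos_mult_at_top[OF tendsto_const]) (auto simp: filterlim_ident)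
    have "((\<lambda>T. f (r * T) / ((r * T) powr \<beta> * h (r * T)) * (r powr \<beta> * (h (r * T) / h T)))
      \<longlongrightarrow> D * (r powr \<beta> * 1)) at_top"
      using sv r by (intro tendsto_mult filterlim_compose[OF lim rT] tendsto_const)
        (auto simp: slowly_varying_def)
    moreover have "\<forall>\<^sub>F T in at_top. f (r * T) / ((r * T) powr \<beta> * h (r * T)) * (r powr \<beta> * (h (r * T) / h T))
       = f (r * T) / (T powr \<beta> * h T)"
      using eventually_gt_at_top[of 0]
    proof eventually_elim
      case (elim T)
      then have "h T > 0" "h (r * T) > 0" using hpos r by auto
      then show ?case using elim r by (simp add: powr_mult field_simps)
    qed
    ultimately show ?thesis by (simp cong: filterlim_cong add: tendsto_cong)
  qed
  have "((\<lambda>T. LINT x|N. K x * (f (s x * T) / (T powr \<beta> * h T))) \<longlongrightarrow>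
    (LINT x|N. K x * (D * s x powr \<beta>))) at_top"
  proof (rule integral_dominated_convergence_at_top)
    show "integrable N (\<lambda>x. (A + B) * (K x * s x powr (\<beta> - \<delta>) + K x * s x powr (\<beta> + \<delta>)))"
      using i1 i2 by auto
    show "AE x in N. ((\<lambda>T. K x * (f (s x * T) / (T powr \<beta> * h T))) \<longlongrightarrow> K x * (D * s x powr \<beta>)) at_top"
    proof (rule AE_I2)
      fix x show "((\<lambda>T. K x * (f (s x * T) / (T powr \<beta> * h T))) \<longlongrightarrow> K x * (D * s x powr \<beta>)) at_top"
        using tendsto_mult_left[OF ptw[OF spos[of x]], of "K x"] by (cases "K x = 0") auto
    qed
    show "\<forall>\<^sub>F T in at_top. AE x in N. norm (K x * (f (s x * T) / (T powr \<beta> * h T)))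
       \<le> (A + B) * (K x * s x powr (\<beta> - \<delta>) + K x * s x powr (\<beta> + \<delta>))"
      using eventually_ge_at_top[of X]
    proof eventually_elim
      case (elim T)
      have T0: "T > 0" "h T > 0" using elim X hpos[of T] by auto
      show ?case
      proof (rule AE_I2)
        fix x
        show "norm (K x * (f (s x * T) / (T powr \<beta> * h T)))
          \<le> (A + B) * (K x * s x powr (\<beta> - \<delta>) + K x * s x powr (\<beta> + \<delta>))"
        proof (cases "K x = 0")
          case False
          have "norm (K x * (f (s x * T) / (T powr \<beta> * h T))) = K x * (f (s x * T) / (T powr \<beta> * h T))"
            using Kpos[of x] fpos[of "s x * T"] spos[OF False] T0 by simp
          also have "\<dots> \<le> K x * ((A + B) * (s x powr (\<beta> - \<delta>) + s x powr (\<beta> + \<delta>)))"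
            using bnd[OF spos[OF False] elim] Kpos[of x] by (intro mult_left_mono) auto
          finally show ?thesis by (simp add: algebra_simps)
        qed simp
      qed
    qed
  qed measurable
  then show ?thesis by (simp add: mult.left_commute)
qed

section \<open>The Fejer transform of a measure on the line\<close>

text \<open>
  The squared modulus of the integral of \<open>exp (\<i> * y * s)\<close> over \<open>s \<in> {0..T}\<close>, extended
  continuously to \<open>y = 0\<close>.
\<close>

definition fejer :: "real \<Rightarrow> real \<Rightarrow> real" where
  "fejer T y = (if y = 0 then T\<^sup>2 else 2 * (1 - cos (y * T)) / y\<^sup>2)"

lemma one_minus_cos_le: "1 - cos x \<le> x\<^sup>2 / 2" for x :: real
proof -
  have "1 - cos x = 2 * (sin (x / 2))\<^sup>2" using cos_double_sin[of "x / 2"] by simp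
  moreover have "(sin (x / 2))\<^sup>2 \<le> (x / 2)\<^sup>2"
    using abs_sin_x_le_abs_x[of "x / 2"] by (rule abs_le_square_iff[THEN iffD1])
  ultimately show ?thesis by (simp add: power_divide)
qed

lemma fejer_nonneg: "0 \<le> fejer T y" and fejer_le: "fejer T y \<le> T\<^sup>2"
proof -
  show "0 \<le> fejer T y" by (simp add: fejer_def)
  show "fejer T y \<le> T\<^sup>2"
    using one_minus_cos_le[of "y * T"] by (simp add: fejer_def field_simps)
qed

lemma fejer_measurable[measurable]: "(\<lambda>(T, y). fejer T y) \<in> borel_measurable (borel \<Otimes>\<^sub>M borel)"
  unfolding fejer_def by measurable

lemma fejer_measurable2[measurable]: "fejer T \<in> borel_measurable borel"
  unfolding fejer_def[abs_def] by measurable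

lemma fejer_scale: "T > 0 \<Longrightarrow> T\<^sup>2 * fejer 1 (T * \<bar>y\<bar>) = fejer T y"
  by (cases "y \<ge> 0") (auto simp: fejer_def field_simps power2_eq_square)

lemma isCont_fejer: "y \<noteq> 0 \<Longrightarrow> isCont (fejer T) y"
proof -
  assume y: "y \<noteq> 0"
  have "isCont (\<lambda>y. 2 * (1 - cos (y * T)) / y\<^sup>2) y" using y by (intro continuous_intros) auto
  moreover have "\<forall>\<^sub>F x in nhds y. fejer T x = 2 * (1 - cos (x * T)) / x\<^sup>2"
    using t1_space_nhds[OF y] by eventually_elim (simp add: fejer_def)
  ultimately show ?thesis by (subst isCont_cong) auto
qed

text \<open>
  The weight \<open>1 + \<theta>\<^sup>2\<close> is the inverse of the kernel against which the Fejer kernel is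
  compared, so this bounds their ratio.
\<close>

lemma fejer_weight_le: "fejer 1 \<theta> * (1 + \<theta>\<^sup>2) \<le> 5"
proof -
  have "fejer 1 \<theta> * \<theta>\<^sup>2 \<le> 4" using cos_ge_minus_one[of \<theta>] by (auto simp: fejer_def simp del: cos_ge_minus_one)
  moreover have "fejer 1 \<theta> \<le> 1" using fejer_le[of 1 \<theta>] by simp
  ultimately show ?thesis by (simp add: algebra_simps)
qed

text \<open>
  Averaging over time turns the oscillating Fejer kernel into a completely monotone function
  of \<open>y\<^sup>2\<close>; this is what makes the Fejer transform accessible to Tauberian arguments.
\<close>

lemma fejer_laplace:
  assumes T: "T > 0"
  shows "(\<integral>\<^sup>+u. ennreal (exp (- u) * fejer (u * T) y) * indicator {0..} u \<partial>lborel) = ennreal (2 * (T\<^sup>2 / (1 + T\<^sup>2 * y\<^sup>2)))"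
proof (cases "y = 0")
  case True
  define F where "F u = - (T\<^sup>2 * (u\<^sup>2 + 2 * u + 2) * exp (- u))" for u :: real
  have "(\<integral>\<^sup>+u. ennreal (exp (- u) * fejer (u * T) y) * indicator {0..} u \<partial>lborel) = ennreal (0 - F 0)"
  proof (rule nn_integral_FTC_atLeast)
    show "DERIV F u :> exp (- u) * fejer (u * T) y" for u
      unfolding F_def fejer_def using True
      by (auto intro!: derivative_eq_intros simp: algebra_simps power2_eq_square)
    show "(F \<longlongrightarrow> 0) at_top" unfolding F_def using T by real_asymp
  qed (auto simp: fejer_nonneg)
  then show ?thesis using True by (simp add: F_def)
next
  case False
  define b :: real where "b = y * T"
  have b: "b\<^sup>2 + 1 > 0" by (simp add: add_nonneg_pos)
  \<comment> \<open>An antiderivative of \<open>exp (- u) * cos (b * u)\<close> up to the factor \<open>b\<^sup>2 + 1\<close>.\<close>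
  define V where "V u = exp (- u) * (b * sin (b * u) - cos (b * u))" for u
  define F where "F u = (2 / y\<^sup>2) * (- exp (- u) - V u / (b\<^sup>2 + 1))" for u :: real
  have V: "DERIV V u :> (b\<^sup>2 + 1) * (exp (- u) * cos (b * u))" for u
    unfolding V_def by (auto intro!: derivative_eq_intros simp: algebra_simps power2_eq_square)
  have Vb: "\<bar>V u\<bar> \<le> exp (- u) * (\<bar>b\<bar> + 1)" for u
  proof -
    have "\<bar>b * sin (b * u)\<bar> \<le> \<bar>b\<bar> * 1" unfolding abs_mult by (intro mult_left_mono) auto
    then have "\<bar>b * sin (b * u) - cos (b * u)\<bar> \<le> \<bar>b\<bar> + 1"
      using abs_cos_le_one[of "b * u"] by linarith
    then show ?thesis unfolding V_def abs_mult by simp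
  qed
  have "(\<integral>\<^sup>+u. ennreal (exp (- u) * fejer (u * T) y) * indicator {0..} u \<partial>lborel) = ennreal (0 - F 0)"
  proof (rule nn_integral_FTC_atLeast)
    show "DERIV F u :> exp (- u) * fejer (u * T) y" for u
    proof -
      have "DERIV F u :> (2 / y\<^sup>2) * (exp (- u) - (b\<^sup>2 + 1) * (exp (- u) * cos (b * u)) / (b\<^sup>2 + 1))"
        unfolding F_def by (intro DERIV_cmult DERIV_diff DERIV_cdivide V) (auto intro!: derivative_eq_intros)
      also have "(b\<^sup>2 + 1) * (exp (- u) * cos (b * u)) / (b\<^sup>2 + 1) = exp (- u) * cos (b * u)"
        using b by simp
      also have "(2 / y\<^sup>2) * (exp (- u) - exp (- u) * cos (b * u)) = exp (- u) * fejer (u * T) y"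
        using False by (simp add: fejer_def b_def right_diff_distrib diff_divide_distrib mult_ac)
      finally show ?thesis .
    qed
    show "(F \<longlongrightarrow> 0) at_top"
    proof (rule Lim_null_comparison)
      show "\<forall>\<^sub>F u in at_top. norm (F u) \<le> (2 / y\<^sup>2) * (1 + (\<bar>b\<bar> + 1) / (b\<^sup>2 + 1)) * exp (- u)"
      proof (rule always_eventually, rule allI)
        fix u
        have "\<bar>V u / (b\<^sup>2 + 1)\<bar> \<le> exp (- u) * (\<bar>b\<bar> + 1) / (b\<^sup>2 + 1)"
          using b Vb[of u] by (simp add: divide_right_mono)
        then have "\<bar>- exp (- u) - V u / (b\<^sup>2 + 1)\<bar> \<le> exp (- u) + exp (- u) * (\<bar>b\<bar> + 1) / (b\<^sup>2 + 1)"
          by (smt (verit) exp_gt_zero)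
        then have "norm (F u) \<le> (2 / y\<^sup>2) * (exp (- u) + exp (- u) * (\<bar>b\<bar> + 1) / (b\<^sup>2 + 1))"
          unfolding F_def norm_mult by (intro mult_mono) auto
        then show "norm (F u) \<le> (2 / y\<^sup>2) * (1 + (\<bar>b\<bar> + 1) / (b\<^sup>2 + 1)) * exp (- u)"
          by (simp only: mult.assoc distrib_right times_divide_eq_right times_divide_eq_left mult.commute[of "exp (- u)"] mult_1)
      qed
      show "((\<lambda>u. (2 / y\<^sup>2) * (1 + (\<bar>b\<bar> + 1) / (b\<^sup>2 + 1)) * exp (- u)) \<longlongrightarrow> 0) at_top"
        by (intro tendsto_mult_right_zero) real_asymp
    qed
  qed (auto simp: fejer_nonneg)
  also have "0 - F 0 = 2 * (T\<^sup>2 / (1 + T\<^sup>2 * y\<^sup>2))"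
    using False b by (simp add: F_def V_def b_def field_simps power_mult_distrib)
  finally show ?thesis .
qed

text \<open>
  The same kernel as a mixture of indicators of the intervals \<open>\<bar>y\<bar> < \<theta> / T\<close>, taken at
  \<open>c = \<bar>y\<bar> * T\<close>.
\<close>

lemma stieltjes_layer:
  "(\<integral>\<^sup>+\<theta>. ennreal (2 * \<theta> / (1 + \<theta>\<^sup>2)\<^sup>2) * indicator {c..} \<theta> \<partial>lborel) = ennreal (1 / (1 + c\<^sup>2))" if "c \<ge> 0" for c :: real
proof -
  have p: "1 + \<theta>\<^sup>2 > 0" for \<theta> :: real by (simp add: add_pos_nonneg)
  have "(\<integral>\<^sup>+\<theta>. ennreal (2 * \<theta> / (1 + \<theta>\<^sup>2)\<^sup>2) * indicator {c..} \<theta> \<partial>lborel) = ennreal (0 - (- (1 / (1 + c\<^sup>2))))"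
  proof (rule nn_integral_FTC_atLeast)
    show "DERIV (\<lambda>\<theta>. - (1 / (1 + \<theta>\<^sup>2))) \<theta> :> 2 * \<theta> / (1 + \<theta>\<^sup>2)\<^sup>2" for \<theta> :: real
      using p[of \<theta>] by (auto intro!: derivative_eq_intros simp: power2_eq_square)
    show "((\<lambda>\<theta>::real. - (1 / (1 + \<theta>\<^sup>2))) \<longlongrightarrow> 0) at_top" by real_asymp
  qed (use that in auto)
  then show ?thesis by simp
qed

lemma has_bochner_integral_lborel_of_has_integral:
  fixes f :: "real \<Rightarrow> real"
  assumes [measurable]: "f \<in> borel_measurable borel" and S[measurable]: "S \<in> sets borel"
    and nn: "\<And>x. x \<in> S \<Longrightarrow> 0 \<le> f x" and I: "(f has_integral I) S"
  shows "has_bochner_integral lborel (\<lambda>x. indicator S x * f x) I"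
proof (rule has_bochner_integral_nn_integral)
  have "((\<lambda>x. if x \<in> S then f x else 0) has_integral I) UNIV"
    using I by (simp add: has_integral_restrict_UNIV)
  then have "((\<lambda>x. indicator S x * f x) has_integral I) UNIV"
    by (rule has_integral_eq[rotated]) (auto simp: indicator_def)
  then show "(\<integral>\<^sup>+x. ennreal (indicator S x * f x) \<partial>lborel) = ennreal I"
    by (intro nn_integral_has_integral_lborel) (auto simp: indicator_def nn)
  show "0 \<le> I" using has_integral_nonneg[OF I] nn by auto
qed (auto simp: indicator_def nn)

lemma gamma_kernel:
  fixes p :: real assumes "p > -1"
  shows "has_bochner_integral lborel (\<lambda>u. (indicator {0<..} u * exp (- u)) * u powr p) (Gamma (p + 1))"
proof -
  have "((\<lambda>t. t powr (p + 1 - 1) / exp t) has_integral Gamma (p + 1)) {0..}"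
    using assms by (intro Gamma_integral_real) auto
  then have "has_bochner_integral lborel (\<lambda>u. indicator {0..} u * (u powr (p + 1 - 1) / exp u)) (Gamma (p + 1))"
    by (intro has_bochner_integral_lborel_of_has_integral) auto
  then show ?thesis
    by (rule has_bochner_integral_cong[THEN iffD1, rotated -1])
       (auto simp: indicator_def exp_minus divide_inverse)
qed

text \<open>
  The substitution \<open>t = \<theta>\<^sup>2 / (1 + \<theta>\<^sup>2)\<close> turns this into Euler's Beta integral.
\<close>

lemma stieltjes_kernel:
  fixes p :: real assumes p: "0 < p" "p < 2"
  shows "has_bochner_integral lborel (\<lambda>\<theta>. (indicator {0<..} \<theta> * (2 * \<theta> / (1 + \<theta>\<^sup>2)\<^sup>2)) * (1 / \<theta>) powr (- p))
    (Beta (1 + p / 2) (1 - p / 2))"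
proof -
  define f where "f t = t powr (p / 2) * (1 - t) powr (- (p / 2))" for t :: real
  define g where "g \<theta> = \<theta>\<^sup>2 / (1 + \<theta>\<^sup>2)" for \<theta> :: real
  define g' where "g' \<theta> = 2 * \<theta> / (1 + \<theta>\<^sup>2)\<^sup>2" for \<theta> :: real
  have pos: "1 + \<theta>\<^sup>2 > 0" for \<theta> :: real by (simp add: add_pos_nonneg)
  have im: "g ` {0<..} = {0<..<1}"
  proof
    show "g ` {0<..} \<subseteq> {0<..<1}" using pos by (auto simp: g_def)
    show "{0<..<1} \<subseteq> g ` {0<..}"
    proof
      fix t :: real assume t: "t \<in> {0<..<1}"
      have "g (sqrt (t / (1 - t))) = t" using t by (simp add: g_def field_simps)
      moreover have "sqrt (t / (1 - t)) \<in> {0<..}" using t by simp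
      ultimately show "t \<in> g ` {0<..}" by (metis imageI)
    qed
  qed
  have inj: "inj_on g {0<..}"
  proof (rule inj_onI)
    fix x y :: real assume xy: "x \<in> {0<..}" "y \<in> {0<..}" "g x = g y"
    then have "x\<^sup>2 = y\<^sup>2" using pos[of x] pos[of y] by (simp add: g_def frac_eq_eq algebra_simps)
    then show "x = y" using xy by (simp add: power2_eq_iff_nonneg)
  qed
  have der: "(g has_field_derivative g' \<theta>) (at \<theta> within {0<..})" for \<theta>
    unfolding g_def g'_def using pos[of \<theta>]
    by (auto intro!: derivative_eq_intros simp: power2_eq_square field_simps)
  have B: "(f has_integral Beta (1 + p / 2) (1 - p / 2)) {0<..<1}"
    using has_integral_Beta_real[of "1 + p / 2" "1 - p / 2"] p
    by (simp add: f_def[abs_def] has_integral_Icc_iff_Ioo)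
  have "f absolutely_integrable_on {0<..<1}"
    using B by (intro nonnegative_absolutely_integrable_1) (auto simp: f_def has_integral_integrable)
  then have "(\<lambda>\<theta>. \<bar>g' \<theta>\<bar> * f (g \<theta>)) absolutely_integrable_on {0<..} \<and>
    integral {0<..} (\<lambda>\<theta>. \<bar>g' \<theta>\<bar> * f (g \<theta>)) = Beta (1 + p / 2) (1 - p / 2)"
    using has_absolute_integral_change_of_variables_1'[of "{0<..}" g g' f "Beta (1 + p / 2) (1 - p / 2)"]
      der inj B unfolding im by (auto simp: integral_unique)
  then have "((\<lambda>\<theta>. \<bar>g' \<theta>\<bar> * f (g \<theta>)) has_integral Beta (1 + p / 2) (1 - p / 2)) {0<..}"
    by (metis absolutely_integrable_on_def integrable_integral)
  then have "has_bochner_integral lborel (\<lambda>\<theta>. indicator {0<..} \<theta> * (\<bar>g' \<theta>\<bar> * f (g \<theta>))) (Beta (1 + p / 2) (1 - p / 2))"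
    by (intro has_bochner_integral_lborel_of_has_integral) (auto simp: f_def g_def g'_def)
  moreover have "indicator {0<..} \<theta> * (\<bar>g' \<theta>\<bar> * f (g \<theta>)) =
    (indicator {0<..} \<theta> * (2 * \<theta> / (1 + \<theta>\<^sup>2)\<^sup>2)) * (1 / \<theta>) powr (- p)" for \<theta> :: real
  proof (cases "\<theta> > 0")
    case True
    have 1: "1 - g \<theta> = 1 / (1 + \<theta>\<^sup>2)" using pos[of \<theta>] by (simp add: g_def field_simps)
    have "f (g \<theta>) = (\<theta>\<^sup>2) powr (p / 2)"
      unfolding f_def 1 using pos[of \<theta>] True by (simp add: g_def powr_divide powr_minus)
    also have "\<dots> = \<theta> powr p" using True by (simp add: powr_powr flip: powr_numeral)
    also have "\<dots> = (1 / \<theta>) powr (- p)" using True by (simp add: powr_minus powr_divide)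
    finally show ?thesis using True by (simp add: g'_def)
  qed simp
  ultimately show ?thesis by simp
qed

locale spectral_measure_on_line = finite_measure \<mu> for \<mu> :: "real measure" +
  assumes sets_eq[measurable_cong]: "sets \<mu> = sets borel"
begin

lemma space_eq: "space \<mu> = UNIV"
  using sets_eq_imp_space_eq[OF sets_eq] by simp

definition fejer_transform :: "real \<Rightarrow> real" where "fejer_transform T = (LINT y|\<mu>. fejer T y)"
definition central_mass :: "real \<Rightarrow> real" where "central_mass x = measure \<mu> {y. \<bar>y\<bar> < x}"
text \<open>
  The function \<open>stieltjes 0 a\<close> is the Stieltjes transform of the image of the measure under
  \<open>y \<mapsto> y\<^sup>2\<close>, at \<open>a / T\<^sup>2\<close>; up to the factor \<open>(-1) ^ j * fact j\<close>, \<open>stieltjes j\<close> is its \<open>j\<close>-th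
  derivative in \<open>a\<close>.
\<close>

definition stieltjes :: "nat \<Rightarrow> real \<Rightarrow> real \<Rightarrow> real" where
  "stieltjes j a T = (LINT y|\<mu>. T\<^sup>2 / (a + T\<^sup>2 * y\<^sup>2) ^ Suc j)"

lemma integrable_fejer: "integrable \<mu> (fejer T)"
  by (rule integrable_const_bound[of _ "T\<^sup>2"]) (auto simp: fejer_nonneg fejer_le)

lemma fejer_transform_nonneg: "0 \<le> fejer_transform T"
  unfolding fejer_transform_def by (rule integral_nonneg_AE) (auto simp: fejer_nonneg)

lemma fejer_transform_le: "fejer_transform T \<le> T\<^sup>2 * measure \<mu> (space \<mu>)"
proof -
  have "fejer_transform T \<le> (LINT y|\<mu>. T\<^sup>2)" unfolding fejer_transform_def
    by (rule integral_mono[OF integrable_fejer]) (auto simp: fejer_le)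
  then show ?thesis by (simp add: mult.commute)
qed

lemma fejer_transform_measurable[measurable]: "fejer_transform \<in> borel_measurable borel"
  unfolding fejer_transform_def[abs_def] by measurable

lemma central_mass_measurable[measurable]: "central_mass \<in> borel_measurable borel"
proof (rule borel_measurable_mono)
  show "mono central_mass" unfolding central_mass_def
    by (intro monoI finite_measure_mono) (auto simp: space_eq sets_eq)
qed

lemma central_mass_nonneg: "0 \<le> central_mass x" by (simp add: central_mass_def)

lemma integrable_stieltjes: "a > 0 \<Longrightarrow> integrable \<mu> (\<lambda>y. T\<^sup>2 / (a + T\<^sup>2 * y\<^sup>2) ^ Suc j)"
proof (rule integrable_const_bound[of _ "T\<^sup>2 / a ^ Suc j"])
  assume a: "a > 0"
  show "AE y in \<mu>. norm (T\<^sup>2 / (a + T\<^sup>2 * y\<^sup>2) ^ Suc j) \<le> T\<^sup>2 / a ^ Suc j"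
  proof (rule AE_I2)
    fix y
    have "0 \<le> T\<^sup>2 * y\<^sup>2" by simp
    then have "a ^ Suc j \<le> (a + T\<^sup>2 * y\<^sup>2) ^ Suc j" using a by (intro power_mono) linarith+
    moreover have "0 < a ^ Suc j" using a by simp
    ultimately have "T\<^sup>2 / (a + T\<^sup>2 * y\<^sup>2) ^ Suc j \<le> T\<^sup>2 / a ^ Suc j"
      by (intro divide_left_mono) (auto intro!: mult_pos_pos simp del: power_Suc)
    moreover have "0 \<le> T\<^sup>2 / (a + T\<^sup>2 * y\<^sup>2) ^ Suc j" using add_pos_nonneg[OF a \<open>0 \<le> T\<^sup>2 * y\<^sup>2\<close>] by simp
    ultimately show "norm (T\<^sup>2 / (a + T\<^sup>2 * y\<^sup>2) ^ Suc j) \<le> T\<^sup>2 / a ^ Suc j"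
      by (simp only: real_norm_def abs_of_nonneg)
  qed
qed measurable

lemma laplace_fejer_transform:
  assumes T: "T > 0"
  shows "(LINT u|lborel. (indicator {0<..} u * exp (- u)) * fejer_transform (u * T)) = 2 * stieltjes 0 1 T"
proof -
  have "(\<integral>\<^sup>+u. ennreal ((indicator {0<..} u * exp (- u)) * fejer_transform (u * T)) \<partial>lborel)
    = (\<integral>\<^sup>+u. (\<integral>\<^sup>+y. ennreal (exp (- u) * fejer (u * T) y) * indicator {0..} u \<partial>\<mu>) \<partial>lborel)"
  proof (rule nn_integral_cong_AE, rule AE_mp[OF AE_lborel_singleton[of 0]], rule AE_I2, rule impI)
    fix u :: real assume u: "u \<noteq> 0"
    have "(\<integral>\<^sup>+y. ennreal (exp (- u) * fejer (u * T) y) * indicator {0..} u \<partial>\<mu>)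
      = (\<integral>\<^sup>+y. ennreal (indicator {0..} u * exp (- u) * fejer (u * T) y) \<partial>\<mu>)"
      by (intro nn_integral_cong) (auto simp: indicator_def)
    also have "\<dots> = ennreal (LINT y|\<mu>. indicator {0..} u * exp (- u) * fejer (u * T) y)"
      using integrable_fejer by (intro nn_integral_eq_integral) (auto simp: fejer_nonneg)
    also have "(LINT y|\<mu>. indicator {0..} u * exp (- u) * fejer (u * T) y) = (indicator {0<..} u * exp (- u)) * fejer_transform (u * T)"
      using u by (auto simp: fejer_transform_def indicator_def)
    finally show "ennreal ((indicator {0<..} u * exp (- u)) * fejer_transform (u * T)) = (\<integral>\<^sup>+y. ennreal (exp (- u) * fejer (u * T) y) * indicator {0..} u \<partial>\<mu>)" ..
  qed
  also have "\<dots> = (\<integral>\<^sup>+y. (\<integral>\<^sup>+u. ennreal (exp (- u) * fejer (u * T) y) * indicator {0..} u \<partial>lborel) \<partial>\<mu>)"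
  proof -
    interpret pair_sigma_finite \<mu> "lborel :: real measure" ..
    show ?thesis by (rule Fubini') measurable
  qed
  also have "\<dots> = (\<integral>\<^sup>+y. ennreal (2 * (T\<^sup>2 / (1 + T\<^sup>2 * y\<^sup>2))) \<partial>\<mu>)"
    by (simp add: fejer_laplace[OF T])
  also have "\<dots> = ennreal (2 * stieltjes 0 1 T)"
    using integrable_mult_right[OF integrable_stieltjes[of 1 T 0], of 2]
    by (subst nn_integral_eq_integral) (auto simp: stieltjes_def simp del: times_divide_eq_right)
  finally have *: "(\<integral>\<^sup>+u. ennreal ((indicator {0<..} u * exp (- u)) * fejer_transform (u * T)) \<partial>lborel) = ennreal (2 * stieltjes 0 1 T)" .
  have "stieltjes 0 1 T \<ge> 0" unfolding stieltjes_def by (intro integral_nonneg_AE AE_I2) auto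
  then show ?thesis using * fejer_transform_nonneg
    by (subst integral_eq_nn_integral) (auto simp: indicator_def)
qed

lemma layer_cake_central_mass:
  assumes T: "T > 0"
  shows "(LINT \<theta>|lborel. (indicator {0<..} \<theta> * (2 * \<theta> / (1 + \<theta>\<^sup>2)\<^sup>2)) * central_mass (\<theta> / T)) = stieltjes 0 1 T / T\<^sup>2"
proof -
  have "(\<integral>\<^sup>+\<theta>. ennreal ((indicator {0<..} \<theta> * (2 * \<theta> / (1 + \<theta>\<^sup>2)\<^sup>2)) * central_mass (\<theta> / T)) \<partial>lborel)
    = (\<integral>\<^sup>+\<theta>. (\<integral>\<^sup>+y. ennreal (2 * \<theta> / (1 + \<theta>\<^sup>2)\<^sup>2) * indicator {\<bar>y\<bar> * T<..} \<theta> \<partial>\<mu>) \<partial>lborel)"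
  proof (rule nn_integral_cong)
    fix \<theta> :: real
    have "(\<integral>\<^sup>+y. ennreal (2 * \<theta> / (1 + \<theta>\<^sup>2)\<^sup>2) * indicator {\<bar>y\<bar> * T<..} \<theta> \<partial>\<mu>)
      = (\<integral>\<^sup>+y. ennreal (2 * \<theta> / (1 + \<theta>\<^sup>2)\<^sup>2) * indicator {y. \<bar>y\<bar> < \<theta> / T} y \<partial>\<mu>)"
      using T by (intro nn_integral_cong) (auto simp: indicator_def pos_less_divide_eq)
    also have "\<dots> = ennreal (2 * \<theta> / (1 + \<theta>\<^sup>2)\<^sup>2) * ennreal (central_mass (\<theta> / T))"
      by (subst nn_integral_cmult_indicator) (auto simp: central_mass_def emeasure_eq_measure sets_eq)
    also have "\<dots> = ennreal ((indicator {0<..} \<theta> * (2 * \<theta> / (1 + \<theta>\<^sup>2)\<^sup>2)) * central_mass (\<theta> / T))"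
    proof (cases "\<theta> > 0")
      case False
      then have "{y. \<bar>y\<bar> < \<theta> / T} = {}" using T by (auto simp: pos_less_divide_eq not_less intro: order_trans)
      then show ?thesis using False by (simp add: central_mass_def)
    qed (simp add: ennreal_mult[symmetric] central_mass_def)
    finally show "ennreal ((indicator {0<..} \<theta> * (2 * \<theta> / (1 + \<theta>\<^sup>2)\<^sup>2)) * central_mass (\<theta> / T)) =
      (\<integral>\<^sup>+y. ennreal (2 * \<theta> / (1 + \<theta>\<^sup>2)\<^sup>2) * indicator {\<bar>y\<bar> * T<..} \<theta> \<partial>\<mu>)" ..
  qed
  also have "\<dots> = (\<integral>\<^sup>+y. (\<integral>\<^sup>+\<theta>. ennreal (2 * \<theta> / (1 + \<theta>\<^sup>2)\<^sup>2) * indicator {\<bar>y\<bar> * T<..} \<theta> \<partial>lborel) \<partial>\<mu>)"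
  proof -
    interpret pair_sigma_finite \<mu> "lborel :: real measure" ..
    have eq: "(\<lambda>(y, \<theta>). ennreal (2 * \<theta> / (1 + \<theta>\<^sup>2)\<^sup>2) * indicator {\<bar>y\<bar> * T<..} \<theta>) =
      (\<lambda>(y, \<theta>). if \<bar>y\<bar> * T < \<theta> then ennreal (2 * \<theta> / (1 + \<theta>\<^sup>2)\<^sup>2) else 0)"
      by (auto simp: indicator_def fun_eq_iff)
    show ?thesis by (rule Fubini', subst eq) measurable
  qed
  also have "\<dots> = (\<integral>\<^sup>+y. ennreal (1 / (1 + T\<^sup>2 * y\<^sup>2)) \<partial>\<mu>)"
  proof (rule nn_integral_cong)
    fix y
    have "(\<integral>\<^sup>+\<theta>. ennreal (2 * \<theta> / (1 + \<theta>\<^sup>2)\<^sup>2) * indicator {\<bar>y\<bar> * T<..} \<theta> \<partial>lborel)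
      = (\<integral>\<^sup>+\<theta>. ennreal (2 * \<theta> / (1 + \<theta>\<^sup>2)\<^sup>2) * indicator {\<bar>y\<bar> * T..} \<theta> \<partial>lborel)"
      by (rule nn_integral_cong_AE, rule AE_mp[OF AE_lborel_singleton[of "\<bar>y\<bar> * T"]]) (auto simp: indicator_def)
    also have "\<dots> = ennreal (1 / (1 + (\<bar>y\<bar> * T)\<^sup>2))" using T by (intro stieltjes_layer) auto
    finally show "(\<integral>\<^sup>+\<theta>. ennreal (2 * \<theta> / (1 + \<theta>\<^sup>2)\<^sup>2) * indicator {\<bar>y\<bar> * T<..} \<theta> \<partial>lborel) = ennreal (1 / (1 + T\<^sup>2 * y\<^sup>2))"
      by (simp add: power_mult_distrib mult.commute)
  qed
  also have "\<dots> = ennreal (stieltjes 0 1 T / T\<^sup>2)"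
    using integrable_stieltjes[of 1 T 0] T integrable_divide[OF integrable_stieltjes[of 1 T 0], of "T\<^sup>2"]
    by (subst nn_integral_eq_integral) (auto simp: stieltjes_def integral_divide_zero[symmetric] simp del: integral_divide_zero)
  finally have *: "(\<integral>\<^sup>+\<theta>. ennreal ((indicator {0<..} \<theta> * (2 * \<theta> / (1 + \<theta>\<^sup>2)\<^sup>2)) * central_mass (\<theta> / T)) \<partial>lborel) = ennreal (stieltjes 0 1 T / T\<^sup>2)" .
  have "stieltjes 0 1 T \<ge> 0" unfolding stieltjes_def by (intro integral_nonneg_AE AE_I2) auto
  then show ?thesis using *
    by (subst integral_eq_nn_integral) (auto simp: indicator_def central_mass_nonneg)
qed

text \<open>
  Near \<open>0\<close> the trivial bound \<open>T\<^sup>2 * \<mu> UNIV\<close> suffices, so \<open>\<delta> = \<alpha>\<close> can be taken.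
\<close>

lemma stieltjes_of_fejer_transform:
  assumes sv: "slowly_varying h" and \<alpha>: "0 < \<alpha>" "\<alpha> < 2"
    and lim: "((\<lambda>T. fejer_transform T / (T powr \<alpha> * h T)) \<longlongrightarrow> D) at_top"
  shows "((\<lambda>T. stieltjes 0 1 T / (T powr \<alpha> * h T)) \<longlongrightarrow> D * (Gamma (1 + \<alpha>) / 2)) at_top"
proof -
  have small: "\<exists>C. \<forall>t\<in>{0<..X}. fejer_transform t \<le> C * t powr (\<alpha> - \<alpha>)" for X
  proof (intro exI ballI)
    fix t assume t: "t \<in> {0<..X}"
    have "fejer_transform t \<le> t\<^sup>2 * measure \<mu> (space \<mu>)" by (rule fejer_transform_le)
    also have "\<dots> \<le> X\<^sup>2 * measure \<mu> (space \<mu>)" using t by (intro mult_right_mono power_mono) auto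
    finally show "fejer_transform t \<le> (X\<^sup>2 * measure \<mu> (space \<mu>)) * t powr (\<alpha> - \<alpha>)" using t by simp
  qed
  have "((\<lambda>T. (LINT u|lborel. (indicator {0<..} u * exp (- u)) * fejer_transform (u * T)) / (T powr \<alpha> * h T)) \<longlongrightarrow>
    D * (LINT u|lborel. (indicator {0<..} u * exp (- u)) * u powr \<alpha>)) at_top"
    by (rule abelian_regular_variation[OF sv \<alpha>(1) fejer_transform_measurable fejer_transform_nonneg lim small])
      (use gamma_kernel[of "0"] gamma_kernel[of "\<alpha> + \<alpha>"] \<alpha> in
        \<open>auto simp: has_bochner_integral_iff indicator_def split: if_splits\<close>)
  moreover have "(LINT u|lborel. (indicator {0<..} u * exp (- u)) * u powr \<alpha>) = Gamma (1 + \<alpha>)"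
    using gamma_kernel[of \<alpha>] \<alpha> by (simp add: has_bochner_integral_iff add.commute)
  ultimately have "((\<lambda>T. (LINT u|lborel. (indicator {0<..} u * exp (- u)) * fejer_transform (u * T)) / (T powr \<alpha> * h T)) \<longlongrightarrow>
    D * Gamma (1 + \<alpha>)) at_top" by simp
  then have "((\<lambda>T. (LINT u|lborel. (indicator {0<..} u * exp (- u)) * fejer_transform (u * T)) / (T powr \<alpha> * h T) / 2) \<longlongrightarrow>
    D * Gamma (1 + \<alpha>) / 2) at_top" by (rule tendsto_divide) auto
  moreover have "\<forall>\<^sub>F T in at_top. (LINT u|lborel. (indicator {0<..} u * exp (- u)) * fejer_transform (u * T)) / (T powr \<alpha> * h T) / 2
    = stieltjes 0 1 T / (T powr \<alpha> * h T)"
    using eventually_gt_at_top[of 0] by eventually_elim (simp add: laplace_fejer_transform)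
  ultimately show ?thesis by (simp add: tendsto_cong)
qed

text \<open>
  The kernel integrates \<open>\<theta> powr p\<close> for \<open>0 < p < 2\<close>, so \<open>\<delta>\<close> is chosen such that both
  \<open>2 - \<alpha> - \<delta>\<close> and \<open>2 - \<alpha> + \<delta>\<close> lie in this range. Small arguments are harmless because the mass
  is bounded.
\<close>

lemma stieltjes_of_central_mass:
  assumes sv: "slowly_varying h" and \<alpha>: "0 < \<alpha>" "\<alpha> < 2"
    and lim: "((\<lambda>T. central_mass (1 / T) / (T powr (\<alpha> - 2) * h T)) \<longlongrightarrow> D) at_top"
  shows "((\<lambda>T. stieltjes 0 1 T / (T powr \<alpha> * h T)) \<longlongrightarrow> D * Beta (2 - \<alpha> / 2) (\<alpha> / 2)) at_top"
proof -
  define \<delta> where "\<delta> = min \<alpha> (2 - \<alpha>) / 2"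
  have \<delta>: "\<delta> > 0" "\<delta> < \<alpha>" "\<delta> < 2 - \<alpha>" using \<alpha> by (auto simp: \<delta>_def)
  have small: "\<exists>C. \<forall>t\<in>{0<..X}. central_mass (1 / t) \<le> C * t powr ((\<alpha> - 2) - \<delta>)" for X
  proof (intro exI ballI)
    fix t assume t: "t \<in> {0<..X}"
    have "central_mass (1 / t) \<le> measure \<mu> (space \<mu>)" unfolding central_mass_def by (rule bounded_measure)
    also have "\<dots> \<le> measure \<mu> (space \<mu>) * (X / t) powr (2 - \<alpha> + \<delta>)"
    proof -
      have "1 \<le> (X / t) powr (2 - \<alpha> + \<delta>)" using t \<delta> by (intro ge_one_powr_ge_zero) auto
      then show ?thesis using mult_left_mono[of 1 "(X / t) powr (2 - \<alpha> + \<delta>)" "measure \<mu> (space \<mu>)"] by simp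
    qed
    also have "(X / t) powr (2 - \<alpha> + \<delta>) = X powr (2 - \<alpha> + \<delta>) * t powr ((\<alpha> - 2) - \<delta>)"
      using t by (simp add: powr_divide powr_minus_divide[symmetric] divide_powr_uminus)
    finally show "central_mass (1 / t) \<le> (measure \<mu> (space \<mu>) * X powr (2 - \<alpha> + \<delta>)) * t powr ((\<alpha> - 2) - \<delta>)"
      by (simp add: mult.assoc)
  qed
  let ?K = "\<lambda>\<theta>::real. indicator {0<..} \<theta> * (2 * \<theta> / (1 + \<theta>\<^sup>2)\<^sup>2) :: real"
  have ints: "integrable lborel (\<lambda>\<theta>. ?K \<theta> * (1 / \<theta>) powr (\<alpha> - 2 - \<delta>))" "integrable lborel (\<lambda>\<theta>. ?K \<theta> * (1 / \<theta>) powr (\<alpha> - 2 + \<delta>))"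
    using stieltjes_kernel[of "2 - \<alpha> + \<delta>"] stieltjes_kernel[of "2 - \<alpha> - \<delta>"] \<alpha> \<delta>
    by (auto simp: has_bochner_integral_iff algebra_simps)
  have "((\<lambda>T. (LINT \<theta>|lborel. ?K \<theta> * central_mass (1 / (1 / \<theta> * T))) / (T powr (\<alpha> - 2) * h T)) \<longlongrightarrow>
    D * (LINT \<theta>|lborel. ?K \<theta> * (1 / \<theta>) powr (\<alpha> - 2))) at_top"
  proof (rule abelian_regular_variation[where f = "\<lambda>t. central_mass (1 / t)", OF sv \<delta>(1) _ _ lim small])
    show "0 \<le> central_mass (1 / t)" for t by (simp add: central_mass_def)
  qed (use ints in \<open>auto simp: indicator_def split: if_splits\<close>)
  moreover have "(LINT \<theta>|lborel. ?K \<theta> * (1 / \<theta>) powr (\<alpha> - 2)) = Beta (2 - \<alpha> / 2) (\<alpha> / 2)"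
    using stieltjes_kernel[of "2 - \<alpha>"] \<alpha> by (simp add: has_bochner_integral_iff field_simps)
  ultimately have "((\<lambda>T. (LINT \<theta>|lborel. ?K \<theta> * central_mass (\<theta> / T)) / (T powr (\<alpha> - 2) * h T)) \<longlongrightarrow>
    D * Beta (2 - \<alpha> / 2) (\<alpha> / 2)) at_top" by simp
  moreover have "\<forall>\<^sub>F T in at_top. (LINT \<theta>|lborel. ?K \<theta> * central_mass (\<theta> / T)) / (T powr (\<alpha> - 2) * h T) = stieltjes 0 1 T / (T powr \<alpha> * h T)"
    using eventually_gt_at_top[of 0]
  proof eventually_elim
    case (elim T)
    then have "T powr \<alpha> = T powr (\<alpha> - 2) * T\<^sup>2" by (simp add: powr_diff)
    then show ?case using elim by (simp only: layer_cake_central_mass[OF elim]) (simp add: mult_ac)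
  qed
  ultimately show ?thesis by (simp add: tendsto_cong)
qed

lemma stieltjes_nonneg: "0 < a \<Longrightarrow> 0 \<le> stieltjes j a T"
  unfolding stieltjes_def by (intro integral_nonneg_AE AE_I2 divide_nonneg_nonneg zero_le_power2
    zero_le_power[of "_ + _"] add_nonneg_nonneg mult_nonneg_nonneg) auto

lemma stieltjes_rescale:
  assumes "a > 0" shows "stieltjes 0 a T = stieltjes 0 1 (T / sqrt a)"
proof -
  have "T\<^sup>2 / (a + T\<^sup>2 * y\<^sup>2) = (T / sqrt a)\<^sup>2 / (1 + (T / sqrt a)\<^sup>2 * y\<^sup>2)" for y
    using assms by (simp add: power_divide divide_simps)
  then show ?thesis by (simp add: stieltjes_def)
qed

text \<open>
  A convex function lies above its tangent.
\<close>

lemma inverse_power_tangent: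
  fixes x :: real assumes "x > 0" "x + \<eta> > 0"
  shows "1 / x ^ m - real m * \<eta> / x ^ Suc m \<le> 1 / (x + \<eta>) ^ m"
proof -
  have "1 + real m * (- \<eta> / (x + \<eta>)) \<le> (1 + (- \<eta> / (x + \<eta>))) ^ m"
    using assms by (intro Bernoulli_inequality) (simp add: field_simps)
  also have "1 + (- \<eta> / (x + \<eta>)) = x / (x + \<eta>)" using assms by (simp add: field_simps)
  finally have 1: "1 - real m * \<eta> / (x + \<eta>) \<le> x ^ m / (x + \<eta>) ^ m" by (simp add: power_divide)
  have "\<eta> / (x + \<eta>) \<le> \<eta> / x"
  proof -
    have "\<eta> / x - \<eta> / (x + \<eta>) = \<eta>\<^sup>2 / (x * (x + \<eta>))" using assms by (simp add: field_simps power2_eq_square)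
    also have "\<dots> \<ge> 0" using assms by simp
    finally show ?thesis by simp
  qed
  then have "real m * (\<eta> / (x + \<eta>)) \<le> real m * (\<eta> / x)" by (intro mult_left_mono) auto
  with 1 have "1 - real m * \<eta> / x \<le> x ^ m / (x + \<eta>) ^ m" by simp
  then have "(1 - real m * \<eta> / x) / x ^ m \<le> (x ^ m / (x + \<eta>) ^ m) / x ^ m"
    using assms by (intro divide_right_mono) auto
  then show ?thesis using assms by (simp add: diff_divide_distrib)
qed

lemma stieltjes_tangent:
  assumes "a > 0" "a + \<eta> > 0"
  shows "stieltjes j a T - real (Suc j) * \<eta> * stieltjes (Suc j) a T \<le> stieltjes j (a + \<eta>) T"
proof -
  have "stieltjes j a T - real (Suc j) * \<eta> * stieltjes (Suc j) a T =
    (LINT y|\<mu>. T\<^sup>2 / (a + T\<^sup>2 * y\<^sup>2) ^ Suc j - real (Suc j) * \<eta> * (T\<^sup>2 / (a + T\<^sup>2 * y\<^sup>2) ^ Suc (Suc j)))"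
    unfolding stieltjes_def using integrable_stieltjes[OF assms(1)]
    by (subst Bochner_Integration.integral_diff) (auto simp del: power_Suc times_divide_eq_right)
  also have "\<dots> \<le> stieltjes j (a + \<eta>) T" unfolding stieltjes_def
  proof (rule integral_mono)
    fix y
    have "0 \<le> T\<^sup>2 * y\<^sup>2" by simp
    then have "1 / (a + T\<^sup>2 * y\<^sup>2) ^ Suc j - real (Suc j) * \<eta> / (a + T\<^sup>2 * y\<^sup>2) ^ Suc (Suc j)
      \<le> 1 / (a + T\<^sup>2 * y\<^sup>2 + \<eta>) ^ Suc j"
      using assms by (intro inverse_power_tangent) linarith+
    then have "T\<^sup>2 * (1 / (a + T\<^sup>2 * y\<^sup>2) ^ Suc j - real (Suc j) * \<eta> / (a + T\<^sup>2 * y\<^sup>2) ^ Suc (Suc j))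
      \<le> T\<^sup>2 * (1 / (a + T\<^sup>2 * y\<^sup>2 + \<eta>) ^ Suc j)"
      by (intro mult_left_mono) auto
    then show "T\<^sup>2 / (a + T\<^sup>2 * y\<^sup>2) ^ Suc j - real (Suc j) * \<eta> * (T\<^sup>2 / (a + T\<^sup>2 * y\<^sup>2) ^ Suc (Suc j))
      \<le> T\<^sup>2 / (a + \<eta> + T\<^sup>2 * y\<^sup>2) ^ Suc j"
      by (simp add: right_diff_distrib mult_ac add_ac del: power_Suc)
  qed (use integrable_stieltjes[OF assms(1)] integrable_stieltjes[OF assms(2)] in \<open>auto simp del: power_Suc times_divide_eq_right\<close>)
  finally show ?thesis .
qed

text \<open>
  Differentiation of an asymptotic relation. The case \<open>j = 0\<close> for all \<open>a\<close> follows by rescaling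
  \<open>T\<close>. In the step, convexity in \<open>a\<close> bounds the derivative by difference quotients from both
  sides; their limits are known from the induction hypothesis and are close to the derivative
  of the limit function once \<open>\<eta>\<close> is small.
\<close>

lemma stieltjes_derivatives:
  assumes sv: "slowly_varying h" and \<alpha>: "0 < \<alpha>" "\<alpha> < 2"
    and lim: "((\<lambda>T. stieltjes 0 1 T / (T powr \<alpha> * h T)) \<longlongrightarrow> c) at_top"
    and a: "a > 0"
  shows "((\<lambda>T. stieltjes j a T / (T powr \<alpha> * h T)) \<longlongrightarrow>
    c * (pochhammer (\<alpha> / 2) j / fact j) * a powr (- (\<alpha> / 2) - real j)) at_top"
  using a
proof (induction j arbitrary: a)
  case (0 a)
  have hpos: "h t > 0" if "t > 0" for t using sv that by (auto simp: slowly_varying_def)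
  define s where "s = 1 / sqrt a"
  have s: "s > 0" using 0 by (simp add: s_def)
  have sT: "filterlim (\<lambda>T. s * T) at_top at_top"
    using s by (intro filterlim_tendsto_pos_mult_at_top[OF tendsto_const]) (auto simp: filterlim_ident)
  have "((\<lambda>T. stieltjes 0 1 (s * T) / ((s * T) powr \<alpha> * h (s * T)) * (s powr \<alpha> * (h (s * T) / h T)))
    \<longlongrightarrow> c * (s powr \<alpha> * 1)) at_top"
    using sv s by (intro tendsto_mult filterlim_compose[OF lim sT] tendsto_const) (auto simp: slowly_varying_def)
  moreover have "\<forall>\<^sub>F T in at_top. stieltjes 0 1 (s * T) / ((s * T) powr \<alpha> * h (s * T)) * (s powr \<alpha> * (h (s * T) / h T))
     = stieltjes 0 a T / (T powr \<alpha> * h T)"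
    using eventually_gt_at_top[of 0]
  proof eventually_elim
    case (elim T)
    then have "h T > 0" "h (s * T) > 0" using hpos s by auto
    moreover have "stieltjes 0 a T = stieltjes 0 1 (s * T)" using stieltjes_rescale[OF 0, of T] by (simp add: s_def)
    ultimately show ?case using elim s by (simp add: powr_mult field_simps)
  qed
  ultimately have "((\<lambda>T. stieltjes 0 a T / (T powr \<alpha> * h T)) \<longlongrightarrow> c * s powr \<alpha>) at_top"
    by (simp add: tendsto_cong)
  moreover have "s powr \<alpha> = a powr (- (\<alpha> / 2))"
    using 0 by (simp add: s_def powr_divide powr_minus_divide powr_half_sqrt[symmetric] powr_powr)
  ultimately show ?case by simp
next
  case (Suc j a)
  define q where "q = c * (pochhammer (\<alpha> / 2) j / fact j)"
  define \<phi> where "\<phi> b = q * b powr (- (\<alpha> / 2) - real j)" for b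
  define L where "L = c * (pochhammer (\<alpha> / 2) (Suc j) / fact (Suc j)) * a powr (- (\<alpha> / 2) - real (Suc j))"
  define n where "n T = T powr \<alpha> * h T" for T
  have hpos: "h t > 0" if "t > 0" for t using sv that by (auto simp: slowly_varying_def)
  have npos: "n T > 0" if "T > 0" for T using hpos that by (simp add: n_def)
  have IH: "((\<lambda>T. stieltjes j b T / n T) \<longlongrightarrow> \<phi> b) at_top" if "b > 0" for b
    using Suc.IH[OF that] by (simp add: \<phi>_def q_def n_def)
  have deriv: "(\<phi> has_real_derivative - (real (Suc j) * L)) (at a)"
  proof -
    have "(\<phi> has_real_derivative q * ((- (\<alpha> / 2) - real j) * a powr (- (\<alpha> / 2) - real j - 1))) (at a)"
      unfolding \<phi>_def using Suc.prems by (auto intro!: derivative_eq_intros)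
    also have "q * ((- (\<alpha> / 2) - real j) * a powr (- (\<alpha> / 2) - real j - 1)) = - (real (Suc j) * L)"
    proof -
      have 1: "- (\<alpha> / 2) - real j - 1 = - (\<alpha> / 2) - real (Suc j)" by simp
      define A where "A = a powr (- (\<alpha> / 2) - real (Suc j))"
      define P where "P = pochhammer (\<alpha> / 2) j / fact j"
      have "real (Suc j) * (pochhammer (\<alpha> / 2) (Suc j) / fact (Suc j)) = P * (\<alpha> / 2 + real j)"
        by (simp add: pochhammer_Suc fact_Suc P_def del: of_nat_Suc)
      moreover have "real (Suc j) * L = (real (Suc j) * (pochhammer (\<alpha> / 2) (Suc j) / fact (Suc j))) * (c * A)"
        by (simp only: L_def A_def mult_ac)
      ultimately have "real (Suc j) * L = P * (\<alpha> / 2 + real j) * (c * A)" by (simp only:)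
      moreover have "q = c * P" by (simp add: q_def P_def)
      ultimately show ?thesis unfolding 1 A_def[symmetric] by (simp add: algebra_simps)
    qed
    finally show ?thesis .
  qed
  have "((\<lambda>T. stieltjes (Suc j) a T / n T) \<longlongrightarrow> L) at_top"
  proof (rule order_tendstoI)
    have quot: "((\<lambda>\<eta>. (\<phi> (a + \<eta>) - \<phi> a) / \<eta>) \<longlongrightarrow> - (real (Suc j) * L)) (at 0)"
      using deriv by (simp add: DERIV_def)
    then have quot': "((\<lambda>\<eta>. (\<phi> a - \<phi> (a + \<eta>)) / (real (Suc j) * \<eta>)) \<longlongrightarrow> L) (at 0)"
    proof -
      have "((\<lambda>\<eta>. - ((\<phi> (a + \<eta>) - \<phi> a) / \<eta>) / real (Suc j)) \<longlongrightarrow> - (- (real (Suc j) * L)) / real (Suc j)) (at 0)"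
        by (intro tendsto_divide tendsto_minus quot tendsto_const) auto
      moreover have "- ((\<phi> (a + \<eta>) - \<phi> a) / \<eta>) / real (Suc j) = (\<phi> a - \<phi> (a + \<eta>)) / (real (Suc j) * \<eta>)" for \<eta>
        by (simp add: minus_divide_left mult.commute del: of_nat_Suc)
      ultimately show ?thesis by (simp del: of_nat_Suc)
    qed
    have Rq: "((\<lambda>T. (stieltjes j a T / n T - stieltjes j (a + \<eta>) T / n T) / (real (Suc j) * \<eta>)) \<longlongrightarrow> (\<phi> a - \<phi> (a + \<eta>)) / (real (Suc j) * \<eta>)) at_top"
      if "a + \<eta> > 0" "\<eta> \<noteq> 0" for \<eta>
      using that Suc.prems by (intro tendsto_divide tendsto_diff IH tendsto_const) auto
    have tan: "(stieltjes j a T / n T - stieltjes j (a + \<eta>) T / n T) \<le> real (Suc j) * \<eta> * (stieltjes (Suc j) a T / n T)"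
      if "a + \<eta> > 0" "T > 0" for \<eta> T
    proof -
      have "stieltjes j a T - stieltjes j (a + \<eta>) T \<le> real (Suc j) * \<eta> * stieltjes (Suc j) a T"
        using stieltjes_tangent[OF Suc.prems that(1), of j T] by linarith
      then have "(stieltjes j a T - stieltjes j (a + \<eta>) T) / n T \<le> (real (Suc j) * \<eta> * stieltjes (Suc j) a T) / n T"
        using npos[OF that(2)] by (intro divide_right_mono) auto
      then show ?thesis by (simp add: diff_divide_distrib del: of_nat_Suc)
    qed
    {
      \<comment> \<open>Lower bounds use a positive increment \<open>\<eta>\<close>, upper bounds a negative one.\<close>
      fix l assume "l < L"
      have "\<forall>\<^sub>F \<eta> in at_right 0. l < (\<phi> a - \<phi> (a + \<eta>)) / (real (Suc j) * \<eta>)"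
        using order_tendstoD(1)[OF quot' \<open>l < L\<close>] by (simp add: eventually_at_split)
      moreover have "\<forall>\<^sub>F \<eta> in at_right (0::real). \<eta> > 0" by (simp add: eventually_at_right_less)
      ultimately have "\<forall>\<^sub>F \<eta> in at_right 0. \<eta> > 0 \<and> l < (\<phi> a - \<phi> (a + \<eta>)) / (real (Suc j) * \<eta>)"
        by (rule eventually_elim2) simp
      then obtain \<eta> where \<eta>: "\<eta> > 0" "l < (\<phi> a - \<phi> (a + \<eta>)) / (real (Suc j) * \<eta>)"
        using eventually_happens trivial_limit_at_right_real by blast
      have a\<eta>: "a + \<eta> > 0" using \<eta> Suc.prems by simp
      have "\<forall>\<^sub>F T in at_top. l < (stieltjes j a T / n T - stieltjes j (a + \<eta>) T / n T) / (real (Suc j) * \<eta>)"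
        using \<eta> by (intro order_tendstoD(1)[OF Rq[OF a\<eta>]]) auto
      then show "\<forall>\<^sub>F T in at_top. l < stieltjes (Suc j) a T / n T"
        using eventually_gt_at_top[of 0]
      proof eventually_elim
        case (elim T)
        note elim(1)
        also have "(stieltjes j a T / n T - stieltjes j (a + \<eta>) T / n T) / (real (Suc j) * \<eta>) \<le> stieltjes (Suc j) a T / n T"
          using tan[OF a\<eta> elim(2)] \<eta>(1) by (subst pos_divide_le_eq) (auto simp: mult_ac simp del: of_nat_Suc)
        finally show ?case .
      qed
    }
    {
      fix u assume "L < u"
      have "\<forall>\<^sub>F \<eta> in at_left 0. (\<phi> a - \<phi> (a + \<eta>)) / (real (Suc j) * \<eta>) < u"
        using order_tendstoD(2)[OF quot' \<open>L < u\<close>] by (simp add: eventually_at_split)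
      moreover have "\<forall>\<^sub>F \<eta> in at_left (0::real). - a < \<eta> \<and> \<eta> < 0"
        using eventually_at_left_real[of "- a" 0] Suc.prems by simp
      ultimately have "\<forall>\<^sub>F \<eta> in at_left 0. (- a < \<eta> \<and> \<eta> < 0) \<and> (\<phi> a - \<phi> (a + \<eta>)) / (real (Suc j) * \<eta>) < u"
        by (rule eventually_elim2) simp
      then obtain \<eta> where \<eta>: "- a < \<eta>" "\<eta> < 0" "(\<phi> a - \<phi> (a + \<eta>)) / (real (Suc j) * \<eta>) < u"
        using eventually_happens trivial_limit_at_left_real by blast
      have a\<eta>: "a + \<eta> > 0" using \<eta> by simp
      have "\<forall>\<^sub>F T in at_top. (stieltjes j a T / n T - stieltjes j (a + \<eta>) T / n T) / (real (Suc j) * \<eta>) < u"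
        using \<eta> by (intro order_tendstoD(2)[OF Rq[OF a\<eta>]]) auto
      then show "\<forall>\<^sub>F T in at_top. stieltjes (Suc j) a T / n T < u"
        using eventually_gt_at_top[of 0]
      proof eventually_elim
        case (elim T)
        have "stieltjes (Suc j) a T / n T \<le> (stieltjes j a T / n T - stieltjes j (a + \<eta>) T / n T) / (real (Suc j) * \<eta>)"
          using tan[OF a\<eta> elim(2)] \<eta>(2)
          by (subst neg_le_divide_eq) (auto simp: mult_ac mult_less_0_iff simp del: of_nat_Suc)
        also note elim(1)
        finally show ?case .
      qed
    }
  qed
  then show ?case by (simp add: L_def n_def)
qed

end

context spectral_measure_on_line begin

lemma stieltjes_pos:
  assumes "stieltjes 0 1 T \<noteq> 0" shows "stieltjes 0 1 T > 0"
  using stieltjes_nonneg[of 1 0 T] assms by simp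

text \<open>
  The law of \<open>1 / (1 + T\<^sup>2 * y\<^sup>2)\<close> when \<open>y\<close> is drawn with density proportional to
  \<open>T\<^sup>2 / (1 + T\<^sup>2 * y\<^sup>2)\<close>. Its \<open>j\<close>-th moment is \<open>stieltjes j 1 T / stieltjes 0 1 T\<close>.
\<close>

definition tilted_law :: "real \<Rightarrow> real measure" where
  "tilted_law T = distr (density \<mu> (\<lambda>y. ennreal (T\<^sup>2 / (1 + T\<^sup>2 * y\<^sup>2) / stieltjes 0 1 T))) borel (\<lambda>y. 1 / (1 + T\<^sup>2 * y\<^sup>2))"

lemma integral_tilted_law:
  fixes \<phi> :: "real \<Rightarrow> real"
  assumes [measurable]: "\<phi> \<in> borel_measurable borel" and R: "stieltjes 0 1 T > 0"
  shows "(LINT t|tilted_law T. \<phi> t) = (LINT y|\<mu>. T\<^sup>2 / (1 + T\<^sup>2 * y\<^sup>2) * \<phi> (1 / (1 + T\<^sup>2 * y\<^sup>2))) / stieltjes 0 1 T"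
proof -
  have "(LINT t|tilted_law T. \<phi> t) = (LINT y|density \<mu> (\<lambda>y. ennreal (T\<^sup>2 / (1 + T\<^sup>2 * y\<^sup>2) / stieltjes 0 1 T)). \<phi> (1 / (1 + T\<^sup>2 * y\<^sup>2)))"
    unfolding tilted_law_def by (intro integral_distr) auto
  also have "\<dots> = (LINT y|\<mu>. (T\<^sup>2 / (1 + T\<^sup>2 * y\<^sup>2) / stieltjes 0 1 T) * \<phi> (1 / (1 + T\<^sup>2 * y\<^sup>2)))"
    using R by (subst integral_density) auto
  also have "\<dots> = (LINT y|\<mu>. T\<^sup>2 / (1 + T\<^sup>2 * y\<^sup>2) * \<phi> (1 / (1 + T\<^sup>2 * y\<^sup>2)) / stieltjes 0 1 T)"
    by (simp add: mult_ac)
  also have "\<dots> = (LINT y|\<mu>. T\<^sup>2 / (1 + T\<^sup>2 * y\<^sup>2) * \<phi> (1 / (1 + T\<^sup>2 * y\<^sup>2))) / stieltjes 0 1 T"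
    by (rule integral_divide_zero)
  finally show ?thesis .
qed

lemma tilted_law_distribution:
  assumes R: "stieltjes 0 1 T > 0"
  shows "real_distribution (tilted_law T)" and "AE t in tilted_law T. 0 < t \<and> t \<le> 1"
proof -
  have p: "0 < 1 + T\<^sup>2 * y\<^sup>2" for y :: real by (intro add_pos_nonneg) auto
  have "emeasure (density \<mu> (\<lambda>y. ennreal (T\<^sup>2 / (1 + T\<^sup>2 * y\<^sup>2) / stieltjes 0 1 T))) (space \<mu>) =
     (\<integral>\<^sup>+y. ennreal (T\<^sup>2 / (1 + T\<^sup>2 * y\<^sup>2) / stieltjes 0 1 T) \<partial>\<mu>)"
    by (subst emeasure_density) (auto intro!: nn_integral_cong)
  also have "\<dots> = ennreal (LINT y|\<mu>. T\<^sup>2 / (1 + T\<^sup>2 * y\<^sup>2) / stieltjes 0 1 T)"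
  proof (rule nn_integral_eq_integral)
    show "integrable \<mu> (\<lambda>y. T\<^sup>2 / (1 + T\<^sup>2 * y\<^sup>2) / stieltjes 0 1 T)"
      using integrable_stieltjes[of 1 T 0] by (intro integrable_divide_zero) auto
  qed (use R in auto)
  also have "(LINT y|\<mu>. T\<^sup>2 / (1 + T\<^sup>2 * y\<^sup>2) / stieltjes 0 1 T) = stieltjes 0 1 T / stieltjes 0 1 T"
    unfolding integral_divide_zero by (simp add: stieltjes_def)
  also have "\<dots> = 1" using R by simp
  finally have "prob_space (density \<mu> (\<lambda>y. ennreal (T\<^sup>2 / (1 + T\<^sup>2 * y\<^sup>2) / stieltjes 0 1 T)))"
    by (intro prob_spaceI) simp
  then interpret D: prob_space "density \<mu> (\<lambda>y. ennreal (T\<^sup>2 / (1 + T\<^sup>2 * y\<^sup>2) / stieltjes 0 1 T))" .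
  show "real_distribution (tilted_law T)"
    unfolding tilted_law_def by (intro D.real_distribution_distr) simp
  show "AE t in tilted_law T. 0 < t \<and> t \<le> 1"
    unfolding tilted_law_def using p by (subst AE_distr_iff) (auto simp: divide_le_eq_1)
qed

end

text \<open>
  The Beta law with parameters \<open>a\<close> and \<open>1 - a\<close>.
\<close>

definition beta_law :: "real \<Rightarrow> real measure" where
  "beta_law a = density lborel (\<lambda>t. ennreal (indicator {0<..<1} t * (t powr (a - 1) * (1 - t) powr (- a)) / Beta a (1 - a)))"

lemma Beta_pos: "0 < a \<Longrightarrow> 0 < b \<Longrightarrow> Beta a b > (0::real)"
  by (simp add: Beta_def Gamma_real_pos)

lemma has_bochner_integral_beta_density:
  assumes a: "0 < a" "a < 1"
  shows "has_bochner_integral lborel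
    (\<lambda>t. indicator {0<..<1} t * (t powr (a - 1) * (1 - t) powr (- a)) * t ^ j) (Beta (a + real j) (1 - a))"
proof -
  have "((\<lambda>t. t powr (a + real j - 1) * (1 - t) powr (1 - a - 1)) has_integral Beta (a + real j) (1 - a)) {0<..<1}"
    using has_integral_Beta_real[of "a + real j" "1 - a"] a by (simp add: has_integral_Icc_iff_Ioo)
  then have "has_bochner_integral lborel (\<lambda>t. indicator {0<..<1} t * (t powr (a + real j - 1) * (1 - t) powr (1 - a - 1)))
      (Beta (a + real j) (1 - a))"
    by (intro has_bochner_integral_lborel_of_has_integral) auto
  then show ?thesis
  proof (rule has_bochner_integral_cong[THEN iffD1, rotated -1])
    fix t :: real
    have "t powr (a + real j - 1) = t powr (a - 1) * t ^ j" if "t > 0"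
      using that by (simp add: powr_realpow[symmetric] powr_add[symmetric] algebra_simps)
    then show "indicator {0<..<1} t * (t powr (a + real j - 1) * (1 - t) powr (1 - a - 1)) =
      indicator {0<..<1} t * (t powr (a - 1) * (1 - t) powr (- a)) * t ^ j"
      by (auto simp: indicator_def)
  qed auto
qed

lemma beta_law_moment:
  assumes a: "0 < a" "a < 1"
  shows "(LINT t|beta_law a. t ^ j) = pochhammer a j / fact j"
proof -
  have B: "Beta a (1 - a) > 0" using a by (intro Beta_pos) auto
  have "(LINT t|beta_law a. t ^ j) = (LINT t|lborel. indicator {0<..<1} t * (t powr (a - 1) * (1 - t) powr (- a)) / Beta a (1 - a) * t ^ j)"
    unfolding beta_law_def using B by (subst integral_density) (auto simp: indicator_def)
  also have "\<dots> = (LINT t|lborel. indicator {0<..<1} t * (t powr (a - 1) * (1 - t) powr (- a)) * t ^ j / Beta a (1 - a))"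
    by (simp add: mult_ac)
  also have "\<dots> = Beta (a + real j) (1 - a) / Beta a (1 - a)"
    using has_bochner_integral_beta_density[OF a, of j] by (simp add: has_bochner_integral_iff)
  also have "\<dots> = (Gamma (a + real j) / Gamma a) / Gamma (1 + real j)"
    using a by (simp add: Beta_def Gamma_real_pos field_simps add.commute less_imp_neq[symmetric])
  also have "Gamma (a + real j) / Gamma a = pochhammer a j"
    using a by (subst pochhammer_Gamma) (auto elim!: nonpos_Ints_cases)
  also have "Gamma (1 + real j) = fact j" by (simp add: Gamma_fact)
  finally show ?thesis .
qed

lemma beta_law_distribution:
  assumes a: "0 < a" "a < 1"
  shows "real_distribution (beta_law a)" and "AE t in beta_law a. 0 < t \<and> t < 1"
proof -
  have B: "Beta a (1 - a) > 0" using a by (intro Beta_pos) auto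
  have "emeasure (beta_law a) UNIV = (\<integral>\<^sup>+t. ennreal (indicator {0<..<1} t * (t powr (a - 1) * (1 - t) powr (- a)) / Beta a (1 - a)) \<partial>lborel)"
    unfolding beta_law_def by (subst emeasure_density) (auto intro!: nn_integral_cong)
  also have "\<dots> = ennreal (Beta a (1 - a) / Beta a (1 - a))"
    using has_bochner_integral_beta_density[OF a, of 0] B
    by (subst nn_integral_eq_integral) (auto simp: has_bochner_integral_iff indicator_def)
  finally show "real_distribution (beta_law a)"
    using B by (intro real_distribution.intro prob_spaceI real_distribution_axioms.intro) (auto simp: beta_law_def)
  show "AE t in beta_law a. 0 < t \<and> t < 1"
    unfolding beta_law_def by (subst AE_density) (auto simp: indicator_def split: if_splits)
qed

text \<open>
  On the unit interval every continuous function is a uniform limit of its Bernstein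
  polynomials, so moments determine convergence.
\<close>

lemma moments_imp_integral_conv:
  fixes f :: "real \<Rightarrow> real"
  assumes M: "\<And>n. real_distribution (M n)" "\<And>n. AE t in M n. 0 \<le> t \<and> t \<le> 1"
    and Q: "real_distribution Q" "AE t in Q. 0 \<le> t \<and> t \<le> 1"
    and mom: "\<And>j. (\<lambda>n. LINT t|M n. t ^ j) \<longlonglongrightarrow> (LINT t|Q. t ^ j)"
    and f: "continuous_on UNIV f"
  shows "(\<lambda>n. LINT t|M n. f t) \<longlonglongrightarrow> (LINT t|Q. f t)"
proof -
  have [measurable]: "f \<in> borel_measurable borel" using f by (rule borel_measurable_continuous_onI)
  have int_poly: "integrable N (\<lambda>t. t ^ k * (1 - t) ^ l)"
    if N: "real_distribution N" "AE t in N. 0 \<le> t \<and> t \<le> 1" for N :: "real measure" and k l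
  proof -
    interpret real_distribution N by fact
    show ?thesis
    proof (rule integrable_const_bound[of _ 1])
      show "AE t in N. norm (t ^ k * (1 - t) ^ l) \<le> 1"
        using N(2) by eventually_elim (auto intro!: mult_le_one power_le_one)
    qed simp
  qed
  have mono: "(\<lambda>n. LINT t|M n. t ^ k * (1 - t) ^ l) \<longlonglongrightarrow> (LINT t|Q. t ^ k * (1 - t) ^ l)" for k l
  proof (induction l arbitrary: k)
    case 0
    then show ?case using mom[of k] by simp
  next
    case (Suc l)
    have "(LINT t|N. t ^ k * (1 - t) ^ Suc l) = (LINT t|N. t ^ k * (1 - t) ^ l) - (LINT t|N. t ^ Suc k * (1 - t) ^ l)"
      if N: "real_distribution N" "AE t in N. 0 \<le> t \<and> t \<le> 1" for N :: "real measure"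
      using int_poly[OF N, of k l] int_poly[OF N, of "Suc k" l]
      by (subst Bochner_Integration.integral_diff[symmetric])
        (auto intro!: Bochner_Integration.integral_cong simp: algebra_simps)
    then show ?case using tendsto_diff[OF Suc[of k] Suc[of "Suc k"]] M Q by simp
  qed
  define p where "p N t = (\<Sum>k\<le>N. f (real k / real N) * Bernstein N k t)" for N t
  have p_int: "(LINT t|N. p K t) = (\<Sum>k\<le>K. f (real k / real K) * (real (K choose k) * (LINT t|N. t ^ k * (1 - t) ^ (K - k))))"
    "integrable N (p K)"
    if N: "real_distribution N" "AE t in N. 0 \<le> t \<and> t \<le> 1" for N :: "real measure" and K
    unfolding p_def Bernstein_def using int_poly[OF N] by (auto simp: mult.assoc)
  show ?thesis
  proof (rule LIMSEQ_I)
    fix r :: real assume r: "0 < r"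
    have f01: "continuous_on {0..1} f" using f by (rule continuous_on_subset) simp
    obtain K where "\<forall>n x. K \<le> n \<and> x \<in> {0..1} \<longrightarrow> \<bar>f x - p n x\<bar> < r / 3"
      using Bernstein_Weierstrass[OF f01, of "r / 3"] r unfolding p_def by auto
    then have K: "\<And>x. x \<in> {0..1} \<Longrightarrow> \<bar>f x - p K x\<bar> < r / 3" by blast
    have close: "\<bar>(LINT t|N. f t) - (LINT t|N. p K t)\<bar> \<le> r / 3"
      if N: "real_distribution N" "AE t in N. 0 \<le> t \<and> t \<le> 1" for N :: "real measure"
    proof -
      interpret real_distribution N by fact
      have i: "integrable N (\<lambda>t. f t - p K t)"
      proof (rule integrable_const_bound[of _ "r / 3"])
        show "AE t in N. norm (f t - p K t) \<le> r / 3" using N(2) by eventually_elim (use K in force)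
      qed (simp add: p_def Bernstein_def)
      have f_int: "integrable N f"
        using Bochner_Integration.integrable_add[OF i p_int(2)[OF N, of K]] by simp
      have "\<bar>(LINT t|N. f t) - (LINT t|N. p K t)\<bar> = \<bar>LINT t|N. f t - p K t\<bar>"
        using f_int p_int(2)[OF N] by simp
      also have "\<dots> \<le> (LINT t|N. \<bar>f t - p K t\<bar>)" by (rule integral_abs_bound)
      also have "\<dots> \<le> (LINT t|N. r / 3)"
      proof (rule integral_mono_AE)
        show "AE t in N. \<bar>f t - p K t\<bar> \<le> r / 3" using N(2) by eventually_elim (use K in force)
      qed (use i in auto)
      also have "\<dots> = r / 3" using prob_space by simp
      finally show ?thesis .
    qed
    have "(\<lambda>n. LINT t|M n. p K t) \<longlonglongrightarrow> (LINT t|Q. p K t)"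
      unfolding p_int(1)[OF M] p_int(1)[OF Q] by (intro tendsto_intros mono)
    then obtain n0 where n0: "\<And>n. n \<ge> n0 \<Longrightarrow> \<bar>(LINT t|M n. p K t) - (LINT t|Q. p K t)\<bar> < r / 3"
      using LIMSEQ_D[of _ _ "r / 3"] r by (force simp: real_norm_def)
    have "norm ((LINT t|M n. f t) - (LINT t|Q. f t)) < r" if "n \<ge> n0" for n
      using n0[OF that] close[OF M, of n] close[OF Q] unfolding real_norm_def by linarith
    then show "\<exists>no. \<forall>n\<ge>no. norm ((LINT t|M n. f t) - (LINT t|Q. f t)) < r" by blast
  qed
qed

lemma continuous_on_cts_step: "x < y \<Longrightarrow> continuous_on UNIV (cts_step x y)"
  using cts_step_uniformly_continuous uniformly_continuous_imp_continuous by blast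

context spectral_measure_on_line
begin

text \<open>
  By \<open>stieltjes_derivatives\<close> at \<open>a = 1\<close> the moments of the tilted laws converge to those of
  the Beta law. The test function may jump on null sets of the limit law, which admits
  indicators of intervals.
\<close>

lemma tilted_law_conv:
  fixes \<psi> :: "real \<Rightarrow> real"
  assumes sv: "slowly_varying h" and \<alpha>: "0 < \<alpha>" "\<alpha> < 2" and c: "c > 0"
    and lim: "((\<lambda>T. stieltjes 0 1 T / (T powr \<alpha> * h T)) \<longlongrightarrow> c) at_top"
    and \<psi>[measurable]: "\<psi> \<in> borel_measurable borel" and bdd: "\<And>t. \<bar>\<psi> t\<bar> \<le> B"
    and cont: "AE t in beta_law (\<alpha> / 2). isCont \<psi> t" 
  shows "((\<lambda>T. LINT t|tilted_law T. \<psi> t) \<longlongrightarrow> (LINT t|beta_law (\<alpha> / 2). \<psi> t)) at_top"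
proof (rule tendsto_at_topI_sequentially)
  fix X :: "nat \<Rightarrow> real" assume X: "filterlim X at_top sequentially"
  have hpos: "h t > 0" if "t > 0" for t using sv that by (auto simp: slowly_varying_def)
  have "\<forall>\<^sub>F T in at_top. 0 < stieltjes 0 1 T / (T powr \<alpha> * h T)"
    by (rule order_tendstoD(1)[OF lim c])
  then have "\<forall>\<^sub>F T in at_top. stieltjes 0 1 T > 0"
    using eventually_gt_at_top[of 0]
  proof eventually_elim
    case (elim T) then show ?case by (intro stieltjes_pos) auto
  qed
  from eventually_compose_filterlim[OF this X]
  obtain N where N: "\<And>n. n \<ge> N \<Longrightarrow> stieltjes 0 1 (X n) > 0" by (auto simp: eventually_sequentially)
  \<comment> \<open>The shift keeps to times at which the tilted law is a probability measure.\<close>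
  define Y where "Y n = X (n + N)" for n
  have Y: "filterlim Y at_top sequentially" unfolding Y_def
    using X by (rule filterlim_compose) (rule filterlim_add_const_nat_at_top)
  have RY: "stieltjes 0 1 (Y n) > 0" for n using N by (simp add: Y_def)
  have a: "0 < \<alpha> / 2" "\<alpha> / 2 < 1" using \<alpha> by auto
  have mom: "(\<lambda>n. LINT t|tilted_law (Y n). t ^ j) \<longlonglongrightarrow> (LINT t|beta_law (\<alpha> / 2). t ^ j)" for j
  proof -
    have eq: "(LINT t|tilted_law (Y n). t ^ j) = stieltjes j 1 (Y n) / stieltjes 0 1 (Y n)" for n
    proof -
      have "(LINT t|tilted_law (Y n). t ^ j) = (LINT y|\<mu>. (Y n)\<^sup>2 / (1 + (Y n)\<^sup>2 * y\<^sup>2) * (1 / (1 + (Y n)\<^sup>2 * y\<^sup>2)) ^ j) / stieltjes 0 1 (Y n)"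
        by (rule integral_tilted_law) (simp, rule RY)
      then show ?thesis by (simp add: stieltjes_def power_divide)
    qed
    have "((\<lambda>T. (stieltjes j 1 T / (T powr \<alpha> * h T)) / (stieltjes 0 1 T / (T powr \<alpha> * h T))) \<longlongrightarrow>
      (c * (pochhammer (\<alpha> / 2) j / fact j) * 1 powr (- (\<alpha> / 2) - real j)) / c) at_top"
      using c by (intro tendsto_divide lim stieltjes_derivatives[OF sv \<alpha> lim]) auto
    moreover have "\<forall>\<^sub>F T in at_top. (stieltjes j 1 T / (T powr \<alpha> * h T)) / (stieltjes 0 1 T / (T powr \<alpha> * h T)) = stieltjes j 1 T / stieltjes 0 1 T"
      using eventually_gt_at_top[of 0]
    proof eventually_elim
      case (elim T) then show ?case using hpos[of T] by simp
    qed
    ultimately have "((\<lambda>T. stieltjes j 1 T / stieltjes 0 1 T) \<longlongrightarrow>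
      (c * (pochhammer (\<alpha> / 2) j / fact j) * 1 powr (- (\<alpha> / 2) - real j)) / c) at_top"
      by (rule Lim_transform_eventually)
    then have "((\<lambda>T. stieltjes j 1 T / stieltjes 0 1 T) \<longlongrightarrow> pochhammer (\<alpha> / 2) j / fact j) at_top"
      using c by simp
    then show ?thesis unfolding eq beta_law_moment[OF a] by (rule filterlim_compose) (rule Y)
  qed
  interpret Q: real_distribution "beta_law (\<alpha> / 2)" by (rule beta_law_distribution[OF a])
  have w: "weak_conv_m (\<lambda>n. tilted_law (Y n)) (beta_law (\<alpha> / 2))"
  proof (rule integral_cts_step_conv_imp_weak_conv)
    show "real_distribution (tilted_law (Y n))" for n by (rule tilted_law_distribution[OF RY])
    show "real_distribution (beta_law (\<alpha> / 2))" ..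
    fix x y :: real assume "x < y"
    then have c: "continuous_on UNIV (cts_step x y)" by (rule continuous_on_cts_step)
    show "(\<lambda>n. LINT t|tilted_law (Y n). cts_step x y t) \<longlonglongrightarrow> (LINT t|beta_law (\<alpha> / 2). cts_step x y t)"
    proof (rule moments_imp_integral_conv[OF _ _ _ _ mom c])
      show "real_distribution (tilted_law (Y n))" for n by (rule tilted_law_distribution[OF RY])
      show "real_distribution (beta_law (\<alpha> / 2))" ..
      show "AE t in tilted_law (Y n). 0 \<le> t \<and> t \<le> 1" for n
        using tilted_law_distribution(2)[OF RY] by (rule eventually_mono) auto
      show "AE t in beta_law (\<alpha> / 2). 0 \<le> t \<and> t \<le> 1"
        using beta_law_distribution(2)[OF a] by (rule eventually_mono) auto
    qed
  qed
  have "(\<lambda>n. LINT t|tilted_law (Y n). \<psi> t) \<longlonglongrightarrow> (LINT t|beta_law (\<alpha> / 2). \<psi> t)"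
  proof (rule weak_conv_imp_bdd_ae_continuous_conv[OF _ _ w])
    show "emeasure (beta_law (\<alpha> / 2)) {x. \<not> isCont \<psi> x} = 0"
      by (rule AE_iff_measurable[THEN iffD1, OF _ _ cont]) (auto simp: Q.space_eq_univ)
    show "real_distribution (tilted_law (Y n))" for n by (rule tilted_law_distribution[OF RY])
    show "real_distribution (beta_law (\<alpha> / 2))" ..
  qed (use bdd in auto)
  then show "(\<lambda>n. LINT t|tilted_law (X n). \<psi> t) \<longlonglongrightarrow> (LINT t|beta_law (\<alpha> / 2). \<psi> t)"
    unfolding Y_def by (rule LIMSEQ_offset)
qed

text \<open>
  In the variable \<open>t = 1 / (1 + T\<^sup>2 * y\<^sup>2)\<close> the Fejer kernel divided by the tilting density is
  \<open>\<psi> t\<close>, and the condition \<open>\<bar>y\<bar> < 1 / T\<close> becomes \<open>1 / 2 < t\<close>, so its indicator gives \<open>\<gamma> t\<close>.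
  Neither function depends on \<open>T\<close>.
\<close>

lemma fejer_transform_and_central_mass_of_stieltjes:
  assumes sv: "slowly_varying h" and \<alpha>: "0 < \<alpha>" "\<alpha> < 2" and c: "c > 0"
    and lim: "((\<lambda>T. stieltjes 0 1 T / (T powr \<alpha> * h T)) \<longlongrightarrow> c) at_top"
  obtains D D' where "((\<lambda>T. fejer_transform T / (T powr \<alpha> * h T)) \<longlongrightarrow> D) at_top"
    and "((\<lambda>T. central_mass (1 / T) / (T powr (\<alpha> - 2) * h T)) \<longlongrightarrow> D') at_top"
proof -
  define \<psi> where "\<psi> t = (if 0 < t \<and> t \<le> 1 then fejer 1 (sqrt ((1 - t) / t)) * (1 / t) else 0)" for t
  define \<gamma> where "\<gamma> t = (if 1 / 2 < t then 1 / t else 0)" for t :: real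
  have a: "0 < \<alpha> / 2" "\<alpha> / 2 < 1" using \<alpha> by auto
  have hpos: "h t > 0" if "t > 0" for t using sv that by (auto simp: slowly_varying_def)
  have [measurable]: "\<psi> \<in> borel_measurable borel" "\<gamma> \<in> borel_measurable borel"
    unfolding \<psi>_def[abs_def] \<gamma>_def[abs_def] by measurable
  have \<psi>b: "\<bar>\<psi> t\<bar> \<le> 5" for t
  proof (cases "0 < t \<and> t \<le> 1")
    case True
    then have "1 / t = 1 + (sqrt ((1 - t) / t))\<^sup>2" by (simp add: field_simps)
    then show ?thesis using True fejer_weight_le[of "sqrt ((1 - t) / t)"] fejer_nonneg
      by (simp add: \<psi>_def)
  qed (auto simp: \<psi>_def)
  have \<gamma>b: "\<bar>\<gamma> t\<bar> \<le> 2" for t by (auto simp: \<gamma>_def divide_le_eq)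
  have \<psi>c: "isCont \<psi> t" if "0 < t" "t < 1" for t
  proof -
    have "isCont (\<lambda>t. fejer 1 (sqrt ((1 - t) / t)) * (1 / t)) t"
      using that by (intro continuous_intros isCont_o2[OF _ isCont_fejer]) auto
    moreover have "\<forall>\<^sub>F x in nhds t. \<psi> x = fejer 1 (sqrt ((1 - x) / x)) * (1 / x)"
    proof -
      have "\<forall>\<^sub>F x in nhds t. x \<in> {0<..<1}" using that by (intro eventually_nhds_in_open) auto
      then show ?thesis by eventually_elim (auto simp: \<psi>_def)
    qed
    ultimately show ?thesis by (subst isCont_cong)
  qed
  have \<gamma>c: "isCont \<gamma> t" if "0 < t" "t \<noteq> 1 / 2" for t
  proof (cases "t < 1 / 2")
    case True
    then have "\<forall>\<^sub>F x in nhds t. x \<in> {..<1/2}" by (intro eventually_nhds_in_open) auto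
    then have "\<forall>\<^sub>F x in nhds t. \<gamma> x = 0" by eventually_elim (auto simp: \<gamma>_def)
    then show ?thesis by (subst isCont_cong) auto
  next
    case False
    then have "\<forall>\<^sub>F x in nhds t. x \<in> {1/2<..}" using that by (intro eventually_nhds_in_open) auto
    then have "\<forall>\<^sub>F x in nhds t. \<gamma> x = 1 / x" by eventually_elim (auto simp: \<gamma>_def)
    moreover have "isCont (\<lambda>x. 1 / x) t" using that by (intro continuous_intros) auto
    ultimately show ?thesis by (subst isCont_cong) auto
  qed
  have half: "AE t in beta_law (\<alpha> / 2). t \<noteq> 1 / 2"
    unfolding beta_law_def using AE_lborel_singleton[of "1/2"] by (subst AE_density) (auto elim: eventually_mono)
  have l\<psi>: "((\<lambda>T. LINT t|tilted_law T. \<psi> t) \<longlongrightarrow> (LINT t|beta_law (\<alpha> / 2). \<psi> t)) at_top"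
  proof (rule tilted_law_conv[OF sv \<alpha> c lim _ \<psi>b])
    show "AE t in beta_law (\<alpha> / 2). isCont \<psi> t"
      using beta_law_distribution(2)[OF a] by (rule eventually_mono) (use \<psi>c in blast)
  qed simp
  have "AE t in beta_law (\<alpha> / 2). isCont \<gamma> t"
    using beta_law_distribution(2)[OF a] half by eventually_elim (use \<gamma>c in auto)
  then have l\<gamma>: "((\<lambda>T. LINT t|tilted_law T. \<gamma> t) \<longlongrightarrow> (LINT t|beta_law (\<alpha> / 2). \<gamma> t)) at_top"
    using \<gamma>b by (intro tilted_law_conv[OF sv \<alpha> c lim]) auto
  have "\<forall>\<^sub>F T in at_top. 0 < stieltjes 0 1 T / (T powr \<alpha> * h T)"
    by (rule order_tendstoD(1)[OF lim c])
  then have Rpos: "\<forall>\<^sub>F T in at_top. T > 0 \<and> stieltjes 0 1 T > 0"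
    using eventually_gt_at_top[of 0]
  proof eventually_elim
    case (elim T) then show ?case by (auto intro!: stieltjes_pos)
  qed
  have p: "0 < 1 + T\<^sup>2 * y\<^sup>2" for y T :: real by (intro add_pos_nonneg) auto
  have q: "(1 - 1 / q) / (1 / q) = q - 1" if "q > 0" for q :: real
    using that by (simp add: field_simps)
  have q': "(1 / 2 < 1 / q) = (q - 1 < 1)" if "q > 0" for q :: real
    using that by (auto simp: field_simps)
  have "((\<lambda>T. (stieltjes 0 1 T / (T powr \<alpha> * h T)) * (LINT t|tilted_law T. \<psi> t)) \<longlongrightarrow> c * (LINT t|beta_law (\<alpha> / 2). \<psi> t)) at_top"
    by (intro tendsto_mult lim l\<psi>)
  moreover have "\<forall>\<^sub>F T in at_top. (stieltjes 0 1 T / (T powr \<alpha> * h T)) * (LINT t|tilted_law T. \<psi> t) = fejer_transform T / (T powr \<alpha> * h T)"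
    using Rpos
  proof eventually_elim
    case (elim T)
    have "T\<^sup>2 / (1 + T\<^sup>2 * y\<^sup>2) * \<psi> (1 / (1 + T\<^sup>2 * y\<^sup>2)) = fejer T y" for y
    proof -
      have 1: "(1 - 1 / (1 + T\<^sup>2 * y\<^sup>2)) / (1 / (1 + T\<^sup>2 * y\<^sup>2)) = (T * \<bar>y\<bar>)\<^sup>2"
        using q[OF p[of T y]] by (simp add: power_mult_distrib)
      have "\<psi> (1 / (1 + T\<^sup>2 * y\<^sup>2)) = fejer 1 (T * \<bar>y\<bar>) * (1 + T\<^sup>2 * y\<^sup>2)"
        using p[of T y] elim unfolding \<psi>_def 1 by (simp add: real_sqrt_mult)
      then show ?thesis using p[of T y] fejer_scale[of T y] elim by simp
    qed
    then have "(LINT t|tilted_law T. \<psi> t) = fejer_transform T / stieltjes 0 1 T"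
      using elim by (subst integral_tilted_law) (auto simp: fejer_transform_def simp del: times_divide_eq_left times_divide_eq_right)
    then show ?case using elim by simp
  qed
  ultimately have 1: "((\<lambda>T. fejer_transform T / (T powr \<alpha> * h T)) \<longlongrightarrow> c * (LINT t|beta_law (\<alpha> / 2). \<psi> t)) at_top"
    by (rule Lim_transform_eventually)
  have "((\<lambda>T. (stieltjes 0 1 T / (T powr \<alpha> * h T)) * (LINT t|tilted_law T. \<gamma> t)) \<longlongrightarrow> c * (LINT t|beta_law (\<alpha> / 2). \<gamma> t)) at_top"
    by (intro tendsto_mult lim l\<gamma>)
  moreover have "\<forall>\<^sub>F T in at_top. (stieltjes 0 1 T / (T powr \<alpha> * h T)) * (LINT t|tilted_law T. \<gamma> t) = central_mass (1 / T) / (T powr (\<alpha> - 2) * h T)"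
    using Rpos
  proof eventually_elim
    case (elim T)
    have "T\<^sup>2 / (1 + T\<^sup>2 * y\<^sup>2) * \<gamma> (1 / (1 + T\<^sup>2 * y\<^sup>2)) = T\<^sup>2 * indicator {y. \<bar>y\<bar> < 1 / T} y" for y
    proof -
      have "(1 / 2 < 1 / (1 + T\<^sup>2 * y\<^sup>2)) = ((T * \<bar>y\<bar>)\<^sup>2 < 1\<^sup>2)"
        using q'[OF p[of T y]] by (simp add: power_mult_distrib)
      also have "\<dots> = (T * \<bar>y\<bar> < 1)" using abs_square_less_1[of "T * \<bar>y\<bar>"] elim by (simp add: abs_mult)
      also have "\<dots> = (\<bar>y\<bar> < 1 / T)" using elim by (simp add: field_simps)
      finally show ?thesis using p[of T y] by (auto simp: \<gamma>_def)
    qed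
    then have "(LINT t|tilted_law T. \<gamma> t) = (LINT y|\<mu>. T\<^sup>2 * indicator {y. \<bar>y\<bar> < 1 / T} y) / stieltjes 0 1 T"
      using elim by (subst integral_tilted_law) (auto simp del: times_divide_eq_left times_divide_eq_right)
    also have "(LINT y|\<mu>. T\<^sup>2 * indicator {y. \<bar>y\<bar> < 1 / T} y) = T\<^sup>2 * central_mass (1 / T)"
      by (simp add: central_mass_def space_eq)
    finally have "(LINT t|tilted_law T. \<gamma> t) = T\<^sup>2 * central_mass (1 / T) / stieltjes 0 1 T" .
    moreover have "T powr \<alpha> = T powr (\<alpha> - 2) * T\<^sup>2" using elim by (simp add: powr_diff)
    ultimately show ?case using elim by simp
  qed
  ultimately have 2: "((\<lambda>T. central_mass (1 / T) / (T powr (\<alpha> - 2) * h T)) \<longlongrightarrow> c * (LINT t|beta_law (\<alpha> / 2). \<gamma> t)) at_top"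
    by (rule Lim_transform_eventually)
  from that[OF 1 2] show ?thesis .
qed

end

text \<open>
  The constant of the theorem is the quotient of the factors that the Laplace average of the
  Fejer transform and the weighted average of the masses produce; Euler's reflection formula
  gives its closed form.
\<close>

lemma Cconst_Beta:
  assumes \<alpha>: "0 < \<alpha>" "\<alpha> < 2"
  shows "Cconst \<alpha> * Beta (2 - \<alpha> / 2) (\<alpha> / 2) = Gamma (1 + \<alpha>) / 2"
proof -
  have s: "sin (pi * (\<alpha> / 2)) > 0" using \<alpha> by (intro sin_gt_zero) auto
  have "complex_of_real (Gamma (\<alpha> / 2) * Gamma (1 - \<alpha> / 2)) = complex_of_real (pi / sin (pi * (\<alpha> / 2)))"
    using Gamma_reflection_complex[of "complex_of_real (\<alpha> / 2)"]
    by (simp only: of_real_mult of_real_divide Gamma_complex_of_real[symmetric] sin_of_real[symmetric] of_real_diff of_real_1)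
  then have refl: "Gamma (\<alpha> / 2) * Gamma (1 - \<alpha> / 2) = pi / sin (pi * (\<alpha> / 2))"
    by (simp only: of_real_eq_iff)
  have "Gamma (2 - \<alpha> / 2) = (1 - \<alpha> / 2) * Gamma (1 - \<alpha> / 2)"
  proof -
    have "1 - \<alpha> / 2 \<notin> \<int>\<^sub>\<le>\<^sub>0" using \<alpha> by (auto dest: nonpos_Ints_nonpos)
    then show ?thesis using Gamma_plus1[of "1 - \<alpha> / 2"] by simp
  qed
  moreover have "Beta (2 - \<alpha> / 2) (\<alpha> / 2) = Gamma (2 - \<alpha> / 2) * Gamma (\<alpha> / 2)"
    by (simp add: Beta_def Gamma_numeral)
  ultimately have "Beta (2 - \<alpha> / 2) (\<alpha> / 2) = (1 - \<alpha> / 2) * (Gamma (\<alpha> / 2) * Gamma (1 - \<alpha> / 2))"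
    by (simp only: mult_ac)
  also note refl
  also have "1 - \<alpha> / 2 = (2 - \<alpha>) / 2" by simp
  finally have B: "Beta (2 - \<alpha> / 2) (\<alpha> / 2) = (2 - \<alpha>) / 2 * (pi / sin (pi * (\<alpha> / 2)))" .
  have "sin (\<alpha> * pi / 2) = sin (pi * (\<alpha> / 2))" by (simp add: mult.commute)
  then show ?thesis unfolding B Cconst_def using s \<alpha> by (simp add: divide_simps)
qed

context spectral_measure_on_line begin

text \<open>
  Each side forces regular variation of \<open>stieltjes 0 1\<close>, which forces convergence of the other
  side to some limit; passing forward again from that limit determines it, since the same
  asymptotics of \<open>stieltjes 0 1\<close> result.
\<close>

theorem fejer_transform_tauberian:
  assumes sv: "slowly_varying h" and \<alpha>: "0 < \<alpha>" "\<alpha> < 2"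
  shows "(fejer_transform \<sim>[at_top] (\<lambda>T. T powr \<alpha> * h T)) \<longleftrightarrow>
    (central_mass \<sim>[at_right 0] (\<lambda>x. Cconst \<alpha> * x powr (2 - \<alpha>) * h (1 / x)))"
proof -
  have hpos: "h t > 0" if "t > 0" for t using sv that by (auto simp: slowly_varying_def)
  have "sin (\<alpha> * pi / 2) > 0" using \<alpha> by (intro sin_gt_zero) auto
  then have C: "Cconst \<alpha> > 0" using \<alpha> by (auto simp: Cconst_def intro!: divide_pos_pos mult_pos_pos Gamma_real_pos)
  have iff: "(f \<sim>[F] g) \<longleftrightarrow> ((\<lambda>x. f x / g x) \<longlongrightarrow> 1) F" if "\<forall>\<^sub>F x in F. g x \<noteq> 0" for f g :: "real \<Rightarrow> real" and F
    unfolding asymp_equiv_def using that by (intro tendsto_cong) (auto elim: eventually_mono)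
  have "(fejer_transform \<sim>[at_top] (\<lambda>T. T powr \<alpha> * h T)) \<longleftrightarrow> ((\<lambda>T. fejer_transform T / (T powr \<alpha> * h T)) \<longlongrightarrow> 1) at_top"
  proof (rule iff)
    show "\<forall>\<^sub>F T in at_top. T powr \<alpha> * h T \<noteq> 0"
      using eventually_gt_at_top[of 0] by eventually_elim (use hpos in force)
  qed
  moreover have "(central_mass \<sim>[at_right 0] (\<lambda>x. Cconst \<alpha> * x powr (2 - \<alpha>) * h (1 / x))) \<longleftrightarrow>
    ((\<lambda>T. central_mass (1 / T) / (T powr (\<alpha> - 2) * h T)) \<longlongrightarrow> Cconst \<alpha>) at_top"
  proof -
    have "(central_mass \<sim>[at_right 0] (\<lambda>x. Cconst \<alpha> * x powr (2 - \<alpha>) * h (1 / x))) \<longleftrightarrow>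
      ((\<lambda>x. central_mass x / (Cconst \<alpha> * x powr (2 - \<alpha>) * h (1 / x))) \<longlongrightarrow> 1) (at_right 0)"
    proof (rule iff)
      show "\<forall>\<^sub>F x in at_right 0. Cconst \<alpha> * x powr (2 - \<alpha>) * h (1 / x) \<noteq> 0"
        using eventually_at_right_less[of 0]
      proof eventually_elim
        case (elim x)
        then show ?case using hpos[of "1 / x"] C by simp
      qed
    qed
    also have "\<dots> \<longleftrightarrow> ((\<lambda>T. central_mass (1 / T) / (Cconst \<alpha> * (1 / T) powr (2 - \<alpha>) * h T)) \<longlongrightarrow> 1) at_top"
      unfolding filterlim_at_right_to_top by (simp add: inverse_eq_divide)
    also have "\<dots> \<longleftrightarrow> ((\<lambda>T. (central_mass (1 / T) / (T powr (\<alpha> - 2) * h T)) / Cconst \<alpha>) \<longlongrightarrow> 1) at_top"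
    proof (rule tendsto_cong)
      show "\<forall>\<^sub>F T in at_top. central_mass (1 / T) / (Cconst \<alpha> * (1 / T) powr (2 - \<alpha>) * h T) = (central_mass (1 / T) / (T powr (\<alpha> - 2) * h T)) / Cconst \<alpha>"
        using eventually_gt_at_top[of 0]
      proof eventually_elim
        case (elim T)
        have "(1 / T) powr (2 - \<alpha>) = T powr (\<alpha> - 2)"
          using elim by (simp add: powr_divide powr_minus_divide[symmetric] )
        then show ?case by (simp add: mult_ac)
      qed
    qed
    also have "\<dots> \<longleftrightarrow> ((\<lambda>T. central_mass (1 / T) / (T powr (\<alpha> - 2) * h T)) \<longlongrightarrow> Cconst \<alpha>) at_top"
    proof
      assume "((\<lambda>T. central_mass (1 / T) / (T powr (\<alpha> - 2) * h T) / Cconst \<alpha>) \<longlongrightarrow> 1) at_top"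
      from tendsto_mult[OF this tendsto_const[of "Cconst \<alpha>"]]
      show "((\<lambda>T. central_mass (1 / T) / (T powr (\<alpha> - 2) * h T)) \<longlongrightarrow> Cconst \<alpha>) at_top" using C by simp
    next
      assume "((\<lambda>T. central_mass (1 / T) / (T powr (\<alpha> - 2) * h T)) \<longlongrightarrow> Cconst \<alpha>) at_top"
      from tendsto_divide[OF this tendsto_const[of "Cconst \<alpha>"]]
      show "((\<lambda>T. central_mass (1 / T) / (T powr (\<alpha> - 2) * h T) / Cconst \<alpha>) \<longlongrightarrow> 1) at_top" using C by simp
    qed
    finally show ?thesis .
  qed
  moreover have "((\<lambda>T. fejer_transform T / (T powr \<alpha> * h T)) \<longlongrightarrow> 1) at_top \<longleftrightarrow>
    ((\<lambda>T. central_mass (1 / T) / (T powr (\<alpha> - 2) * h T)) \<longlongrightarrow> Cconst \<alpha>) at_top"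
  proof
    let ?B = "Beta (2 - \<alpha> / 2) (\<alpha> / 2)"
    have \<Gamma>: "Gamma (1 + \<alpha>) / 2 > 0" using \<alpha> by (simp add: Gamma_real_pos)
    have B: "?B > 0" using \<alpha> by (intro Beta_pos) auto
    {
      assume "((\<lambda>T. fejer_transform T / (T powr \<alpha> * h T)) \<longlongrightarrow> 1) at_top"
      from stieltjes_of_fejer_transform[OF sv \<alpha> this] have R: "((\<lambda>T. stieltjes 0 1 T / (T powr \<alpha> * h T)) \<longlongrightarrow> Gamma (1 + \<alpha>) / 2) at_top" by simp
      obtain D' where D': "((\<lambda>T. central_mass (1 / T) / (T powr (\<alpha> - 2) * h T)) \<longlongrightarrow> D') at_top"
        using fejer_transform_and_central_mass_of_stieltjes[OF sv \<alpha> \<Gamma> R] by blast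
      have "D' * ?B = Gamma (1 + \<alpha>) / 2"
        by (rule tendsto_unique[OF _ stieltjes_of_central_mass[OF sv \<alpha> D'] R]) simp
      then have "D' = Cconst \<alpha>" using Cconst_Beta[OF \<alpha>] B by (metis mult_right_cancel less_numeral_extra(3))
      then show "((\<lambda>T. central_mass (1 / T) / (T powr (\<alpha> - 2) * h T)) \<longlongrightarrow> Cconst \<alpha>) at_top" using D' by simp
    next
      assume "((\<lambda>T. central_mass (1 / T) / (T powr (\<alpha> - 2) * h T)) \<longlongrightarrow> Cconst \<alpha>) at_top"
      from stieltjes_of_central_mass[OF sv \<alpha> this] have R: "((\<lambda>T. stieltjes 0 1 T / (T powr \<alpha> * h T)) \<longlongrightarrow> Gamma (1 + \<alpha>) / 2) at_top"
        by (simp add: Cconst_Beta[OF \<alpha>])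
      obtain D where D: "((\<lambda>T. fejer_transform T / (T powr \<alpha> * h T)) \<longlongrightarrow> D) at_top"
        using fejer_transform_and_central_mass_of_stieltjes[OF sv \<alpha> \<Gamma> R] by blast
      have "D * (Gamma (1 + \<alpha>) / 2) = Gamma (1 + \<alpha>) / 2"
        by (rule tendsto_unique[OF _ stieltjes_of_fejer_transform[OF sv \<alpha> D] R]) simp
      then have "D = 1" using \<Gamma> by simp
      then show "((\<lambda>T. fejer_transform T / (T powr \<alpha> * h T)) \<longlongrightarrow> 1) at_top" using D by simp
    }
  qed
  ultimately show ?thesis by simp
qed

end

section \<open>Exit from the half-plane along dyadic grids\<close>

text \<open>
  A bounded stopping time: whether it equals some \<open>j < k\<close> is decided by \<open>a 0, ..., a j\<close>.
\<close>

definition stop_idx :: "(nat \<Rightarrow> real) \<Rightarrow> nat \<Rightarrow> nat" where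
  "stop_idx a k = (if \<exists>j\<le>k. 0 < a j then LEAST j. 0 < a j else k)"

lemma stop_idx_0 [simp]: "stop_idx a 0 = 0"
  unfolding stop_idx_def by (auto intro!: Least_equality)

lemma stop_idx_live: "(\<forall>j\<le>k. a j \<le> 0) \<Longrightarrow> stop_idx a k = k"
  by (force simp: stop_idx_def)

lemma stop_idx_Suc_live:
  assumes "\<forall>j\<le>k. a j \<le> 0" shows "stop_idx a (Suc k) = Suc k"
proof -
  have "(LEAST j. 0 < a j) = Suc k" if "0 < a (Suc k)"
    by (intro Least_equality) (use that assms not_less_eq_eq in force)+
  moreover have "\<exists>j\<le>Suc k. 0 < a j \<Longrightarrow> 0 < a (Suc k)" using assms le_Suc_eq not_less by metis
  ultimately show ?thesis by (auto simp: stop_idx_def)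
qed

lemma stop_idx_Suc_stopped:
  assumes "\<exists>j\<le>k. 0 < a j" shows "stop_idx a (Suc k) = stop_idx a k"
  using assms le_Suc_eq by (auto simp: stop_idx_def)

lemma stop_idx_cases:
  obtains "stop_idx a k = k" "\<forall>j<k. a j \<le> 0" | "0 < a (stop_idx a k)" "stop_idx a k \<le> k"
proof (cases "\<exists>j\<le>k. 0 < a j")
  case True
  then obtain j where j: "j \<le> k" "0 < a j" by blast
  then have "stop_idx a k = (LEAST j. 0 < a j)" by (auto simp: stop_idx_def)
  moreover have "0 < a (LEAST j. 0 < a j)" "(LEAST j. 0 < a j) \<le> j"
    using j by (auto intro: LeastI Least_le)
  ultimately show ?thesis using that(2) j by simp
next
  case False
  then have "\<forall>j\<le>k. a j \<le> 0" by (auto simp: not_less)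
  then show ?thesis using that(1) stop_idx_live by auto
qed

lemma stop_idx_le_k: "stop_idx a k \<le> k"
  by (rule stop_idx_cases[of a k]) auto

lemma stop_idx_le:
  assumes "0 < a j" "j \<le> k" shows "stop_idx a k \<le> j"
  using assms by (auto simp: stop_idx_def intro: Least_le)

lemma exit_time_lessD:
  assumes "exit_time D x < ereal c" obtains u where "0 \<le> u" "u < c" "x u \<notin> D"
  using assms unfolding exit_time_def INF_less_iff by auto

lemma exit_time_le: "0 \<le> u \<Longrightarrow> x u \<notin> D \<Longrightarrow> exit_time D x \<le> ereal u"
  unfolding exit_time_def by (intro INF_lower) auto

lemma exit_time_nonneg: "0 \<le> exit_time D x"
  unfolding exit_time_def by (intro INF_greatest) auto

text \<open>
  The cap makes sense of the position at exit before the exit time is known to be finite.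
\<close>

definition capped_exit :: "real \<Rightarrow> (real \<Rightarrow> complex) \<Rightarrow> real" where
  "capped_exit S x = real_of_ereal (min (exit_time Hminus x) (ereal S))"

lemma ereal_capped_exit: "0 \<le> S \<Longrightarrow> ereal (capped_exit S x) = min (exit_time Hminus x) (ereal S)"
  unfolding capped_exit_def using exit_time_nonneg[of Hminus x]
  by (intro ereal_real') (auto simp: min_def)

lemma capped_exit_bounds: "0 \<le> S \<Longrightarrow> 0 \<le> capped_exit S x" "0 \<le> S \<Longrightarrow> capped_exit S x \<le> S"
proof -
  assume S: "0 \<le> S"
  have "ereal 0 \<le> ereal (capped_exit S x)" "ereal (capped_exit S x) \<le> ereal S"
    unfolding ereal_capped_exit[OF S] using exit_time_nonneg[of Hminus x] S by (auto simp: zero_ereal_def[symmetric])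
  then show "0 \<le> capped_exit S x" "capped_exit S x \<le> S" by auto
qed

text \<open>
  On a grid the exit is noticed late, never early. It is noticed arbitrarily soon on fine
  grids, because the complement of \<open>Hminus\<close> is open: arbitrarily soon after the exit time the
  path spends a whole time interval outside.
\<close>

lemma grid_stop_tendsto:
  assumes c: "continuous_on {0..} x"
  shows "(\<lambda>n. real (stop_idx (\<lambda>j. Re (x (real j / 2 ^ n))) (S * 2 ^ n)) / 2 ^ n) \<longlonglongrightarrow> capped_exit (real S) x"
proof -
  define s where "s n = real (stop_idx (\<lambda>j. Re (x (real j / 2 ^ n))) (S * 2 ^ n)) / 2 ^ n" for n
  define m where "m = capped_exit (real S) x"
  have em: "ereal m = min (exit_time Hminus x) (ereal (real S))" unfolding m_def by (rule ereal_capped_exit) simp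
  have lower: "m \<le> s n" for n
  proof (rule stop_idx_cases[of "\<lambda>j. Re (x (real j / 2 ^ n))" "S * 2 ^ n"])
    assume "stop_idx (\<lambda>j. Re (x (real j / 2 ^ n))) (S * 2 ^ n) = S * 2 ^ n"
    then have "s n = real S" by (simp add: s_def)
    moreover have "ereal m \<le> ereal (real S)" unfolding em by simp
    ultimately show ?thesis by simp
  next
    assume "0 < Re (x (real (stop_idx (\<lambda>j. Re (x (real j / 2 ^ n))) (S * 2 ^ n)) / 2 ^ n))"
    then have "exit_time Hminus x \<le> ereal (s n)"
      unfolding s_def by (intro exit_time_le) (auto simp: Hminus_def)
    then have "ereal m \<le> ereal (s n)" unfolding em by (simp add: min_le_iff_disj)
    then show ?thesis by simp
  qed
  have sle: "s n \<le> real S" for n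
  proof -
    have "real (stop_idx (\<lambda>j. Re (x (real j / 2 ^ n))) (S * 2 ^ n)) \<le> real (S * 2 ^ n)"
      using stop_idx_le_k of_nat_le_iff by blast
    then show ?thesis by (simp add: s_def divide_le_eq)
  qed
  have "s \<longlonglongrightarrow> m"
  proof (cases "m < real S")
    case False
    then have "s = (\<lambda>_. m)" using lower sle by (intro ext antisym) (force intro: order_trans)+
    then show ?thesis by simp
  next
    case True
    then have e: "exit_time Hminus x = ereal m" using em by (auto simp: min_def split: if_splits)
    show ?thesis
    proof (rule LIMSEQ_I)
      fix r :: real assume r: "0 < r"
      have "exit_time Hminus x < ereal (min (m + r) (real S))" using e r True by simp
      then obtain u where u: "0 \<le> u" "u < min (m + r) (real S)" "x u \<notin> Hminus"
        by (rule exit_time_lessD)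
      have "0 < Re (x u)" using u by (simp add: Hminus_def)
      moreover have "((\<lambda>v. Re (x v)) \<longlongrightarrow> Re (x u)) (at u within {0..})"
        using c u(1) by (intro tendsto_Re) (auto simp: continuous_on_def)
      ultimately have "\<forall>\<^sub>F v in at u within {0..}. 0 < Re (x v)" by (rule order_tendstoD(1)[rotated])
      then obtain d where d: "d > 0" "\<And>v. v \<in> {0..} \<Longrightarrow> v \<noteq> u \<Longrightarrow> dist v u < d \<Longrightarrow> 0 < Re (x v)"
        unfolding eventually_at by auto
      then have d': "0 < Re (x v)" if "0 \<le> v" "\<bar>v - u\<bar> < d" for v
        using that \<open>0 < Re (x u)\<close> by (cases "v = u") (auto simp: dist_real_def)
      define \<eta> where "\<eta> = min d (min (m + r - u) (real S - u))"
      have \<eta>: "\<eta> > 0" using d u by (simp add: \<eta>_def)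
      obtain N where N: "(1 / 2) ^ N < \<eta>" using real_arch_pow_inv[OF \<eta>, of "1 / 2"] by auto
      have "norm (s n - m) < r" if n: "n \<ge> N" for n
      proof -
        have "(1 / 2 :: real) ^ n \<le> (1 / 2) ^ N" using n by (intro power_decreasing) auto
        with N have p: "(1 / 2 :: real) ^ n < \<eta>" by linarith
        define j where "j = nat \<lceil>u * 2 ^ n\<rceil>"
        have "real j = of_int \<lceil>u * 2 ^ n\<rceil>" using u by (simp add: j_def)
        then have "u * 2 ^ n \<le> real j" "real j < u * 2 ^ n + 1" by linarith+
        then have j: "u \<le> real j / 2 ^ n" "real j / 2 ^ n < u + (1 / 2) ^ n"
          by (auto simp: field_simps power_one_over)
        have "0 < Re (x (real j / 2 ^ n))" using j p u(1) by (intro d') (auto simp: \<eta>_def)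
        moreover have "j \<le> S * 2 ^ n"
        proof -
          have "real j / 2 ^ n < real S" using j p by (simp add: \<eta>_def)
          then have "real j < real (S * 2 ^ n)" by (simp add: divide_less_eq)
          then show ?thesis by linarith
        qed
        ultimately have "stop_idx (\<lambda>j. Re (x (real j / 2 ^ n))) (S * 2 ^ n) \<le> j" by (intro stop_idx_le)
        then have "s n \<le> real j / 2 ^ n" unfolding s_def by (intro divide_right_mono) auto
        then have "s n < m + r" using j p by (simp add: \<eta>_def)
        then show ?thesis using lower[of n] by simp
      qed
      then show "\<exists>no. \<forall>n\<ge>no. norm (s n - m) < r" by blast
    qed
  qed
  then show ?thesis by (simp add: s_def[abs_def] m_def)
qed

text \<open>
  Up to the exit time the path stays in the closed half-plane.
\<close>

lemma capped_exit_position_le: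
  assumes c: "continuous_on {0..} x" and x0: "Re (x 0) \<le> 0" and S: "0 \<le> S"
  shows "Re (x (capped_exit S x)) \<le> 0"
proof (rule ccontr)
  define m where "m = capped_exit S x"
  assume "\<not> ?thesis" then have pos: "0 < Re (x m)" by (simp add: m_def)
  have m: "0 \<le> m" "m \<noteq> 0" using capped_exit_bounds[OF S, of x] pos x0 by (auto simp: m_def)
  have "((\<lambda>v. Re (x v)) \<longlongrightarrow> Re (x m)) (at m within {0..})"
    using c m(1) by (intro tendsto_Re) (auto simp: continuous_on_def)
  then have "\<forall>\<^sub>F v in at m within {0..}. 0 < Re (x v)" using pos by (rule order_tendstoD(1))
  then obtain d where d: "d > 0" "\<And>v. v \<in> {0..} \<Longrightarrow> v \<noteq> m \<Longrightarrow> dist v m < d \<Longrightarrow> 0 < Re (x v)"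
    unfolding eventually_at by auto
  define v where "v = max 0 (m - d / 2)"
  have "0 < Re (x v)" using d m by (intro d(2)) (auto simp: v_def dist_real_def max_def)
  then have "exit_time Hminus x \<le> ereal v" by (intro exit_time_le) (auto simp: Hminus_def v_def)
  moreover have "ereal m \<le> exit_time Hminus x" unfolding m_def ereal_capped_exit[OF S] by simp
  ultimately have "m \<le> v" using ereal_less_eq(3) order_trans by blast
  then show False using d m by (auto simp: v_def)
qed

text \<open>
  The path is outside at times arbitrarily close to the exit time.
\<close>

lemma exit_position_ge:
  assumes c: "continuous_on {0..} x" and e: "exit_time Hminus x = ereal m"
  shows "0 \<le> Re (x m)"
proof (rule ccontr)
  assume "\<not> ?thesis" then have neg: "Re (x m) < 0" by simp
  have m: "0 \<le> m" using exit_time_nonneg[of Hminus x] e by simp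
  have "((\<lambda>v. Re (x v)) \<longlongrightarrow> Re (x m)) (at m within {0..})"
    using c m(1) by (intro tendsto_Re) (auto simp: continuous_on_def)
  then have "\<forall>\<^sub>F v in at m within {0..}. Re (x v) < 0" using neg by (rule order_tendstoD(2))
  then obtain d where d: "d > 0" "\<And>v. v \<in> {0..} \<Longrightarrow> v \<noteq> m \<Longrightarrow> dist v m < d \<Longrightarrow> Re (x v) < 0"
    unfolding eventually_at by auto
  have "exit_time Hminus x < ereal (m + d)" using e d by simp
  then obtain u where u: "0 \<le> u" "u < m + d" "x u \<notin> Hminus" by (rule exit_time_lessD)
  have "ereal m \<le> ereal u" using exit_time_le[OF u(1), of x Hminus] u(3) e by simp
  then have "Re (x u) < 0" using d(2)[of u] u neg by (cases "u = m") (auto simp: dist_real_def)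
  then show False using u by (simp add: Hminus_def)
qed

text \<open>
  Boundedness in \<open>L\<^sup>2\<close> implies uniform integrability: replacing \<open>X n\<close> by its radial truncation
  at level \<open>K\<close> costs at most \<open>C / K\<close> in mean, and truncated variables converge boundedly.
\<close>

lemma (in prob_space) integral_tendsto_of_L2_bounded:
  fixes X :: "nat \<Rightarrow> 'a \<Rightarrow> complex"
  assumes m[measurable]: "\<And>n. X n \<in> borel_measurable M" "Y \<in> borel_measurable M"
    and lim: "AE \<omega> in M. (\<lambda>n. X n \<omega>) \<longlonglongrightarrow> Y \<omega>"
    and Y1: "AE \<omega> in M. cmod (Y \<omega>) \<le> 1"
    and int: "\<And>n. integrable M (\<lambda>\<omega>. (cmod (X n \<omega>))\<^sup>2)" and bd: "\<And>n. expectation (\<lambda>\<omega>. (cmod (X n \<omega>))\<^sup>2) \<le> C"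
  shows "(\<lambda>n. LINT \<omega>|M. X n \<omega>) \<longlonglongrightarrow> (LINT \<omega>|M. Y \<omega>)"
proof (rule LIMSEQ_I)
  fix r :: real assume r: "0 < r"
  define K where "K = max 1 (2 * \<bar>C\<bar> / r + 1)"
  have K: "K \<ge> 1" "\<bar>C\<bar> / K < r / 2"
  proof -
    show "K \<ge> 1" by (simp add: K_def)
    have "2 * \<bar>C\<bar> / r < K" by (simp add: K_def)
    then show "\<bar>C\<bar> / K < r / 2" using r \<open>K \<ge> 1\<close> by (simp add: field_simps)
  qed
  define c where "c z = complex_of_real (K / max K (cmod z)) * z" for z
  have cc: "continuous_on UNIV c" unfolding c_def using K by (intro continuous_intros) (auto simp: max_def)
  have [measurable]: "c \<in> borel_measurable borel" using cc by (rule borel_measurable_continuous_onI)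
  have cb: "cmod (c z) \<le> K" for z
    using K by (auto simp: c_def norm_mult norm_divide max_def field_simps)
  have c1: "c z = z" if "cmod z \<le> 1" for z using that K max_absorb1[of "cmod z" K] by (simp add: c_def)
  have cd: "cmod (z - c z) \<le> (cmod z)\<^sup>2 / K" for z
  proof (cases "cmod z \<le> K")
    case True then show ?thesis using K by (auto simp: c_def max_def)
  next
    case False
    have pos: "K < cmod z" "0 < cmod z" using False K by linarith+
    from False have "z - c z = complex_of_real (1 - K / cmod z) * z" by (simp add: c_def max_def algebra_simps)
    then have "cmod (z - c z) = \<bar>1 - K / cmod z\<bar> * cmod z" by (simp add: norm_mult del: of_real_diff)
    also have "\<dots> \<le> 1 * cmod z" using pos K by (intro mult_right_mono) (auto simp: abs_if divide_le_eq)
    also have "\<dots> \<le> (cmod z)\<^sup>2 / K" using mult_right_mono[of K "cmod z" "cmod z"] pos K by (simp add: pos_le_divide_eq power2_eq_square mult.commute)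
    finally show ?thesis .
  qed
  have intX: "integrable M (X n)" for n
  proof (rule Bochner_Integration.integrable_bound[OF Bochner_Integration.integrable_add[OF integrable_const[of 1] int[of n]]])
    show "AE \<omega> in M. norm (X n \<omega>) \<le> norm (1 + (cmod (X n \<omega>))\<^sup>2)"
    proof (rule AE_I2)
      fix \<omega> have "0 \<le> (cmod (X n \<omega>) - 1 / 2)\<^sup>2" by simp
      then show "norm (X n \<omega>) \<le> norm (1 + (cmod (X n \<omega>))\<^sup>2)" by (simp add: power2_diff power_divide)
    qed
  qed simp
  have intc: "integrable M (\<lambda>\<omega>. c (X n \<omega>))" for n
    by (rule integrable_const_bound[of _ K]) (auto intro: cb)
  have A: "cmod ((LINT \<omega>|M. X n \<omega>) - (LINT \<omega>|M. c (X n \<omega>))) \<le> \<bar>C\<bar> / K" for n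
  proof -
    have "cmod ((LINT \<omega>|M. X n \<omega>) - (LINT \<omega>|M. c (X n \<omega>))) = cmod (LINT \<omega>|M. X n \<omega> - c (X n \<omega>))"
      using intX intc by simp
    also have "\<dots> \<le> (LINT \<omega>|M. cmod (X n \<omega> - c (X n \<omega>)))" by (rule integral_norm_bound)
    also have "\<dots> \<le> (LINT \<omega>|M. (cmod (X n \<omega>))\<^sup>2 / K)"
      using intX intc int by (intro integral_mono) (auto intro: cd)
    also have "\<dots> \<le> \<bar>C\<bar> / K" using bd[of n] K by (auto intro!: divide_right_mono)
    finally show ?thesis .
  qed
  have "(\<lambda>n. LINT \<omega>|M. c (X n \<omega>)) \<longlonglongrightarrow> (LINT \<omega>|M. c (Y \<omega>))"
  proof (rule integral_dominated_convergence[where w = "\<lambda>_. K"])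
    show "AE \<omega> in M. (\<lambda>n. c (X n \<omega>)) \<longlonglongrightarrow> c (Y \<omega>)"
      using lim
    proof eventually_elim
      case (elim \<omega>)
      then show ?case using cc by (intro continuous_on_tendsto_compose[OF cc]) auto
    qed
  qed (auto intro: cb)
  also have "(LINT \<omega>|M. c (Y \<omega>)) = (LINT \<omega>|M. Y \<omega>)"
    using Y1 by (intro integral_cong_AE) (auto simp: c1 elim: eventually_mono)
  finally obtain N where N: "\<And>n. n \<ge> N \<Longrightarrow> cmod ((LINT \<omega>|M. c (X n \<omega>)) - (LINT \<omega>|M. Y \<omega>)) < r / 2"
    using LIMSEQ_D[of _ _ "r / 2"] r by (metis half_gt_zero)
  have "cmod ((LINT \<omega>|M. X n \<omega>) - (LINT \<omega>|M. Y \<omega>)) < r" if "n \<ge> N" for n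
    using norm_triangle_lt[of "(LINT \<omega>|M. X n \<omega>) - (LINT \<omega>|M. c (X n \<omega>))" "(LINT \<omega>|M. c (X n \<omega>)) - (LINT \<omega>|M. Y \<omega>)" r]
      A[of n] N[OF that] K by simp
  then show "\<exists>no. \<forall>n\<ge>no. norm ((LINT \<omega>|M. X n \<omega>) - (LINT \<omega>|M. Y \<omega>)) < r" by blast
qed

lemma normal_mgf:
  fixes X :: "'b \<Rightarrow> real"
  assumes d: "distributed M lborel X (normal_density 0 (sqrt v))" and v: "v > 0"
  shows "integrable M (\<lambda>\<omega>. exp (t * X \<omega>))" and "(LINT \<omega>|M. exp (t * X \<omega>)) = exp (t\<^sup>2 * v / 2)"
proof -
  have eq: "normal_density 0 (sqrt v) x * exp (t * x) = exp (t\<^sup>2 * v / 2) * normal_density (t * v) (sqrt v) x" for x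
  proof -
    have "- (x - 0)\<^sup>2 / (2 * (sqrt v)\<^sup>2) + t * x = t\<^sup>2 * v / 2 + - (x - t * v)\<^sup>2 / (2 * (sqrt v)\<^sup>2)"
      using v by (simp add: field_simps power2_eq_square)
    then show ?thesis unfolding normal_density_def by (simp add: exp_add[symmetric] mult_ac)
  qed
  have "integrable lborel (\<lambda>x. normal_density 0 (sqrt v) x * exp (t * x))"
    unfolding eq using v by (intro integrable_mult_right integrable_normal_density) auto
  then show "integrable M (\<lambda>\<omega>. exp (t * X \<omega>))"
    by (subst (asm) distributed_integrable[OF d]) auto
  have "(LINT \<omega>|M. exp (t * X \<omega>)) = (LINT x|lborel. normal_density 0 (sqrt v) x * exp (t * x))"
    by (rule distributed_integral[OF d, symmetric]) auto
  also have "\<dots> = exp (t\<^sup>2 * v / 2)" unfolding eq using v by simp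
  finally show "(LINT \<omega>|M. exp (t * X \<omega>)) = exp (t\<^sup>2 * v / 2)" .
qed

lemma normal_char:
  fixes X :: "'b \<Rightarrow> real"
  assumes M: "prob_space M" and d: "distributed M lborel X (normal_density 0 (sqrt v))" and v: "v > 0"
  shows "(LINT \<omega>|M. exp (\<i> * complex_of_real (r * X \<omega>))) = complex_of_real (exp (- (r\<^sup>2 * v / 2)))"
proof -
  interpret prob_space M by fact
  have [measurable]: "X \<in> borel_measurable M" using distributed_measurable[OF d] by simp
  define Y where "Y \<omega> = X \<omega> / sqrt v" for \<omega>
  have "distributed M lborel Y std_normal_density"
    using d v unfolding Y_def by (subst (asm) normal_standard_normal_convert) auto
  then have dY: "distr M borel Y = std_normal_distribution"
    using distributed_distr_eq_density[of M lborel Y std_normal_density] by (simp cong: distr_cong)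
  have [measurable]: "Y \<in> borel_measurable M" unfolding Y_def by measurable
  have "(LINT \<omega>|M. exp (\<i> * complex_of_real (r * X \<omega>))) = (LINT \<omega>|M. iexp ((r * sqrt v) * Y \<omega>))"
    using v by (simp add: Y_def)
  also have "\<dots> = (LINT y|distr M borel Y. iexp ((r * sqrt v) * y))"
    by (subst integral_distr) auto
  also have "\<dots> = char std_normal_distribution (r * sqrt v)"
    unfolding dY char_def ..
  also have "\<dots> = complex_of_real (exp (- (r\<^sup>2 * v / 2)))"
    using v unfolding char_std_normal_distribution by (simp add: power_mult_distrib)
  finally show ?thesis .
qed

section \<open>Increments on a grid\<close>

lemma Hminus_id_measurable: "(\<lambda>z. z) \<in> borel_measurable Hminus_borel"
  unfolding Hminus_borel_def by (intro measurable_restrict_space1) simp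

lemma space_Hminus_borel: "space Hminus_borel = Hminus"
  by (simp add: Hminus_borel_def space_restrict_space)

lemma (in prob_space) indep_set_mono:
  assumes "indep_set A B" "A' \<subseteq> A" "B' \<subseteq> B" shows "indep_set A' B'"
  using assms unfolding indep_sets2_eq by blast

locale planar_exit = prob_space P for P :: "'b measure" +
  fixes W :: "real \<Rightarrow> 'b \<Rightarrow> complex" and Z :: "'b \<Rightarrow> complex"
  assumes bm: "planar_brownian_motion P W"
    and Zm: "Z \<in> measurable P Hminus_borel"
    and indep_start: "indep_set (sets (vimage_algebra (space P) Z Hminus_borel)) (process_events P W)"
begin

definition increment :: "(complex \<Rightarrow> real) \<Rightarrow> real \<Rightarrow> nat \<Rightarrow> 'b \<Rightarrow> real" where
  "increment c \<delta> i \<omega> = c (W (real (Suc i) * \<delta>) \<omega>) - c (W (real i * \<delta>) \<omega>)"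

text \<open>
  The independent sources of randomness up to a grid time: the starting point (\<open>None\<close>) and the
  increments of the real (\<open>Inl\<close>) and of the imaginary part (\<open>Inr\<close>).
\<close>

definition source :: "real \<Rightarrow> (nat + nat) option \<Rightarrow> 'b set set" where
  "source \<delta> i = (case i of None \<Rightarrow> sets (vimage_algebra (space P) Z Hminus_borel)
    | Some (Inl i) \<Rightarrow> {increment Re \<delta> i -` S \<inter> space P | S. S \<in> sets borel}
    | Some (Inr i) \<Rightarrow> {increment Im \<delta> i -` S \<inter> space P | S. S \<in> sets borel})"

lemma bmRe: "brownian_motion P (\<lambda>t \<omega>. Re (W t \<omega>))" and bmIm: "brownian_motion P (\<lambda>t \<omega>. Im (W t \<omega>))"
  using bm by (auto simp: planar_brownian_motion_def)

lemma W0: "\<omega> \<in> space P \<Longrightarrow> W 0 \<omega> = 0"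
  using bmRe bmIm by (auto simp: brownian_motion_def complex_eq_iff)

lemma W_continuous: "\<omega> \<in> space P \<Longrightarrow> continuous_on {0..} (\<lambda>t. W t \<omega>)"
proof -
  assume "\<omega> \<in> space P"
  then have "continuous_on {0..} (\<lambda>t. Re (W t \<omega>))" "continuous_on {0..} (\<lambda>t. Im (W t \<omega>))"
    using bmRe bmIm by (auto simp: brownian_motion_def)
  then have "continuous_on {0..} (\<lambda>t. complex_of_real (Re (W t \<omega>)) + \<i> * complex_of_real (Im (W t \<omega>)))"
    by (intro continuous_on_add continuous_on_mult continuous_on_const continuous_on_of_real)
  then show ?thesis by (simp flip: complex_eq)
qed

lemma W_component_measurable[measurable (raw)]:
  assumes "t \<ge> 0" shows "(\<lambda>\<omega>. Re (W t \<omega>)) \<in> borel_measurable P" "(\<lambda>\<omega>. Im (W t \<omega>)) \<in> borel_measurable P"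
  using bmRe bmIm assms by (auto simp: brownian_motion_def)

lemma W_measurable: assumes "t \<ge> 0" shows "W t \<in> borel_measurable P"
proof -
  have "(\<lambda>\<omega>. complex_of_real (Re (W t \<omega>)) + \<i> * complex_of_real (Im (W t \<omega>))) \<in> borel_measurable P"
    using W_component_measurable[OF assms] by measurable
  then show ?thesis by (simp flip: complex_eq)
qed

lemma Z_space: "\<omega> \<in> space P \<Longrightarrow> Re (Z \<omega>) \<le> 0"
  using measurable_space[OF Zm] by (auto simp: Hminus_borel_def space_restrict_space Hminus_def)

lemma Z_measurable[measurable]: "Z \<in> borel_measurable P"
  using measurable_compose[OF Zm Hminus_id_measurable] .

lemma increment_distributed:
  assumes "\<delta> > 0"
  shows "distributed P lborel (increment Re \<delta> i) (normal_density 0 (sqrt \<delta>))"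
    "distributed P lborel (increment Im \<delta> i) (normal_density 0 (sqrt \<delta>))"
proof -
  have "0 \<le> real i * \<delta>" "real i * \<delta> < real (Suc i) * \<delta>" "real (Suc i) * \<delta> - real i * \<delta> = \<delta>"
    using assms by (auto simp: algebra_simps)
  then show "distributed P lborel (increment Re \<delta> i) (normal_density 0 (sqrt \<delta>))"
    "distributed P lborel (increment Im \<delta> i) (normal_density 0 (sqrt \<delta>))"
    using bmRe[unfolded brownian_motion_def, THEN conjunct2, THEN conjunct2, THEN conjunct2, THEN conjunct1, rule_format, of "real i * \<delta>" "real (Suc i) * \<delta>"]
      bmIm[unfolded brownian_motion_def, THEN conjunct2, THEN conjunct2, THEN conjunct2, THEN conjunct1, rule_format, of "real i * \<delta>" "real (Suc i) * \<delta>"]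
    by (simp_all only: increment_def[abs_def] simp_thms)
qed

lemma increment_measurable: "\<delta> > 0 \<Longrightarrow> increment Re \<delta> i \<in> borel_measurable P" "\<delta> > 0 \<Longrightarrow> increment Im \<delta> i \<in> borel_measurable P"
  using increment_distributed[of \<delta> i] by (auto dest: distributed_measurable)

lemma increment_indep:
  assumes "\<delta> > 0"
  shows "indep_vars (\<lambda>_. borel) (increment Re \<delta>) {..<n}" "indep_vars (\<lambda>_. borel) (increment Im \<delta>) {..<n}"
proof -
  have m: "mono (\<lambda>i. real i * \<delta>)" using assms by (intro monoI) (auto intro: mult_right_mono)
  show "indep_vars (\<lambda>_. borel) (increment Re \<delta>) {..<n}"
    using bmRe[unfolded brownian_motion_def, THEN conjunct2, THEN conjunct2, THEN conjunct2, THEN conjunct2, rule_format, of "\<lambda>i. real i * \<delta>" n] m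
    by (simp add: increment_def[abs_def])
  show "indep_vars (\<lambda>_. borel) (increment Im \<delta>) {..<n}"
    using bmIm[unfolded brownian_motion_def, THEN conjunct2, THEN conjunct2, THEN conjunct2, THEN conjunct2, rule_format, of "\<lambda>i. real i * \<delta>" n] m
    by (simp add: increment_def[abs_def])
qed

lemma process_events_sigma_algebra: "sigma_algebra (space P) (process_events P X)"
  unfolding process_events_def by (intro sigma_algebra_sigma_sets) auto

lemma process_measurable:
  fixes X :: "real \<Rightarrow> 'b \<Rightarrow> 'c::topological_space"
  assumes "t \<ge> 0"
  shows "X t \<in> borel_measurable (measure_of (space P) (process_events P X) (\<lambda>_. 0))"
proof (rule measurableI)
  fix A :: "'c set" assume "A \<in> sets borel"
  then have "X t -` A \<inter> space P \<in> process_events P X"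
    unfolding process_events_def using assms by (intro sigma_sets.Basic) auto
  then show "X t -` A \<inter> space (measure_of (space P) (process_events P X) (\<lambda>_. 0)) \<in> sets (measure_of (space P) (process_events P X) (\<lambda>_. 0))"
    by (simp add: process_events_def sigma_sets_sigma_sets_eq sets_measure_of_conv space_measure_of_conv)
       (auto simp: process_events_def subset_eq dest: sigma_sets_into_sp[rotated])
qed simp

lemma sets_process: "sets (measure_of (space P) (process_events P X) (\<lambda>_. 0)) = process_events P X"
  using process_events_sigma_algebra[of X] sigma_algebra.sets_measure_of_eq by blast

lemma increment_vimage:
  assumes "\<delta> > 0" "S \<in> sets borel"
  shows "increment c \<delta> i -` S \<inter> space P \<in> process_events P (\<lambda>t \<omega>. c (W t \<omega>))"
proof -
  let ?N = "measure_of (space P) (process_events P (\<lambda>t \<omega>. c (W t \<omega>))) (\<lambda>_. 0)"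
  have "(\<lambda>\<omega>. c (W (real (Suc i) * \<delta>) \<omega>)) \<in> borel_measurable ?N" "(\<lambda>\<omega>. c (W (real i * \<delta>) \<omega>)) \<in> borel_measurable ?N"
    using assms process_measurable[of _ "\<lambda>t \<omega>. c (W t \<omega>)"] by auto
  then have "increment c \<delta> i \<in> borel_measurable ?N" unfolding increment_def[abs_def] by (rule borel_measurable_diff)
  then have "increment c \<delta> i -` S \<inter> space ?N \<in> sets ?N" using assms(2) by (rule measurable_sets)
  then show ?thesis unfolding sets_process by (simp add: space_measure_of_conv)
qed

lemma component_events:
  fixes c :: "complex \<Rightarrow> real"
  assumes c: "c \<in> borel_measurable borel"
  shows "process_events P (\<lambda>t \<omega>. c (W t \<omega>)) \<subseteq> process_events P W"
  unfolding process_events_def[of P "\<lambda>t \<omega>. c (W t \<omega>)"]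
proof (rule sigma_algebra.sigma_sets_subset[OF process_events_sigma_algebra], safe)
  fix t :: real and A :: "real set" assume "0 \<le> t" "A \<in> sets borel"
  then have "c -` A \<in> sets borel" using measurable_sets[OF c, of A] by simp
  then have "W t -` (c -` A) \<inter> space P \<in> {W t -` B \<inter> space P | t B. 0 \<le> t \<and> B \<in> sets borel}"
    using \<open>0 \<le> t\<close> by blast
  then have "W t -` (c -` A) \<inter> space P \<in> process_events P W"
    unfolding process_events_def by (rule sigma_sets.Basic)
  then show "(\<lambda>\<omega>. c (W t \<omega>)) -` A \<inter> space P \<in> process_events P W" by (simp add: vimage_def)
qed

definition source_index :: "nat \<Rightarrow> (nat + nat) option set" where
  "source_index n = insert None (Some ` (Inl ` {..<n} \<union> Inr ` {..<n}))"

lemma source_events: "\<delta> > 0 \<Longrightarrow> source \<delta> i \<subseteq> events" and source_space: "space P \<in> source \<delta> i"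
  and source_Int_stable: "Int_stable (source \<delta> i)"
proof -
  show "source \<delta> i \<subseteq> events" if "\<delta> > 0"
    using increment_measurable[OF that] measurable_sets sets_image_in_sets[OF refl Zm]
    by (auto simp: source_def split: option.splits sum.splits)
  have "space P = increment c \<delta> j -` UNIV \<inter> space P" for c j by auto
  then show "space P \<in> source \<delta> i"
    using sets.top[of "vimage_algebra (space P) Z Hminus_borel"]
    by (auto simp: source_def split: option.splits sum.splits intro!: exI[of _ UNIV])
  have "Int_stable {X -` S \<inter> space P | S. S \<in> sets borel}" for X :: "'b \<Rightarrow> real"
  proof (rule Int_stableI, safe)
    fix S S' :: "real set" assume "S \<in> sets borel" "S' \<in> sets borel"
    then show "\<exists>S''. X -` S \<inter> space P \<inter> (X -` S' \<inter> space P) = X -` S'' \<inter> space P \<and> S'' \<in> sets borel"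
      by (intro exI[of _ "S \<inter> S'"]) auto
  qed
  moreover have "Int_stable (sets N)" for N :: "'b measure" by (rule Int_stableI) auto
  ultimately show "Int_stable (source \<delta> i)"
    by (auto simp: source_def split: option.splits sum.splits)
qed

text \<open>
  Increments within a coordinate are independent, the coordinates are independent of each
  other, and the starting point is independent of both. Only intersections have to be
  multiplied, since all sources contain the whole space.
\<close>

lemma source_indep:
  assumes \<delta>: "\<delta> > 0" and n: "n > 0"
  shows "indep_sets (source \<delta>) (source_index n)"
proof (subst indep_sets_finite)
  show "source_index n \<noteq> {}" "finite (source_index n)" by (auto simp: source_index_def)
  show "source \<delta> i \<subseteq> events" "space P \<in> source \<delta> i" for i using source_events[OF \<delta>] source_space by auto
  show "\<forall>A\<in>Pi (source_index n) (source \<delta>). prob (\<Inter>j\<in>source_index n. A j) = (\<Prod>j\<in>source_index n. prob (A j))"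
  proof
    fix A assume A: "A \<in> Pi (source_index n) (source \<delta>)"
    define U where "U = (\<Inter>i<n. A (Some (Inl i)))"
    define V where "V = (\<Inter>i<n. A (Some (Inr i)))"
    have As: "A j \<in> source \<delta> j" if "j \<in> source_index n" for j using A that by (rule Pi_mem)
    have ARe: "A (Some (Inl i)) \<in> {increment Re \<delta> i -` S \<inter> space P | S. S \<in> sets borel}" if "i < n" for i
      using As[of "Some (Inl i)"] that by (simp add: source_index_def source_def)
    have AIm: "A (Some (Inr i)) \<in> {increment Im \<delta> i -` S \<inter> space P | S. S \<in> sets borel}" if "i < n" for i
      using As[of "Some (Inr i)"] that by (simp add: source_index_def source_def)
    have AN: "A None \<in> sets (vimage_algebra (space P) Z Hminus_borel)"
      using As[of None] by (simp add: source_index_def source_def)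
    interpret R: sigma_algebra "space P" "process_events P (\<lambda>t \<omega>. Re (W t \<omega>))" by (rule process_events_sigma_algebra)
    interpret I: sigma_algebra "space P" "process_events P (\<lambda>t \<omega>. Im (W t \<omega>))" by (rule process_events_sigma_algebra)
    interpret C: sigma_algebra "space P" "process_events P W" by (rule process_events_sigma_algebra)
    have U: "U \<in> process_events P (\<lambda>t \<omega>. Re (W t \<omega>))"
      unfolding U_def
    proof (intro R.finite_INT)
      show "A (Some (Inl i)) \<in> process_events P (\<lambda>t \<omega>. Re (W t \<omega>))" if "i \<in> {..<n}" for i
        using ARe[of i] increment_vimage[OF \<delta>, of _ Re i] that by auto
    qed (use n in auto)
    have V: "V \<in> process_events P (\<lambda>t \<omega>. Im (W t \<omega>))"
      unfolding V_def
    proof (intro I.finite_INT)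
      show "A (Some (Inr i)) \<in> process_events P (\<lambda>t \<omega>. Im (W t \<omega>))" if "i \<in> {..<n}" for i
        using AIm[of i] increment_vimage[OF \<delta>, of _ Im i] that by auto
    qed (use n in auto)
    have UV: "U \<inter> V \<in> process_events P W"
      using U V component_events[of Re] component_events[of Im] by auto
    have pU: "prob U = (\<Prod>i<n. prob (A (Some (Inl i))))"
      unfolding U_def
    proof (rule indep_setsD[where F = "\<lambda>i. {increment Re \<delta> i -` S \<inter> space P | S. S \<in> sets borel}" and I = "{..<n}"])
      show "indep_sets (\<lambda>i. {increment Re \<delta> i -` S \<inter> space P | S. S \<in> sets borel}) {..<n}"
        using increment_indep(1)[OF \<delta>, of n] unfolding indep_vars_def2 by blast
      show "\<forall>j\<in>{..<n}. A (Some (Inl j)) \<in> {increment Re \<delta> j -` S \<inter> space P | S. S \<in> sets borel}"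
        using ARe by blast
    qed (use n in auto)
    have pV: "prob V = (\<Prod>i<n. prob (A (Some (Inr i))))"
      unfolding V_def
    proof (rule indep_setsD[where F = "\<lambda>i. {increment Im \<delta> i -` S \<inter> space P | S. S \<in> sets borel}" and I = "{..<n}"])
      show "indep_sets (\<lambda>i. {increment Im \<delta> i -` S \<inter> space P | S. S \<in> sets borel}) {..<n}"
        using increment_indep(2)[OF \<delta>, of n] unfolding indep_vars_def2 by blast
      show "\<forall>j\<in>{..<n}. A (Some (Inr j)) \<in> {increment Im \<delta> j -` S \<inter> space P | S. S \<in> sets borel}"
        using AIm by blast
    qed (use n in auto)
    have "(\<Inter>j\<in>source_index n. A j) = A None \<inter> (U \<inter> V)"
      unfolding source_index_def U_def V_def by auto
    also have "prob \<dots> = prob (A None) * prob (U \<inter> V)"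
      by (rule indep_setD[OF indep_start AN UV])
    also have "prob (U \<inter> V) = prob U * prob V"
      using bm U V by (intro indep_setD) (auto simp: planar_brownian_motion_def)
    also have "prob (A None) * (prob U * prob V) = (\<Prod>j\<in>source_index n. prob (A j))"
    proof -
      have "(\<Prod>j\<in>source_index n. prob (A j)) = prob (A None) * (\<Prod>j\<in>Some ` (Inl ` {..<n} \<union> Inr ` {..<n}). prob (A j))"
        unfolding source_index_def by (subst prod.insert) auto
      also have "(\<Prod>j\<in>Some ` (Inl ` {..<n} \<union> Inr ` {..<n}). prob (A j)) = (\<Prod>j\<in>Inl ` {..<n} \<union> Inr ` {..<n}. prob (A (Some j)))"
        by (subst prod.reindex) auto
      also have "\<dots> = (\<Prod>j\<in>Inl ` {..<n}. prob (A (Some j))) * (\<Prod>j\<in>Inr ` {..<n}. prob (A (Some j)))"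
        by (rule prod.union_disjoint) auto
      also have "\<dots> = prob U * prob V" unfolding pU pV by (simp add: prod.reindex)
      finally show ?thesis ..
    qed
    finally show "prob (\<Inter>j\<in>source_index n. A j) = (\<Prod>j\<in>source_index n. prob (A j))" .
  qed
qed

definition past :: "real \<Rightarrow> nat \<Rightarrow> 'b measure" where
  "past \<delta> k = sigma (space P) (\<Union>i\<in>source_index k. source \<delta> i)"

lemma source_subset: "source \<delta> i \<subseteq> Pow (space P)"
  using sets.sets_into_space[of _ "vimage_algebra (space P) Z Hminus_borel"]
  by (auto simp: source_def split: option.splits sum.splits)

lemma space_past[simp]: "space (past \<delta> k) = space P"
  using source_subset by (auto simp: past_def intro!: space_measure_of)

lemma sets_past: "sets (past \<delta> k) = sigma_sets (space P) (\<Union>i\<in>source_index k. source \<delta> i)"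
  using source_subset unfolding past_def by (intro sets_measure_of) auto

lemma past_measurable_P:
  fixes f :: "'b \<Rightarrow> 'c::topological_space"
  assumes \<delta>: "\<delta> > 0" and f: "f \<in> borel_measurable (past \<delta> k)"
  shows "f \<in> borel_measurable P"
proof (rule measurableI)
  have "sets (past \<delta> k) \<subseteq> events"
    unfolding sets_past using source_events[OF \<delta>] by (intro sets.sigma_sets_subset) blast
  moreover fix A :: "'c set" assume "A \<in> sets borel"
  then have "f -` A \<inter> space P \<in> sets (past \<delta> k)" using measurable_sets[OF f] by simp
  ultimately show "f -` A \<inter> space P \<in> events" by blast
qed simp

lemma indep_past_increment:
  fixes f :: "'b \<Rightarrow> 'c::{second_countable_topology}" and \<phi> :: "real \<Rightarrow> real \<Rightarrow> 'c"
  assumes \<delta>: "\<delta> > 0" and f: "f \<in> borel_measurable (past \<delta> k)"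
    and \<phi>: "(\<lambda>(x, y). \<phi> x y) \<in> borel_measurable (borel \<Otimes>\<^sub>M borel)"
  shows "indep_var borel f borel (\<lambda>\<omega>. \<phi> (increment Re \<delta> k \<omega>) (increment Im \<delta> k \<omega>))"
  unfolding indep_var_eq
proof (intro conjI)
  show "f \<in> borel_measurable P" using past_measurable_P[OF \<delta> f] .
  note [measurable] = increment_measurable[OF \<delta>]
  show "(\<lambda>\<omega>. \<phi> (increment Re \<delta> k \<omega>) (increment Im \<delta> k \<omega>)) \<in> borel_measurable P"
    using measurable_compose[OF measurable_Pair[OF increment_measurable[OF \<delta>, of k]] \<phi>] by simp
  define I where "I b = (if b then source_index k else {Some (Inl k), Some (Inr k)})" for b
  have "indep_sets (\<lambda>b. sigma_sets (space P) (\<Union>i\<in>I b. source \<delta> i)) UNIV"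
  proof (rule indep_sets_collect_sigma)
    have "(\<Union>j. I j) \<subseteq> source_index (Suc k)" by (auto simp: I_def source_index_def)
    then show "indep_sets (source \<delta>) (\<Union>j\<in>UNIV. I j)"
      using source_indep[OF \<delta>, of "Suc k"] by (auto intro: indep_sets_mono_index)
    show "disjoint_family_on I UNIV"
      by (auto simp: disjoint_family_on_def I_def source_index_def)
  qed (rule source_Int_stable)
  then have "indep_set (sigma_sets (space P) (\<Union>i\<in>source_index k. source \<delta> i)) (sigma_sets (space P) (\<Union>i\<in>{Some (Inl k), Some (Inr k)}. source \<delta> i))"
    unfolding indep_set_def
    by (rule indep_sets_mono_sets) (auto simp: I_def split: bool.splits)
  then show "indep_set (sigma_sets (space P) {f -` A \<inter> space P | A. A \<in> sets borel})
    (sigma_sets (space P) {(\<lambda>\<omega>. \<phi> (increment Re \<delta> k \<omega>) (increment Im \<delta> k \<omega>)) -` A \<inter> space P | A. A \<in> sets borel})"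
  proof (rule indep_set_mono)
  show "sigma_sets (space P) {f -` A \<inter> space P | A. A \<in> sets borel} \<subseteq> sigma_sets (space P) (\<Union>i\<in>source_index k. source \<delta> i)"
    using measurable_sets[OF f] by (intro sigma_sets_mono) (auto simp: sets_past)
  show "sigma_sets (space P) {(\<lambda>\<omega>. \<phi> (increment Re \<delta> k \<omega>) (increment Im \<delta> k \<omega>)) -` A \<inter> space P | A. A \<in> sets borel}
    \<subseteq> sigma_sets (space P) (\<Union>i\<in>{Some (Inl k), Some (Inr k)}. source \<delta> i)"
  proof -
    define N where "N = sigma (space P) (\<Union>i\<in>{Some (Inl k), Some (Inr k)}. source \<delta> i)"
    have sN: "sets N = sigma_sets (space P) (\<Union>i\<in>{Some (Inl k), Some (Inr k)}. source \<delta> i)" "space N = space P"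
      using source_subset unfolding N_def by (intro sets_measure_of space_measure_of, blast)+
    have "increment Re \<delta> k -` A \<inter> space P \<in> sets N" "increment Im \<delta> k -` A \<inter> space P \<in> sets N" if "A \<in> sets borel" for A
    proof -
      have "increment Re \<delta> k -` A \<inter> space P \<in> source \<delta> (Some (Inl k))" "increment Im \<delta> k -` A \<inter> space P \<in> source \<delta> (Some (Inr k))"
        using that by (auto simp: source_def)
      then show "increment Re \<delta> k -` A \<inter> space P \<in> sets N" "increment Im \<delta> k -` A \<inter> space P \<in> sets N"
        unfolding sN by (intro sigma_sets.Basic; blast)+
    qed
    then have "increment Re \<delta> k \<in> borel_measurable N" "increment Im \<delta> k \<in> borel_measurable N"
      by (auto intro!: measurableI simp: sN(2))
    from measurable_compose[OF measurable_Pair[OF this] \<phi>]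
    have "(\<lambda>\<omega>. \<phi> (increment Re \<delta> k \<omega>) (increment Im \<delta> k \<omega>)) \<in> borel_measurable N" by simp
    from measurable_sets[OF this] show ?thesis by (intro sigma_sets_mono) (auto simp: sN)
  qed
  qed
qed

text \<open>
  The real part enters through its moment generating function, the imaginary part through its
  characteristic function, so the variances contribute with opposite signs.
\<close>

lemma increment_exp:
  assumes \<delta>: "\<delta> > 0"
  shows "integrable P (\<lambda>\<omega>. exp (complex_of_real (t * increment Re \<delta> k \<omega>) + \<i> * complex_of_real (r * increment Im \<delta> k \<omega>)))"
    and "(LINT \<omega>|P. exp (complex_of_real (t * increment Re \<delta> k \<omega>) + \<i> * complex_of_real (r * increment Im \<delta> k \<omega>)))
      = complex_of_real (exp ((t\<^sup>2 - r\<^sup>2) * \<delta> / 2))"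
proof -
  note [measurable] = increment_measurable[OF \<delta>]
  have "indep_var borel (increment Re \<delta> k) borel (increment Im \<delta> k)"
  proof -
    have "indep_set {increment Re \<delta> k -` A \<inter> space P | A. A \<in> sets borel} {increment Im \<delta> k -` A \<inter> space P | A. A \<in> sets borel}"
    proof (rule indep_set_mono)
      show "indep_set (process_events P (\<lambda>t \<omega>. Re (W t \<omega>))) (process_events P (\<lambda>t \<omega>. Im (W t \<omega>)))"
        using bm by (simp add: planar_brownian_motion_def)
    qed (auto intro: increment_vimage[OF \<delta>])
    moreover have "Int_stable {increment Re \<delta> k -` A \<inter> space P | A. A \<in> sets borel}" "Int_stable {increment Im \<delta> k -` A \<inter> space P | A. A \<in> sets borel}"
      using source_Int_stable[of \<delta> "Some (Inl k)"] source_Int_stable[of \<delta> "Some (Inr k)"] by (simp_all add: source_def)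
    ultimately show ?thesis
      unfolding indep_var_eq using increment_measurable[OF \<delta>, of k] by (intro conjI indep_set_sigma_sets)
  qed
  then have ind: "indep_var borel (\<lambda>\<omega>. complex_of_real (exp (t * increment Re \<delta> k \<omega>))) borel (\<lambda>\<omega>. exp (\<i> * complex_of_real (r * increment Im \<delta> k \<omega>)))"
    using indep_var_compose[where ?Y1.0 = "\<lambda>x. complex_of_real (exp (t * x))" and ?Y2.0 = "\<lambda>x. exp (\<i> * complex_of_real (r * x))" and ?N1.0 = borel and ?N2.0 = borel]
    by (force simp: comp_def)
  have i1: "integrable P (\<lambda>\<omega>. complex_of_real (exp (t * increment Re \<delta> k \<omega>)))"
    using normal_mgf(1)[OF increment_distributed(1)[OF \<delta>] \<delta>] by (rule integrable_of_real)
  have i2: "integrable P (\<lambda>\<omega>. exp (\<i> * complex_of_real (r * increment Im \<delta> k \<omega>)))"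
    by (rule integrable_const_bound[of _ 1]) auto
  have eq: "exp (complex_of_real (t * increment Re \<delta> k \<omega>) + \<i> * complex_of_real (r * increment Im \<delta> k \<omega>))
    = complex_of_real (exp (t * increment Re \<delta> k \<omega>)) * exp (\<i> * complex_of_real (r * increment Im \<delta> k \<omega>))" for \<omega>
    by (simp add: exp_add exp_of_real[symmetric])
  show "integrable P (\<lambda>\<omega>. exp (complex_of_real (t * increment Re \<delta> k \<omega>) + \<i> * complex_of_real (r * increment Im \<delta> k \<omega>)))"
    unfolding eq by (rule indep_var_integrable[OF ind i1 i2])
  have "(LINT \<omega>|P. exp (complex_of_real (t * increment Re \<delta> k \<omega>) + \<i> * complex_of_real (r * increment Im \<delta> k \<omega>)))
    = (LINT \<omega>|P. complex_of_real (exp (t * increment Re \<delta> k \<omega>))) * (LINT \<omega>|P. exp (\<i> * complex_of_real (r * increment Im \<delta> k \<omega>)))"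
    unfolding eq by (rule indep_var_lebesgue_integral[OF ind i1 i2])
  also have "(LINT \<omega>|P. complex_of_real (exp (t * increment Re \<delta> k \<omega>))) = complex_of_real (exp (t\<^sup>2 * \<delta> / 2))"
    using normal_mgf(2)[OF increment_distributed(1)[OF \<delta>] \<delta>] by simp
  also have "(LINT \<omega>|P. exp (\<i> * complex_of_real (r * increment Im \<delta> k \<omega>))) = complex_of_real (exp (- (r\<^sup>2 * \<delta> / 2)))"
    by (rule normal_char[OF prob_space_axioms increment_distributed(2)[OF \<delta>] \<delta>])
  also have "complex_of_real (exp (t\<^sup>2 * \<delta> / 2)) * complex_of_real (exp (- (r\<^sup>2 * \<delta> / 2))) = complex_of_real (exp ((t\<^sup>2 - r\<^sup>2) * \<delta> / 2))"
    unfolding of_real_mult[symmetric] exp_add[symmetric] by (simp add: left_diff_distrib diff_divide_distrib)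
  finally show "(LINT \<omega>|P. exp (complex_of_real (t * increment Re \<delta> k \<omega>) + \<i> * complex_of_real (r * increment Im \<delta> k \<omega>)))
      = complex_of_real (exp ((t\<^sup>2 - r\<^sup>2) * \<delta> / 2))" .
qed

end

section \<open>Optional stopping of the exponential martingale\<close>

context planar_exit begin

definition grid_pos :: "real \<Rightarrow> nat \<Rightarrow> 'b \<Rightarrow> complex" where
  "grid_pos \<delta> k \<omega> = Z \<omega> + W (real k * \<delta>) \<omega>"

lemma grid_pos_Suc: "Re (grid_pos \<delta> (Suc k) \<omega>) = Re (grid_pos \<delta> k \<omega>) + increment Re \<delta> k \<omega>"
  "Im (grid_pos \<delta> (Suc k) \<omega>) = Im (grid_pos \<delta> k \<omega>) + increment Im \<delta> k \<omega>"
  by (simp_all add: grid_pos_def increment_def)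

lemma grid_pos_0: "\<omega> \<in> space P \<Longrightarrow> grid_pos \<delta> 0 \<omega> = Z \<omega>"
  by (simp add: grid_pos_def W0)

lemma grid_pos_measurable: "\<delta> > 0 \<Longrightarrow> grid_pos \<delta> k \<in> borel_measurable P"
  unfolding grid_pos_def[abs_def] using W_measurable[of "real k * \<delta>"] by measurable

lemma source_past: "i \<in> source_index k \<Longrightarrow> A \<in> source \<delta> i \<Longrightarrow> A \<in> sets (past \<delta> k)"
  unfolding sets_past by (intro sigma_sets.Basic) blast

lemma Z_past: "Z \<in> borel_measurable (past \<delta> k)"
proof (rule measurableI)
  fix A :: "complex set" assume A: "A \<in> sets borel"
  have "Z \<in> measurable (vimage_algebra (space P) Z Hminus_borel) Hminus_borel"
    using measurable_space[OF Zm] by (intro measurable_vimage_algebra1) auto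
  from measurable_compose[OF this Hminus_id_measurable]
  have "Z \<in> borel_measurable (vimage_algebra (space P) Z Hminus_borel)" .
  from measurable_sets[OF this A]
  have "Z -` A \<inter> space P \<in> source \<delta> None" by (simp add: source_def)
  then have "Z -` A \<inter> space P \<in> sets (past \<delta> k)" by (rule source_past[rotated]) (simp add: source_index_def)
  then show "Z -` A \<inter> space (past \<delta> k) \<in> sets (past \<delta> k)" by simp
qed simp

lemma increment_past:
  assumes "j < k" shows "increment Re \<delta> j \<in> borel_measurable (past \<delta> k)" "increment Im \<delta> j \<in> borel_measurable (past \<delta> k)"
proof -
  have "increment Re \<delta> j -` A \<inter> space P \<in> sets (past \<delta> k)" if "A \<in> sets borel" for A
    by (rule source_past[of "Some (Inl j)"]) (use that assms in \<open>auto simp: source_def source_index_def\<close>)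
  then show "increment Re \<delta> j \<in> borel_measurable (past \<delta> k)" by (intro measurableI) auto
  have "increment Im \<delta> j -` A \<inter> space P \<in> sets (past \<delta> k)" if "A \<in> sets borel" for A
    by (rule source_past[of "Some (Inr j)"]) (use that assms in \<open>auto simp: source_def source_index_def\<close>)
  then show "increment Im \<delta> j \<in> borel_measurable (past \<delta> k)" by (intro measurableI) auto
qed

lemma grid_pos_past:
  assumes "j \<le> k"
  shows "(\<lambda>\<omega>. Re (grid_pos \<delta> j \<omega>)) \<in> borel_measurable (past \<delta> k)" "(\<lambda>\<omega>. Im (grid_pos \<delta> j \<omega>)) \<in> borel_measurable (past \<delta> k)"
proof -
  have "(\<lambda>\<omega>. Re (grid_pos \<delta> j \<omega>)) \<in> borel_measurable (past \<delta> k) \<and> (\<lambda>\<omega>. Im (grid_pos \<delta> j \<omega>)) \<in> borel_measurable (past \<delta> k)"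
    using assms
  proof (induction j)
    case 0
    note [measurable] = Z_past[of \<delta> k]
    have "(\<lambda>\<omega>. Re (Z \<omega>)) \<in> borel_measurable (past \<delta> k)" "(\<lambda>\<omega>. Im (Z \<omega>)) \<in> borel_measurable (past \<delta> k)" by measurable
    moreover have "((\<lambda>\<omega>. Re (grid_pos \<delta> 0 \<omega>)) \<in> borel_measurable (past \<delta> k)) = ((\<lambda>\<omega>. Re (Z \<omega>)) \<in> borel_measurable (past \<delta> k))"
      "((\<lambda>\<omega>. Im (grid_pos \<delta> 0 \<omega>)) \<in> borel_measurable (past \<delta> k)) = ((\<lambda>\<omega>. Im (Z \<omega>)) \<in> borel_measurable (past \<delta> k))"
      by (rule measurable_cong, simp add: grid_pos_0)+
    ultimately show ?case by blast
  next
    case (Suc j)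
    then show ?case unfolding grid_pos_Suc using increment_past[of j k \<delta>] by (auto intro!: borel_measurable_add)
  qed
  then show "(\<lambda>\<omega>. Re (grid_pos \<delta> j \<omega>)) \<in> borel_measurable (past \<delta> k)" "(\<lambda>\<omega>. Im (grid_pos \<delta> j \<omega>)) \<in> borel_measurable (past \<delta> k)" by auto
qed

text \<open>
  For \<open>t = r\<close> this is \<open>exp (r * z)\<close> along the path. Taking \<open>t > r\<close> adds a decay in time that
  handles paths which stay in the half-plane for long, at the price of a function that is no
  longer holomorphic.
\<close>

definition exp_mart :: "real \<Rightarrow> real \<Rightarrow> real \<Rightarrow> nat \<Rightarrow> 'b \<Rightarrow> complex" where
  "exp_mart t r \<delta> k \<omega> = exp (complex_of_real (t * Re (grid_pos \<delta> k \<omega>)) + \<i> * complex_of_real (r * Im (grid_pos \<delta> k \<omega>))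
     - complex_of_real ((t\<^sup>2 - r\<^sup>2) * (real k * \<delta>) / 2))"

definition live :: "real \<Rightarrow> nat \<Rightarrow> 'b \<Rightarrow> bool" where
  "live \<delta> k \<omega> \<longleftrightarrow> (\<forall>j\<le>k. Re (grid_pos \<delta> j \<omega>) \<le> 0)"

definition stopped :: "real \<Rightarrow> real \<Rightarrow> real \<Rightarrow> nat \<Rightarrow> 'b \<Rightarrow> complex" where
  "stopped t r \<delta> k \<omega> = exp_mart t r \<delta> (stop_idx (\<lambda>j. Re (grid_pos \<delta> j \<omega>)) k) \<omega>"

definition factor :: "real \<Rightarrow> real \<Rightarrow> real \<Rightarrow> real \<Rightarrow> real \<Rightarrow> complex" where
  "factor t r \<delta> x y = exp (complex_of_real (t * x) + \<i> * complex_of_real (r * y) - complex_of_real ((t\<^sup>2 - r\<^sup>2) * \<delta> / 2))"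

lemma cmod_exp_mart: "cmod (exp_mart t r \<delta> k \<omega>) = exp (t * Re (grid_pos \<delta> k \<omega>) - (t\<^sup>2 - r\<^sup>2) * (real k * \<delta>) / 2)"
  by (simp add: exp_mart_def)

lemma cmod_factor: "cmod (factor t r \<delta> x y) = exp (t * x - (t\<^sup>2 - r\<^sup>2) * \<delta> / 2)"
  by (simp add: factor_def)

lemma exp_mart_Suc: "exp_mart t r \<delta> (Suc k) \<omega> = exp_mart t r \<delta> k \<omega> * factor t r \<delta> (increment Re \<delta> k \<omega>) (increment Im \<delta> k \<omega>)"
proof -
  have e: "complex_of_real ((t\<^sup>2 - r\<^sup>2) * (real (Suc k) * \<delta>) / 2) =
    complex_of_real ((t\<^sup>2 - r\<^sup>2) * (real k * \<delta>) / 2) + complex_of_real ((t\<^sup>2 - r\<^sup>2) * \<delta> / 2)"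
    unfolding of_real_add[symmetric] by (simp add: field_simps)
  show ?thesis
    unfolding exp_mart_def factor_def exp_add[symmetric] grid_pos_Suc e distrib_left of_real_add
    by (rule arg_cong[where f = exp]) algebra
qed

definition alive_mart :: "real \<Rightarrow> real \<Rightarrow> real \<Rightarrow> nat \<Rightarrow> 'b \<Rightarrow> complex" where
  "alive_mart t r \<delta> k \<omega> = (if live \<delta> k \<omega> then exp_mart t r \<delta> k \<omega> else 0)"

text \<open>
  Before exit the stopped process is multiplied by an independent factor of mean \<open>1\<close>, after
  exit it is constant.
\<close>

lemma stopped_Suc:
  "stopped t r \<delta> (Suc k) \<omega> = stopped t r \<delta> k \<omega> + alive_mart t r \<delta> k \<omega> * (factor t r \<delta> (increment Re \<delta> k \<omega>) (increment Im \<delta> k \<omega>) - 1)"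
proof (cases "live \<delta> k \<omega>")
  case True
  then have "\<forall>j\<le>k. Re (grid_pos \<delta> j \<omega>) \<le> 0" by (simp add: live_def)
  then show ?thesis
    using True unfolding stopped_def by (simp add: alive_mart_def stop_idx_live stop_idx_Suc_live exp_mart_Suc right_diff_distrib)
next
  case False
  then have "\<exists>j\<le>k. 0 < Re (grid_pos \<delta> j \<omega>)" by (auto simp: live_def not_le)
  then show ?thesis using False unfolding stopped_def by (simp add: alive_mart_def stop_idx_Suc_stopped)
qed

lemma alive_mart_past: "alive_mart t r \<delta> k \<in> borel_measurable (past \<delta> k)"
proof -
  note [measurable] = grid_pos_past
  have "{\<omega> \<in> space (past \<delta> k). live \<delta> k \<omega>} \<in> sets (past \<delta> k)"
  proof -
    have "{\<omega> \<in> space (past \<delta> k). live \<delta> k \<omega>} = (\<Inter>j\<in>{..k}. {\<omega> \<in> space (past \<delta> k). Re (grid_pos \<delta> j \<omega>) \<le> 0})"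
      by (auto simp: live_def)
    also have "\<dots> \<in> sets (past \<delta> k)"
    proof (intro sets.finite_INT)
      fix j assume "j \<in> {..k}"
      then have [measurable]: "(\<lambda>\<omega>. Re (grid_pos \<delta> j \<omega>)) \<in> borel_measurable (past \<delta> k)" using grid_pos_past by simp
      show "{\<omega> \<in> space (past \<delta> k). Re (grid_pos \<delta> j \<omega>) \<le> 0} \<in> sets (past \<delta> k)" by measurable
    qed auto
    finally show ?thesis .
  qed
  moreover have "exp_mart t r \<delta> k \<in> borel_measurable (past \<delta> k)"
  proof -
    have [measurable]: "(\<lambda>\<omega>. Re (grid_pos \<delta> k \<omega>)) \<in> borel_measurable (past \<delta> k)" "(\<lambda>\<omega>. Im (grid_pos \<delta> k \<omega>)) \<in> borel_measurable (past \<delta> k)"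
      using grid_pos_past by auto
    show ?thesis unfolding exp_mart_def[abs_def] by measurable
  qed
  ultimately show ?thesis unfolding alive_mart_def[abs_def] by (intro measurable_If) auto
qed

lemma power2_diff_nonneg: "0 \<le> r \<Longrightarrow> r \<le> t \<Longrightarrow> 0 \<le> t\<^sup>2 - r\<^sup>2" for r t :: real by (simp add: power_mono)

context
  fixes t r \<delta> :: real
  assumes tr: "0 \<le> r" "r \<le> t" and \<delta>: "\<delta> > 0"
begin

lemma cmod_alive_mart: "cmod (alive_mart t r \<delta> k \<omega>) \<le> 1"
proof (cases "live \<delta> k \<omega>")
  case True
  then have "Re (grid_pos \<delta> k \<omega>) \<le> 0" by (simp add: live_def)
  then have "t * Re (grid_pos \<delta> k \<omega>) - (t\<^sup>2 - r\<^sup>2) * (real k * \<delta>) / 2 \<le> 0"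
  proof -
    have "0 \<le> (t\<^sup>2 - r\<^sup>2) * (real k * \<delta>)" using \<delta> by (intro mult_nonneg_nonneg power2_diff_nonneg[OF tr]) auto
    moreover have "t * Re (grid_pos \<delta> k \<omega>) \<le> 0" using tr \<open>Re (grid_pos \<delta> k \<omega>) \<le> 0\<close> by (intro mult_nonneg_nonpos) auto
    ultimately show ?thesis by linarith
  qed
  then show ?thesis using True by (simp add: alive_mart_def cmod_exp_mart)
qed (simp add: alive_mart_def)

lemma factor_mean:
  shows "integrable P (\<lambda>\<omega>. factor t r \<delta> (increment Re \<delta> k \<omega>) (increment Im \<delta> k \<omega>))"
    and "(LINT \<omega>|P. factor t r \<delta> (increment Re \<delta> k \<omega>) (increment Im \<delta> k \<omega>)) = 1"
proof -
  have eq: "factor t r \<delta> x y = exp (complex_of_real (t * x) + \<i> * complex_of_real (r * y)) * complex_of_real (exp (- ((t\<^sup>2 - r\<^sup>2) * \<delta> / 2)))" for x y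
  proof -
    have "exp (u - complex_of_real c) = exp u * complex_of_real (exp (- c))" for u c
      unfolding exp_of_real[symmetric] exp_add[symmetric] by simp
    then show ?thesis unfolding factor_def by blast
  qed
  show "integrable P (\<lambda>\<omega>. factor t r \<delta> (increment Re \<delta> k \<omega>) (increment Im \<delta> k \<omega>))"
    unfolding eq by (intro integrable_mult_left increment_exp(1)[OF \<delta>])
  have "(LINT \<omega>|P. factor t r \<delta> (increment Re \<delta> k \<omega>) (increment Im \<delta> k \<omega>))
    = complex_of_real (exp ((t\<^sup>2 - r\<^sup>2) * \<delta> / 2)) * complex_of_real (exp (- ((t\<^sup>2 - r\<^sup>2) * \<delta> / 2)))"
    unfolding eq using increment_exp[OF \<delta>, of t k r] by simp
  also have "\<dots> = 1" unfolding of_real_mult[symmetric] exp_add[symmetric] by simp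
  finally show "(LINT \<omega>|P. factor t r \<delta> (increment Re \<delta> k \<omega>) (increment Im \<delta> k \<omega>)) = 1" .
qed

text \<open>
  The mean is preserved step by step because the factor is independent of the past. The second
  moment controls the overshoot: inside the half-plane the martingale is bounded by \<open>1\<close>, so
  each step adds at most \<open>exp (2 * t\<^sup>2 * \<delta>) - 1\<close>, which is of order \<open>\<delta>\<close>. Over a fixed time
  span the bound is therefore uniform in the grid.
\<close>

lemma stopped_moments:
  shows "integrable P (stopped t r \<delta> k)"
    and "(LINT \<omega>|P. stopped t r \<delta> k \<omega>) = (LINT \<omega>|P. exp (complex_of_real (t * Re (Z \<omega>)) + \<i> * complex_of_real (r * Im (Z \<omega>))))"
    and "integrable P (\<lambda>\<omega>. (cmod (stopped t r \<delta> k \<omega>))\<^sup>2)"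
    and "(LINT \<omega>|P. (cmod (stopped t r \<delta> k \<omega>))\<^sup>2) \<le> 1 + real k * (exp (2 * t\<^sup>2 * \<delta>) - 1)"
proof (induction k)
  case 0
  have eq: "stopped t r \<delta> 0 \<omega> = exp (complex_of_real (t * Re (Z \<omega>)) + \<i> * complex_of_real (r * Im (Z \<omega>)))" if "\<omega> \<in> space P" for \<omega>
    using that by (simp add: stopped_def exp_mart_def grid_pos_0)
  have [measurable]: "stopped t r \<delta> 0 \<in> borel_measurable P"
    by (subst measurable_cong[OF eq]) auto
  have b: "cmod (stopped t r \<delta> 0 \<omega>) \<le> 1" if "\<omega> \<in> space P" for \<omega>
    using Z_space[OF that] tr by (simp add: eq[OF that] mult_nonneg_nonpos)
  {
    case 1
    show ?case by (rule integrable_const_bound[of _ 1]) (auto intro: b)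
  next
    case 2
    show ?case by (rule Bochner_Integration.integral_cong) (auto simp: eq)
  next
    case 3
    show ?case by (rule integrable_const_bound[of _ 1]) (auto intro!: power_le_one b)
  next
    case 4
    have "(LINT \<omega>|P. (cmod (stopped t r \<delta> 0 \<omega>))\<^sup>2) \<le> (LINT \<omega>|P. 1)"
      by (rule integral_mono[OF integrable_const_bound[of _ 1]]) (auto intro!: power_le_one b)
    then show ?case by (simp add: prob_space)
  }
next
  case (Suc k)
  let ?A = "alive_mart t r \<delta> k" and ?F = "\<lambda>\<omega>. factor t r \<delta> (increment Re \<delta> k \<omega>) (increment Im \<delta> k \<omega>)"
  note [measurable] = past_measurable_P[OF \<delta> alive_mart_past[of t r \<delta> k]] increment_measurable[OF \<delta>]
  have [measurable]: "(\<lambda>(x, y). factor t r \<delta> x y - 1) \<in> borel_measurable (borel \<Otimes>\<^sub>M borel)"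
    unfolding factor_def by measurable
  have ind: "indep_var borel ?A borel (\<lambda>\<omega>. ?F \<omega> - 1)"
    by (rule indep_past_increment[OF \<delta> alive_mart_past, of "\<lambda>x y. factor t r \<delta> x y - 1"]) measurable
  have iA: "integrable P ?A" by (rule integrable_const_bound[of _ 1]) (auto intro: cmod_alive_mart)
  have iF: "integrable P (\<lambda>\<omega>. ?F \<omega> - 1)" using factor_mean(1) by auto
  have iAF: "integrable P (\<lambda>\<omega>. ?A \<omega> * (?F \<omega> - 1))" by (rule indep_var_integrable[OF ind iA iF])
  have "(LINT \<omega>|P. ?A \<omega> * (?F \<omega> - 1)) = (LINT \<omega>|P. ?A \<omega>) * (LINT \<omega>|P. ?F \<omega> - 1)"
    by (rule indep_var_lebesgue_integral[OF ind iA iF])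
  also have "(LINT \<omega>|P. ?F \<omega> - 1) = 0" using factor_mean[of k] by (simp add: prob_space)
  finally have z: "(LINT \<omega>|P. ?A \<omega> * (?F \<omega> - 1)) = 0" by simp
  have [measurable]: "stopped t r \<delta> k \<in> borel_measurable P" using Suc(1) by auto
  have [measurable]: "stopped t r \<delta> (Suc k) \<in> borel_measurable P"
    unfolding stopped_Suc[abs_def] using iAF by measurable
  let ?B = "\<lambda>\<omega>. (cmod (?A \<omega>))\<^sup>2" and ?X = "\<lambda>\<omega>. exp (2 * t * increment Re \<delta> k \<omega>) - 1"
  have ind2: "indep_var borel ?B borel ?X"
  proof (rule indep_past_increment[OF \<delta>, of _ _ "\<lambda>x y. exp (2 * t * x) - 1"])
    show "?B \<in> borel_measurable (past \<delta> k)"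
      using alive_mart_past[of t r \<delta> k] by measurable
  qed measurable
  have iB: "integrable P ?B"
    by (rule integrable_const_bound[of _ 1]) (auto intro!: power_le_one cmod_alive_mart)
  have iX: "integrable P ?X" "(LINT \<omega>|P. ?X \<omega>) = exp (2 * t\<^sup>2 * \<delta>) - 1"
    using normal_mgf[OF increment_distributed(1)[OF \<delta>] \<delta>, of "2 * t" k] by (auto simp: prob_space power_mult_distrib)
  have iBX: "integrable P (\<lambda>\<omega>. ?B \<omega> * ?X \<omega>)" by (rule indep_var_integrable[OF ind2 iB iX(1)])
  have BX: "(LINT \<omega>|P. ?B \<omega> * ?X \<omega>) \<le> exp (2 * t\<^sup>2 * \<delta>) - 1"
  proof -
    have "(LINT \<omega>|P. ?B \<omega> * ?X \<omega>) = (LINT \<omega>|P. ?B \<omega>) * (exp (2 * t\<^sup>2 * \<delta>) - 1)"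
      using indep_var_lebesgue_integral[OF ind2 iB iX(1)] iX(2) by simp
    also have "\<dots> \<le> 1 * (exp (2 * t\<^sup>2 * \<delta>) - 1)"
    proof (rule mult_right_mono)
      have "(LINT \<omega>|P. ?B \<omega>) \<le> (LINT \<omega>|P. 1)"
        by (rule integral_mono[OF iB]) (auto intro!: power_le_one cmod_alive_mart)
      then show "(LINT \<omega>|P. ?B \<omega>) \<le> 1" by (simp add: prob_space)
      show "0 \<le> exp (2 * t\<^sup>2 * \<delta>) - 1" using \<delta> by simp
    qed
    finally show ?thesis by simp
  qed
  have le: "(cmod (stopped t r \<delta> (Suc k) \<omega>))\<^sup>2 \<le> (cmod (stopped t r \<delta> k \<omega>))\<^sup>2 + ?B \<omega> * ?X \<omega>" for \<omega>
  proof (cases "live \<delta> k \<omega>")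
    case True
    then have "\<forall>j\<le>k. Re (grid_pos \<delta> j \<omega>) \<le> 0" by (simp add: live_def)
    then have 1: "stopped t r \<delta> k \<omega> = ?A \<omega>" using True unfolding stopped_def by (simp add: alive_mart_def stop_idx_live)
    then have 2: "stopped t r \<delta> (Suc k) \<omega> = ?A \<omega> * ?F \<omega>" unfolding stopped_Suc by (simp add: algebra_simps)
    have "(cmod (?F \<omega>))\<^sup>2 = exp (2 * (t * increment Re \<delta> k \<omega> - (t\<^sup>2 - r\<^sup>2) * \<delta> / 2))"
      unfolding cmod_factor exp_double[symmetric] by simp
    also have "\<dots> \<le> exp (2 * t * increment Re \<delta> k \<omega>)" using power2_diff_nonneg[OF tr] \<delta> by simp
    finally have "?B \<omega> * (cmod (?F \<omega>))\<^sup>2 \<le> ?B \<omega> * exp (2 * t * increment Re \<delta> k \<omega>)" by (intro mult_left_mono) auto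
    then show ?thesis unfolding 1 2 by (simp add: norm_mult power_mult_distrib algebra_simps)
  next
    case False
    then show ?thesis by (simp add: stopped_Suc alive_mart_def)
  qed
  have i3: "integrable P (\<lambda>\<omega>. (cmod (stopped t r \<delta> (Suc k) \<omega>))\<^sup>2)"
  proof (rule Bochner_Integration.integrable_bound[OF Bochner_Integration.integrable_add[OF Suc(3) iBX]])
    show "AE \<omega> in P. norm ((cmod (stopped t r \<delta> (Suc k) \<omega>))\<^sup>2) \<le> norm ((cmod (stopped t r \<delta> k \<omega>))\<^sup>2 + ?B \<omega> * ?X \<omega>)"
      using le by (intro AE_I2) (smt (verit) real_norm_def zero_le_power2)
  qed measurable
  {
    case 1 show ?case unfolding stopped_Suc[abs_def] using Suc(1) iAF by auto
  next
    case 2 show ?case unfolding stopped_Suc[abs_def] using Suc(1,2) iAF z by simp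
  next
    case 3 show ?case by (rule i3)
  next
    case 4
    have "(LINT \<omega>|P. (cmod (stopped t r \<delta> (Suc k) \<omega>))\<^sup>2) \<le> (LINT \<omega>|P. (cmod (stopped t r \<delta> k \<omega>))\<^sup>2 + ?B \<omega> * ?X \<omega>)"
      using i3 Suc(3) iBX le by (intro integral_mono) auto
    also have "\<dots> = (LINT \<omega>|P. (cmod (stopped t r \<delta> k \<omega>))\<^sup>2) + (LINT \<omega>|P. ?B \<omega> * ?X \<omega>)"
      using Suc(3) iBX by simp
    also have "\<dots> \<le> 1 + real (Suc k) * (exp (2 * t\<^sup>2 * \<delta>) - 1)"
      using Suc(4) BX by (simp add: algebra_simps)
    finally show ?case .
  }
qed

end

end

section \<open>The place of exit\<close>

context planar_exit begin

abbreviation path :: "'b \<Rightarrow> real \<Rightarrow> complex" where "path \<omega> \<equiv> (\<lambda>s. Z \<omega> + W s \<omega>)"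

definition capped :: "nat \<Rightarrow> 'b \<Rightarrow> real" where "capped S \<omega> = capped_exit (real S) (path \<omega>)"
definition capped_pos :: "nat \<Rightarrow> 'b \<Rightarrow> complex" where "capped_pos S \<omega> = path \<omega> (capped S \<omega>)"
definition stop_step :: "nat \<Rightarrow> nat \<Rightarrow> 'b \<Rightarrow> nat" where
  "stop_step n S \<omega> = stop_idx (\<lambda>j. Re (grid_pos (1 / 2 ^ n) j \<omega>)) (S * 2 ^ n)"

lemma path_continuous: "\<omega> \<in> space P \<Longrightarrow> continuous_on {0..} (path \<omega>)"
  by (intro continuous_on_add continuous_on_const W_continuous)

lemma path_0: "\<omega> \<in> space P \<Longrightarrow> Re (path \<omega> 0) \<le> 0"
  by (simp add: W0 Z_space)

lemma capped_nonneg: "0 \<le> capped S \<omega>"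
  unfolding capped_def by (rule capped_exit_bounds) simp

lemma stop_step_tendsto: "\<omega> \<in> space P \<Longrightarrow> (\<lambda>n. real (stop_step n S \<omega>) * (1 / 2 ^ n)) \<longlonglongrightarrow> capped S \<omega>"
  using grid_stop_tendsto[OF path_continuous, of \<omega> S] by (simp add: stop_step_def capped_def grid_pos_def)

lemma grid_pos_stop_step_tendsto: "\<omega> \<in> space P \<Longrightarrow> (\<lambda>n. grid_pos (1 / 2 ^ n) (stop_step n S \<omega>) \<omega>) \<longlonglongrightarrow> capped_pos S \<omega>"
  unfolding grid_pos_def capped_pos_def
  using continuous_on_tendsto_compose[OF path_continuous stop_step_tendsto[of \<omega> S]] by (simp add: capped_nonneg)

lemma stop_step_measurable[measurable]: "stop_step n S \<in> measurable P (count_space UNIV)"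
proof -
  have [measurable]: "grid_pos (1 / 2 ^ n) j \<in> borel_measurable P" for j by (rule grid_pos_measurable) simp
  show ?thesis unfolding stop_step_def[abs_def] stop_idx_def by measurable
qed

lemma capped_measurable[measurable]: "capped S \<in> borel_measurable P"
  by (rule borel_measurable_LIMSEQ_metric[OF _ stop_step_tendsto]) auto

lemma capped_pos_measurable[measurable]: "capped_pos S \<in> borel_measurable P"
proof (rule borel_measurable_LIMSEQ_metric[OF _ grid_pos_stop_step_tendsto])
  fix n
  show "(\<lambda>\<omega>. grid_pos (1 / 2 ^ n) (stop_step n S \<omega>) \<omega>) \<in> borel_measurable P"
    by (rule measurable_compose_countable[OF grid_pos_measurable stop_step_measurable]) simp
qed

lemma capped_pos_Re: "\<omega> \<in> space P \<Longrightarrow> Re (capped_pos S \<omega>) \<le> 0"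
  unfolding capped_pos_def capped_def by (rule capped_exit_position_le[OF path_continuous path_0]) auto

definition limit_mart :: "real \<Rightarrow> real \<Rightarrow> nat \<Rightarrow> 'b \<Rightarrow> complex" where
  "limit_mart t r S \<omega> = exp (complex_of_real (t * Re (capped_pos S \<omega>)) + \<i> * complex_of_real (r * Im (capped_pos S \<omega>))
     - complex_of_real ((t\<^sup>2 - r\<^sup>2) * capped S \<omega> / 2))"

lemma cmod_limit_mart: "cmod (limit_mart t r S \<omega>) = exp (t * Re (capped_pos S \<omega>) - (t\<^sup>2 - r\<^sup>2) * capped S \<omega> / 2)"
  by (simp add: limit_mart_def)

lemma limit_mart_le_1:
  assumes tr: "0 \<le> r" "r \<le> t" and \<omega>: "\<omega> \<in> space P"
  shows "cmod (limit_mart t r S \<omega>) \<le> 1"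
proof -
  have "0 \<le> (t\<^sup>2 - r\<^sup>2) * capped S \<omega>" by (intro mult_nonneg_nonneg power2_diff_nonneg tr capped_nonneg)
  moreover have "t * Re (capped_pos S \<omega>) \<le> 0" using tr capped_pos_Re[OF \<omega>] by (intro mult_nonneg_nonpos) auto
  ultimately show ?thesis unfolding cmod_limit_mart by simp
qed

text \<open>
  Optional stopping in continuous time, as the limit along the grids of mesh \<open>1 / 2 ^ n\<close>; the
  limit itself is bounded by \<open>1\<close>, since no overshoot remains.
\<close>

lemma limit_mart_mean:
  assumes tr: "0 \<le> r" "r \<le> t"
  shows "(LINT \<omega>|P. limit_mart t r S \<omega>) = (LINT \<omega>|P. exp (complex_of_real (t * Re (Z \<omega>)) + \<i> * complex_of_real (r * Im (Z \<omega>))))"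
proof -
  define C where "C = 1 + real S * (2 * t\<^sup>2 * exp (2 * t\<^sup>2))"
  define X where "X n = stopped t r (1 / 2 ^ n) (S * 2 ^ n)" for n
  have d: "0 < (1 / 2 ^ n :: real)" for n by simp
  have "(\<lambda>n. LINT \<omega>|P. X n \<omega>) \<longlonglongrightarrow> (LINT \<omega>|P. limit_mart t r S \<omega>)"
  proof (rule integral_tendsto_of_L2_bounded)
    show "X n \<in> borel_measurable P" for n
      using stopped_moments(1)[OF tr d] unfolding X_def by (rule borel_measurable_integrable)
    show "limit_mart t r S \<in> borel_measurable P" unfolding limit_mart_def[abs_def] by measurable
    show "AE \<omega> in P. cmod (limit_mart t r S \<omega>) \<le> 1" using limit_mart_le_1[OF tr] by auto
    show "integrable P (\<lambda>\<omega>. (cmod (X n \<omega>))\<^sup>2)" for n unfolding X_def by (rule stopped_moments(3)[OF tr d])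
    show "(LINT \<omega>|P. (cmod (X n \<omega>))\<^sup>2) \<le> C" for n
    proof -
      define x where "x = 2 * t\<^sup>2 * (1 / 2 ^ n)"
      have x: "0 \<le> x" "x \<le> 2 * t\<^sup>2" using mult_left_mono[of "1 / 2 ^ n" 1 "2 * t\<^sup>2"] by (auto simp: x_def divide_le_eq)
      have "exp x * (1 - x) \<le> exp x * exp (- x)" using exp_ge_add_one_self[of "- x"] by (intro mult_left_mono) auto
      then have "exp x - 1 \<le> x * exp x" by (simp add: exp_minus algebra_simps)
      also have "\<dots> \<le> x * exp (2 * t\<^sup>2)" using x by (intro mult_left_mono) auto
      finally have "real (S * 2 ^ n) * (exp x - 1) \<le> real (S * 2 ^ n) * (x * exp (2 * t\<^sup>2))" by (intro mult_left_mono) auto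
      also have "\<dots> = real S * (2 * t\<^sup>2 * exp (2 * t\<^sup>2))" by (simp add: x_def)
      finally show ?thesis using stopped_moments(4)[OF tr d, of n "S * 2 ^ n"] unfolding X_def C_def x_def by linarith
    qed
    show "AE \<omega> in P. (\<lambda>n. X n \<omega>) \<longlonglongrightarrow> limit_mart t r S \<omega>"
    proof (rule AE_I2)
      fix \<omega> assume \<omega>: "\<omega> \<in> space P"
      have X: "X n \<omega> = exp (complex_of_real (t * Re (grid_pos (1 / 2 ^ n) (stop_step n S \<omega>) \<omega>)) + \<i> * complex_of_real (r * Im (grid_pos (1 / 2 ^ n) (stop_step n S \<omega>) \<omega>))
         - complex_of_real ((t\<^sup>2 - r\<^sup>2) * (real (stop_step n S \<omega>) * (1 / 2 ^ n)) / 2))" for n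
        by (simp add: X_def stopped_def exp_mart_def stop_step_def)
      show "(\<lambda>n. X n \<omega>) \<longlonglongrightarrow> limit_mart t r S \<omega>"
        unfolding X limit_mart_def
        by (intro tendsto_exp tendsto_diff tendsto_add tendsto_mult tendsto_of_real tendsto_const tendsto_divide
          tendsto_Re tendsto_Im grid_pos_stop_step_tendsto[OF \<omega>] stop_step_tendsto[OF \<omega>]) simp
    qed
  qed
  moreover have "(LINT \<omega>|P. X n \<omega>) = (LINT \<omega>|P. exp (complex_of_real (t * Re (Z \<omega>)) + \<i> * complex_of_real (r * Im (Z \<omega>))))" for n
    unfolding X_def by (rule stopped_moments(2)[OF tr d])
  ultimately show ?thesis by (simp add: LIMSEQ_const_iff)
qed

definition exits :: "'b \<Rightarrow> bool" where "exits \<omega> \<longleftrightarrow> exit_time Hminus (path \<omega>) < \<infinity>"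
definition exit_instant :: "'b \<Rightarrow> real" where "exit_instant \<omega> = real_of_ereal (exit_time Hminus (path \<omega>))"
text \<open>
  The value \<open>0\<close> is a default for paths that never leave the half-plane.
\<close>

definition height :: "'b \<Rightarrow> real" where "height \<omega> = (if exits \<omega> then Im (path \<omega> (exit_instant \<omega>)) else 0)"

lemma exits_exit_instant: "exits \<omega> \<Longrightarrow> exit_time Hminus (path \<omega>) = ereal (exit_instant \<omega>)"
  unfolding exits_def exit_instant_def using exit_time_nonneg[of Hminus "path \<omega>"]
  by (cases "exit_time Hminus (path \<omega>)") auto

lemma exit_instant_nonneg: "exits \<omega> \<Longrightarrow> 0 \<le> exit_instant \<omega>"
  using exit_time_nonneg[of Hminus "path \<omega>"] exits_exit_instant[of \<omega>] by simp

lemma ereal_capped: "ereal (capped S \<omega>) = min (exit_time Hminus (path \<omega>)) (ereal (real S))"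
  unfolding capped_def by (rule ereal_capped_exit) simp

lemma capped_exits: "exits \<omega> \<Longrightarrow> capped S \<omega> = min (exit_instant \<omega>) (real S)"
  using ereal_capped[of S \<omega>] exits_exit_instant[of \<omega>] by (simp flip: ereal_min)

lemma capped_not_exits: "\<not> exits \<omega> \<Longrightarrow> capped S \<omega> = real S"
  using ereal_capped[of S \<omega>] by (simp add: exits_def)

lemma exits_iff: "exits \<omega> \<longleftrightarrow> (\<exists>S. capped S \<omega> < real S)"
proof
  assume e: "exits \<omega>"
  obtain S where "exit_instant \<omega> < real S" using reals_Archimedean2 by blast
  then have "capped S \<omega> < real S" by (simp add: capped_exits[OF e])
  then show "\<exists>S. capped S \<omega> < real S" ..
qed (use capped_not_exits in force)

lemma exits_measurable[measurable]: "Measurable.pred P exits"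
  unfolding exits_iff[abs_def] by measurable

lemma eventually_capped: "exits \<omega> \<Longrightarrow> \<forall>\<^sub>F S in sequentially. capped S \<omega> = exit_instant \<omega> \<and> exit_instant \<omega> < real S"
proof -
  assume e: "exits \<omega>"
  obtain S0 where S0: "exit_instant \<omega> < real S0" using reals_Archimedean2 by blast
  have "exit_instant \<omega> < real S" if "S0 \<le> S" for S using S0 that by (meson less_le_trans of_nat_le_iff)
  then show ?thesis unfolding eventually_sequentially by (intro exI[of _ S0]) (auto simp: capped_exits[OF e])
qed

lemma exit_point:
  assumes \<omega>: "\<omega> \<in> space P" and e: "exits \<omega>"
  shows "Re (path \<omega> (exit_instant \<omega>)) = 0"
proof -
  obtain S where S: "capped S \<omega> = exit_instant \<omega>" using eventually_happens[OF eventually_capped[OF e]] by auto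
  have "Re (path \<omega> (exit_instant \<omega>)) \<le> 0" using capped_pos_Re[OF \<omega>, of S] by (simp add: capped_pos_def S)
  moreover have "0 \<le> Re (path \<omega> (exit_instant \<omega>))" by (rule exit_position_ge[OF path_continuous[OF \<omega>] exits_exit_instant[OF e]])
  ultimately show ?thesis by simp
qed

lemma height_measurable[measurable]: "height \<in> borel_measurable P"
proof (rule borel_measurable_LIMSEQ_metric)
  show "(\<lambda>\<omega>. if capped S \<omega> < real S then Im (capped_pos S \<omega>) else 0) \<in> borel_measurable P" for S by measurable
  fix \<omega> assume "\<omega> \<in> space P"
  show "(\<lambda>S. if capped S \<omega> < real S then Im (capped_pos S \<omega>) else 0) \<longlonglongrightarrow> height \<omega>"
  proof (cases "exits \<omega>")
    case True
    have "\<forall>\<^sub>F S in sequentially. (if capped S \<omega> < real S then Im (capped_pos S \<omega>) else 0) = height \<omega>"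
      using eventually_capped[OF True] by eventually_elim (simp add: height_def True capped_pos_def)
    then show ?thesis by (rule tendsto_eventually)
  qed (simp add: height_def capped_not_exits)
qed

lemma exit_instant_measurable[measurable]: "(\<lambda>\<omega>. if exits \<omega> then exit_instant \<omega> else 0) \<in> borel_measurable P"
proof (rule borel_measurable_LIMSEQ_metric)
  show "(\<lambda>\<omega>. if exits \<omega> then capped S \<omega> else 0) \<in> borel_measurable P" for S by measurable
  fix \<omega> assume "\<omega> \<in> space P"
  show "(\<lambda>S. if exits \<omega> then capped S \<omega> else 0) \<longlonglongrightarrow> (if exits \<omega> then exit_instant \<omega> else 0)"
    using eventually_capped[of \<omega>] by (auto intro!: tendsto_eventually elim: eventually_mono)
qed

text \<open>
  Letting the cap grow, the paths that never leave drop out because of the factor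
  \<open>exp (- (t\<^sup>2 - r\<^sup>2) * s / 2)\<close>. This needs \<open>r < t\<close>.
\<close>

lemma exit_transform:
  assumes tr: "0 \<le> r" "r < t"
  shows "(LINT \<omega>|P. (if exits \<omega> then exp (\<i> * complex_of_real (r * height \<omega>) - complex_of_real ((t\<^sup>2 - r\<^sup>2) * (if exits \<omega> then exit_instant \<omega> else 0) / 2)) else 0))
    = (LINT \<omega>|P. exp (complex_of_real (t * Re (Z \<omega>)) + \<i> * complex_of_real (r * Im (Z \<omega>))))"
    (is "?L = ?R")
proof -
  have d: "0 < t\<^sup>2 - r\<^sup>2" using tr by (simp add: power_strict_mono)
  have "(\<lambda>S. LINT \<omega>|P. limit_mart t r S \<omega>) \<longlonglongrightarrow> ?L"
  proof (rule integral_dominated_convergence[where w = "\<lambda>_. 1"])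
    show "(\<lambda>\<omega>. if exits \<omega> then exp (\<i> * complex_of_real (r * height \<omega>) - complex_of_real ((t\<^sup>2 - r\<^sup>2) * (if exits \<omega> then exit_instant \<omega> else 0) / 2)) else 0) \<in> borel_measurable P"
      by measurable
    show "limit_mart t r S \<in> borel_measurable P" for S unfolding limit_mart_def[abs_def] by measurable
    show "AE \<omega> in P. norm (limit_mart t r S \<omega>) \<le> 1" for S using limit_mart_le_1 tr by auto
    show "AE \<omega> in P. (\<lambda>S. limit_mart t r S \<omega>) \<longlonglongrightarrow> (if exits \<omega> then exp (\<i> * complex_of_real (r * height \<omega>) - complex_of_real ((t\<^sup>2 - r\<^sup>2) * (if exits \<omega> then exit_instant \<omega> else 0) / 2)) else 0)"
    proof (rule AE_I2)
      fix \<omega> assume \<omega>: "\<omega> \<in> space P"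
      show "(\<lambda>S. limit_mart t r S \<omega>) \<longlonglongrightarrow> (if exits \<omega> then exp (\<i> * complex_of_real (r * height \<omega>) - complex_of_real ((t\<^sup>2 - r\<^sup>2) * (if exits \<omega> then exit_instant \<omega> else 0) / 2)) else 0)"
      proof (cases "exits \<omega>")
        case True
        have "\<forall>\<^sub>F S in sequentially. limit_mart t r S \<omega> = exp (\<i> * complex_of_real (r * height \<omega>) - complex_of_real ((t\<^sup>2 - r\<^sup>2) * exit_instant \<omega> / 2))"
          using eventually_capped[OF True]
        proof eventually_elim
          case (elim S)
          then have "Re (capped_pos S \<omega>) = 0" "Im (capped_pos S \<omega>) = height \<omega>"
            using exit_point[OF \<omega> True] by (auto simp: capped_pos_def height_def True)
          then show ?case using elim by (simp add: limit_mart_def)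
        qed
        then show ?thesis using True by (simp add: tendsto_eventually)
      next
        case False
        have "(\<lambda>S. limit_mart t r S \<omega>) \<longlonglongrightarrow> 0"
        proof (rule Lim_null_comparison)
          show "\<forall>\<^sub>F S in sequentially. norm (limit_mart t r S \<omega>) \<le> exp (- ((t\<^sup>2 - r\<^sup>2) / 2 * real S))"
          proof (rule always_eventually, rule allI)
            fix S
            have "t * Re (capped_pos S \<omega>) \<le> 0" using tr capped_pos_Re[OF \<omega>] by (intro mult_nonneg_nonpos) auto
            then show "norm (limit_mart t r S \<omega>) \<le> exp (- ((t\<^sup>2 - r\<^sup>2) / 2 * real S))"
              unfolding cmod_limit_mart capped_not_exits[OF False] by simp
          qed
          have "filterlim (\<lambda>S. (t\<^sup>2 - r\<^sup>2) / 2 * real S) at_top sequentially"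
            using d by (intro filterlim_tendsto_pos_mult_at_top[OF tendsto_const _ filterlim_real_sequentially]) auto
          then show "(\<lambda>S. exp (- ((t\<^sup>2 - r\<^sup>2) / 2 * real S))) \<longlonglongrightarrow> 0"
            by (intro filterlim_compose[OF exp_at_bot]) (simp add: filterlim_uminus_at_bot)
        qed
        then show ?thesis using False by simp
      qed
    qed
  qed auto
  then show ?thesis using limit_mart_mean[of r t] tr by (simp add: LIMSEQ_const_iff)
qed

text \<open>
  Removal of the decay in time, \<open>t \<rightarrow> r\<close>.
\<close>

lemma exit_char_aux:
  assumes r: "0 \<le> r"
  shows "(LINT \<omega>|P. (if exits \<omega> then exp (\<i> * complex_of_real (r * height \<omega>)) else 0)) = (LINT \<omega>|P. exp (complex_of_real r * Z \<omega>))"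
    (is "?L = ?R")
proof -
  define t where "t n = r + 1 / real (Suc n)" for n
  have t: "r < t n" for n by (simp add: t_def)
  have tl: "t \<longlonglongrightarrow> r" unfolding t_def using tendsto_add[OF tendsto_const LIMSEQ_Suc[OF lim_1_over_n]] by fastforce
  define A where "A n \<omega> = (if exits \<omega> then exp (\<i> * complex_of_real (r * height \<omega>) - complex_of_real (((t n)\<^sup>2 - r\<^sup>2) * (if exits \<omega> then exit_instant \<omega> else 0) / 2)) else 0)" for n \<omega>
  define B where "B n \<omega> = exp (complex_of_real (t n * Re (Z \<omega>)) + \<i> * complex_of_real (r * Im (Z \<omega>)))" for n \<omega>
  have [measurable]: "A n \<in> borel_measurable P" "B n \<in> borel_measurable P" for n
    unfolding A_def[abs_def] B_def[abs_def] by measurable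
  have AL: "(\<lambda>n. LINT \<omega>|P. A n \<omega>) \<longlonglongrightarrow> ?L"
  proof (rule integral_dominated_convergence[where w = "\<lambda>_. 1"])
    show "AE \<omega> in P. norm (A n \<omega>) \<le> 1" for n
    proof (rule AE_I2)
      fix \<omega> show "norm (A n \<omega>) \<le> 1"
      proof (cases "exits \<omega>")
        case True
        have "0 \<le> ((t n)\<^sup>2 - r\<^sup>2) * exit_instant \<omega>"
          using t[of n] r exit_instant_nonneg[OF True] by (intro mult_nonneg_nonneg power2_diff_nonneg) auto
        then show ?thesis using True by (simp add: A_def)
      qed (simp add: A_def)
    qed
    show "AE \<omega> in P. (\<lambda>n. A n \<omega>) \<longlonglongrightarrow> (if exits \<omega> then exp (\<i> * complex_of_real (r * height \<omega>)) else 0)"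
    proof (rule AE_I2)
      fix \<omega>
      have "(\<lambda>n. exp (\<i> * complex_of_real (r * height \<omega>) - complex_of_real (((t n)\<^sup>2 - r\<^sup>2) * exit_instant \<omega> / 2))) \<longlonglongrightarrow>
        exp (\<i> * complex_of_real (r * height \<omega>) - complex_of_real ((r\<^sup>2 - r\<^sup>2) * exit_instant \<omega> / 2))"
        by (intro tendsto_intros tl) auto
      then show "(\<lambda>n. A n \<omega>) \<longlonglongrightarrow> (if exits \<omega> then exp (\<i> * complex_of_real (r * height \<omega>)) else 0)"
        by (simp add: A_def)
    qed
  qed auto
  have BR: "(\<lambda>n. LINT \<omega>|P. B n \<omega>) \<longlonglongrightarrow> ?R"
  proof (rule integral_dominated_convergence[where w = "\<lambda>_. 1"])
    show "AE \<omega> in P. norm (B n \<omega>) \<le> 1" for n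
    proof (rule AE_I2)
      fix \<omega> assume "\<omega> \<in> space P"
      then have "t n * Re (Z \<omega>) \<le> 0" using t[of n] r Z_space by (intro mult_nonneg_nonpos) auto
      then show "norm (B n \<omega>) \<le> 1" by (simp add: B_def)
    qed
    show "AE \<omega> in P. (\<lambda>n. B n \<omega>) \<longlonglongrightarrow> exp (complex_of_real r * Z \<omega>)"
    proof (rule AE_I2)
      fix \<omega>
      have "(\<lambda>n. B n \<omega>) \<longlonglongrightarrow> exp (complex_of_real (r * Re (Z \<omega>)) + \<i> * complex_of_real (r * Im (Z \<omega>)))"
        unfolding B_def by (intro tendsto_intros tl)
      also have "complex_of_real (r * Re (Z \<omega>)) + \<i> * complex_of_real (r * Im (Z \<omega>)) = complex_of_real r * Z \<omega>"
        by (simp add: complex_eq_iff)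
      finally show "(\<lambda>n. B n \<omega>) \<longlonglongrightarrow> exp (complex_of_real r * Z \<omega>)" .
    qed
  qed auto
  have "(LINT \<omega>|P. A n \<omega>) = (LINT \<omega>|P. B n \<omega>)" for n
    unfolding A_def B_def by (rule exit_transform[OF r t])
  then show ?thesis using AL BR LIMSEQ_unique by simp
qed

text \<open>
  The case \<open>r = 0\<close> compares the probability of leaving with \<open>1\<close>.
\<close>

lemma AE_exits: "AE \<omega> in P. exits \<omega>"
proof -
  have "(LINT \<omega>|P. (if exits \<omega> then exp (\<i> * complex_of_real (0 * height \<omega>)) else 0)) = (LINT \<omega>|P. exp (complex_of_real 0 * Z \<omega>))"
    by (rule exit_char_aux) simp
  moreover have "(LINT \<omega>|P. (if exits \<omega> then exp (\<i> * complex_of_real (0 * height \<omega>)) else 0)) = (LINT \<omega>|P. complex_of_real (indicator {\<omega>\<in>space P. exits \<omega>} \<omega>))"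
    by (intro Bochner_Integration.integral_cong) (auto simp: indicator_def)
  moreover have "(LINT \<omega>|P. indicator {\<omega>\<in>space P. exits \<omega>} \<omega>) = prob {\<omega>\<in>space P. exits \<omega>}" by simp
  ultimately have "complex_of_real (prob {\<omega>\<in>space P. exits \<omega>}) = 1"
    by (simp add: prob_space)
  then have "prob {\<omega>\<in>space P. exits \<omega>} = 1" by (simp only: of_real_eq_1_iff)
  then show ?thesis by (subst (asm) prob_Collect_eq_1) auto
qed

text \<open>
  The harmonic measure of the half-plane, averaged over the starting point and described by
  its Fourier transform.
\<close>

lemma exit_char:
  assumes r: "0 \<le> r"
  shows "(LINT \<omega>|P. exp (\<i> * complex_of_real (r * height \<omega>))) = (LINT \<omega>|P. exp (complex_of_real r * Z \<omega>))"
proof -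
  have "(LINT \<omega>|P. exp (\<i> * complex_of_real (r * height \<omega>))) = (LINT \<omega>|P. (if exits \<omega> then exp (\<i> * complex_of_real (r * height \<omega>)) else 0))"
    by (rule integral_cong_AE) (use AE_exits in auto)
  then show ?thesis using exit_char_aux[OF r] by simp
qed

lemma exits_through_iff:
  assumes \<omega>: "\<omega> \<in> space P"
  shows "exits_through Hminus (path \<omega>) (imag_segment x) \<longleftrightarrow> exits \<omega> \<and> \<bar>height \<omega>\<bar> < x"
proof (cases "exits \<omega>")
  case True
  have "path \<omega> (exit_instant \<omega>) = \<i> * complex_of_real (height \<omega>)"
    using exit_point[OF \<omega> True] True by (simp add: complex_eq_iff height_def)
  then have "exits_through Hminus (path \<omega>) (imag_segment x) \<longleftrightarrow> \<i> * complex_of_real (height \<omega>) \<in> imag_segment x"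
    using True by (simp add: exits_through_def exits_def exit_instant_def)
  also have "\<dots> \<longleftrightarrow> \<bar>height \<omega>\<bar> < x" by (auto simp: imag_segment_def)
  finally show ?thesis using True by simp
qed (simp add: exits_through_def exits_def)

lemma exit_probability:
  "prob {\<omega> \<in> space P. exits_through Hminus (path \<omega>) (imag_segment x)} = prob {\<omega> \<in> space P. \<bar>height \<omega>\<bar> < x}"
proof (rule finite_measure_eq_AE)
  have eq: "{\<omega> \<in> space P. exits_through Hminus (path \<omega>) (imag_segment x)} = {\<omega> \<in> space P. exits \<omega> \<and> \<bar>height \<omega>\<bar> < x}"
    using exits_through_iff by auto
  show "{\<omega> \<in> space P. exits_through Hminus (path \<omega>) (imag_segment x)} \<in> events" unfolding eq by measurable
  show "AE \<omega> in P. (\<omega> \<in> {\<omega> \<in> space P. exits_through Hminus (path \<omega>) (imag_segment x)}) = (\<omega> \<in> {\<omega> \<in> space P. \<bar>height \<omega>\<bar> < x})"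
    unfolding eq using AE_exits by eventually_elim auto
qed measurable

end

section \<open>Calculus in the Hilbert space of square-integrable functions\<close>

lemma borel_measurable_cnj[measurable (raw)]:
  "f \<in> borel_measurable M \<Longrightarrow> (\<lambda>x. cnj (f x)) \<in> borel_measurable M"
  by (rule borel_measurable_continuous_on[of cnj]) (auto intro!: continuous_intros)

lemma cL2_measurable: "f \<in> cL2 \<mu> \<Longrightarrow> f \<in> borel_measurable \<mu>"
  and cL2_integrable: "f \<in> cL2 \<mu> \<Longrightarrow> integrable \<mu> (\<lambda>x. (cmod (f x))\<^sup>2)"
  by (auto simp: cL2_def)

lemma cL2_dominated:
  assumes [measurable]: "f \<in> borel_measurable \<mu>" and "integrable \<mu> w" and "AE x in \<mu>. (cmod (f x))\<^sup>2 \<le> w x"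
  shows "f \<in> cL2 \<mu>"
  unfolding cL2_def using assms(2,3)
  by (auto intro!: Bochner_Integration.integrable_bound[OF assms(2)] elim: eventually_mono)

lemma cmod_mult_le: "cmod (a * cnj b) \<le> ((cmod a)\<^sup>2 + (cmod b)\<^sup>2) / 2"
  using sum_squares_bound[of "cmod a" "cmod b"] by (simp add: norm_mult)

lemma cL2_add: 
  assumes f: "f \<in> cL2 \<mu>" and k: "k \<in> cL2 \<mu>" shows "(\<lambda>x. f x + k x) \<in> cL2 \<mu>"
proof (rule cL2_dominated[where w = "\<lambda>x. 2 * (cmod (f x))\<^sup>2 + 2 * (cmod (k x))\<^sup>2"])
  show "(\<lambda>x. f x + k x) \<in> borel_measurable \<mu>" using cL2_measurable[OF f] cL2_measurable[OF k] by measurable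
  show "AE x in \<mu>. (cmod (f x + k x))\<^sup>2 \<le> 2 * (cmod (f x))\<^sup>2 + 2 * (cmod (k x))\<^sup>2"
  proof (rule AE_I2)
    fix x
    have "(cmod (f x + k x))\<^sup>2 \<le> (cmod (f x) + cmod (k x))\<^sup>2" by (intro power_mono norm_triangle_ineq) auto
    then show "(cmod (f x + k x))\<^sup>2 \<le> 2 * (cmod (f x))\<^sup>2 + 2 * (cmod (k x))\<^sup>2"
      using sum_squares_bound[of "cmod (f x)" "cmod (k x)"] by (simp add: power2_sum)
  qed
qed (use cL2_integrable[OF f] cL2_integrable[OF k] in auto)

lemma cL2_scale: assumes f: "f \<in> cL2 \<mu>" shows "(\<lambda>x. c * f x) \<in> cL2 \<mu>"
  using cL2_measurable[OF f] cL2_integrable[OF f] unfolding cL2_def by (auto simp: norm_mult power_mult_distrib)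

lemma cL2_diff: "f \<in> cL2 \<mu> \<Longrightarrow> k \<in> cL2 \<mu> \<Longrightarrow> (\<lambda>x. f x - k x) \<in> cL2 \<mu>"
  using cL2_add[of f \<mu> "\<lambda>x. - 1 * k x"] cL2_scale[of k \<mu> "- 1"] by simp

lemma cL2_zero: "(\<lambda>x. 0) \<in> cL2 \<mu>"
  by (simp add: cL2_def)

lemma cL2_sum: "(\<And>i. i \<in> I \<Longrightarrow> f i \<in> cL2 \<mu>) \<Longrightarrow> (\<lambda>x. \<Sum>i\<in>I. c i * f i x) \<in> cL2 \<mu>"
  by (induction I rule: infinite_finite_induct) (auto intro: cL2_zero intro!: cL2_add cL2_scale)

lemma cL2_inner_integrable: 
  assumes f: "f \<in> cL2 \<mu>" and k: "k \<in> cL2 \<mu>" shows "integrable \<mu> (\<lambda>x. f x * cnj (k x))"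
proof (rule Bochner_Integration.integrable_bound[where f = "\<lambda>x. ((cmod (f x))\<^sup>2 + (cmod (k x))\<^sup>2) / 2"])
  show "(\<lambda>x. f x * cnj (k x)) \<in> borel_measurable \<mu>" using cL2_measurable[OF f] cL2_measurable[OF k] by measurable
  show "AE x in \<mu>. norm (f x * cnj (k x)) \<le> norm (((cmod (f x))\<^sup>2 + (cmod (k x))\<^sup>2) / 2)"
    by (intro AE_I2) (use cmod_mult_le in auto)
qed (use cL2_integrable[OF f] cL2_integrable[OF k] in auto)

lemma cL2_inner_add_left: "f \<in> cL2 \<mu> \<Longrightarrow> k \<in> cL2 \<mu> \<Longrightarrow> u \<in> cL2 \<mu> \<Longrightarrow>
    cL2_inner \<mu> (\<lambda>x. f x + k x) u = cL2_inner \<mu> f u + cL2_inner \<mu> k u"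
  unfolding cL2_inner_def distrib_right by (intro Bochner_Integration.integral_add cL2_inner_integrable)

lemma cL2_inner_diff_left: "f \<in> cL2 \<mu> \<Longrightarrow> k \<in> cL2 \<mu> \<Longrightarrow> u \<in> cL2 \<mu> \<Longrightarrow>
    cL2_inner \<mu> (\<lambda>x. f x - k x) u = cL2_inner \<mu> f u - cL2_inner \<mu> k u"
  unfolding cL2_inner_def left_diff_distrib by (intro Bochner_Integration.integral_diff cL2_inner_integrable)

lemma cL2_inner_scale_left: "cL2_inner \<mu> (\<lambda>x. c * f x) u = c * cL2_inner \<mu> f u"
  unfolding cL2_inner_def by (simp add: mult.assoc)

lemma cL2_inner_zero_left: "cL2_inner \<mu> (\<lambda>x. 0) u = 0"
  unfolding cL2_inner_def by simp

lemma cL2_inner_sum_left: "(\<And>i. i \<in> I \<Longrightarrow> f i \<in> cL2 \<mu>) \<Longrightarrow> u \<in> cL2 \<mu> \<Longrightarrow>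
    cL2_inner \<mu> (\<lambda>x. \<Sum>i\<in>I. c i * f i x) u = (\<Sum>i\<in>I. c i * cL2_inner \<mu> (f i) u)"
  by (induction I rule: infinite_finite_induct)
    (auto simp: cL2_inner_zero_left cL2_inner_scale_left cL2_inner_add_left cL2_scale cL2_sum)

lemma cL2_inner_commute: "cL2_inner \<mu> f k = cnj (cL2_inner \<mu> k f)"
  unfolding cL2_inner_def by (simp add: mult.commute flip: Bochner_Integration.integral_cnj)

lemma cL2_inner_scale_right: "cL2_inner \<mu> f (\<lambda>x. c * u x) = cnj c * cL2_inner \<mu> f u"
  by (subst (1 2) cL2_inner_commute) (simp add: cL2_inner_scale_left)

lemma cL2_inner_add_right: "f \<in> cL2 \<mu> \<Longrightarrow> k \<in> cL2 \<mu> \<Longrightarrow> u \<in> cL2 \<mu> \<Longrightarrow>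
    cL2_inner \<mu> u (\<lambda>x. f x + k x) = cL2_inner \<mu> u f + cL2_inner \<mu> u k"
  using cL2_inner_add_left[of f \<mu> k u] cL2_inner_commute[of \<mu> u] by simp

lemma cL2_inner_diff_right: "f \<in> cL2 \<mu> \<Longrightarrow> k \<in> cL2 \<mu> \<Longrightarrow> u \<in> cL2 \<mu> \<Longrightarrow>
    cL2_inner \<mu> u (\<lambda>x. f x - k x) = cL2_inner \<mu> u f - cL2_inner \<mu> u k"
  using cL2_inner_diff_left[of f \<mu> k u] cL2_inner_commute[of \<mu> u] by simp

lemma cL2_inner_sum_right: "(\<And>i. i \<in> I \<Longrightarrow> f i \<in> cL2 \<mu>) \<Longrightarrow> u \<in> cL2 \<mu> \<Longrightarrow>
    cL2_inner \<mu> u (\<lambda>x. \<Sum>i\<in>I. c i * f i x) = (\<Sum>i\<in>I. cnj (c i) * cL2_inner \<mu> u (f i))"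
  using cL2_inner_sum_left[of I f \<mu> u c] cL2_inner_commute[of \<mu> u] by simp

lemma cL2_norm_nonneg: "0 \<le> cL2_norm \<mu> f"
  by (simp add: cL2_norm_def)

lemma cL2_norm_power2: "(cL2_norm \<mu> f)\<^sup>2 = (LINT x|\<mu>. (cmod (f x))\<^sup>2)"
  by (simp add: cL2_norm_def)

lemma cL2_inner_self: "cL2_inner \<mu> f f = complex_of_real ((cL2_norm \<mu> f)\<^sup>2)"
  unfolding cL2_norm_power2 cL2_inner_def by (simp add: complex_norm_square[symmetric] flip: of_real_power)

lemma cL2_norm_scale: "cL2_norm \<mu> (\<lambda>x. c * f x) = cmod c * cL2_norm \<mu> f"
  by (simp add: cL2_norm_def norm_mult power_mult_distrib real_sqrt_mult)

lemma cL2_inner_cong_AE: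
  assumes "f \<in> borel_measurable \<mu>" "f' \<in> borel_measurable \<mu>" "k \<in> borel_measurable \<mu>" "k' \<in> borel_measurable \<mu>"
    and "AE x in \<mu>. f x = f' x" "AE x in \<mu>. k x = k' x"
  shows "cL2_inner \<mu> f k = cL2_inner \<mu> f' k'"
  unfolding cL2_inner_def
proof (rule integral_cong_AE)
  show "AE x in \<mu>. f x * cnj (k x) = f' x * cnj (k' x)" using assms(5,6) by eventually_elim simp
qed (use assms(1-4) in measurable)

lemma cL2_norm_cong_AE:
  assumes "f \<in> borel_measurable \<mu>" "f' \<in> borel_measurable \<mu>" "AE x in \<mu>. f x = f' x"
  shows "cL2_norm \<mu> f = cL2_norm \<mu> f'"
proof -
  have "(LINT x|\<mu>. (cmod (f x))\<^sup>2) = (LINT x|\<mu>. (cmod (f' x))\<^sup>2)"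
  proof (rule integral_cong_AE)
    show "AE x in \<mu>. (cmod (f x))\<^sup>2 = (cmod (f' x))\<^sup>2" using assms(3) by eventually_elim simp
  qed (use assms(1,2) in measurable)
  then show ?thesis by (simp add: cL2_norm_def)
qed

lemma cL2_norm_eq_0_iff: "f \<in> cL2 \<mu> \<Longrightarrow> cL2_norm \<mu> f = 0 \<longleftrightarrow> (AE x in \<mu>. f x = 0)"
  using integral_nonneg_eq_0_iff_AE[OF cL2_integrable[of f \<mu>]] by (simp add: cL2_norm_def)

lemma cL2_inner_bound:
  assumes f: "f \<in> cL2 \<mu>" and k: "k \<in> cL2 \<mu>"
  shows "cmod (cL2_inner \<mu> f k) \<le> cL2_norm \<mu> f * cL2_norm \<mu> k"
proof (cases "cL2_norm \<mu> f = 0 \<or> cL2_norm \<mu> k = 0")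
  case True
  have "AE x in \<mu>. f x * cnj (k x) = 0"
    using True cL2_norm_eq_0_iff[OF f] cL2_norm_eq_0_iff[OF k] by (auto elim: eventually_mono)
  then have "cL2_inner \<mu> f k = 0" unfolding cL2_inner_def by (rule integral_eq_zero_AE)
  then show ?thesis by (simp add: cL2_norm_nonneg)
next
  case False
  define a where "a = cL2_norm \<mu> f"
  define b where "b = cL2_norm \<mu> k"
  have ab: "a > 0" "b > 0" using False cL2_norm_nonneg[of \<mu> f] cL2_norm_nonneg[of \<mu> k] by (auto simp: a_def b_def)
  have pt: "cmod (u * cnj v) \<le> (b / a * (cmod u)\<^sup>2 + a / b * (cmod v)\<^sup>2) / 2" for u v
  proof -
    have "0 \<le> (b * cmod u - a * cmod v)\<^sup>2 / (2 * a * b)" using ab by simp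
    also have "\<dots> = (b / a * (cmod u)\<^sup>2 + a / b * (cmod v)\<^sup>2) / 2 - cmod u * cmod v"
      using ab by (simp add: power2_diff field_simps power2_eq_square)
    finally show ?thesis by (simp add: norm_mult)
  qed
  have "cmod (cL2_inner \<mu> f k) \<le> (LINT x|\<mu>. cmod (f x * cnj (k x)))"
    unfolding cL2_inner_def by (rule integral_norm_bound)
  also have "\<dots> \<le> (LINT x|\<mu>. (b / a * (cmod (f x))\<^sup>2 + a / b * (cmod (k x))\<^sup>2) / 2)"
    using cL2_inner_integrable[OF f k] cL2_integrable[OF f] cL2_integrable[OF k]
    by (intro integral_mono pt) auto
  also have "\<dots> = (b / a * a\<^sup>2 + a / b * b\<^sup>2) / 2"
    using cL2_integrable[OF f] cL2_integrable[OF k] unfolding a_def b_def cL2_norm_power2 by simp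
  also have "\<dots> = a * b" using ab by (simp add: field_simps power2_eq_square)
  finally show ?thesis by (simp add: a_def b_def)
qed

lemma cL2_norm_add_power2:
  assumes f: "f \<in> cL2 \<mu>" and k: "k \<in> cL2 \<mu>"
  shows "(cL2_norm \<mu> (\<lambda>x. f x + k x))\<^sup>2 = (cL2_norm \<mu> f)\<^sup>2 + (cL2_norm \<mu> k)\<^sup>2 + 2 * Re (cL2_inner \<mu> f k)"
proof -
  have "complex_of_real ((cL2_norm \<mu> (\<lambda>x. f x + k x))\<^sup>2) = cL2_inner \<mu> f f + cL2_inner \<mu> f k + (cL2_inner \<mu> k f + cL2_inner \<mu> k k)"
    unfolding cL2_inner_self[symmetric] using f k by (simp add: cL2_inner_add_left cL2_inner_add_right cL2_add)
  also have "\<dots> = complex_of_real ((cL2_norm \<mu> f)\<^sup>2 + (cL2_norm \<mu> k)\<^sup>2 + 2 * Re (cL2_inner \<mu> f k))"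
    unfolding cL2_inner_self cL2_inner_commute[of \<mu> k f] by (simp add: complex_eq_iff)
  finally show ?thesis by (simp only: of_real_eq_iff)
qed

lemma cL2_norm_triangle:
  assumes f: "f \<in> cL2 \<mu>" and k: "k \<in> cL2 \<mu>"
  shows "cL2_norm \<mu> (\<lambda>x. f x + k x) \<le> cL2_norm \<mu> f + cL2_norm \<mu> k"
proof (rule power2_le_imp_le)
  have "Re (cL2_inner \<mu> f k) \<le> cL2_norm \<mu> f * cL2_norm \<mu> k"
    using cL2_inner_bound[OF f k] complex_Re_le_cmod order_trans by blast
  then show "(cL2_norm \<mu> (\<lambda>x. f x + k x))\<^sup>2 \<le> (cL2_norm \<mu> f + cL2_norm \<mu> k)\<^sup>2"
    by (simp add: cL2_norm_add_power2[OF f k] power2_sum)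
qed (simp add: cL2_norm_nonneg)

lemma cL2_norm_triangle_diff:
  assumes f: "f \<in> cL2 \<mu>" and k: "k \<in> cL2 \<mu>" and u: "u \<in> cL2 \<mu>"
  shows "cL2_norm \<mu> (\<lambda>x. f x - u x) \<le> cL2_norm \<mu> (\<lambda>x. f x - k x) + cL2_norm \<mu> (\<lambda>x. k x - u x)"
  using cL2_norm_triangle[OF cL2_diff[OF f k] cL2_diff[OF k u]] by simp

lemma cL2_norm_sum_le:
  assumes "finite I" "\<And>i. i \<in> I \<Longrightarrow> f i \<in> cL2 \<mu>"
  shows "cL2_norm \<mu> (\<lambda>x. \<Sum>i\<in>I. c i * f i x) \<le> (\<Sum>i\<in>I. cmod (c i) * cL2_norm \<mu> (f i))"
  using assms
proof (induction I rule: finite_induct)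
  case (insert i I)
  have "cL2_norm \<mu> (\<lambda>x. \<Sum>i\<in>insert i I. c i * f i x) = cL2_norm \<mu> (\<lambda>x. c i * f i x + (\<Sum>i\<in>I. c i * f i x))"
    using insert.hyps by simp
  also have "\<dots> \<le> cL2_norm \<mu> (\<lambda>x. c i * f i x) + cL2_norm \<mu> (\<lambda>x. \<Sum>i\<in>I. c i * f i x)"
    using insert.prems by (intro cL2_norm_triangle cL2_scale cL2_sum) auto
  finally show ?case using insert by (simp add: cL2_norm_scale)
qed (simp add: cL2_norm_def)

lemma AE_eq_of_inner_eq:
  assumes f: "f \<in> cL2 \<mu>" and k: "k \<in> cL2 \<mu>"
    and eq: "\<And>u. u \<in> cL2 \<mu> \<Longrightarrow> cL2_inner \<mu> f u = cL2_inner \<mu> k u"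
  shows "AE x in \<mu>. f x = k x"
proof -
  have d: "(\<lambda>x. f x - k x) \<in> cL2 \<mu>" by (rule cL2_diff[OF f k])
  have "cL2_inner \<mu> (\<lambda>x. f x - k x) (\<lambda>x. f x - k x) = 0"
    using eq[OF d] by (simp add: cL2_inner_diff_left[OF f k d])
  then have "cL2_norm \<mu> (\<lambda>x. f x - k x) = 0" unfolding cL2_inner_self by simp
  then show ?thesis using cL2_norm_eq_0_iff[OF d] by simp
qed

lemma sum_lessThan_4: "(\<Sum>j<4. F j) = F 0 + F 1 + F 2 + F (3::nat)" for F :: "nat \<Rightarrow> 'a::comm_monoid_add"
  by (simp add: eval_nat_numeral add.assoc)

lemma i_powers: "\<i> ^ 0 = 1" "\<i> ^ 1 = \<i>" "\<i> ^ 2 = - 1" "\<i> ^ 3 = - \<i>"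
  by (simp_all add: power3_eq_cube)

text \<open>
  The second identity is the parallelogram law; it bounds the total mass of the four measures
  that make up a polarized integral.
\<close>

lemma cL2_polarization:
  assumes f: "f \<in> cL2 \<mu>" and u: "u \<in> cL2 \<mu>"
  shows "(1 / 4) * (\<Sum>j<4. \<i> ^ j * complex_of_real ((cL2_norm \<mu> (\<lambda>x. f x + \<i> ^ j * u x))\<^sup>2)) = cL2_inner \<mu> f u"
    and "(\<Sum>j<4. (cL2_norm \<mu> (\<lambda>x. f x + \<i> ^ j * u x))\<^sup>2) = 4 * ((cL2_norm \<mu> f)\<^sup>2 + (cL2_norm \<mu> u)\<^sup>2)"
proof -
  have *: "(cL2_norm \<mu> (\<lambda>x. f x + c * u x))\<^sup>2 = (cL2_norm \<mu> f)\<^sup>2 + (cmod c * cL2_norm \<mu> u)\<^sup>2 + 2 * Re (cnj c * cL2_inner \<mu> f u)" for c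
    by (simp add: cL2_norm_add_power2[OF f cL2_scale[OF u]] cL2_norm_scale cL2_inner_scale_right)
  show "(1 / 4) * (\<Sum>j<4. \<i> ^ j * complex_of_real ((cL2_norm \<mu> (\<lambda>x. f x + \<i> ^ j * u x))\<^sup>2)) = cL2_inner \<mu> f u"
    unfolding sum_lessThan_4 * by (simp add: i_powers complex_eq_iff power3_eq_cube)
  show "(\<Sum>j<4. (cL2_norm \<mu> (\<lambda>x. f x + \<i> ^ j * u x))\<^sup>2) = 4 * ((cL2_norm \<mu> f)\<^sup>2 + (cL2_norm \<mu> u)\<^sup>2)"
    unfolding sum_lessThan_4 * by (simp add: i_powers norm_power power3_eq_cube)
qed

text \<open>
  By induction over nonnegative measurable functions. The factorizing functions in the limit
  step may diverge off the range of \<open>Y\<close>, where the default value of \<open>lim\<close> is harmless.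
\<close>

lemma doob_dynkin:
  fixes X :: "'b \<Rightarrow> real"
  assumes Y: "Y \<in> \<Omega> \<rightarrow> space N" and X: "X \<in> borel_measurable (vimage_algebra \<Omega> Y N)"
  obtains u where "u \<in> borel_measurable N" "\<And>\<omega>. \<omega> \<in> \<Omega> \<Longrightarrow> X \<omega> = u (Y \<omega>)"
proof -
  let ?P = "\<lambda>X. \<exists>u\<in>borel_measurable N. \<forall>\<omega>\<in>\<Omega>. X \<omega> = (u (Y \<omega>) :: real)"
  have pos: "?P X" if "X \<in> borel_measurable (vimage_algebra \<Omega> Y N)" "\<And>x. 0 \<le> X x" for X
    using that
  proof (induction X rule: borel_measurable_induct_real)
    case (set A)
    then obtain B where B: "B \<in> sets N" "A = Y -` B \<inter> \<Omega>" unfolding sets_vimage_algebra2[OF Y] by blast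
    then show ?case by (intro bexI[of _ "indicator B"]) (auto simp: indicator_def)
  next
    case (mult X c)
    then obtain u where u: "u \<in> borel_measurable N" "\<forall>\<omega>\<in>\<Omega>. X \<omega> = u (Y \<omega>)" by blast
    then show ?case by (intro bexI[of _ "\<lambda>x. c * u x"]) auto
  next
    case (add X1 X2)
    then obtain u v where "u \<in> borel_measurable N" "\<forall>\<omega>\<in>\<Omega>. X1 \<omega> = u (Y \<omega>)" "v \<in> borel_measurable N" "\<forall>\<omega>\<in>\<Omega>. X2 \<omega> = v (Y \<omega>)" by blast
    then show ?case by (intro bexI[of _ "\<lambda>x. v x + u x"]) auto
  next
    case (seq U)
    then obtain u where u: "\<And>i. u i \<in> borel_measurable N" "\<And>i \<omega>. \<omega> \<in> \<Omega> \<Longrightarrow> U i \<omega> = u i (Y \<omega>)" by metis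
    show ?case
    proof (intro bexI[of _ "\<lambda>x. lim (\<lambda>i. u i x)"] ballI)
      fix \<omega> assume \<omega>: "\<omega> \<in> \<Omega>"
      then have "(\<lambda>i. u i (Y \<omega>)) \<longlonglongrightarrow> X \<omega>" using seq(4)[of \<omega>] u(2) by simp
      then show "X \<omega> = lim (\<lambda>i. u i (Y \<omega>))" by (simp add: limI)
    qed (use u(1) in measurable)
  qed
  have "?P (\<lambda>\<omega>. max 0 (X \<omega>))" "?P (\<lambda>\<omega>. max 0 (- X \<omega>))" using X by (auto intro!: pos)
  then obtain u v where u: "u \<in> borel_measurable N" "\<forall>\<omega>\<in>\<Omega>. max 0 (X \<omega>) = u (Y \<omega>)"
    and v: "v \<in> borel_measurable N" "\<forall>\<omega>\<in>\<Omega>. max 0 (- X \<omega>) = v (Y \<omega>)" by blast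
  show ?thesis
  proof (rule that)
    show "(\<lambda>x. u x - v x) \<in> borel_measurable N" using u v by measurable
    fix \<omega> assume "\<omega> \<in> \<Omega>"
    then show "X \<omega> = u (Y \<omega>) - v (Y \<omega>)" using u v by (simp flip: u(2)[rule_format] v(2)[rule_format])
  qed
qed

lemma AE_eq_0_of_indicator_integrals:
  fixes D :: "'a \<Rightarrow> complex"
  assumes i: "integrable N D" and z: "\<And>B. B \<in> sets N \<Longrightarrow> (LINT x|N. indicator B x *\<^sub>R D x) = 0"
  shows "AE x in N. D x = 0"
proof -
  have [measurable]: "D \<in> borel_measurable N" using i by auto
  have real: "AE x in N. R x = 0" if R: "integrable N R" and zR: "\<And>B. B \<in> sets N \<Longrightarrow> (LINT x|N. indicator B x * R x) = 0" for R :: "'a \<Rightarrow> real"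
  proof -
    have [measurable]: "R \<in> borel_measurable N" using R by auto
    have "AE x in N. indicator {x\<in>space N. R x > 0} x * R x = 0"
    proof (subst integral_nonneg_eq_0_iff_AE[symmetric])
      show "integrable N (\<lambda>x. indicator {x\<in>space N. R x > 0} x * R x)"
        using integrable_mult_indicator[of "{x\<in>space N. R x > 0}" N R] R by simp
      show "AE x in N. 0 \<le> indicator {x\<in>space N. R x > 0} x * R x" by (auto simp: indicator_def)
      show "(LINT x|N. indicator {x\<in>space N. R x > 0} x * R x) = 0" using zR[of "{x\<in>space N. R x > 0}"] by simp
    qed
    moreover have "AE x in N. indicator {x\<in>space N. R x < 0} x * (- R x) = 0"
    proof (subst integral_nonneg_eq_0_iff_AE[symmetric])
      show "integrable N (\<lambda>x. indicator {x\<in>space N. R x < 0} x * (- R x))"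
        using integrable_mult_indicator[of "{x\<in>space N. R x < 0}" N R] R by simp
      show "AE x in N. 0 \<le> indicator {x\<in>space N. R x < 0} x * (- R x)" by (auto simp: indicator_def)
      show "(LINT x|N. indicator {x\<in>space N. R x < 0} x * (- R x)) = 0" using zR[of "{x\<in>space N. R x < 0}"] by simp
    qed
    ultimately show ?thesis using AE_space by eventually_elim (auto simp: indicator_def split: if_splits)
  qed
  have iB: "integrable N (\<lambda>x. indicator B x *\<^sub>R D x)" if "B \<in> sets N" for B using that i by (rule integrable_mult_indicator)
  have "AE x in N. Re (D x) = 0"
  proof (rule real)
    show "(LINT x|N. indicator B x * Re (D x)) = 0" if "B \<in> sets N" for B
      using z[OF that] integral_Re[OF iB[OF that]] by simp
  qed (use i in auto)
  moreover have "AE x in N. Im (D x) = 0"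
  proof (rule real)
    show "(LINT x|N. indicator B x * Im (D x)) = 0" if "B \<in> sets N" for B
      using z[OF that] integral_Im[OF iB[OF that]] by simp
  qed (use i in auto)
  ultimately show ?thesis by eventually_elim (simp add: complex_eq_iff)
qed

section \<open>The transition semigroup\<close>

context stationary_markov_process begin

abbreviation T where "T \<equiv> transition_op M \<pi> \<xi>"
abbreviation state_algebra where "state_algebra s \<equiv> vimage_algebra (space M) (\<xi> s) \<pi>"

lemma adapted:
  assumes "0 \<le> s" "s \<le> t" shows "\<xi> s \<in> measurable (F t) \<pi>"
proof -
  have "(\<lambda>\<omega>. (s, \<omega>)) \<in> measurable (F t) (restrict_space borel {0..t} \<Otimes>\<^sub>M F t)"
    using assms by (intro measurable_Pair) (auto simp: space_restrict_space)
  from measurable_compose[OF this progressive[of t]] assms show ?thesis by simp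
qed

lemma rv[measurable]: assumes "t \<ge> 0" shows "\<xi> t \<in> measurable M \<pi>"
  using measurable_from_subalg[OF sub[OF assms] adapted[OF assms order_refl]] .

lemma prob_\<pi>: "prob_space \<pi>"
  using prob_space_distr[OF rv[of 0]] law[of 0] by simp

lemma comp_integrable_iff:
  fixes f :: "'s \<Rightarrow> 'e::{banach, second_countable_topology}"
  assumes "t \<ge> 0" "f \<in> borel_measurable \<pi>"
  shows "integrable M (\<lambda>\<omega>. f (\<xi> t \<omega>)) \<longleftrightarrow> integrable \<pi> f"
  using integrable_distr_eq[OF rv[OF assms(1)] assms(2)] law[OF assms(1)] by simp

lemma comp_integral:
  fixes f :: "'s \<Rightarrow> 'e::{banach, second_countable_topology}"
  assumes "t \<ge> 0" "f \<in> borel_measurable \<pi>"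
  shows "(LINT \<omega>|M. f (\<xi> t \<omega>)) = (LINT x|\<pi>. f x)"
  using integral_distr[OF rv[OF assms(1)] assms(2)] law[OF assms(1)] by simp

lemma comp_measurable[measurable (raw)]: "t \<ge> 0 \<Longrightarrow> f \<in> borel_measurable \<pi> \<Longrightarrow> (\<lambda>\<omega>. f (\<xi> t \<omega>)) \<in> borel_measurable M"
  by (rule measurable_compose[OF rv])

lemma comp_cL2: "t \<ge> 0 \<Longrightarrow> f \<in> cL2 \<pi> \<Longrightarrow> (\<lambda>\<omega>. f (\<xi> t \<omega>)) \<in> cL2 M"
  unfolding cL2_def by (auto simp: comp_integrable_iff[of t "\<lambda>x. (cmod (f x))\<^sup>2"])

lemma comp_inner: "t \<ge> 0 \<Longrightarrow> f \<in> cL2 \<pi> \<Longrightarrow> k \<in> cL2 \<pi> \<Longrightarrow> cL2_inner M (\<lambda>\<omega>. f (\<xi> t \<omega>)) (\<lambda>\<omega>. k (\<xi> t \<omega>)) = cL2_inner \<pi> f k"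
  unfolding cL2_inner_def using cL2_measurable[of f \<pi>] cL2_measurable[of k \<pi>]
  by (intro comp_integral[of t "\<lambda>x. f x * cnj (k x)"]) auto

lemma comp_norm: "t \<ge> 0 \<Longrightarrow> f \<in> cL2 \<pi> \<Longrightarrow> cL2_norm M (\<lambda>\<omega>. f (\<xi> t \<omega>)) = cL2_norm \<pi> f"
  unfolding cL2_norm_def using comp_integral[of t "\<lambda>x. (cmod (f x))\<^sup>2"] cL2_measurable[of f \<pi>] by simp

lemma state_algebra_subalgebra: "s \<ge> 0 \<Longrightarrow> subalgebra M (state_algebra s)"
  unfolding subalgebra_def using sets_image_in_sets[OF refl rv[of s]] by simp

lemma state_algebra_sigma_finite: "s \<ge> 0 \<Longrightarrow> sigma_finite_subalgebra M (state_algebra s)"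
  using state_algebra_subalgebra finite_measure_axioms
  by (intro finite_measure_subalgebra_is_sigma_finite finite_measure_subalgebra.intro finite_measure_subalgebra_axioms.intro)

lemma F_sigma_finite: "s \<ge> 0 \<Longrightarrow> sigma_finite_subalgebra M (F s)"
  using sub finite_measure_axioms
  by (intro finite_measure_subalgebra_is_sigma_finite finite_measure_subalgebra.intro finite_measure_subalgebra_axioms.intro)

lemma state_algebra_space: "s \<ge> 0 \<Longrightarrow> \<xi> s \<in> space M \<rightarrow> space \<pi>"
  using measurable_space[OF rv] by auto

lemma state_algebra_comp: "s \<ge> 0 \<Longrightarrow> f \<in> borel_measurable \<pi> \<Longrightarrow> (\<lambda>\<omega>. f (\<xi> s \<omega>)) \<in> borel_measurable (state_algebra s)"
  by (rule measurable_compose[OF measurable_vimage_algebra1[OF state_algebra_space]])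

lemma real_L2_mult:
  fixes X Y :: "'z \<Rightarrow> real"
  assumes "X \<in> borel_measurable N" "Y \<in> borel_measurable N" "integrable N (\<lambda>\<omega>. (X \<omega>)\<^sup>2)" "integrable N (\<lambda>\<omega>. (Y \<omega>)\<^sup>2)"
  shows "integrable N (\<lambda>\<omega>. X \<omega> * Y \<omega>)"
proof (rule Bochner_Integration.integrable_bound[OF Bochner_Integration.integrable_add[OF assms(3,4)]])
  show "AE \<omega> in N. norm (X \<omega> * Y \<omega>) \<le> norm ((X \<omega>)\<^sup>2 + (Y \<omega>)\<^sup>2)"
  proof (rule AE_I2)
    fix \<omega>
    have "2 * \<bar>X \<omega>\<bar> * \<bar>Y \<omega>\<bar> \<le> \<bar>X \<omega>\<bar>\<^sup>2 + \<bar>Y \<omega>\<bar>\<^sup>2" by (rule sum_squares_bound)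
    moreover have "0 \<le> \<bar>X \<omega>\<bar> * \<bar>Y \<omega>\<bar>" by simp
    ultimately have "\<bar>X \<omega>\<bar> * \<bar>Y \<omega>\<bar> \<le> (X \<omega>)\<^sup>2 + (Y \<omega>)\<^sup>2" unfolding power2_abs mult.assoc by linarith
    then show "norm (X \<omega> * Y \<omega>) \<le> norm ((X \<omega>)\<^sup>2 + (Y \<omega>)\<^sup>2)" unfolding real_norm_def abs_mult by simp
  qed
qed (use assms in measurable)

lemma square_integrable_imp_integrable: 
  fixes X :: "'a \<Rightarrow> real"
  assumes "X \<in> borel_measurable M" "integrable M (\<lambda>\<omega>. (X \<omega>)\<^sup>2)" shows "integrable M X"
  using real_L2_mult[of X M "\<lambda>_. 1"] assms by simp

lemma cond_exp_L2:
  fixes X :: "'a \<Rightarrow> real"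
  assumes s: "s \<ge> 0" and X: "X \<in> borel_measurable M" "integrable M (\<lambda>\<omega>. (X \<omega>)\<^sup>2)"
  shows "integrable M (\<lambda>\<omega>. (real_cond_exp M (state_algebra s) X \<omega>)\<^sup>2)"
proof -
  interpret S: sigma_finite_subalgebra M "state_algebra s" by (rule state_algebra_sigma_finite[OF s])
  show ?thesis
    by (rule S.integrable_convex_cond_exp[where q = "\<lambda>x. x\<^sup>2" and X = X and I = UNIV])
      (use square_integrable_imp_integrable[OF X] X convex_power2 in \<open>auto\<close>)
qed

definition cexp :: "real \<Rightarrow> ('a \<Rightarrow> complex) \<Rightarrow> 'a \<Rightarrow> complex" where
  "cexp s X \<omega> = Complex (real_cond_exp M (state_algebra s) (\<lambda>\<omega>. Re (X \<omega>)) \<omega>) (real_cond_exp M (state_algebra s) (\<lambda>\<omega>. Im (X \<omega>)) \<omega>)"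

text \<open>
  A function \<open>u\<close> as in the definition of the transition operator exists by Doob-Dynkin
  factorization of the conditional expectations of the real and the imaginary part.
\<close>

lemma transition_op_spec:
  assumes t: "t \<ge> 0"
  shows "T t f \<in> borel_measurable \<pi>" and "AE \<omega> in M. T t f (\<xi> 0 \<omega>) = cexp 0 (\<lambda>\<omega>. f (\<xi> t \<omega>)) \<omega>"
proof -
  have z: "(0::real) \<le> 0" by simp
  obtain u v where u: "u \<in> borel_measurable \<pi>" "\<And>\<omega>. \<omega> \<in> space M \<Longrightarrow> real_cond_exp M (state_algebra 0) (\<lambda>\<omega>. Re (f (\<xi> t \<omega>))) \<omega> = u (\<xi> 0 \<omega>)"
    and v: "v \<in> borel_measurable \<pi>" "\<And>\<omega>. \<omega> \<in> space M \<Longrightarrow> real_cond_exp M (state_algebra 0) (\<lambda>\<omega>. Im (f (\<xi> t \<omega>))) \<omega> = v (\<xi> 0 \<omega>)"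
    using doob_dynkin[OF state_algebra_space[OF z] borel_measurable_cond_exp] by metis
  have "(\<lambda>x. complex_of_real (u x) + \<i> * complex_of_real (v x)) \<in> borel_measurable \<pi>" using u(1) v(1) by measurable
  then have "\<exists>u. u \<in> borel_measurable \<pi> \<and> (AE \<omega> in M. u (\<xi> 0 \<omega>) =
        Complex (real_cond_exp M (state_algebra 0) (\<lambda>\<omega>. Re (f (\<xi> t \<omega>))) \<omega>) (real_cond_exp M (state_algebra 0) (\<lambda>\<omega>. Im (f (\<xi> t \<omega>))) \<omega>))"
    by (intro exI[of _ "\<lambda>x. complex_of_real (u x) + \<i> * complex_of_real (v x)"] conjI AE_I2)
      (auto simp: u(2) v(2) complex_eq_iff)
  from someI_ex[OF this] show "T t f \<in> borel_measurable \<pi>" "AE \<omega> in M. T t f (\<xi> 0 \<omega>) = cexp 0 (\<lambda>\<omega>. f (\<xi> t \<omega>)) \<omega>"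
    unfolding transition_op_def cexp_def by blast+
qed

lemma cL2_Re_Im:
  assumes "X \<in> cL2 N"
  shows "integrable N (\<lambda>\<omega>. (Re (X \<omega>))\<^sup>2)" "integrable N (\<lambda>\<omega>. (Im (X \<omega>))\<^sup>2)"
    "(\<lambda>\<omega>. Re (X \<omega>)) \<in> borel_measurable N" "(\<lambda>\<omega>. Im (X \<omega>)) \<in> borel_measurable N"
proof -
  have [measurable]: "X \<in> borel_measurable N" by (rule cL2_measurable[OF assms])
  show "(\<lambda>\<omega>. Re (X \<omega>)) \<in> borel_measurable N" "(\<lambda>\<omega>. Im (X \<omega>)) \<in> borel_measurable N" by measurable
  have *: "(Re z)\<^sup>2 \<le> (cmod z)\<^sup>2" "(Im z)\<^sup>2 \<le> (cmod z)\<^sup>2" for z by (auto simp: cmod_power2)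
  show "integrable N (\<lambda>\<omega>. (Re (X \<omega>))\<^sup>2)" "integrable N (\<lambda>\<omega>. (Im (X \<omega>))\<^sup>2)"
    by (rule Bochner_Integration.integrable_bound[OF cL2_integrable[OF assms]]; auto simp: *)+
qed

lemma cexp_inner:
  assumes s: "s \<ge> 0" and X: "X \<in> cL2 M" and k: "k \<in> cL2 \<pi>"
  shows "cexp s X \<in> cL2 M" and "cL2_inner M (cexp s X) (\<lambda>\<omega>. k (\<xi> s \<omega>)) = cL2_inner M X (\<lambda>\<omega>. k (\<xi> s \<omega>))"
proof -
  interpret S: sigma_finite_subalgebra M "state_algebra s" by (rule state_algebra_sigma_finite[OF s])
  let ?A = "\<lambda>\<omega>. Re (X \<omega>)" and ?B = "\<lambda>\<omega>. Im (X \<omega>)" and ?C = "\<lambda>\<omega>. Re (k (\<xi> s \<omega>))" and ?D = "\<lambda>\<omega>. Im (k (\<xi> s \<omega>))"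
  let ?E = "real_cond_exp M (state_algebra s)"
  note x = cL2_Re_Im[OF X] and kk = cL2_Re_Im[OF comp_cL2[OF s k]]
  have e: "integrable M (\<lambda>\<omega>. (?E ?A \<omega>)\<^sup>2)" "integrable M (\<lambda>\<omega>. (?E ?B \<omega>)\<^sup>2)"
    using cond_exp_L2[OF s] x by auto
  have [measurable]: "?E Y \<in> borel_measurable M" for Y
    using measurable_from_subalg[OF state_algebra_subalgebra[OF s]] borel_measurable_cond_exp by blast
  have cm: "(\<lambda>\<omega>. complex_of_real (?E ?A \<omega>) + \<i> * complex_of_real (?E ?B \<omega>)) \<in> borel_measurable M" by measurable
  have ce: "cexp s X = (\<lambda>\<omega>. complex_of_real (?E ?A \<omega>) + \<i> * complex_of_real (?E ?B \<omega>))"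
    by (auto simp: cexp_def complex_eq_iff)
  show "cexp s X \<in> cL2 M"
    using e cm by (intro cL2_dominated[where w = "\<lambda>\<omega>. (?E ?A \<omega>)\<^sup>2 + (?E ?B \<omega>)\<^sup>2"]) (auto simp: ce cmod_power2)
  have CD: "?C \<in> borel_measurable (state_algebra s)" "?D \<in> borel_measurable (state_algebra s)"
    using cL2_measurable[OF k] by (auto intro!: state_algebra_comp[OF s])
  have mu: "(LINT \<omega>|M. Y \<omega> * G \<omega>) = (LINT \<omega>|M. ?E Y \<omega> * G \<omega>)" "integrable M (\<lambda>\<omega>. Y \<omega> * G \<omega>)" "integrable M (\<lambda>\<omega>. ?E Y \<omega> * G \<omega>)"
    if Y: "Y \<in> borel_measurable M" "integrable M (\<lambda>\<omega>. (Y \<omega>)\<^sup>2)" and G: "G \<in> borel_measurable (state_algebra s)" "integrable M (\<lambda>\<omega>. (G \<omega>)\<^sup>2)" for Y G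
  proof -
    have Gm: "G \<in> borel_measurable M" using measurable_from_subalg[OF state_algebra_subalgebra[OF s] G(1)] .
    show i: "integrable M (\<lambda>\<omega>. Y \<omega> * G \<omega>)" by (rule real_L2_mult[OF Y(1) Gm Y(2) G(2)])
    then have i': "integrable M (\<lambda>\<omega>. G \<omega> * Y \<omega>)" by (simp add: mult.commute)
    show "(LINT \<omega>|M. Y \<omega> * G \<omega>) = (LINT \<omega>|M. ?E Y \<omega> * G \<omega>)" "integrable M (\<lambda>\<omega>. ?E Y \<omega> * G \<omega>)"
      using S.real_cond_exp_intg[OF i' G(1) Y(1)] by (simp_all add: mult.commute)
  qed
  note m1 = mu[OF x(3,1) CD(1) kk(1)] and m2 = mu[OF x(4,2) CD(1) kk(1)] and m3 = mu[OF x(3,1) CD(2) kk(2)] and m4 = mu[OF x(4,2) CD(2) kk(2)]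
  have expand: "cL2_inner M (\<lambda>\<omega>. complex_of_real (U \<omega>) + \<i> * complex_of_real (V \<omega>)) (\<lambda>\<omega>. k (\<xi> s \<omega>)) =
    complex_of_real ((LINT \<omega>|M. U \<omega> * ?C \<omega>) + (LINT \<omega>|M. V \<omega> * ?D \<omega>)) + \<i> * complex_of_real ((LINT \<omega>|M. V \<omega> * ?C \<omega>) - (LINT \<omega>|M. U \<omega> * ?D \<omega>))"
    if "integrable M (\<lambda>\<omega>. U \<omega> * ?C \<omega>)" "integrable M (\<lambda>\<omega>. V \<omega> * ?C \<omega>)" "integrable M (\<lambda>\<omega>. U \<omega> * ?D \<omega>)" "integrable M (\<lambda>\<omega>. V \<omega> * ?D \<omega>)" for U V
  proof -
    have "(\<lambda>\<omega>. (complex_of_real (U \<omega>) + \<i> * complex_of_real (V \<omega>)) * cnj (k (\<xi> s \<omega>))) =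
      (\<lambda>\<omega>. complex_of_real (U \<omega> * ?C \<omega> + V \<omega> * ?D \<omega>) + \<i> * complex_of_real (V \<omega> * ?C \<omega> - U \<omega> * ?D \<omega>))"
      by (auto simp: complex_eq_iff algebra_simps)
    moreover have i1: "integrable M (\<lambda>\<omega>. complex_of_real (U \<omega> * ?C \<omega> + V \<omega> * ?D \<omega>))" using that by (intro integrable_of_real) auto
    moreover have i2: "integrable M (\<lambda>\<omega>. \<i> * complex_of_real (V \<omega> * ?C \<omega> - U \<omega> * ?D \<omega>))" using that by (intro integrable_mult_right integrable_of_real) auto
    ultimately have "cL2_inner M (\<lambda>\<omega>. complex_of_real (U \<omega>) + \<i> * complex_of_real (V \<omega>)) (\<lambda>\<omega>. k (\<xi> s \<omega>)) =
      (LINT \<omega>|M. complex_of_real (U \<omega> * ?C \<omega> + V \<omega> * ?D \<omega>)) + (LINT \<omega>|M. \<i> * complex_of_real (V \<omega> * ?C \<omega> - U \<omega> * ?D \<omega>))"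
      unfolding cL2_inner_def by (simp only: Bochner_Integration.integral_add[OF i1 i2])
    also have "\<dots> = complex_of_real (LINT \<omega>|M. U \<omega> * ?C \<omega> + V \<omega> * ?D \<omega>) + \<i> * complex_of_real (LINT \<omega>|M. V \<omega> * ?C \<omega> - U \<omega> * ?D \<omega>)"
      by (simp only: integral_mult_right_zero integral_complex_of_real)
    finally show ?thesis using that by simp
  qed
  have "cL2_inner M (cexp s X) (\<lambda>\<omega>. k (\<xi> s \<omega>)) = cL2_inner M (\<lambda>\<omega>. complex_of_real (?A \<omega>) + \<i> * complex_of_real (?B \<omega>)) (\<lambda>\<omega>. k (\<xi> s \<omega>))"
    unfolding ce expand[OF m1(3) m2(3) m3(3) m4(3)] expand[OF m1(2) m2(2) m3(2) m4(2)] m1(1) m2(1) m3(1) m4(1) ..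
  also have "(\<lambda>\<omega>. complex_of_real (?A \<omega>) + \<i> * complex_of_real (?B \<omega>)) = X" by (auto simp: complex_eq_iff)
  finally show "cL2_inner M (cexp s X) (\<lambda>\<omega>. k (\<xi> s \<omega>)) = cL2_inner M X (\<lambda>\<omega>. k (\<xi> s \<omega>))" .
qed

lemma T_cL2:
  assumes t: "t \<ge> 0" and f: "f \<in> cL2 \<pi>" shows "T t f \<in> cL2 \<pi>"
proof -
  note sp = transition_op_spec[OF t, of f]
  have c: "cexp 0 (\<lambda>\<omega>. f (\<xi> t \<omega>)) \<in> cL2 M" by (rule cexp_inner(1)[OF _ comp_cL2[OF t f] f]) simp
  have "(\<lambda>\<omega>. T t f (\<xi> 0 \<omega>)) \<in> cL2 M"
    using sp comp_measurable[OF _ sp(1), of 0]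
    by (intro cL2_dominated[OF _ cL2_integrable[OF c]]) auto
  then show ?thesis
    using sp(1) comp_integrable_iff[of 0 "\<lambda>x. (cmod (T t f x))\<^sup>2"] by (auto simp: cL2_def)
qed

text \<open>
  The transition operator tested against a function of the initial state. Together with
  \<open>AE_eq_of_inner_eq\<close> this determines the operator, and all its properties are derived from
  it.
\<close>

lemma T_inner:
  assumes t: "t \<ge> 0" and f: "f \<in> cL2 \<pi>" and k: "k \<in> cL2 \<pi>"
  shows "cL2_inner \<pi> (T t f) k = cL2_inner M (\<lambda>\<omega>. f (\<xi> t \<omega>)) (\<lambda>\<omega>. k (\<xi> 0 \<omega>))"
proof -
  have z: "(0::real) \<le> 0" by simp
  note ci = cexp_inner[OF z comp_cL2[OF t f] k]
  have "cL2_inner \<pi> (T t f) k = cL2_inner M (\<lambda>\<omega>. T t f (\<xi> 0 \<omega>)) (\<lambda>\<omega>. k (\<xi> 0 \<omega>))"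
    by (rule comp_inner[OF z T_cL2[OF t f] k, symmetric])
  also have "\<dots> = cL2_inner M (cexp 0 (\<lambda>\<omega>. f (\<xi> t \<omega>))) (\<lambda>\<omega>. k (\<xi> 0 \<omega>))"
    using transition_op_spec[OF t, of f] ci(1) cL2_measurable[OF k]
    by (intro cL2_inner_cong_AE) (auto intro: cL2_measurable)
  also have "\<dots> = cL2_inner M (\<lambda>\<omega>. f (\<xi> t \<omega>)) (\<lambda>\<omega>. k (\<xi> 0 \<omega>))" by (rule ci(2))
  finally show ?thesis .
qed

lemma T_contraction:
  assumes t: "t \<ge> 0" and f: "f \<in> cL2 \<pi>" shows "cL2_norm \<pi> (T t f) \<le> cL2_norm \<pi> f"
proof -
  have z: "(0::real) \<le> 0" by simp
  note Tf = T_cL2[OF t f]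
  have "(cL2_norm \<pi> (T t f))\<^sup>2 = cmod (cL2_inner \<pi> (T t f) (T t f))" by (simp only: cL2_inner_self norm_of_real abs_of_nonneg zero_le_power2)
  also have "\<dots> \<le> cL2_norm \<pi> f * cL2_norm \<pi> (T t f)"
    unfolding T_inner[OF t f Tf]
    using cL2_inner_bound[OF comp_cL2[OF t f] comp_cL2[OF z Tf]] by (simp add: comp_norm[OF t f] comp_norm[OF z Tf])
  finally show ?thesis
    using cL2_norm_nonneg[of \<pi> "T t f"] cL2_norm_nonneg[of \<pi> f] by (cases "cL2_norm \<pi> (T t f) = 0") (auto simp: power2_eq_square)
qed

lemma T_sum:
  assumes t: "t \<ge> 0" and f: "\<And>i. i \<in> I \<Longrightarrow> f i \<in> cL2 \<pi>"
  shows "AE x in \<pi>. T t (\<lambda>x. \<Sum>i\<in>I. c i * f i x) x = (\<Sum>i\<in>I. c i * T t (f i) x)"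
proof (rule AE_eq_of_inner_eq)
  show "T t (\<lambda>x. \<Sum>i\<in>I. c i * f i x) \<in> cL2 \<pi>" by (intro T_cL2 t cL2_sum f)
  show "(\<lambda>x. \<Sum>i\<in>I. c i * T t (f i) x) \<in> cL2 \<pi>" by (intro T_cL2 t cL2_sum f)
  fix u assume u: "u \<in> cL2 \<pi>"
  have z: "(0::real) \<le> 0" by simp
  have S: "(\<lambda>x. \<Sum>i\<in>I. c i * f i x) \<in> cL2 \<pi>" by (intro cL2_sum f)
  have "cL2_inner \<pi> (T t (\<lambda>x. \<Sum>i\<in>I. c i * f i x)) u = cL2_inner M (\<lambda>\<omega>. \<Sum>i\<in>I. c i * f i (\<xi> t \<omega>)) (\<lambda>\<omega>. u (\<xi> 0 \<omega>))"
    by (rule T_inner[OF t S u])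
  also have "\<dots> = (\<Sum>i\<in>I. c i * cL2_inner M (\<lambda>\<omega>. f i (\<xi> t \<omega>)) (\<lambda>\<omega>. u (\<xi> 0 \<omega>)))"
  proof (rule cL2_inner_sum_left)
    show "(\<lambda>\<omega>. f i (\<xi> t \<omega>)) \<in> cL2 M" if "i \<in> I" for i by (rule comp_cL2[OF t f[OF that]])
    show "(\<lambda>\<omega>. u (\<xi> 0 \<omega>)) \<in> cL2 M" by (rule comp_cL2[OF z u])
  qed
  also have "\<dots> = cL2_inner \<pi> (\<lambda>x. \<Sum>i\<in>I. c i * T t (f i) x) u"
    using T_cL2[OF t f] by (subst cL2_inner_sum_left) (auto simp: u T_inner[OF t f u])
  finally show "cL2_inner \<pi> (T t (\<lambda>x. \<Sum>i\<in>I. c i * f i x)) u = cL2_inner \<pi> (\<lambda>x. \<Sum>i\<in>I. c i * T t (f i) x) u" .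
qed

abbreviation ind :: "'s set \<Rightarrow> 's \<Rightarrow> complex" where "ind A \<equiv> (\<lambda>x. complex_of_real (indicator A x))"

lemma bounded_cL2:
  fixes w :: "'s \<Rightarrow> real"
  assumes "w \<in> borel_measurable \<pi>" "\<And>x. 0 \<le> w x" "\<And>x. w x \<le> 1"
  shows "(\<lambda>x. complex_of_real (w x)) \<in> cL2 \<pi>"
proof -
  interpret \<pi>: prob_space \<pi> by (rule prob_\<pi>)
  show ?thesis using assms by (intro cL2_dominated[where w = "\<lambda>_. 1"]) (auto simp: power_le_one abs_le_iff)
qed

lemma ind_cL2: "A \<in> sets \<pi> \<Longrightarrow> ind A \<in> cL2 \<pi>"
  by (rule bounded_cL2) auto

lemma cL2_inner_real: "cL2_inner M X (\<lambda>\<omega>. complex_of_real (w \<omega>)) = (LINT \<omega>|M. w \<omega> *\<^sub>R X \<omega>)"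
  by (simp add: cL2_inner_def scaleR_conv_of_real mult.commute)

lemma pair_law:
  assumes s: "s \<ge> 0" and t: "t \<ge> 0" and A: "A \<in> sets \<pi>" and D: "D \<in> sets \<pi>"
  shows "prob {\<omega>\<in>space M. \<xi> s \<omega> \<in> D \<and> \<xi> (s + t) \<omega> \<in> A} = prob {\<omega>\<in>space M. \<xi> 0 \<omega> \<in> D \<and> \<xi> t \<omega> \<in> A}"
proof -
  let ?Q = "{x \<in> space (Pi\<^sub>M {0, t} (\<lambda>_. \<pi>)). x 0 \<in> D \<and> x t \<in> A}"
  have Q: "?Q \<in> sets (Pi\<^sub>M {0, t} (\<lambda>_. \<pi>))"
  proof -
    have [measurable]: "(\<lambda>x. x 0) \<in> measurable (Pi\<^sub>M {0, t} (\<lambda>_. \<pi>)) \<pi>" "(\<lambda>x. x t) \<in> measurable (Pi\<^sub>M {0, t} (\<lambda>_. \<pi>)) \<pi>"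
      by (rule measurable_component_singleton; simp)+
    show ?thesis using A D by measurable
  qed
  have m: "(\<lambda>\<omega>. \<lambda>u\<in>{0, t}. \<xi> (r + u) \<omega>) \<in> measurable M (Pi\<^sub>M {0, t} (\<lambda>_. \<pi>))" if "r \<ge> 0" for r
    using that t by (intro measurable_restrict rv) auto
  have e: "(\<lambda>\<omega>. \<lambda>u\<in>{0, t}. \<xi> (r + u) \<omega>) -` ?Q \<inter> space M = {\<omega>\<in>space M. \<xi> r \<omega> \<in> D \<and> \<xi> (r + t) \<omega> \<in> A}" if "r \<ge> 0" for r
    using measurable_space[OF m[OF that]] by (auto simp: space_PiM)
  have "measure (distr M (Pi\<^sub>M {0, t} (\<lambda>_. \<pi>)) (\<lambda>\<omega>. \<lambda>u\<in>{0, t}. \<xi> (s + u) \<omega>)) ?Q = measure (distr M (Pi\<^sub>M {0, t} (\<lambda>_. \<pi>)) (\<lambda>\<omega>. \<lambda>u\<in>{0, t}. \<xi> (0 + u) \<omega>)) ?Q"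
    using stationary[of "{0, t}" s] s t by simp
  then show ?thesis
    unfolding measure_distr[OF m[OF s] Q] measure_distr[OF m[OF order_refl] Q] e[OF s] e[OF order_refl] by simp
qed

text \<open>
  By stationarity the transition from time \<open>s\<close> to \<open>s + t\<close> is the transition from \<open>0\<close> to \<open>t\<close>,
  and by the Markov property conditioning on the present state gives the same as conditioning
  on the whole past, which includes the initial state.
\<close>

lemma T_indicator_shift:
  assumes s: "s \<ge> 0" and t: "t \<ge> 0" and A: "A \<in> sets \<pi>" and B: "B \<in> sets \<pi>"
  shows "(LINT \<omega>|M. indicator A (\<xi> (s + t) \<omega>) * indicator B (\<xi> 0 \<omega>)) = (LINT \<omega>|M. Re (T t (ind A) (\<xi> s \<omega>)) * indicator B (\<xi> 0 \<omega>))"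
proof -
  have st: "s + t \<ge> 0" "(0::real) \<le> 0" using s t by auto
  interpret S: sigma_finite_subalgebra M "state_algebra s" by (rule state_algebra_sigma_finite[OF s])
  interpret Fs: sigma_finite_subalgebra M "F s" by (rule F_sigma_finite[OF s])
  let ?X = "\<lambda>\<omega>. indicator A (\<xi> (s + t) \<omega>) :: real"
  have [measurable]: "(indicator A :: 's \<Rightarrow> real) \<in> borel_measurable \<pi>" "(indicator B :: 's \<Rightarrow> real) \<in> borel_measurable \<pi>" using A B by auto
  have Xm[measurable]: "?X \<in> borel_measurable M" using st by measurable
  have Xi: "integrable M ?X" by (rule integrable_const_bound[of _ 1]) auto
  note TA = T_cL2[OF t ind_cL2[OF A]]
  have TAm[measurable]: "T t (ind A) \<in> borel_measurable \<pi>" by (rule cL2_measurable[OF TA])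
  have Tm: "(\<lambda>\<omega>. Re (T t (ind A) (\<xi> s \<omega>))) \<in> borel_measurable (state_algebra s)" using TAm by (intro state_algebra_comp[OF s]) auto
  have Ti: "integrable M (\<lambda>\<omega>. Re (T t (ind A) (\<xi> s \<omega>)))"
    using square_integrable_imp_integrable cL2_Re_Im[OF comp_cL2[OF s TA]] by blast
  have char: "AE \<omega> in M. real_cond_exp M (state_algebra s) ?X \<omega> = Re (T t (ind A) (\<xi> s \<omega>))"
  proof (rule S.real_cond_exp_charact[OF _ Xi Ti Tm])
    fix C assume "C \<in> sets (state_algebra s)"
    then obtain D where D: "D \<in> sets \<pi>" "C = \<xi> s -` D \<inter> space M" unfolding sets_vimage_algebra2[OF state_algebra_space[OF s]] by blast
    have [measurable]: "(indicator D :: 's \<Rightarrow> real) \<in> borel_measurable \<pi>" using D by auto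
    have "(LINT \<omega>:C|M. ?X \<omega>) = (LINT \<omega>|M. indicator {\<omega>\<in>space M. \<xi> s \<omega> \<in> D \<and> \<xi> (s + t) \<omega> \<in> A} \<omega>)"
      unfolding set_lebesgue_integral_def by (intro Bochner_Integration.integral_cong) (auto simp: D indicator_def)
    also have "\<dots> = prob {\<omega>\<in>space M. \<xi> s \<omega> \<in> D \<and> \<xi> (s + t) \<omega> \<in> A}" by (simp add: Int_absorb2 subset_iff)
    also have "\<dots> = prob {\<omega>\<in>space M. \<xi> 0 \<omega> \<in> D \<and> \<xi> t \<omega> \<in> A}" by (rule pair_law[OF s t A D(1)])
    also have "\<dots> = (LINT \<omega>|M. indicator {\<omega>\<in>space M. \<xi> 0 \<omega> \<in> D \<and> \<xi> t \<omega> \<in> A} \<omega>)" by (simp add: Int_absorb2 subset_iff)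
    also have "\<dots> = (LINT \<omega>|M. Re (ind A (\<xi> t \<omega>) * cnj (ind D (\<xi> 0 \<omega>))))"
      by (intro Bochner_Integration.integral_cong) (auto simp: indicator_def)
    also have "\<dots> = Re (cL2_inner M (\<lambda>\<omega>. ind A (\<xi> t \<omega>)) (\<lambda>\<omega>. ind D (\<xi> 0 \<omega>)))"
      unfolding cL2_inner_def
      by (rule integral_Re[OF cL2_inner_integrable[OF comp_cL2[OF t ind_cL2[OF A]] comp_cL2[OF st(2) ind_cL2[OF D(1)]]]])
    also have "\<dots> = Re (cL2_inner \<pi> (T t (ind A)) (ind D))" by (simp only: T_inner[OF t ind_cL2[OF A] ind_cL2[OF D(1)]])
    also have "\<dots> = Re (cL2_inner M (\<lambda>\<omega>. T t (ind A) (\<xi> s \<omega>)) (\<lambda>\<omega>. ind D (\<xi> s \<omega>)))"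
      by (simp only: comp_inner[OF s TA ind_cL2[OF D(1)]])
    also have "\<dots> = (LINT \<omega>|M. Re (T t (ind A) (\<xi> s \<omega>) * cnj (ind D (\<xi> s \<omega>))))"
      unfolding cL2_inner_def
      by (rule integral_Re[symmetric, OF cL2_inner_integrable[OF comp_cL2[OF s TA] comp_cL2[OF s ind_cL2[OF D(1)]]]])
    also have "\<dots> = (LINT \<omega>:C|M. Re (T t (ind A) (\<xi> s \<omega>)))"
      unfolding set_lebesgue_integral_def by (intro Bochner_Integration.integral_cong) (auto simp: D indicator_def)
    finally show "(LINT \<omega>:C|M. ?X \<omega>) = (LINT \<omega>:C|M. Re (T t (ind A) (\<xi> s \<omega>)))" .
  qed
  have iB: "integrable M (\<lambda>\<omega>. indicator B (\<xi> 0 \<omega>) * ?X \<omega>)"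
  proof (rule integrable_const_bound[of _ 1])
    show "(\<lambda>\<omega>. indicator B (\<xi> 0 \<omega>) * ?X \<omega>) \<in> borel_measurable M" using st by measurable
  qed (auto simp: indicator_def)
  have Bm: "(\<lambda>\<omega>. indicator B (\<xi> 0 \<omega>) :: real) \<in> borel_measurable (F s)"
    using measurable_compose[OF adapted[of 0 s], of "indicator B :: 's \<Rightarrow> real"] s B by auto
  have "(LINT \<omega>|M. ?X \<omega> * indicator B (\<xi> 0 \<omega>)) = (LINT \<omega>|M. indicator B (\<xi> 0 \<omega>) * real_cond_exp M (F s) ?X \<omega>)"
    using Fs.real_cond_exp_intg(2)[OF iB Bm Xm] by (simp add: mult.commute)
  also have "\<dots> = (LINT \<omega>|M. Re (T t (ind A) (\<xi> s \<omega>)) * indicator B (\<xi> 0 \<omega>))"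
  proof (rule integral_cong_AE)
    show "(\<lambda>\<omega>. indicator B (\<xi> 0 \<omega>) * real_cond_exp M (F s) ?X \<omega>) \<in> borel_measurable M"
      using measurable_from_subalg[OF sub[OF s] borel_measurable_cond_exp[of M "F s" ?X]] by measurable
    show "(\<lambda>\<omega>. Re (T t (ind A) (\<xi> s \<omega>)) * indicator B (\<xi> 0 \<omega>)) \<in> borel_measurable M" using s by measurable
    show "AE \<omega> in M. indicator B (\<xi> 0 \<omega>) * real_cond_exp M (F s) ?X \<omega> = Re (T t (ind A) (\<xi> s \<omega>)) * indicator B (\<xi> 0 \<omega>)"
      using markov[OF s t A] char by eventually_elim simp
  qed
  finally show ?thesis .
qed

text \<open>
  The Markov property is given for indicators of the future state. To extend it to an
  arbitrary \<open>f\<close>, test against an indicator of the initial state and replace that by its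
  conditional expectation \<open>w\<close> given the state at time \<open>s\<close>. Both sides become integrals of \<open>f\<close>
  against measures on the state space that agree on indicators, hence are equal.
\<close>

lemma T_semigroup:
  assumes s: "s \<ge> 0" and t: "t \<ge> 0" and f: "f \<in> cL2 \<pi>"
  shows "AE x in \<pi>. T (s + t) f x = T s (T t f) x"
proof -
  interpret \<pi>: prob_space \<pi> by (rule prob_\<pi>)
  have st: "s + t \<ge> 0" "(0::real) \<le> 0" using s t by auto
  note Tf = T_cL2[OF t f]
  have d: "(\<lambda>x. T (s + t) f x - T s (T t f) x) \<in> cL2 \<pi>" by (intro cL2_diff T_cL2 st s t f)
  have key: "cL2_inner \<pi> (T (s + t) f) (ind B) = cL2_inner \<pi> (T s (T t f)) (ind B)" if B: "B \<in> sets \<pi>" for B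
  proof -
    interpret S: sigma_finite_subalgebra M "state_algebra s" by (rule state_algebra_sigma_finite[OF s])
    have [measurable]: "(indicator B :: 's \<Rightarrow> real) \<in> borel_measurable \<pi>" using B by auto
    let ?Y = "\<lambda>\<omega>. indicator B (\<xi> 0 \<omega>) :: real"
    have Ym: "?Y \<in> borel_measurable M" using st by measurable
    have Yi: "integrable M ?Y" by (rule integrable_const_bound[of _ 1]) (use Ym in auto)
    obtain v where v: "v \<in> borel_measurable \<pi>" "\<And>\<omega>. \<omega> \<in> space M \<Longrightarrow> real_cond_exp M (state_algebra s) ?Y \<omega> = v (\<xi> s \<omega>)"
      using doob_dynkin[OF state_algebra_space[OF s] borel_measurable_cond_exp] by metis
    \<comment> \<open>Clipping keeps \<open>w\<close> between \<open>0\<close> and \<open>1\<close> everywhere, so that it can serve as a density.\<close>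
    define w where "w x = max 0 (min 1 (v x))" for x
    have wm[measurable]: "w \<in> borel_measurable \<pi>" using v(1) unfolding w_def[abs_def] by measurable
    have w01: "0 \<le> w x" "w x \<le> 1" for x by (auto simp: w_def)
    note wL = bounded_cL2[OF wm w01]
    have vw: "AE \<omega> in M. real_cond_exp M (state_algebra s) ?Y \<omega> = w (\<xi> s \<omega>)"
    proof -
      have "AE \<omega> in M. 0 \<le> real_cond_exp M (state_algebra s) ?Y \<omega>" by (intro S.real_cond_exp_ge_c Yi) auto
      moreover have "AE \<omega> in M. real_cond_exp M (state_algebra s) ?Y \<omega> \<le> 1" by (intro S.real_cond_exp_le_c Yi) (auto simp: indicator_def)
      ultimately show ?thesis using AE_space by eventually_elim (use v(2) in \<open>auto simp: w_def\<close>)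
    qed
    have shift_w: "cL2_inner M (\<lambda>\<omega>. u (\<xi> s \<omega>)) (\<lambda>\<omega>. ind B (\<xi> 0 \<omega>)) = cL2_inner M (\<lambda>\<omega>. u (\<xi> s \<omega>)) (\<lambda>\<omega>. complex_of_real (w (\<xi> s \<omega>)))"
      if u: "u \<in> cL2 \<pi>" for u
    proof -
      have YL: "(\<lambda>\<omega>. ind B (\<xi> 0 \<omega>)) \<in> cL2 M" by (rule comp_cL2[OF st(2) ind_cL2[OF B]])
      have c: "AE \<omega> in M. cexp s (\<lambda>\<omega>. ind B (\<xi> 0 \<omega>)) \<omega> = complex_of_real (w (\<xi> s \<omega>))"
      proof -
        have "AE \<omega> in M. real_cond_exp M (state_algebra s) (\<lambda>\<omega>. 0) \<omega> = 0" by (rule S.real_cond_exp_F_meas) auto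
        then show ?thesis using vw by eventually_elim (simp add: cexp_def complex_eq_iff)
      qed
      have "cL2_inner M (\<lambda>\<omega>. ind B (\<xi> 0 \<omega>)) (\<lambda>\<omega>. u (\<xi> s \<omega>)) = cL2_inner M (cexp s (\<lambda>\<omega>. ind B (\<xi> 0 \<omega>))) (\<lambda>\<omega>. u (\<xi> s \<omega>))"
        by (rule cexp_inner(2)[OF s YL u, symmetric])
      also have "\<dots> = cL2_inner M (\<lambda>\<omega>. complex_of_real (w (\<xi> s \<omega>))) (\<lambda>\<omega>. u (\<xi> s \<omega>))"
        using c cL2_measurable[OF cexp_inner(1)[OF s YL u]] cL2_measurable[OF comp_cL2[OF s wL]] cL2_measurable[OF comp_cL2[OF s u]]
        by (intro cL2_inner_cong_AE) auto
      finally show ?thesis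
        using cL2_inner_commute[of M "\<lambda>\<omega>. u (\<xi> s \<omega>)" "\<lambda>\<omega>. ind B (\<xi> 0 \<omega>)"] cL2_inner_commute[of M "\<lambda>\<omega>. u (\<xi> s \<omega>)" "\<lambda>\<omega>. complex_of_real (w (\<xi> s \<omega>))"] by simp
    qed
    have chain: "cL2_inner M (\<lambda>\<omega>. k (\<xi> t \<omega>)) (\<lambda>\<omega>. complex_of_real (w (\<xi> 0 \<omega>))) = cL2_inner M (\<lambda>\<omega>. T t k (\<xi> s \<omega>)) (\<lambda>\<omega>. ind B (\<xi> 0 \<omega>))"
      if k: "k \<in> cL2 \<pi>" for k
    proof -
      have "cL2_inner M (\<lambda>\<omega>. k (\<xi> t \<omega>)) (\<lambda>\<omega>. complex_of_real (w (\<xi> 0 \<omega>))) = cL2_inner \<pi> (T t k) (\<lambda>x. complex_of_real (w x))"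
        by (rule T_inner[OF t k wL, symmetric])
      also have "\<dots> = cL2_inner M (\<lambda>\<omega>. T t k (\<xi> s \<omega>)) (\<lambda>\<omega>. complex_of_real (w (\<xi> s \<omega>)))"
        by (rule comp_inner[OF s T_cL2[OF t k] wL, symmetric])
      also have "\<dots> = cL2_inner M (\<lambda>\<omega>. T t k (\<xi> s \<omega>)) (\<lambda>\<omega>. ind B (\<xi> 0 \<omega>))" by (rule shift_w[OF T_cL2[OF t k], symmetric])
      finally show ?thesis .
    qed
    \<comment> \<open>The laws of the future state under the weights \<open>1_B (\<xi> 0)\<close> and \<open>w (\<xi> 0)\<close>.\<close>
    define \<mu>1 where "\<mu>1 = distr (density M (\<lambda>\<omega>. ennreal (?Y \<omega>))) \<pi> (\<xi> (s + t))"
    define \<mu>2 where "\<mu>2 = distr (density M (\<lambda>\<omega>. ennreal (w (\<xi> 0 \<omega>)))) \<pi> (\<xi> t)"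
    have w0m: "(\<lambda>\<omega>. w (\<xi> 0 \<omega>)) \<in> borel_measurable M" using st by measurable
    have em: "emeasure (distr (density M (\<lambda>\<omega>. ennreal (y \<omega>))) \<pi> (\<xi> r)) A = ennreal (LINT \<omega>|M. indicator A (\<xi> r \<omega>) * y \<omega>)"
      if A: "A \<in> sets \<pi>" and r: "r \<ge> 0" and y: "y \<in> borel_measurable M" "\<And>\<omega>. 0 \<le> y \<omega>" "\<And>\<omega>. y \<omega> \<le> 1" for A r and y :: "'a \<Rightarrow> real"
    proof -
      have [measurable]: "A \<in> sets \<pi>" "y \<in> borel_measurable M" "\<xi> r \<in> measurable M \<pi>" using that by auto
      have "emeasure (distr (density M (\<lambda>\<omega>. ennreal (y \<omega>))) \<pi> (\<xi> r)) A = (\<integral>\<^sup>+\<omega>. ennreal (y \<omega>) * indicator (\<xi> r -` A \<inter> space M) \<omega> \<partial>M)"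
        by (subst emeasure_distr) (auto simp: emeasure_density)
      also have "\<dots> = (\<integral>\<^sup>+\<omega>. ennreal (indicator A (\<xi> r \<omega>) * y \<omega>) \<partial>M)"
        by (intro nn_integral_cong) (auto simp: indicator_def)
      also have "\<dots> = ennreal (LINT \<omega>|M. indicator A (\<xi> r \<omega>) * y \<omega>)"
        by (intro nn_integral_eq_integral integrable_const_bound[of _ 1]) (use y in \<open>auto simp: indicator_def\<close>)
      finally show ?thesis .
    qed
    have "\<mu>1 = \<mu>2"
    proof (rule measure_eqI)
      show "sets \<mu>1 = sets \<mu>2" by (simp add: \<mu>1_def \<mu>2_def)
      fix A assume "A \<in> sets \<mu>1"
      then have A: "A \<in> sets \<pi>" by (simp add: \<mu>1_def)
      note TA = T_cL2[OF t ind_cL2[OF A]]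
      have iw: "integrable M (\<lambda>\<omega>. indicator A (\<xi> t \<omega>) * w (\<xi> 0 \<omega>))"
        by (intro integrable_const_bound[of _ 1]) (use A t w0m w01 in \<open>auto simp: indicator_def\<close>)
      have "(LINT \<omega>|M. indicator A (\<xi> t \<omega>) * w (\<xi> 0 \<omega>)) = Re (cL2_inner M (\<lambda>\<omega>. ind A (\<xi> t \<omega>)) (\<lambda>\<omega>. complex_of_real (w (\<xi> 0 \<omega>))))"
        unfolding cL2_inner_def
        by (subst integral_Re[symmetric, OF cL2_inner_integrable[OF comp_cL2[OF t ind_cL2[OF A]] comp_cL2[OF st(2) wL]]]) simp
      also have "\<dots> = Re (cL2_inner M (\<lambda>\<omega>. T t (ind A) (\<xi> s \<omega>)) (\<lambda>\<omega>. ind B (\<xi> 0 \<omega>)))" unfolding chain[OF ind_cL2[OF A]] ..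
      also have "\<dots> = (LINT \<omega>|M. Re (T t (ind A) (\<xi> s \<omega>)) * ?Y \<omega>)"
        unfolding cL2_inner_def
        by (subst integral_Re[symmetric, OF cL2_inner_integrable[OF comp_cL2[OF s TA] comp_cL2[OF st(2) ind_cL2[OF B]]]]) simp
      also have "\<dots> = (LINT \<omega>|M. indicator A (\<xi> (s + t) \<omega>) * ?Y \<omega>)" by (rule T_indicator_shift[OF s t A B, symmetric])
      finally show "emeasure \<mu>1 A = emeasure \<mu>2 A"
        unfolding \<mu>1_def \<mu>2_def em[OF A st(1) Ym indicator_pos_le indicator_le_1] em[OF A t w0m w01] by simp
    qed
    moreover have dist_int: "(LINT x|distr (density M (\<lambda>\<omega>. ennreal (y \<omega>))) \<pi> (\<xi> r). f x) = cL2_inner M (\<lambda>\<omega>. f (\<xi> r \<omega>)) (\<lambda>\<omega>. complex_of_real (y \<omega>))"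
      if r: "r \<ge> 0" and y: "y \<in> borel_measurable M" "\<And>\<omega>. 0 \<le> y \<omega>" for r and y :: "'a \<Rightarrow> real"
    proof -
      have [measurable]: "f \<in> borel_measurable \<pi>" "y \<in> borel_measurable M" "\<xi> r \<in> measurable M \<pi>" using that cL2_measurable[OF f] by auto
      have "(LINT x|distr (density M (\<lambda>\<omega>. ennreal (y \<omega>))) \<pi> (\<xi> r). f x) = (LINT \<omega>|density M (\<lambda>\<omega>. ennreal (y \<omega>)). f (\<xi> r \<omega>))"
        by (rule integral_distr) auto
      also have "\<dots> = (LINT \<omega>|M. y \<omega> *\<^sub>R f (\<xi> r \<omega>))" by (rule integral_density) (use y in auto)
      finally show ?thesis unfolding cL2_inner_real .
    qed
    ultimately have "cL2_inner M (\<lambda>\<omega>. f (\<xi> (s + t) \<omega>)) (\<lambda>\<omega>. ind B (\<xi> 0 \<omega>)) = cL2_inner M (\<lambda>\<omega>. f (\<xi> t \<omega>)) (\<lambda>\<omega>. complex_of_real (w (\<xi> 0 \<omega>)))"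
      using dist_int[OF st(1) Ym indicator_pos_le] dist_int[OF t w0m w01(1)] by (simp add: \<mu>1_def \<mu>2_def)
    then show ?thesis
      unfolding T_inner[OF st(1) f ind_cL2[OF B]] T_inner[OF s Tf ind_cL2[OF B]] using chain[OF f] by simp
  qed
  have "AE x in \<pi>. T (s + t) f x - T s (T t f) x = 0"
  proof (rule AE_eq_0_of_indicator_integrals)
    show "integrable \<pi> (\<lambda>x. T (s + t) f x - T s (T t f) x)"
      using cL2_inner_integrable[OF d bounded_cL2[of "\<lambda>_. 1"]] by simp
    fix B assume B: "B \<in> sets \<pi>"
    have "(LINT x|\<pi>. indicator B x *\<^sub>R (T (s + t) f x - T s (T t f) x)) = cL2_inner \<pi> (\<lambda>x. T (s + t) f x - T s (T t f) x) (ind B)"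
      by (simp add: cL2_inner_def scaleR_conv_of_real mult.commute)
    also have "\<dots> = 0" using key[OF B] by (simp add: cL2_inner_diff_left[OF T_cL2[OF st(1) f] T_cL2[OF s Tf] ind_cL2[OF B]])
    finally show "(LINT x|\<pi>. indicator B x *\<^sub>R (T (s + t) f x - T s (T t f) x)) = 0" .
  qed
  then show ?thesis by simp
qed

end

section \<open>Projection-valued measures\<close>

text \<open>
  A polarized integral is a combination of four integrals with coefficients \<open>\<i> ^ j\<close>. Equality
  of the underlying complex measures amounts to two identities between sums of positive
  measures; in this form they extend from sets to functions without subtraction of infinite
  values.
\<close>

lemma integral_eq_of_measure_sums:
  fixes \<phi> :: "'z \<Rightarrow> complex"
  assumes fin: "finite_measure a" "finite_measure b" "finite_measure c" "finite_measure d"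
    and sets: "sets b = sets a" "sets c = sets a" "sets d = sets a"
    and eq: "\<And>A. A \<in> sets a \<Longrightarrow> measure a A + measure b A = measure c A + measure d A"
    and int: "integrable a \<phi>" "integrable b \<phi>" "integrable c \<phi>" "integrable d \<phi>"
  shows "(LINT z|a. \<phi> z) + (LINT z|b. \<phi> z) = (LINT z|c. \<phi> z) + (LINT z|d. \<phi> z)"
proof -
  note [measurable_cong] = sets
  have sp: "space b = space a" "space c = space a" "space d = space a" using sets by (auto dest: sets_eq_imp_space_eq)
  have nn: "(\<integral>\<^sup>+z. u z \<partial>a) + (\<integral>\<^sup>+z. u z \<partial>b) = (\<integral>\<^sup>+z. u z \<partial>c) + (\<integral>\<^sup>+z. u z \<partial>d)" if "u \<in> borel_measurable a" for u :: "'z \<Rightarrow> ennreal"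
    using that
  proof (induction u rule: borel_measurable_induct)
    case (cong f g)
    then have "(\<integral>\<^sup>+z. f z \<partial>N) = (\<integral>\<^sup>+z. g z \<partial>N)" if "space N = space a" for N
      using that by (intro nn_integral_cong) auto
    then show ?case using cong sp by metis
  next
    case (set A)
    have "emeasure a A + emeasure b A = emeasure c A + emeasure d A"
      using eq[OF set] fin by (simp add: finite_measure.emeasure_eq_measure flip: ennreal_plus)
    then show ?case using set sets by simp
  next
    case (mult u v)
    then have "u \<in> borel_measurable a" "u \<in> borel_measurable b" "u \<in> borel_measurable c" "u \<in> borel_measurable d" by auto
    then show ?case using mult by (simp add: nn_integral_cmult flip: distrib_left)
  next
    case (add u v)
    have m: "u \<in> borel_measurable a" "u \<in> borel_measurable b" "u \<in> borel_measurable c" "u \<in> borel_measurable d"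
      "v \<in> borel_measurable a" "v \<in> borel_measurable b" "v \<in> borel_measurable c" "v \<in> borel_measurable d" using add by auto
    have "(\<integral>\<^sup>+z. v z + u z \<partial>a) + (\<integral>\<^sup>+z. v z + u z \<partial>b) = ((\<integral>\<^sup>+z. v z \<partial>a) + (\<integral>\<^sup>+z. v z \<partial>b)) + ((\<integral>\<^sup>+z. u z \<partial>a) + (\<integral>\<^sup>+z. u z \<partial>b))"
      using m by (simp add: nn_integral_add ac_simps)
    also have "\<dots> = (\<integral>\<^sup>+z. v z + u z \<partial>c) + (\<integral>\<^sup>+z. v z + u z \<partial>d)"
      unfolding add.IH using m by (simp add: nn_integral_add ac_simps)
    finally show ?case .
  next
    case (seq U)
    have m: "\<And>i. U i \<in> borel_measurable a" "\<And>i. U i \<in> borel_measurable b" "\<And>i. U i \<in> borel_measurable c" "\<And>i. U i \<in> borel_measurable d" using seq(1) by auto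
    have inc: "incseq (\<lambda>i. \<integral>\<^sup>+z. U i z \<partial>N)" for N using seq(3) by (intro incseq_nn_integral)
    have S: "(\<integral>\<^sup>+z. (SUP i. U i) z \<partial>N) = (SUP i. \<integral>\<^sup>+z. U i z \<partial>N)" if "\<And>i. U i \<in> borel_measurable N" for N
      using nn_integral_monotone_convergence_SUP[OF seq(3) that] by (simp add: image_comp)
    have "(SUP i. (\<integral>\<^sup>+z. U i z \<partial>a) + (\<integral>\<^sup>+z. U i z \<partial>b)) = (SUP i. (\<integral>\<^sup>+z. U i z \<partial>c) + (\<integral>\<^sup>+z. U i z \<partial>d))"
      using seq by simp
    then show ?case unfolding S[OF m(1)] S[OF m(2)] S[OF m(3)] S[OF m(4)] by (simp add: ennreal_SUP_add inc)
  qed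
  have real: "(LINT z|a. r z) + (LINT z|b. r z) = (LINT z|c. r z) + (LINT z|d. r z)"
    if r: "integrable a r" "integrable b r" "integrable c r" "integrable d r" for r :: "'z \<Rightarrow> real"
  proof -
    have rm[measurable]: "r \<in> borel_measurable a" using r by auto
    have fin': "(\<integral>\<^sup>+z. ennreal (r z) \<partial>N) < \<top>" "(\<integral>\<^sup>+z. ennreal (- r z) \<partial>N) < \<top>" if "integrable N r" for N
      using that unfolding real_integrable_def by (auto simp: less_top)
    have e1: "enn2real (\<integral>\<^sup>+z. ennreal (q z) \<partial>a) + enn2real (\<integral>\<^sup>+z. ennreal (q z) \<partial>b) = enn2real (\<integral>\<^sup>+z. ennreal (q z) \<partial>c) + enn2real (\<integral>\<^sup>+z. ennreal (q z) \<partial>d)"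
      if "q \<in> borel_measurable a" "(\<integral>\<^sup>+z. ennreal (q z) \<partial>a) < \<top>" "(\<integral>\<^sup>+z. ennreal (q z) \<partial>b) < \<top>" "(\<integral>\<^sup>+z. ennreal (q z) \<partial>c) < \<top>" "(\<integral>\<^sup>+z. ennreal (q z) \<partial>d) < \<top>" for q
      using nn[of "\<lambda>z. ennreal (q z)"] that by (simp flip: enn2real_plus)
    show ?thesis
      unfolding real_lebesgue_integral_def[OF r(1)] real_lebesgue_integral_def[OF r(2)] real_lebesgue_integral_def[OF r(3)] real_lebesgue_integral_def[OF r(4)]
      using e1[OF rm fin'(1)[OF r(1)] fin'(1)[OF r(2)] fin'(1)[OF r(3)] fin'(1)[OF r(4)]]
        e1[OF _ fin'(2)[OF r(1)] fin'(2)[OF r(2)] fin'(2)[OF r(3)] fin'(2)[OF r(4)]] by simp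
  qed
  show ?thesis
    using real[of "\<lambda>z. Re (\<phi> z)"] real[of "\<lambda>z. Im (\<phi> z)"] int by (simp add: complex_eq_iff)
qed

locale pvm =
  fixes \<mu> :: "'s measure" and \<Sigma> :: "'z measure" and E :: "'z set \<Rightarrow> ('s \<Rightarrow> complex) \<Rightarrow> 's \<Rightarrow> complex"
  assumes pvm: "projection_valued_measure \<mu> \<Sigma> E"
begin

lemma E_cL2: "A \<in> sets \<Sigma> \<Longrightarrow> f \<in> cL2 \<mu> \<Longrightarrow> E A f \<in> cL2 \<mu>"
  by (rule pvm[unfolded projection_valued_measure_def, THEN conjunct1, rule_format])

lemma E_sym: "A \<in> sets \<Sigma> \<Longrightarrow> f \<in> cL2 \<mu> \<Longrightarrow> k \<in> cL2 \<mu> \<Longrightarrow> cL2_inner \<mu> (E A f) k = cL2_inner \<mu> f (E A k)"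
  by (rule pvm[unfolded projection_valued_measure_def, THEN conjunct2, THEN conjunct1, rule_format])

lemma E_Int: "A \<in> sets \<Sigma> \<Longrightarrow> B \<in> sets \<Sigma> \<Longrightarrow> f \<in> cL2 \<mu> \<Longrightarrow> AE x in \<mu>. E (A \<inter> B) f x = E A (E B f) x"
  by (rule pvm[unfolded projection_valued_measure_def, THEN conjunct2, THEN conjunct2, THEN conjunct1, rule_format])

lemma E_empty: "f \<in> cL2 \<mu> \<Longrightarrow> AE x in \<mu>. E {} f x = 0"
  by (rule pvm[unfolded projection_valued_measure_def, THEN conjunct2, THEN conjunct2, THEN conjunct2, THEN conjunct1, rule_format])

lemma E_space: "f \<in> cL2 \<mu> \<Longrightarrow> AE x in \<mu>. E (space \<Sigma>) f x = f x"
  by (rule pvm[unfolded projection_valued_measure_def, THEN conjunct2, THEN conjunct2, THEN conjunct2, THEN conjunct2, THEN conjunct1, rule_format])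

lemma E_sums: "range A \<subseteq> sets \<Sigma> \<Longrightarrow> disjoint_family A \<Longrightarrow> f \<in> cL2 \<mu> \<Longrightarrow> k \<in> cL2 \<mu> \<Longrightarrow>
        (\<lambda>n::nat. cL2_inner \<mu> (E (A n) f) k) sums cL2_inner \<mu> (E (\<Union>n. A n) f) k"
  by (rule pvm[unfolded projection_valued_measure_def, THEN conjunct2, THEN conjunct2, THEN conjunct2, THEN conjunct2, THEN conjunct2, rule_format]) (rule conjI)

lemma cL2_inner_cong_left: "f \<in> cL2 \<mu> \<Longrightarrow> f' \<in> cL2 \<mu> \<Longrightarrow> k \<in> cL2 \<mu> \<Longrightarrow> (AE x in \<mu>. f x = f' x) \<Longrightarrow> cL2_inner \<mu> f k = cL2_inner \<mu> f' k"
  by (rule cL2_inner_cong_AE) (auto intro: cL2_measurable)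

lemma cL2_norm_cong: "f \<in> cL2 \<mu> \<Longrightarrow> f' \<in> cL2 \<mu> \<Longrightarrow> (AE x in \<mu>. f x = f' x) \<Longrightarrow> cL2_norm \<mu> f = cL2_norm \<mu> f'"
  by (rule cL2_norm_cong_AE) (auto intro: cL2_measurable)

lemma inner_E_E:
  assumes "A \<in> sets \<Sigma>" "B \<in> sets \<Sigma>" "f \<in> cL2 \<mu>" "k \<in> cL2 \<mu>"
  shows "cL2_inner \<mu> (E A f) (E B k) = cL2_inner \<mu> (E (A \<inter> B) f) k"
proof -
  have "cL2_inner \<mu> (E A f) (E B k) = cL2_inner \<mu> (E B (E A f)) k" using assms by (simp add: E_sym E_cL2)
  also have "\<dots> = cL2_inner \<mu> (E (B \<inter> A) f) k"
    using assms E_Int[of B A f] by (intro cL2_inner_cong_left) (auto intro: E_cL2 elim: eventually_mono)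
  finally show ?thesis by (simp add: Int_commute)
qed

lemma E_norm: "A \<in> sets \<Sigma> \<Longrightarrow> f \<in> cL2 \<mu> \<Longrightarrow> cL2_inner \<mu> (E A f) f = complex_of_real ((cL2_norm \<mu> (E A f))\<^sup>2)"
  using inner_E_E[of A A f f] by (simp add: cL2_inner_self)

abbreviation \<nu> where "\<nu> f \<equiv> pvm_measure \<mu> \<Sigma> E f"

lemma sets_\<nu>[measurable_cong, simp]: "sets (\<nu> f) = sets \<Sigma>" and space_\<nu>[simp]: "space (\<nu> f) = space \<Sigma>"
  by (simp_all add: pvm_measure_def)

lemma emeasure_\<nu>:
  assumes f: "f \<in> cL2 \<mu>" and A: "A \<in> sets \<Sigma>"
  shows "emeasure (\<nu> f) A = ennreal ((cL2_norm \<mu> (E A f))\<^sup>2)"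
proof -
  let ?m = "\<lambda>A. ennreal (Re (cL2_inner \<mu> (E A f) f))"
  have eq: "Re (cL2_inner \<mu> (E A f) f) = (cL2_norm \<mu> (E A f))\<^sup>2" if "A \<in> sets \<Sigma>" for A
    using E_norm[OF that f] by simp
  have "emeasure (\<nu> f) A = ?m A"
  proof (rule emeasure_measure_of[OF pvm_measure_def])
    show "sets \<Sigma> \<subseteq> Pow (space \<Sigma>)" by (rule sets.space_closed)
    have "cL2_inner \<mu> (E {} f) f = cL2_inner \<mu> (\<lambda>x. 0) f"
      using E_empty[OF f] f by (intro cL2_inner_cong_left) (auto intro: E_cL2 cL2_zero)
    then show "positive (sets (\<nu> f)) ?m" by (simp add: positive_def cL2_inner_zero_left)
    show "countably_additive (sets (\<nu> f)) ?m"
    proof (rule countably_additiveI)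
      fix A :: "nat \<Rightarrow> 'z set" assume A: "range A \<subseteq> sets (\<nu> f)" "disjoint_family A" "(\<Union>i. A i) \<in> sets (\<nu> f)"
      have "(\<lambda>n. Re (cL2_inner \<mu> (E (A n) f) f)) sums Re (cL2_inner \<mu> (E (\<Union>n. A n) f) f)"
        using E_sums[of A f f] A f by (intro sums_Re) auto
      moreover have "0 \<le> Re (cL2_inner \<mu> (E (A n) f) f)" for n using A eq[of "A n"] by auto
      ultimately have "(\<lambda>n. ?m (A n)) sums ?m (\<Union>n. A n)" by (subst sums_ennreal) (use A eq in auto)
      then show "(\<Sum>i. ?m (A i)) = ?m (\<Union>i. A i)" by (rule sums_unique[symmetric])
    qed
  qed (use A in simp)
  then show ?thesis using eq[OF A] by simp
qed

lemma E_total_norm: "f \<in> cL2 \<mu> \<Longrightarrow> cL2_norm \<mu> (E (space \<Sigma>) f) = cL2_norm \<mu> f"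
  using E_space[of f] by (intro cL2_norm_cong E_cL2) auto

lemma finite_\<nu>: "f \<in> cL2 \<mu> \<Longrightarrow> finite_measure (\<nu> f)"
  by (rule finite_measureI) (simp add: emeasure_\<nu>)

lemma measure_\<nu>: "f \<in> cL2 \<mu> \<Longrightarrow> A \<in> sets \<Sigma> \<Longrightarrow> measure (\<nu> f) A = (cL2_norm \<mu> (E A f))\<^sup>2"
  by (simp add: measure_def emeasure_\<nu>)

lemma measure_\<nu>_space: "f \<in> cL2 \<mu> \<Longrightarrow> measure (\<nu> f) (space \<Sigma>) = (cL2_norm \<mu> f)\<^sup>2"
  by (simp add: measure_\<nu> E_total_norm)

lemma E_norm_le: "A \<in> sets \<Sigma> \<Longrightarrow> f \<in> cL2 \<mu> \<Longrightarrow> cL2_norm \<mu> (E A f) \<le> cL2_norm \<mu> f"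
proof -
  assume a: "A \<in> sets \<Sigma>" "f \<in> cL2 \<mu>"
  interpret finite_measure "\<nu> f" by (rule finite_\<nu>[OF a(2)])
  have "(cL2_norm \<mu> (E A f))\<^sup>2 \<le> (cL2_norm \<mu> f)\<^sup>2"
    using bounded_measure[of A] a by (simp add: measure_\<nu> E_total_norm)
  then show ?thesis by (rule power2_le_imp_le) (rule cL2_norm_nonneg)
qed

text \<open>
  Linearity is a consequence of symmetry.
\<close>

lemma E_linear:
  assumes A: "A \<in> sets \<Sigma>" and f: "f \<in> cL2 \<mu>" and u: "u \<in> cL2 \<mu>"
  shows "AE x in \<mu>. E A (\<lambda>x. f x + c * u x) x = E A f x + c * E A u x"
proof (rule AE_eq_of_inner_eq)
  fix v assume v: "v \<in> cL2 \<mu>"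
  have "cL2_inner \<mu> (E A (\<lambda>x. f x + c * u x)) v = cL2_inner \<mu> f (E A v) + c * cL2_inner \<mu> u (E A v)"
    using A f u v by (simp add: E_sym cL2_add cL2_scale cL2_inner_add_left cL2_inner_scale_left E_cL2)
  also have "\<dots> = cL2_inner \<mu> (\<lambda>x. E A f x + c * E A u x) v"
    using A f u v by (simp add: E_sym cL2_add cL2_scale cL2_inner_add_left cL2_inner_scale_left E_cL2)
  finally show "cL2_inner \<mu> (E A (\<lambda>x. f x + c * u x)) v = cL2_inner \<mu> (\<lambda>x. E A f x + c * E A u x) v" .
qed (use assms in \<open>auto intro!: E_cL2 cL2_add cL2_scale\<close>)

lemma E_cong_AE:
  assumes A: "A \<in> sets \<Sigma>" and f: "f \<in> cL2 \<mu>" "f' \<in> cL2 \<mu>" and eq: "AE x in \<mu>. f x = f' x"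
  shows "AE x in \<mu>. E A f x = E A f' x"
proof (rule AE_eq_of_inner_eq)
  fix v assume v: "v \<in> cL2 \<mu>"
  show "cL2_inner \<mu> (E A f) v = cL2_inner \<mu> (E A f') v"
    using cL2_inner_cong_left[OF f E_cL2[OF A v] eq] A f v by (simp add: E_sym)
qed (use assms in \<open>auto intro!: E_cL2\<close>)

lemma \<nu>_polarization:
  assumes A: "A \<in> sets \<Sigma>" and f: "f \<in> cL2 \<mu>" and u: "u \<in> cL2 \<mu>"
  shows "(1 / 4) * (\<Sum>j<4. \<i> ^ j * complex_of_real (measure (\<nu> (\<lambda>x. f x + \<i> ^ j * u x)) A)) = cL2_inner \<mu> (E A f) u"
proof -
  have eq: "measure (\<nu> (\<lambda>x. f x + \<i> ^ j * u x)) A = (cL2_norm \<mu> (\<lambda>x. E A f x + \<i> ^ j * E A u x))\<^sup>2" for j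
    using cL2_norm_cong[OF _ _ E_linear[OF A f u, of "\<i> ^ j"]] A f u by (simp add: measure_\<nu> cL2_add cL2_scale E_cL2)
  have "(1 / 4) * (\<Sum>j<4. \<i> ^ j * complex_of_real (measure (\<nu> (\<lambda>x. f x + \<i> ^ j * u x)) A)) = cL2_inner \<mu> (E A f) (E A u)"
    unfolding eq by (rule cL2_polarization(1)[OF E_cL2[OF A f] E_cL2[OF A u]])
  then show ?thesis using inner_E_E[OF A A f u] by simp
qed

text \<open>
  The integral depends on \<open>f\<close> and \<open>u\<close> only through the complex measure
  \<open>A \<mapsto> cL2_inner \<mu> (E A f) u\<close>.
\<close>

lemma pvm_integral_cong:
  assumes f: "f \<in> cL2 \<mu>" "f' \<in> cL2 \<mu>" and u: "u \<in> cL2 \<mu>" "u' \<in> cL2 \<mu>"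
    and eq: "\<And>A. A \<in> sets \<Sigma> \<Longrightarrow> cL2_inner \<mu> (E A f) u = cL2_inner \<mu> (E A f') u'"
    and i: "\<And>j. integrable (\<nu> (\<lambda>x. f x + \<i> ^ j * u x)) \<phi>" "\<And>j. integrable (\<nu> (\<lambda>x. f' x + \<i> ^ j * u' x)) \<phi>"
  shows "pvm_integral \<mu> \<Sigma> E \<phi> f u = pvm_integral \<mu> \<Sigma> E \<phi> f' u'"
proof -
  let ?m = "\<lambda>j. \<nu> (\<lambda>x. f x + \<i> ^ j * u x)" and ?m' = "\<lambda>j. \<nu> (\<lambda>x. f' x + \<i> ^ j * u' x)"
  have fin: "finite_measure (?m j)" "finite_measure (?m' j)" for j
    using f u by (auto intro!: finite_\<nu> cL2_add cL2_scale)
  have m: "measure (?m 0) A + measure (?m' 2) A = measure (?m 2) A + measure (?m' 0) A \<and>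
    measure (?m 1) A + measure (?m' 3) A = measure (?m 3) A + measure (?m' 1) A" if A: "A \<in> sets \<Sigma>" for A
  proof -
    define x where "x j = measure (?m j) A" for j
    define y where "y j = measure (?m' j) A" for j
    have "(1 / 4) * (\<Sum>j<4. \<i> ^ j * complex_of_real (x j)) = (1 / 4) * (\<Sum>j<4. \<i> ^ j * complex_of_real (y j))"
      unfolding x_def y_def \<nu>_polarization[OF A f(1) u(1)] \<nu>_polarization[OF A f(2) u(2)] by (rule eq[OF A])
    then have "x 0 + y 2 = x 2 + y 0 \<and> x 1 + y 3 = x 3 + y 1"
      unfolding sum_lessThan_4 i_powers by (simp add: complex_eq_iff)
    then show ?thesis by (simp only: x_def y_def)
  qed
  have I: "(LINT z|?m p. \<phi> z) + (LINT z|?m' q. \<phi> z) = (LINT z|?m q. \<phi> z) + (LINT z|?m' p. \<phi> z)"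
    if e: "\<And>A. A \<in> sets \<Sigma> \<Longrightarrow> measure (?m p) A + measure (?m' q) A = measure (?m q) A + measure (?m' p) A" for p q :: nat
    by (rule integral_eq_of_measure_sums[OF fin(1) fin(2) fin(1) fin(2) _ _ _ _ i(1) i(2) i(1) i(2)]) (simp_all add: e)
  have I02: "(LINT z|?m 0. \<phi> z) + (LINT z|?m' 2. \<phi> z) = (LINT z|?m 2. \<phi> z) + (LINT z|?m' 0. \<phi> z)"
    by (rule I) (use m in blast)
  have I13: "(LINT z|?m 1. \<phi> z) + (LINT z|?m' 3. \<phi> z) = (LINT z|?m 3. \<phi> z) + (LINT z|?m' 1. \<phi> z)"
    by (rule I) (use m in blast)
  have comb: "1 * a0 + \<i> * a1 + - 1 * a2 + - \<i> * a3 = 1 * b0 + \<i> * b1 + - 1 * b2 + - \<i> * b3"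
    if "a0 + b2 = a2 + b0" "a1 + b3 = a3 + b1" for a0 a1 a2 a3 b0 b1 b2 b3 :: complex
  proof -
    show ?thesis using that by algebra
  qed
  show ?thesis
    unfolding pvm_integral_def sum_lessThan_4 using comb[OF I02 I13] by (simp only: i_powers)
qed

text \<open>
  The range of the projection of \<open>B\<close>.
\<close>

definition supported :: "'z set \<Rightarrow> ('s \<Rightarrow> complex) \<Rightarrow> bool" where
  "supported B f \<longleftrightarrow> f \<in> cL2 \<mu> \<and> (AE x in \<mu>. E B f x = f x)"

lemma supported_E: "B \<in> sets \<Sigma> \<Longrightarrow> f \<in> cL2 \<mu> \<Longrightarrow> supported B (E B f)"
  using E_Int[of B B f] by (auto simp: supported_def E_cL2 elim: eventually_mono)

lemma supported_mono:
  assumes "supported A f" "A \<in> sets \<Sigma>" "B \<in> sets \<Sigma>" "A \<subseteq> B" shows "supported B f"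
proof -
  have f: "f \<in> cL2 \<mu>" "AE x in \<mu>. E A f x = f x" using assms by (auto simp: supported_def)
  have "AE x in \<mu>. E B (E A f) x = E B f x" by (rule E_cong_AE) (use assms f in \<open>auto intro: E_cL2\<close>)
  moreover have "AE x in \<mu>. E (B \<inter> A) f x = E B (E A f) x" using assms f by (intro E_Int)
  moreover have "B \<inter> A = A" using assms by auto
  ultimately have "AE x in \<mu>. E B (E A f) x = E B f x" "AE x in \<mu>. E A f x = E B (E A f) x" by simp_all
  then have "AE x in \<mu>. E B f x = f x" using f(2) by eventually_elim simp
  then show ?thesis using f by (simp add: supported_def)
qed

lemma supported_add:
  assumes B: "B \<in> sets \<Sigma>" and f: "supported B f" and u: "supported B u"
  shows "supported B (\<lambda>x. f x + c * u x)"
proof -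
  have "AE x in \<mu>. E B (\<lambda>x. f x + c * u x) x = E B f x + c * E B u x" using B f u by (intro E_linear) (auto simp: supported_def)
  moreover have "AE x in \<mu>. E B f x = f x" "AE x in \<mu>. E B u x = u x" using f u by (auto simp: supported_def)
  ultimately have "AE x in \<mu>. E B (\<lambda>x. f x + c * u x) x = f x + c * u x" by eventually_elim simp
  then show ?thesis using f u by (auto simp: supported_def intro!: cL2_add cL2_scale)
qed

lemma supported_sum:
  assumes B: "B \<in> sets \<Sigma>" and "finite I" "\<And>i. i \<in> I \<Longrightarrow> supported B (f i)"
  shows "supported B (\<lambda>x. \<Sum>i\<in>I. c i * f i x)"
  using assms(2,3)
proof (induction I rule: finite_induct)
  case empty
  have "AE x in \<mu>. E B (\<lambda>x. 0) x = (\<lambda>x. 0) x"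
    by (rule AE_eq_of_inner_eq) (auto intro!: E_cL2 B cL2_zero simp: E_sym B cL2_zero cL2_inner_zero_left)
  then show ?case by (simp add: supported_def cL2_zero)
next
  case (insert i I)
  have "supported B (\<lambda>x. (\<Sum>i\<in>I. c i * f i x) + c i * f i x)" using insert by (intro supported_add B) auto
  then show ?case using insert by (simp add: add.commute)
qed

lemma AE_supported:
  assumes B: "B \<in> sets \<Sigma>" and f: "supported B f"
  shows "AE z in \<nu> f. z \<in> B"
proof -
  have fL: "f \<in> cL2 \<mu>" and fB: "AE x in \<mu>. E B f x = f x" using f by (auto simp: supported_def)
  let ?C = "space \<Sigma> - B"
  have C: "?C \<in> sets \<Sigma>" using B by auto
  have "AE x in \<mu>. E ?C (E B f) x = E ?C f x" by (rule E_cong_AE) (use B C fL fB in \<open>auto intro: E_cL2\<close>)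
  moreover have "AE x in \<mu>. E (?C \<inter> B) f x = E ?C (E B f) x" using B C fL by (intro E_Int)
  moreover have "?C \<inter> B = {}" by auto
  moreover have "AE x in \<mu>. E {} f x = 0" by (rule E_empty[OF fL])
  ultimately have "AE x in \<mu>. E ?C (E B f) x = E ?C f x" "AE x in \<mu>. E {} f x = E ?C (E B f) x" "AE x in \<mu>. E {} f x = 0" by simp_all
  then have "AE x in \<mu>. E ?C f x = 0" by eventually_elim simp
  then have "cL2_norm \<mu> (E ?C f) = 0" using cL2_norm_eq_0_iff[OF E_cL2[OF C fL]] by simp
  then have "emeasure (\<nu> f) ?C = 0" by (simp add: emeasure_\<nu>[OF fL C])
  then show ?thesis by (intro AE_I[of _ _ ?C]) (use C in auto)
qed

end

section \<open>The generator on bounded parts of the spectrum\<close>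

locale spectral_pvm = pvm \<mu> Hminus_borel E
  for \<mu> :: "'s measure" and E :: "complex set \<Rightarrow> ('s \<Rightarrow> complex) \<Rightarrow> 's \<Rightarrow> complex" +
  fixes G :: "(('s \<Rightarrow> complex) \<times> ('s \<Rightarrow> complex)) set"
  assumes sr: "spectral_resolution \<mu> Hminus_borel G E"
    and dense: "densely_defined \<mu> G"
    and G_fst: "(f, k) \<in> G \<Longrightarrow> f \<in> cL2 \<mu>" and G_snd: "(f, k) \<in> G \<Longrightarrow> k \<in> cL2 \<mu>"
    and G_add: "(f, k) \<in> G \<Longrightarrow> (f', k') \<in> G \<Longrightarrow> ((\<lambda>x. f x + c * f' x), (\<lambda>x. k x + c * k' x)) \<in> G"
begin

lemma Domain_iff: "f \<in> Domain G \<longleftrightarrow> f \<in> cL2 \<mu> \<and> integrable (\<nu> f) (\<lambda>z. (cmod z)\<^sup>2)"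
  using sr unfolding spectral_resolution_def by auto

lemma G_inner: "(f, k) \<in> G \<Longrightarrow> u \<in> Domain G \<Longrightarrow> cL2_inner \<mu> k u = pvm_integral \<mu> Hminus_borel E (\<lambda>z. z) f u"
  using sr unfolding spectral_resolution_def by fast

lemma \<nu>_id_measurable: "(\<lambda>z. z) \<in> borel_measurable (\<nu> f)"
  using Hminus_id_measurable measurable_cong_sets[OF sets_\<nu> refl] by blast

lemma Domain_integrable:
  assumes "f \<in> Domain G" shows "integrable (\<nu> f) (\<lambda>z. z)"
proof -
  have f: "f \<in> cL2 \<mu>" "integrable (\<nu> f) (\<lambda>z. (cmod z)\<^sup>2)" using assms by (auto simp: Domain_iff)
  interpret finite_measure "\<nu> f" by (rule finite_\<nu>[OF f(1)])
  note [measurable] = \<nu>_id_measurable[of f]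
  have le: "cmod z \<le> \<bar>1 + (cmod z)\<^sup>2\<bar>" for z
  proof -
    have "0 \<le> (cmod z - 1 / 2)\<^sup>2" by simp
    then show ?thesis by (simp add: power2_diff power_divide)
  qed
  show ?thesis
    by (rule Bochner_Integration.integrable_bound[where f = "\<lambda>z. 1 + (cmod z)\<^sup>2"]) (use f(2) le in auto)
qed

lemma Domain_add: "f \<in> Domain G \<Longrightarrow> u \<in> Domain G \<Longrightarrow> (\<lambda>x. f x + c * u x) \<in> Domain G"
  using G_add by blast

lemma bounded_Domain:
  assumes B: "B \<in> sets Hminus_borel" "B \<subseteq> cball 0 K" and f: "supported B f"
  shows "f \<in> Domain G"
proof -
  have fL: "f \<in> cL2 \<mu>" using f by (simp add: supported_def)
  interpret finite_measure "\<nu> f" by (rule finite_\<nu>[OF fL])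
  note [measurable] = \<nu>_id_measurable[of f]
  have "integrable (\<nu> f) (\<lambda>z. (cmod z)\<^sup>2)"
  proof (rule integrable_const_bound[of _ "K\<^sup>2"])
    show "AE z in \<nu> f. norm ((cmod z)\<^sup>2) \<le> K\<^sup>2"
      using AE_supported[OF B(1) f]
    proof eventually_elim
      case (elim z)
      then have "cmod z \<le> K" using B(2) by auto
      then show ?case by (simp add: power_mono)
    qed
  qed measurable
  then show ?thesis using fL by (simp add: Domain_iff)
qed

lemma E_sum:
  assumes A: "A \<in> sets Hminus_borel" and f: "\<And>i. i \<in> I \<Longrightarrow> f i \<in> cL2 \<mu>"
  shows "AE x in \<mu>. E A (\<lambda>x. \<Sum>i\<in>I. c i * f i x) x = (\<Sum>i\<in>I. c i * E A (f i) x)"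
proof (rule AE_eq_of_inner_eq)
  have S: "(\<lambda>x. \<Sum>i\<in>I. c i * f i x) \<in> cL2 \<mu>" by (intro cL2_sum f)
  show "E A (\<lambda>x. \<Sum>i\<in>I. c i * f i x) \<in> cL2 \<mu>" by (rule E_cL2[OF A S])
  show "(\<lambda>x. \<Sum>i\<in>I. c i * E A (f i) x) \<in> cL2 \<mu>" by (intro cL2_sum E_cL2 A f)
  fix u assume u: "u \<in> cL2 \<mu>"
  have "cL2_inner \<mu> (E A (\<lambda>x. \<Sum>i\<in>I. c i * f i x)) u = (\<Sum>i\<in>I. c i * cL2_inner \<mu> (f i) (E A u))"
    unfolding E_sym[OF A S u] by (intro cL2_inner_sum_left f E_cL2 A u)
  also have "\<dots> = (\<Sum>i\<in>I. c i * cL2_inner \<mu> (E A (f i)) u)" using E_sym[OF A f u] by simp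
  also have "\<dots> = cL2_inner \<mu> (\<lambda>x. \<Sum>i\<in>I. c i * E A (f i) x) u"
    by (intro cL2_inner_sum_left[symmetric] E_cL2 A f u)
  finally show "cL2_inner \<mu> (E A (\<lambda>x. \<Sum>i\<in>I. c i * f i x)) u = cL2_inner \<mu> (\<lambda>x. \<Sum>i\<in>I. c i * E A (f i) x) u" .
qed

lemma supported_inner:
  assumes B: "B \<in> sets Hminus_borel" and f: "supported B f" and u: "u \<in> cL2 \<mu>" and A: "A \<in> sets Hminus_borel"
  shows "cL2_inner \<mu> (E A f) u = cL2_inner \<mu> (E A f) (E B u)"
proof -
  have fL: "f \<in> cL2 \<mu>" and fB: "AE x in \<mu>. E B f x = f x" using f by (auto simp: supported_def)
  have "AE x in \<mu>. E A (E B f) x = E A f x" by (rule E_cong_AE[OF A E_cL2[OF B fL] fL fB])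
  moreover have "AE x in \<mu>. E (A \<inter> B) f x = E A (E B f) x" by (rule E_Int[OF A B fL])
  ultimately have "AE x in \<mu>. E (A \<inter> B) f x = E A f x" by eventually_elim simp
  then have "cL2_inner \<mu> (E A f) u = cL2_inner \<mu> (E (A \<inter> B) f) u"
    using A B fL u by (intro cL2_inner_cong_left) (auto intro: E_cL2 elim: eventually_mono)
  then show ?thesis using inner_E_E[OF A B fL u] by simp
qed

text \<open>
  On functions supported in \<open>B\<close> the generator differs from the step function \<open>s\<close> of the
  resolution by an error of order \<open>\<epsilon>\<close>: both are integrals against the four measures of the
  polarization, of \<open>z\<close> and of \<open>s z\<close>. Polarization gives a bound by a sum of squares instead of
  a product.
\<close>

lemma cell_approximation_weak:
  assumes B: "B \<in> sets Hminus_borel" "B \<subseteq> cball 0 K"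
    and s: "s \<in> borel_measurable Hminus_borel" "finite (s ` B)"
    and close: "\<And>z. z \<in> B \<Longrightarrow> cmod (z - s z) \<le> \<epsilon>" and \<epsilon>: "0 \<le> \<epsilon>"
    and f: "supported B f" and fk: "(f, k) \<in> G" and u: "u \<in> Domain G"
    and A_def: "\<And>c. A c = {z\<in>B. s z = c}"
  shows "cmod (cL2_inner \<mu> (\<lambda>x. k x - (\<Sum>c\<in>s ` B. c * E (A c) f x)) u) \<le> \<epsilon> * ((cL2_norm \<mu> f)\<^sup>2 + (cL2_norm \<mu> u)\<^sup>2)"
proof -
  have BH: "B \<subseteq> Hminus" using sets.sets_into_space[OF B(1)] by (simp add: space_Hminus_borel)
  have A: "A c \<in> sets Hminus_borel" for c
  proof -
    have "s -` {c} \<inter> space Hminus_borel \<in> sets Hminus_borel" using s(1) by (rule measurable_sets) simp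
    then have "B \<inter> (s -` {c} \<inter> space Hminus_borel) \<in> sets Hminus_borel" using B(1) by auto
    also have "B \<inter> (s -` {c} \<inter> space Hminus_borel) = A c" using BH by (auto simp: A_def space_Hminus_borel)
    finally show ?thesis .
  qed
  have fL: "f \<in> cL2 \<mu>" and kL: "k \<in> cL2 \<mu>" using fk G_fst G_snd by auto
  have fD: "f \<in> Domain G" using fk by blast
  have uL: "u \<in> cL2 \<mu>" using u by (simp add: Domain_iff)
  \<comment> \<open>Only the component of \<open>u\<close> in \<open>B\<close> contributes, and it makes all four measures live on \<open>B\<close>.\<close>
  define u' where "u' = E B u"
  have u': "supported B u'" unfolding u'_def by (rule supported_E[OF B(1) uL])
  then have u'L: "u' \<in> cL2 \<mu>" by (simp add: supported_def)
  have u'D: "u' \<in> Domain G" by (rule bounded_Domain[OF B u'])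
  define w where "w j = (\<lambda>x. f x + \<i> ^ j * u' x)" for j :: nat
  have w: "supported B (w j)" for j unfolding w_def by (rule supported_add[OF B(1) f u'])
  then have wL: "w j \<in> cL2 \<mu>" for j by (simp add: supported_def)
  define \<sigma> where "\<sigma> z = (\<Sum>c\<in>s ` B. c * complex_of_real (indicator (A c) z))" for z
  have \<sigma>B: "\<sigma> z = s z" if "z \<in> B" for z
  proof -
    have "\<sigma> z = (\<Sum>c\<in>s ` B. if c = s z then c else 0)"
      unfolding \<sigma>_def using that by (intro sum.cong) (auto simp: A_def indicator_def)
    then show ?thesis using that s(2) by simp
  qed
  have \<sigma>m: "\<sigma> \<in> borel_measurable (\<nu> g)" for g
    unfolding \<sigma>_def using A by (intro borel_measurable_sum borel_measurable_times borel_measurable_const measurable_compose[OF _ borel_measurable_of_real] borel_measurable_indicator) auto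
  have i\<sigma>: "integrable (\<nu> (w j)) \<sigma>" for j
  proof -
    interpret finite_measure "\<nu> (w j)" by (rule finite_\<nu>[OF wL])
    show ?thesis unfolding \<sigma>_def
    proof (intro Bochner_Integration.integrable_sum integrable_mult_right integrable_of_real)
      fix c show "integrable (\<nu> (w j)) (indicator (A c) :: complex \<Rightarrow> real)"
        using A by (intro integrable_const_bound[of _ 1]) auto
    qed
  qed
  have i_id: "integrable (\<nu> (w j)) (\<lambda>z. z)" for j
    unfolding w_def by (intro Domain_integrable Domain_add fD u'D)
  have I\<sigma>: "(LINT z|\<nu> (w j). \<sigma> z) = (\<Sum>c\<in>s ` B. c * complex_of_real (measure (\<nu> (w j)) (A c)))" for j
  proof -
    interpret finite_measure "\<nu> (w j)" by (rule finite_\<nu>[OF wL])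
    have i: "integrable (\<nu> (w j)) (\<lambda>z. complex_of_real (indicator (A c) z))" for c
      using A by (intro integrable_of_real integrable_const_bound[of _ 1]) auto
    have "(LINT z|\<nu> (w j). \<sigma> z) = (\<Sum>c\<in>s ` B. LINT z|\<nu> (w j). c * complex_of_real (indicator (A c) z))"
      unfolding \<sigma>_def by (intro Bochner_Integration.integral_sum integrable_mult_right i)
    also have "\<dots> = (\<Sum>c\<in>s ` B. c * complex_of_real (measure (\<nu> (w j)) (A c)))"
    proof (rule sum.cong[OF refl])
      fix c
      have "(LINT z|\<nu> (w j). complex_of_real (indicator (A c) z)) = complex_of_real (measure (\<nu> (w j)) (A c \<inter> space (\<nu> (w j))))"
        by (simp only: integral_complex_of_real Bochner_Integration.integral_indicator)
      also have "A c \<inter> space (\<nu> (w j)) = A c" using sets.sets_into_space[OF A[of c]] by auto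
      finally show "(LINT z|\<nu> (w j). c * complex_of_real (indicator (A c) z)) = c * complex_of_real (measure (\<nu> (w j)) (A c))"
        by (simp only: integral_mult_right_zero)
    qed
    finally show ?thesis .
  qed
  have k_u: "cL2_inner \<mu> k u = (1 / 4) * (\<Sum>j<4. \<i> ^ j * (LINT z|\<nu> (w j). z))"
  proof -
    have "cL2_inner \<mu> k u = pvm_integral \<mu> Hminus_borel E (\<lambda>z. z) f u" by (rule G_inner[OF fk u])
    also have "\<dots> = pvm_integral \<mu> Hminus_borel E (\<lambda>z. z) f u'"
    proof (rule pvm_integral_cong[OF fL fL uL u'L])
      show "cL2_inner \<mu> (E A f) u = cL2_inner \<mu> (E A f) u'" if "A \<in> sets Hminus_borel" for A
        unfolding u'_def by (rule supported_inner[OF B(1) f uL that])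
    qed (intro Domain_integrable Domain_add fD u'D u)+
    finally show ?thesis unfolding pvm_integral_def w_def .
  qed
  have D_u: "cL2_inner \<mu> (\<lambda>x. \<Sum>c\<in>s ` B. c * E (A c) f x) u = (1 / 4) * (\<Sum>j<4. \<i> ^ j * (LINT z|\<nu> (w j). \<sigma> z))"
  proof -
    have "cL2_inner \<mu> (\<lambda>x. \<Sum>c\<in>s ` B. c * E (A c) f x) u = (\<Sum>c\<in>s ` B. c * cL2_inner \<mu> (E (A c) f) u)"
      by (intro cL2_inner_sum_left E_cL2 A fL uL)
    also have "\<dots> = (\<Sum>c\<in>s ` B. c * ((1 / 4) * (\<Sum>j<4. \<i> ^ j * complex_of_real (measure (\<nu> (w j)) (A c)))))"
    proof (rule sum.cong[OF refl])
      fix c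
      have "cL2_inner \<mu> (E (A c) f) u = cL2_inner \<mu> (E (A c) f) u'"
        unfolding u'_def by (rule supported_inner[OF B(1) f uL A])
      then show "c * cL2_inner \<mu> (E (A c) f) u = c * ((1 / 4) * (\<Sum>j<4. \<i> ^ j * complex_of_real (measure (\<nu> (w j)) (A c))))"
        unfolding w_def \<nu>_polarization[OF A fL u'L] by simp
    qed
    also have "\<dots> = (\<Sum>c\<in>s ` B. \<Sum>j<4. (1 / 4) * (\<i> ^ j * (c * complex_of_real (measure (\<nu> (w j)) (A c)))))"
      by (simp only: sum_distrib_left mult_ac)
    also have "\<dots> = (\<Sum>j<4. \<Sum>c\<in>s ` B. (1 / 4) * (\<i> ^ j * (c * complex_of_real (measure (\<nu> (w j)) (A c)))))"
      by (rule sum.swap)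
    also have "\<dots> = (1 / 4) * (\<Sum>j<4. \<i> ^ j * (LINT z|\<nu> (w j). \<sigma> z))"
      unfolding I\<sigma> by (simp only: sum_distrib_left)
    finally show ?thesis .
  qed
  have DL: "(\<lambda>x. \<Sum>c\<in>s ` B. c * E (A c) f x) \<in> cL2 \<mu>" by (intro cL2_sum E_cL2 A fL)
  have "cL2_inner \<mu> (\<lambda>x. k x - (\<Sum>c\<in>s ` B. c * E (A c) f x)) u = (1 / 4) * (\<Sum>j<4. \<i> ^ j * (LINT z|\<nu> (w j). z - \<sigma> z))"
    unfolding cL2_inner_diff_left[OF kL DL uL] k_u D_u
    by (simp add: Bochner_Integration.integral_diff[OF i_id i\<sigma>] right_diff_distrib sum_subtractf)
  also have "cmod \<dots> \<le> (1 / 4) * (\<Sum>j<4. cmod (LINT z|\<nu> (w j). z - \<sigma> z))"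
  proof -
    have "cmod (\<Sum>j<4. \<i> ^ j * (LINT z|\<nu> (w j). z - \<sigma> z)) \<le> (\<Sum>j<4. cmod (\<i> ^ j * (LINT z|\<nu> (w j). z - \<sigma> z)))" by (rule norm_sum)
    then show ?thesis by (simp add: norm_mult norm_power)
  qed
  also have "\<dots> \<le> (1 / 4) * (\<Sum>j<4. \<epsilon> * (cL2_norm \<mu> (w j))\<^sup>2)"
  proof (intro mult_left_mono sum_mono)
    fix j :: nat
    interpret finite_measure "\<nu> (w j)" by (rule finite_\<nu>[OF wL])
    have "cmod (LINT z|\<nu> (w j). z - \<sigma> z) \<le> (LINT z|\<nu> (w j). cmod (z - \<sigma> z))" by (rule integral_norm_bound)
    also have "\<dots> \<le> (LINT z|\<nu> (w j). \<epsilon>)"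
    proof (rule integral_mono_AE)
      show "AE z in \<nu> (w j). cmod (z - \<sigma> z) \<le> \<epsilon>"
        using AE_supported[OF B(1) w] by eventually_elim (simp add: \<sigma>B close)
    qed (use i_id i\<sigma> in auto)
    also have "\<dots> = \<epsilon> * (cL2_norm \<mu> (w j))\<^sup>2" using measure_\<nu>_space[OF wL[of j]] by simp
    finally show "cmod (LINT z|\<nu> (w j). z - \<sigma> z) \<le> \<epsilon> * (cL2_norm \<mu> (w j))\<^sup>2" .
  qed simp
  also have "\<dots> = \<epsilon> * ((cL2_norm \<mu> f)\<^sup>2 + (cL2_norm \<mu> u')\<^sup>2)"
    using cL2_polarization(2)[OF fL u'L] by (simp add: w_def sum_distrib_left[symmetric])
  also have "\<dots> \<le> \<epsilon> * ((cL2_norm \<mu> f)\<^sup>2 + (cL2_norm \<mu> u)\<^sup>2)"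
    unfolding u'_def using E_norm_le[OF B(1) uL] \<epsilon> by (intro mult_left_mono add_left_mono power_mono) (auto simp: cL2_norm_nonneg)
  finally show ?thesis .
qed

text \<open>
  The bound extends from the dense domain to all \<open>u\<close>. Since it is not homogeneous, inserting
  \<open>u = l * r\<close> and optimizing over \<open>l\<close> turns the sum of squares back into a product.
\<close>

lemma norm_le_of_form_bound:
  assumes r: "r \<in> cL2 \<mu>" and f: "0 \<le> F" and \<epsilon>: "0 \<le> \<epsilon>"
    and b: "\<And>u. u \<in> Domain G \<Longrightarrow> cmod (cL2_inner \<mu> r u) \<le> \<epsilon> * (F\<^sup>2 + (cL2_norm \<mu> u)\<^sup>2)"
  shows "cL2_norm \<mu> r \<le> 2 * \<epsilon> * F"
proof -
  have b2: "cmod (cL2_inner \<mu> r u) \<le> \<epsilon> * (F\<^sup>2 + (cL2_norm \<mu> u)\<^sup>2)" if u: "u \<in> cL2 \<mu>" for u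
  proof (rule tendsto_lowerbound)
    show "((\<lambda>e. \<epsilon> * (F\<^sup>2 + (cL2_norm \<mu> u + e)\<^sup>2) + cL2_norm \<mu> r * e) \<longlongrightarrow> \<epsilon> * (F\<^sup>2 + (cL2_norm \<mu> u)\<^sup>2)) (at_right 0)"
      by (auto intro!: tendsto_eq_intros)
    show "\<forall>\<^sub>F e in at_right 0. cmod (cL2_inner \<mu> r u) \<le> \<epsilon> * (F\<^sup>2 + (cL2_norm \<mu> u + e)\<^sup>2) + cL2_norm \<mu> r * e"
      using eventually_at_right_less[of 0]
    proof eventually_elim
      case (elim e)
      then obtain v where v: "v \<in> Domain G" "cL2_norm \<mu> (\<lambda>x. v x - u x) < e"
        using dense u unfolding densely_defined_def by blast
      have vL: "v \<in> cL2 \<mu>" using v(1) by (simp add: Domain_iff)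
      note vu = cL2_diff[OF vL u]
      have "cL2_norm \<mu> v \<le> cL2_norm \<mu> (\<lambda>x. v x - u x) + cL2_norm \<mu> u"
        using cL2_norm_triangle[OF vu u] by simp
      then have nv: "cL2_norm \<mu> v \<le> cL2_norm \<mu> u + e" using v(2) by simp
      have "cL2_inner \<mu> r u = cL2_inner \<mu> r v - cL2_inner \<mu> r (\<lambda>x. v x - u x)"
        using cL2_inner_diff_right[OF vL u r] by simp
      then have "cmod (cL2_inner \<mu> r u) \<le> cmod (cL2_inner \<mu> r v) + cmod (cL2_inner \<mu> r (\<lambda>x. v x - u x))"
        using norm_triangle_ineq4 by metis
      also have "\<dots> \<le> \<epsilon> * (F\<^sup>2 + (cL2_norm \<mu> v)\<^sup>2) + cL2_norm \<mu> r * cL2_norm \<mu> (\<lambda>x. v x - u x)"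
        by (intro add_mono b v(1) cL2_inner_bound r vu)
      also have "\<dots> \<le> \<epsilon> * (F\<^sup>2 + (cL2_norm \<mu> u + e)\<^sup>2) + cL2_norm \<mu> r * e"
        using nv v(2) \<epsilon> f by (intro add_mono mult_left_mono power_mono) (auto simp: cL2_norm_nonneg)
      finally show ?case .
    qed
  qed simp
  have key: "l * (cL2_norm \<mu> r)\<^sup>2 \<le> \<epsilon> * (F\<^sup>2 + l\<^sup>2 * (cL2_norm \<mu> r)\<^sup>2)" if "l > 0" for l
  proof -
    have "cmod (cL2_inner \<mu> r (\<lambda>x. complex_of_real l * r x)) = l * (cL2_norm \<mu> r)\<^sup>2"
      using that by (simp only: cL2_inner_scale_right cL2_inner_self norm_mult complex_cnj_complex_of_real norm_of_real) simp
    then show ?thesis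
      using b2[OF cL2_scale[OF r], of "complex_of_real l"] that by (simp add: cL2_norm_scale power_mult_distrib)
  qed
  show ?thesis
  proof (cases "cL2_norm \<mu> r = 0")
    case True then show ?thesis using f \<epsilon> by simp
  next
    case False
    then have rp: "cL2_norm \<mu> r > 0" using cL2_norm_nonneg[of \<mu> r] by simp
    show ?thesis
    proof (cases "F = 0")
      case True
      define l where "l = 1 / (2 * (\<epsilon> + 1))"
      have l: "l > 0" "\<epsilon> * l < 1" using \<epsilon> by (auto simp: l_def field_simps)
      have "l * (cL2_norm \<mu> r)\<^sup>2 \<le> (\<epsilon> * l) * (l * (cL2_norm \<mu> r)\<^sup>2)" using key[OF l(1)] True by (simp add: power2_eq_square mult_ac)
      also have "\<dots> < 1 * (l * (cL2_norm \<mu> r)\<^sup>2)" using l rp by (intro mult_strict_right_mono) auto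
      finally show ?thesis by simp
    next
      case False
      then have Fp: "F > 0" using f by simp
      have "F / cL2_norm \<mu> r * (cL2_norm \<mu> r)\<^sup>2 \<le> \<epsilon> * (F\<^sup>2 + (F / cL2_norm \<mu> r)\<^sup>2 * (cL2_norm \<mu> r)\<^sup>2)"
        using Fp rp by (intro key) auto
      then have "F * cL2_norm \<mu> r \<le> F * (2 * \<epsilon> * F)" using rp by (simp add: power2_eq_square field_simps)
      then show ?thesis using Fp by simp
    qed
  qed
qed

lemma cell_approximation:
  assumes B: "B \<in> sets Hminus_borel" "B \<subseteq> cball 0 K"
    and s: "s \<in> borel_measurable Hminus_borel" "finite (s ` B)"
    and close: "\<And>z. z \<in> B \<Longrightarrow> cmod (z - s z) \<le> \<epsilon>" and \<epsilon>: "0 \<le> \<epsilon>"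
    and f: "supported B f" and fk: "(f, k) \<in> G" and A_def: "\<And>c. A c = {z\<in>B. s z = c}" and A: "\<And>c. A c \<in> sets Hminus_borel"
  shows "cL2_norm \<mu> (\<lambda>x. k x - (\<Sum>c\<in>s ` B. c * E (A c) f x)) \<le> 2 * \<epsilon> * cL2_norm \<mu> f"
  using G_fst[OF fk] G_snd[OF fk]
  by (intro norm_le_of_form_bound cell_approximation_weak[OF B s close \<epsilon> f fk _ A_def] cL2_diff cL2_sum E_cL2 A cL2_norm_nonneg \<epsilon>)

end

section \<open>The semigroup in terms of the resolution\<close>

lemma exp_lipschitz_left_half_plane:
  assumes "Re a \<le> 0" "Re b \<le> 0" shows "cmod (exp a - exp b) \<le> cmod (a - b)"
proof -
  have "cmod (exp a - exp b) \<le> 1 * cmod (a - b)"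
  proof (rule field_differentiable_bound[of "{z. Re z \<le> 0}" exp exp])
    show "convex {z. Re z \<le> 0}" by (rule convex_halfspace_Re_le)
  qed (use assms in \<open>auto intro: DERIV_exp has_field_derivative_at_within\<close>)
  then show ?thesis by simp
qed

context stationary_markov_process begin

abbreviation "gen \<equiv> generator \<pi> T"

lemma T_add:
  assumes t: "t \<ge> 0" and f: "f \<in> cL2 \<pi>" and k: "k \<in> cL2 \<pi>"
  shows "AE x in \<pi>. T t (\<lambda>x. f x + c * k x) x = T t f x + c * T t k x"
proof -
  have "AE x in \<pi>. T t (\<lambda>x. \<Sum>i\<in>{0, 1::nat}. (if i = 0 then 1 else c) * (if i = 0 then f else k) x) x
    = (\<Sum>i\<in>{0, 1::nat}. (if i = 0 then 1 else c) * T t (if i = 0 then f else k) x)"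
    by (rule T_sum[OF t]) (use f k in auto)
  then show ?thesis by simp
qed

lemma T_zero_time:
  assumes f: "f \<in> cL2 \<pi>" shows "AE x in \<pi>. T 0 f x = f x"
proof (rule AE_eq_of_inner_eq)
  have z: "(0::real) \<le> 0" by simp
  show "T 0 f \<in> cL2 \<pi>" by (rule T_cL2[OF z f])
  show "cL2_inner \<pi> (T 0 f) u = cL2_inner \<pi> f u" if u: "u \<in> cL2 \<pi>" for u
    unfolding T_inner[OF z f u] by (rule comp_inner[OF z f u])
qed (rule f)

lemma T_norm_diff:
  assumes t: "t \<ge> 0" and f: "f \<in> cL2 \<pi>" and k: "k \<in> cL2 \<pi>"
  shows "cL2_norm \<pi> (\<lambda>x. T t f x - T t k x) \<le> cL2_norm \<pi> (\<lambda>x. f x - k x)"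
proof -
  have d: "(\<lambda>x. f x + (- 1) * k x) \<in> cL2 \<pi>" by (intro cL2_add cL2_scale f k)
  have "cL2_norm \<pi> (\<lambda>x. T t f x - T t k x) = cL2_norm \<pi> (T t (\<lambda>x. f x + (- 1) * k x))"
  proof (rule cL2_norm_cong_AE)
    show "AE x in \<pi>. T t f x - T t k x = T t (\<lambda>x. f x + (- 1) * k x) x"
      using T_add[OF t f k, of "- 1"] by eventually_elim simp
  qed (auto intro!: cL2_measurable cL2_diff T_cL2 t f k d)
  also have "\<dots> \<le> cL2_norm \<pi> (\<lambda>x. f x + (- 1) * k x)" by (rule T_contraction[OF t d])
  finally show ?thesis by simp
qed

text \<open>
  The generator is linear because the transition operators are, up to null sets.
\<close>

lemma gen_add:
  assumes fk: "(f, k) \<in> gen" and fk': "(f', k') \<in> gen"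
  shows "((\<lambda>x. f x + c * f' x), (\<lambda>x. k x + c * k' x)) \<in> gen"
proof -
  have f: "f \<in> cL2 \<pi>" "k \<in> cL2 \<pi>" "f' \<in> cL2 \<pi>" "k' \<in> cL2 \<pi>" using assms by (auto simp: generator_def)
  let ?q = "\<lambda>f k t x. (T t f x - f x) / complex_of_real t - k x"
  have qL: "?q f k t \<in> cL2 \<pi>" if "t \<ge> 0" "f \<in> cL2 \<pi>" "k \<in> cL2 \<pi>" for f k t
    using cL2_diff[OF cL2_scale[OF cL2_diff[OF T_cL2[OF that(1,2)] that(2)], of "1 / complex_of_real t"] that(3)] by simp
  have lim: "((\<lambda>t. cL2_norm \<pi> (?q f k t)) \<longlongrightarrow> 0) (at_right 0)" "((\<lambda>t. cL2_norm \<pi> (?q f' k' t)) \<longlongrightarrow> 0) (at_right 0)"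
    using assms by (auto simp: generator_def)
  have "((\<lambda>t. cL2_norm \<pi> (?q (\<lambda>x. f x + c * f' x) (\<lambda>x. k x + c * k' x) t)) \<longlongrightarrow> 0) (at_right 0)"
  proof (rule tendsto_sandwich[OF _ _ tendsto_const])
    show "((\<lambda>t. cL2_norm \<pi> (?q f k t) + cmod c * cL2_norm \<pi> (?q f' k' t)) \<longlongrightarrow> 0) (at_right 0)"
      using tendsto_add[OF lim(1) tendsto_mult_left[OF lim(2), of "cmod c"]] by simp
    show "\<forall>\<^sub>F t in at_right 0. cL2_norm \<pi> (?q (\<lambda>x. f x + c * f' x) (\<lambda>x. k x + c * k' x) t)
      \<le> cL2_norm \<pi> (?q f k t) + cmod c * cL2_norm \<pi> (?q f' k' t)"
      using eventually_at_right_less[of 0]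
    proof eventually_elim
      case (elim t)
      then have t: "0 \<le> t" by simp
      have "cL2_norm \<pi> (?q (\<lambda>x. f x + c * f' x) (\<lambda>x. k x + c * k' x) t) = cL2_norm \<pi> (\<lambda>x. ?q f k t x + c * ?q f' k' t x)"
      proof (rule cL2_norm_cong_AE)
        show "AE x in \<pi>. ?q (\<lambda>x. f x + c * f' x) (\<lambda>x. k x + c * k' x) t x = ?q f k t x + c * ?q f' k' t x"
          using T_add[OF t f(1,3), of c] by eventually_elim (use elim in \<open>simp add: field_simps\<close>)
      qed (auto intro!: cL2_measurable cL2_add cL2_scale qL[OF t] f)
      also have "\<dots> \<le> cL2_norm \<pi> (?q f k t) + cL2_norm \<pi> (\<lambda>x. c * ?q f' k' t x)"
        by (intro cL2_norm_triangle cL2_scale qL t f)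
      finally show ?case by (simp only: cL2_norm_scale)
    qed
  qed (simp add: cL2_norm_nonneg)
  then show ?thesis using f by (auto simp: generator_def intro: cL2_add cL2_scale)
qed

end

locale markov_spectral = stationary_markov_process M F \<pi> \<xi>
  for M :: "'a measure" and F and \<pi> :: "'s measure" and \<xi> +
  fixes E :: "complex set \<Rightarrow> ('s \<Rightarrow> complex) \<Rightarrow> 's \<Rightarrow> complex"
  assumes spec: "spectral_resolution \<pi> Hminus_borel (generator \<pi> (transition_op M \<pi> \<xi>)) E"
    and dense_gen: "densely_defined \<pi> (generator \<pi> (transition_op M \<pi> \<xi>))"
begin

sublocale spectral_pvm \<pi> E gen
proof
  show "projection_valued_measure \<pi> Hminus_borel E" using spec by (simp add: spectral_resolution_def)
qed (use spec dense_gen gen_add in \<open>auto simp: generator_def\<close>)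

lemma gen_sum:
  assumes "finite I" "\<And>i. i \<in> I \<Longrightarrow> (f i, k i) \<in> gen"
  shows "((\<lambda>x. \<Sum>i\<in>I. c i * f i x), (\<lambda>x. \<Sum>i\<in>I. c i * k i x)) \<in> gen"
  using assms
proof (induction I rule: finite_induct)
  case empty
  obtain f where "f \<in> Domain gen" using dense_gen cL2_zero unfolding densely_defined_def by (metis zero_less_one)
  then obtain k where "(f, k) \<in> gen" by blast
  from gen_add[OF this this, of "- 1"] show ?case by simp
next
  case (insert i I)
  have "((\<lambda>x. (\<Sum>i\<in>I. c i * f i x) + c i * f i x), (\<lambda>x. (\<Sum>i\<in>I. c i * k i x) + c i * k i x)) \<in> gen"
    using insert by (intro gen_add) auto
  then show ?case using insert by (simp add: add.commute)
qed

context
  \<comment> \<open>A bounded part \<open>B\<close> of the spectrum, cut into the finitely many cells on which \<open>s\<close> is constant.\<close>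
  fixes g :: "'s \<Rightarrow> complex" and B :: "complex set" and K :: real and s :: "complex \<Rightarrow> complex" and \<epsilon> :: real
  assumes g: "g \<in> cL2 \<pi>" and B: "B \<in> sets Hminus_borel" "B \<subseteq> cball 0 K"
    and s: "s \<in> borel_measurable Hminus_borel" "finite (s ` B)"
    and close: "\<And>z. z \<in> B \<Longrightarrow> cmod (z - s z) \<le> \<epsilon>" and \<epsilon>: "0 \<le> \<epsilon>"
    and Re_s: "\<And>z. z \<in> B \<Longrightarrow> Re (s z) \<le> 0"
begin

definition cell :: "complex \<Rightarrow> complex set" where "cell c = {z\<in>B. s z = c}"
definition part :: "complex \<Rightarrow> 's \<Rightarrow> complex" where "part c = E (cell c) g"

lemma B_Hminus: "B \<subseteq> Hminus"
  using sets.sets_into_space[OF B(1)] by (simp add: space_Hminus_borel)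

lemma cell_sets: "cell c \<in> sets Hminus_borel"
proof -
  have "s -` {c} \<inter> space Hminus_borel \<in> sets Hminus_borel" using s(1) by (rule measurable_sets) simp
  then have "B \<inter> (s -` {c} \<inter> space Hminus_borel) \<in> sets Hminus_borel" using B(1) by auto
  also have "B \<inter> (s -` {c} \<inter> space Hminus_borel) = cell c" using B_Hminus by (auto simp: cell_def space_Hminus_borel)
  finally show ?thesis .
qed

lemma part_cL2: "part c \<in> cL2 \<pi>" unfolding part_def by (rule E_cL2[OF cell_sets g])

lemma part_supported: "supported B (part c)"
  by (rule supported_mono[OF supported_E[OF cell_sets g, of c, folded part_def] cell_sets B(1)]) (auto simp: cell_def)

lemma part_Domain: "part c \<in> Domain gen" by (rule bounded_Domain[OF B part_supported])

text \<open>
  The generator applied to \<open>part c\<close>; it is nearly \<open>c\<close> times \<open>part c\<close>.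
\<close>

definition img :: "complex \<Rightarrow> 's \<Rightarrow> complex" where "img c = (SOME k. (part c, k) \<in> gen)"

lemma part_img: "(part c, img c) \<in> gen"
  unfolding img_def using part_Domain[of c] by (intro someI_ex[of "\<lambda>k. (part c, k) \<in> gen"]) blast

lemma img_cL2: "img c \<in> cL2 \<pi>" using G_snd[OF part_img] .

lemma part_inner: "cL2_inner \<pi> (part c) (part d) = (if c = d then complex_of_real (measure (\<nu> g) (cell c)) else 0)"
proof (cases "c = d")
  case True
  then show ?thesis using measure_\<nu>[OF g cell_sets] by (simp add: cL2_inner_self part_def)
next
  case False
  have "cL2_inner \<pi> (part c) (part d) = cL2_inner \<pi> (E (cell c \<inter> cell d) g) g" unfolding part_def by (rule inner_E_E[OF cell_sets cell_sets g g])
  also have "cell c \<inter> cell d = {}" using False by (auto simp: cell_def)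
  also have "cL2_inner \<pi> (E {} g) g = cL2_inner \<pi> (\<lambda>x. 0) g"
    using E_empty[OF g] by (intro cL2_inner_cong_left) (auto intro: E_cL2 g cL2_zero)
  finally show ?thesis using False by (simp add: cL2_inner_zero_left)
qed

lemma part_inner_g: "cL2_inner \<pi> (part c) g = complex_of_real (measure (\<nu> g) (cell c))"
  unfolding part_def using E_norm[OF cell_sets g] measure_\<nu>[OF g cell_sets] by simp

definition comb :: "(complex \<Rightarrow> complex) \<Rightarrow> 's \<Rightarrow> complex" where
  "comb a = (\<lambda>x. \<Sum>c\<in>s ` B. a c * part c x)"

lemma comb_cL2: "comb a \<in> cL2 \<pi>" unfolding comb_def by (intro cL2_sum part_cL2)

lemma measure_cells: "(\<Sum>c\<in>s ` B. measure (\<nu> g) (cell c)) = measure (\<nu> g) B"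
proof -
  interpret finite_measure "\<nu> g" by (rule finite_\<nu>[OF g])
  have "measure (\<nu> g) (\<Union>c\<in>s ` B. cell c) = (\<Sum>c\<in>s ` B. measure (\<nu> g) (cell c))"
    using cell_sets s(2) by (intro finite_measure_finite_Union) (auto simp: disjoint_family_on_def cell_def)
  also have "(\<Union>c\<in>s ` B. cell c) = B" by (auto simp: cell_def)
  finally show ?thesis ..
qed

text \<open>
  The parts are orthogonal.
\<close>

lemma comb_norm:
  assumes a: "\<And>c. c \<in> s ` B \<Longrightarrow> cmod (a c) \<le> 1" shows "cL2_norm \<pi> (comb a) \<le> cL2_norm \<pi> g"
proof -
  interpret finite_measure "\<nu> g" by (rule finite_\<nu>[OF g])
  have "complex_of_real ((cL2_norm \<pi> (comb a))\<^sup>2) = (\<Sum>c\<in>s ` B. a c * cL2_inner \<pi> (part c) (comb a))"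
    unfolding cL2_inner_self[symmetric] by (subst (1) comb_def) (intro cL2_inner_sum_left part_cL2 comb_cL2)
  also have "\<dots> = (\<Sum>c\<in>s ` B. a c * (\<Sum>d\<in>s ` B. cnj (a d) * cL2_inner \<pi> (part c) (part d)))"
    unfolding comb_def by (subst cL2_inner_sum_right) (auto intro: part_cL2)
  also have "\<dots> = (\<Sum>c\<in>s ` B. complex_of_real ((cmod (a c))\<^sup>2 * measure (\<nu> g) (cell c)))"
  proof (rule sum.cong[OF refl])
    fix c assume c: "c \<in> s ` B"
    have "(\<Sum>d\<in>s ` B. cnj (a d) * cL2_inner \<pi> (part c) (part d)) = (\<Sum>d\<in>s ` B. if d = c then cnj (a c) * complex_of_real (measure (\<nu> g) (cell c)) else 0)"
      by (intro sum.cong) (auto simp: part_inner)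
    also have "\<dots> = cnj (a c) * complex_of_real (measure (\<nu> g) (cell c))" using c s(2) by simp
    finally have "a c * (\<Sum>d\<in>s ` B. cnj (a d) * cL2_inner \<pi> (part c) (part d)) = (a c * cnj (a c)) * complex_of_real (measure (\<nu> g) (cell c))"
      by (simp only: mult.assoc)
    then show "a c * (\<Sum>d\<in>s ` B. cnj (a d) * cL2_inner \<pi> (part c) (part d)) = complex_of_real ((cmod (a c))\<^sup>2 * measure (\<nu> g) (cell c))"
      by (simp only: complex_norm_square[symmetric] of_real_mult)
  qed
  finally have "(cL2_norm \<pi> (comb a))\<^sup>2 = (\<Sum>c\<in>s ` B. (cmod (a c))\<^sup>2 * measure (\<nu> g) (cell c))"
    by (simp only: of_real_sum[symmetric] of_real_eq_iff)
  also have "\<dots> \<le> (\<Sum>c\<in>s ` B. 1 * measure (\<nu> g) (cell c))"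
    using a by (intro sum_mono mult_right_mono) (auto simp: power_le_one)
  also have "\<dots> \<le> (cL2_norm \<pi> g)\<^sup>2" using measure_cells bounded_measure[of B] measure_\<nu>_space[OF g] by simp
  finally show ?thesis by (rule power2_le_imp_le) (rule cL2_norm_nonneg)
qed

lemma comb_generator_error:
  assumes a: "\<And>c. c \<in> s ` B \<Longrightarrow> cmod (a c) \<le> 1"
  shows "cL2_norm \<pi> (\<lambda>x. \<Sum>c\<in>s ` B. a c * (img c x - c * part c x)) \<le> 2 * \<epsilon> * cL2_norm \<pi> g"
proof -
  define k where "k = (\<lambda>x. \<Sum>c\<in>s ` B. a c * img c x)"
  have G: "(comb a, k) \<in> gen" unfolding comb_def k_def by (intro gen_sum s(2) part_img)
  have kL: "k \<in> cL2 \<pi>" by (rule G_snd[OF G])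
  have sup: "supported B (comb a)" unfolding comb_def by (intro supported_sum B(1) s(2) part_supported)
  have "AE x in \<pi>. \<forall>c\<in>s ` B. E (cell c) (comb a) x = a c * part c x"
  proof (subst AE_finite_all[OF s(2)], rule ballI)
    fix c assume c: "c \<in> s ` B"
    have 1: "AE x in \<pi>. E (cell c) (comb a) x = (\<Sum>d\<in>s ` B. a d * E (cell c) (part d) x)"
      unfolding comb_def by (intro E_sum cell_sets part_cL2)
    have 2: "AE x in \<pi>. \<forall>d\<in>s ` B. E (cell c) (part d) x = (if d = c then part c x else 0)"
    proof (subst AE_finite_all[OF s(2)], rule ballI)
      fix d
      have i: "AE x in \<pi>. E (cell c \<inter> cell d) g x = E (cell c) (part d) x" unfolding part_def by (rule E_Int[OF cell_sets cell_sets g])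
      show "AE x in \<pi>. E (cell c) (part d) x = (if d = c then part c x else 0)"
      proof (cases "d = c")
        case True
        then show ?thesis using i by (simp add: part_def) (erule eventually_mono, simp)
      next
        case False
        then have "cell c \<inter> cell d = {}" by (auto simp: cell_def)
        then have i': "AE x in \<pi>. E {} g x = E (cell c) (part d) x" using i by simp
        show ?thesis using i' E_empty[OF g] by eventually_elim (use False in simp)
      qed
    qed
    show "AE x in \<pi>. E (cell c) (comb a) x = a c * part c x"
      using 1 2
    proof eventually_elim
      case (elim x)
      have "(\<Sum>d\<in>s ` B. a d * E (cell c) (part d) x) = (\<Sum>d\<in>s ` B. if d = c then a c * part c x else 0)"
        using elim(2) by (intro sum.cong) auto
      then show ?case using elim(1) c s(2) by simp
    qed
  qed
  then have "AE x in \<pi>. (\<Sum>c\<in>s ` B. a c * (img c x - c * part c x)) = k x - (\<Sum>c\<in>s ` B. c * E (cell c) (comb a) x)"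
  proof eventually_elim
    case (elim x)
    then have "(\<Sum>c\<in>s ` B. c * E (cell c) (comb a) x) = (\<Sum>c\<in>s ` B. c * (a c * part c x))" by (intro sum.cong) auto
    then show ?case by (simp add: k_def right_diff_distrib sum_subtractf mult_ac)
  qed
  then have "cL2_norm \<pi> (\<lambda>x. \<Sum>c\<in>s ` B. a c * (img c x - c * part c x)) = cL2_norm \<pi> (\<lambda>x. k x - (\<Sum>c\<in>s ` B. c * E (cell c) (comb a) x))"
    by (intro cL2_norm_cong) (auto intro!: cL2_sum cL2_diff cL2_scale img_cL2 part_cL2 kL E_cL2 cell_sets comb_cL2)
  also have "\<dots> \<le> 2 * \<epsilon> * cL2_norm \<pi> (comb a)"
    by (rule cell_approximation[OF B s close \<epsilon> sup G]) (auto simp: cell_def intro: cell_sets[unfolded cell_def])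
  also have "\<dots> \<le> 2 * \<epsilon> * cL2_norm \<pi> g" using comb_norm[OF a] \<epsilon> by (intro mult_left_mono) auto
  finally show ?thesis .
qed

text \<open>
  What is lost per unit of time when, over a time \<open>h\<close>, the semigroup and the exponentials are
  replaced by their first order expansions.
\<close>

definition step_error :: "real \<Rightarrow> real" where
  "step_error h = (\<Sum>c\<in>s ` B. cL2_norm \<pi> (\<lambda>x. (T h (part c) x - part c x) / complex_of_real h - img c x)
     + cmod ((exp (c * complex_of_real h) - 1) / complex_of_real h - c) * cL2_norm \<pi> (part c))"

lemma step_error_tendsto: "(step_error \<longlongrightarrow> 0) (at_right 0)"
proof -
  have e: "((\<lambda>h. (exp (c * complex_of_real h) - 1) / complex_of_real h) \<longlongrightarrow> c) (at_right 0)" for c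
  proof -
    have "((\<lambda>z. exp (c * z)) has_field_derivative c * exp (c * 0)) (at 0)" by (auto intro!: derivative_eq_intros)
    then have "((\<lambda>z. (exp (c * z) - 1) / z) \<longlongrightarrow> c) (at 0)" by (simp add: DERIV_def)
    moreover have "filterlim complex_of_real (at 0) (at_right 0)"
      by (auto simp: filterlim_at intro!: tendsto_eq_intros eventually_at_rightI[of 0 1])
    ultimately show ?thesis by (rule filterlim_compose)
  qed
  have "(step_error \<longlongrightarrow> (\<Sum>c\<in>s ` B. 0 + cmod (c - c) * cL2_norm \<pi> (part c))) (at_right 0)"
    unfolding step_error_def[abs_def]
  proof (intro tendsto_sum tendsto_add tendsto_mult tendsto_norm tendsto_diff e tendsto_const)
    fix c show "((\<lambda>h. cL2_norm \<pi> (\<lambda>x. (T h (part c) x - part c x) / complex_of_real h - img c x)) \<longlongrightarrow> 0) (at_right 0)"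
      using part_img[of c] by (auto simp: generator_def)
  qed
  then show ?thesis by simp
qed

text \<open>
  The difference is split into the error of the expansion of the semigroup, the error of
  replacing the generator by multiplication on each cell, and the error of the expansion of
  the exponentials. The second one is estimated for all cells together, as a sum over cells
  would lose their orthogonality.
\<close>

lemma one_step:
  assumes h: "h > 0" and a: "\<And>c. c \<in> s ` B \<Longrightarrow> cmod (a c) \<le> 1"
  shows "cL2_norm \<pi> (\<lambda>x. T h (comb a) x - comb (\<lambda>c. exp (c * complex_of_real h) * a c) x)
    \<le> h * (2 * \<epsilon> * cL2_norm \<pi> g + step_error h)"
proof -
  let ?I = "s ` B"
  let ?q = "\<lambda>c x. (T h (part c) x - part c x) / complex_of_real h - img c x"
  let ?r = "\<lambda>c. c - (exp (c * complex_of_real h) - 1) / complex_of_real h"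
  have h0: "0 \<le> h" using h by simp
  have qL: "?q c \<in> cL2 \<pi>" for c
    using cL2_diff[OF cL2_scale[OF cL2_diff[OF T_cL2[OF h0 part_cL2] part_cL2], of "1 / complex_of_real h"] img_cL2] by simp
  have L1: "(\<lambda>x. \<Sum>c\<in>?I. a c * ?q c x) \<in> cL2 \<pi>" by (intro cL2_sum qL)
  have L2: "(\<lambda>x. \<Sum>c\<in>?I. a c * (img c x - c * part c x)) \<in> cL2 \<pi>" by (intro cL2_sum cL2_diff cL2_scale img_cL2 part_cL2)
  have L3: "(\<lambda>x. \<Sum>c\<in>?I. (a c * ?r c) * part c x) \<in> cL2 \<pi>" by (intro cL2_sum part_cL2)
  have "AE x in \<pi>. T h (comb a) x = (\<Sum>c\<in>?I. a c * T h (part c) x)"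
    unfolding comb_def by (intro T_sum h0 part_cL2)
  then have "AE x in \<pi>. T h (comb a) x - comb (\<lambda>c. exp (c * complex_of_real h) * a c) x =
     complex_of_real h * (((\<Sum>c\<in>?I. a c * ?q c x) + (\<Sum>c\<in>?I. a c * (img c x - c * part c x))) + (\<Sum>c\<in>?I. (a c * ?r c) * part c x))"
  proof eventually_elim
    case (elim x)
    have "complex_of_real h * (((\<Sum>c\<in>?I. a c * ?q c x) + (\<Sum>c\<in>?I. a c * (img c x - c * part c x))) + (\<Sum>c\<in>?I. (a c * ?r c) * part c x))
      = (\<Sum>c\<in>?I. complex_of_real h * (a c * ?q c x + a c * (img c x - c * part c x) + (a c * ?r c) * part c x))"
      by (simp only: sum.distrib[symmetric] sum_distrib_left)
    also have "\<dots> = (\<Sum>c\<in>?I. a c * T h (part c) x - exp (c * complex_of_real h) * a c * part c x)"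
      using h by (intro sum.cong) (auto simp: field_simps)
    finally show ?case using elim by (simp add: comb_def sum_subtractf)
  qed
  then have "cL2_norm \<pi> (\<lambda>x. T h (comb a) x - comb (\<lambda>c. exp (c * complex_of_real h) * a c) x) =
    cL2_norm \<pi> (\<lambda>x. complex_of_real h * (((\<Sum>c\<in>?I. a c * ?q c x) + (\<Sum>c\<in>?I. a c * (img c x - c * part c x))) + (\<Sum>c\<in>?I. (a c * ?r c) * part c x)))"
    by (intro cL2_norm_cong) (auto intro!: cL2_diff T_cL2 h0 comb_cL2 cL2_scale cL2_add L1 L2 L3)
  also have "\<dots> = h * cL2_norm \<pi> (\<lambda>x. ((\<Sum>c\<in>?I. a c * ?q c x) + (\<Sum>c\<in>?I. a c * (img c x - c * part c x))) + (\<Sum>c\<in>?I. (a c * ?r c) * part c x))"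
    using h by (simp only: cL2_norm_scale norm_of_real abs_of_pos)
  also have "\<dots> \<le> h * ((cL2_norm \<pi> (\<lambda>x. \<Sum>c\<in>?I. a c * ?q c x) + cL2_norm \<pi> (\<lambda>x. \<Sum>c\<in>?I. a c * (img c x - c * part c x))) + cL2_norm \<pi> (\<lambda>x. \<Sum>c\<in>?I. (a c * ?r c) * part c x))"
    using h0 by (intro mult_left_mono order_trans[OF cL2_norm_triangle[OF cL2_add[OF L1 L2] L3]] add_right_mono cL2_norm_triangle L1 L2)
  also have "\<dots> \<le> h * (((\<Sum>c\<in>?I. cL2_norm \<pi> (?q c)) + 2 * \<epsilon> * cL2_norm \<pi> g) + (\<Sum>c\<in>?I. cmod (- ?r c) * cL2_norm \<pi> (part c)))"
  proof (intro mult_left_mono add_mono comb_generator_error a)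
    have "cL2_norm \<pi> (\<lambda>x. \<Sum>c\<in>?I. a c * ?q c x) \<le> (\<Sum>c\<in>?I. cmod (a c) * cL2_norm \<pi> (?q c))" by (rule cL2_norm_sum_le[OF s(2) qL])
    also have "\<dots> \<le> (\<Sum>c\<in>?I. 1 * cL2_norm \<pi> (?q c))" using a by (intro sum_mono mult_right_mono) (auto simp: cL2_norm_nonneg)
    finally show "cL2_norm \<pi> (\<lambda>x. \<Sum>c\<in>?I. a c * ?q c x) \<le> (\<Sum>c\<in>?I. cL2_norm \<pi> (?q c))" by simp
    have "cL2_norm \<pi> (\<lambda>x. \<Sum>c\<in>?I. (a c * ?r c) * part c x) \<le> (\<Sum>c\<in>?I. cmod (a c * ?r c) * cL2_norm \<pi> (part c))" by (rule cL2_norm_sum_le[OF s(2) part_cL2])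
    also have "\<dots> \<le> (\<Sum>c\<in>?I. (1 * cmod (?r c)) * cL2_norm \<pi> (part c))"
      unfolding norm_mult using a by (intro sum_mono mult_right_mono) (auto simp: cL2_norm_nonneg)
    finally show "cL2_norm \<pi> (\<lambda>x. \<Sum>c\<in>?I. (a c * ?r c) * part c x) \<le> (\<Sum>c\<in>?I. cmod (- ?r c) * cL2_norm \<pi> (part c))" by (simp only: norm_minus_cancel mult_1)
  qed (use h0 in auto)
  also have "\<dots> = h * (2 * \<epsilon> * cL2_norm \<pi> g + step_error h)"
    unfolding step_error_def by (simp add: sum.distrib)
  finally show ?thesis .
qed

text \<open>
  Errors add up since the semigroup contracts, and the coefficients stay bounded by \<open>1\<close> since
  the cells are labelled by points of the left half-plane.
\<close>

lemma many_steps: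
  assumes h: "h > 0"
  shows "cL2_norm \<pi> (\<lambda>x. T (real n * h) (comb (\<lambda>c. 1)) x - comb (\<lambda>c. exp (c * complex_of_real (real n * h))) x)
    \<le> real n * (h * (2 * \<epsilon> * cL2_norm \<pi> g + step_error h))"
proof (induction n)
  case 0
  have "AE x in \<pi>. T (real 0 * h) (comb (\<lambda>c. 1)) x - comb (\<lambda>c. exp (c * complex_of_real (real 0 * h))) x = 0"
    using T_zero_time[OF comb_cL2, of "\<lambda>c. 1"] by simp
  moreover have "(\<lambda>x. T (real 0 * h) (comb (\<lambda>c. 1)) x - comb (\<lambda>c. exp (c * complex_of_real (real 0 * h))) x) \<in> cL2 \<pi>"
    by (intro cL2_diff T_cL2 comb_cL2) simp
  ultimately have "cL2_norm \<pi> (\<lambda>x. T (real 0 * h) (comb (\<lambda>c. 1)) x - comb (\<lambda>c. exp (c * complex_of_real (real 0 * h))) x) = 0"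
    by (simp only: cL2_norm_eq_0_iff)
  then show ?case by simp
next
  case (Suc n)
  let ?a = "\<lambda>c. exp (c * complex_of_real (real n * h))" and ?f = "comb (\<lambda>c. 1)"
  have h0: "0 \<le> h" "0 \<le> real n * h" "0 \<le> real (Suc n) * h" using h by auto
  have a1: "cmod (?a c) \<le> 1" if "c \<in> s ` B" for c
    using that Re_s h0 by (auto simp: norm_exp_eq_Re intro: mult_nonpos_nonneg)
  have nL: "T (real n * h) ?f \<in> cL2 \<pi>" by (intro T_cL2 h0 comb_cL2)
  have hn: "h + real n * h = real (Suc n) * h" by (simp add: algebra_simps)
  have sg: "AE x in \<pi>. T (real (Suc n) * h) ?f x = T h (T (real n * h) ?f) x"
    using T_semigroup[OF h0(1,2) comb_cL2, of "\<lambda>c. 1"] unfolding hn .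
  have ea: "exp (c * complex_of_real h) * ?a c = exp (c * complex_of_real (real (Suc n) * h))" for c
    by (simp add: exp_add[symmetric] algebra_simps)
  have "cL2_norm \<pi> (\<lambda>x. T (real (Suc n) * h) ?f x - comb (\<lambda>c. exp (c * complex_of_real (real (Suc n) * h))) x)
    = cL2_norm \<pi> (\<lambda>x. T h (T (real n * h) ?f) x - comb (\<lambda>c. exp (c * complex_of_real h) * ?a c) x)"
    unfolding ea
  proof (rule cL2_norm_cong)
    show "AE x in \<pi>. T (real (Suc n) * h) ?f x - comb (\<lambda>c. exp (c * complex_of_real (real (Suc n) * h))) x
      = T h (T (real n * h) ?f) x - comb (\<lambda>c. exp (c * complex_of_real (real (Suc n) * h))) x"
      using sg by eventually_elim simp
  qed (intro cL2_diff T_cL2 comb_cL2 nL h0)+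
  also have "\<dots> \<le> cL2_norm \<pi> (\<lambda>x. T h (T (real n * h) ?f) x - T h (comb ?a) x) + cL2_norm \<pi> (\<lambda>x. T h (comb ?a) x - comb (\<lambda>c. exp (c * complex_of_real h) * ?a c) x)"
    by (intro cL2_norm_triangle_diff T_cL2 h0 nL comb_cL2)
  also have "\<dots> \<le> cL2_norm \<pi> (\<lambda>x. T (real n * h) ?f x - comb ?a x) + h * (2 * \<epsilon> * cL2_norm \<pi> g + step_error h)"
    by (intro add_mono T_norm_diff h0 nL comb_cL2 one_step h a1)
  also have "\<dots> \<le> real (Suc n) * (h * (2 * \<epsilon> * cL2_norm \<pi> g + step_error h))"
    using Suc by (simp add: algebra_simps)
  finally show ?case .
qed

text \<open>
  Finer time steps remove the error of the expansions and leave that of the cells.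
\<close>

lemma comb_evolution:
  assumes t: "t > 0"
  shows "cL2_norm \<pi> (\<lambda>x. T t (comb (\<lambda>c. 1)) x - comb (\<lambda>c. exp (c * complex_of_real t)) x) \<le> t * (2 * \<epsilon> * cL2_norm \<pi> g)"
proof (rule tendsto_lowerbound)
  have fl: "filterlim (\<lambda>n. t / real (Suc n)) (at_right 0) sequentially"
  proof -
    have "(\<lambda>n. t / real (Suc n)) \<longlonglongrightarrow> 0" by (rule LIMSEQ_Suc) (rule lim_const_over_n)
    then show ?thesis using t by (auto simp: filterlim_at intro!: always_eventually)
  qed
  show "(\<lambda>n. t * (2 * \<epsilon> * cL2_norm \<pi> g + step_error (t / real (Suc n)))) \<longlonglongrightarrow> t * (2 * \<epsilon> * cL2_norm \<pi> g)"
    using tendsto_mult_left[OF tendsto_add[OF tendsto_const filterlim_compose[OF step_error_tendsto fl]], of t "2 * \<epsilon> * cL2_norm \<pi> g"] by simp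
  show "\<forall>\<^sub>F n in sequentially. cL2_norm \<pi> (\<lambda>x. T t (comb (\<lambda>c. 1)) x - comb (\<lambda>c. exp (c * complex_of_real t)) x)
    \<le> t * (2 * \<epsilon> * cL2_norm \<pi> g + step_error (t / real (Suc n)))"
  proof (rule always_eventually, rule allI)
    fix n
    have "real (Suc n) * (t / real (Suc n)) = t" by simp
    then show "cL2_norm \<pi> (\<lambda>x. T t (comb (\<lambda>c. 1)) x - comb (\<lambda>c. exp (c * complex_of_real t)) x)
      \<le> t * (2 * \<epsilon> * cL2_norm \<pi> g + step_error (t / real (Suc n)))"
      using many_steps[of "t / real (Suc n)" "Suc n"] t by (simp only: mult.assoc[symmetric]) simp
  qed
qed simp

text \<open>
  The three terms account for the part of the spectrum outside \<open>B\<close> in the semigroup, for the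
  size of the cells, and for the part outside \<open>B\<close> in the integral.
\<close>

lemma spectral_error:
  assumes t: "t > 0"
  shows "cmod (cL2_inner \<pi> (T t g) g - (LINT z|\<nu> g. exp (complex_of_real t * z)))
    \<le> cL2_norm \<pi> g * sqrt (measure (\<nu> g) (space Hminus_borel) - measure (\<nu> g) B) + 3 * \<epsilon> * t * (cL2_norm \<pi> g)\<^sup>2
      + (measure (\<nu> g) (space Hminus_borel) - measure (\<nu> g) B)"
proof -
  let ?f = "comb (\<lambda>c. 1)" and ?N = "measure (\<nu> g) (space Hminus_borel)"
  let ?e = "\<lambda>c. exp (c * complex_of_real t)"
  interpret \<nu>g: finite_measure "\<nu> g" by (rule finite_\<nu>[OF g])
  have t0: "0 \<le> t" using t by simp
  note [measurable] = \<nu>_id_measurable[of g]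
  have fL: "?f \<in> cL2 \<pi>" by (rule comb_cL2)
  have fg: "cL2_inner \<pi> ?f g = complex_of_real (measure (\<nu> g) B)"
  proof -
    have "cL2_inner \<pi> ?f g = (\<Sum>c\<in>s ` B. 1 * cL2_inner \<pi> (part c) g)" unfolding comb_def by (intro cL2_inner_sum_left part_cL2 g)
    then show ?thesis unfolding part_inner_g measure_cells[symmetric] by simp
  qed
  have ff: "(cL2_norm \<pi> ?f)\<^sup>2 = measure (\<nu> g) B"
  proof -
    have "complex_of_real ((cL2_norm \<pi> ?f)\<^sup>2) = (\<Sum>c\<in>s ` B. 1 * cL2_inner \<pi> (part c) ?f)"
      unfolding cL2_inner_self[symmetric] by (subst (1) comb_def) (intro cL2_inner_sum_left part_cL2 fL)
    also have "\<dots> = (\<Sum>c\<in>s ` B. \<Sum>d\<in>s ` B. if d = c then complex_of_real (measure (\<nu> g) (cell c)) else 0)"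
      unfolding comb_def by (subst cL2_inner_sum_right) (auto intro!: part_cL2 sum.cong simp: part_inner)
    also have "\<dots> = complex_of_real (measure (\<nu> g) B)" using s(2) unfolding measure_cells[symmetric] by simp
    finally show ?thesis by (simp only: of_real_eq_iff)
  qed
  have gf: "cL2_norm \<pi> (\<lambda>x. g x - ?f x) = sqrt (?N - measure (\<nu> g) B)"
  proof -
    have "(cL2_norm \<pi> (\<lambda>x. g x + (- 1) * ?f x))\<^sup>2 = (cL2_norm \<pi> g)\<^sup>2 + (cmod (- 1) * cL2_norm \<pi> ?f)\<^sup>2 + 2 * Re (cL2_inner \<pi> g (\<lambda>x. (- 1) * ?f x))"
      unfolding cL2_norm_add_power2[OF g cL2_scale[OF fL]] cL2_norm_scale ..
    also have "cL2_inner \<pi> g (\<lambda>x. (- 1) * ?f x) = - complex_of_real (measure (\<nu> g) B)"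
      using cL2_inner_commute[of \<pi> g ?f] fg cL2_inner_scale_right[of \<pi> g "- 1" ?f] by simp
    finally have "(cL2_norm \<pi> (\<lambda>x. g x - ?f x))\<^sup>2 = ?N - measure (\<nu> g) B"
      using ff measure_\<nu>_space[OF g] by simp
    then show ?thesis using cL2_norm_nonneg[of \<pi> "\<lambda>x. g x - ?f x"] by (metis real_sqrt_abs abs_of_nonneg)
  qed
  have A: "cmod (cL2_inner \<pi> (T t g) g - cL2_inner \<pi> (T t ?f) g) \<le> cL2_norm \<pi> g * sqrt (?N - measure (\<nu> g) B)"
  proof -
    have "cmod (cL2_inner \<pi> (T t g) g - cL2_inner \<pi> (T t ?f) g) = cmod (cL2_inner \<pi> (\<lambda>x. T t g x - T t ?f x) g)"
      using cL2_inner_diff_left[OF T_cL2[OF t0 g] T_cL2[OF t0 fL] g] by simp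
    also have "\<dots> \<le> cL2_norm \<pi> (\<lambda>x. T t g x - T t ?f x) * cL2_norm \<pi> g" by (intro cL2_inner_bound cL2_diff T_cL2 t0 g fL)
    also have "\<dots> \<le> cL2_norm \<pi> (\<lambda>x. g x - ?f x) * cL2_norm \<pi> g" by (intro mult_right_mono T_norm_diff t0 g fL cL2_norm_nonneg)
    finally show ?thesis unfolding gf by (simp add: mult.commute)
  qed
  \<comment> \<open>The sum over cells stands between the semigroup and the integral: it is the inner product of the evolved combination with \<open>g\<close>, and it is the integral of \<open>\<sigma>\<close>.\<close>
  have Bd: "cmod (cL2_inner \<pi> (T t ?f) g - (\<Sum>c\<in>s ` B. ?e c * complex_of_real (measure (\<nu> g) (cell c)))) \<le> 2 * \<epsilon> * t * (cL2_norm \<pi> g)\<^sup>2"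
  proof -
    have "cL2_inner \<pi> (comb ?e) g = (\<Sum>c\<in>s ` B. ?e c * complex_of_real (measure (\<nu> g) (cell c)))"
      unfolding comb_def by (subst cL2_inner_sum_left) (auto intro: part_cL2 g simp: part_inner_g)
    then have "cmod (cL2_inner \<pi> (T t ?f) g - (\<Sum>c\<in>s ` B. ?e c * complex_of_real (measure (\<nu> g) (cell c)))) = cmod (cL2_inner \<pi> (\<lambda>x. T t ?f x - comb ?e x) g)"
      using cL2_inner_diff_left[OF T_cL2[OF t0 fL] comb_cL2 g, of ?e] by simp
    also have "\<dots> \<le> cL2_norm \<pi> (\<lambda>x. T t ?f x - comb ?e x) * cL2_norm \<pi> g" by (intro cL2_inner_bound cL2_diff T_cL2 t0 g fL comb_cL2)
    also have "\<dots> \<le> t * (2 * \<epsilon> * cL2_norm \<pi> g) * cL2_norm \<pi> g" by (intro mult_right_mono comb_evolution t cL2_norm_nonneg)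
    finally show ?thesis by (simp add: power2_eq_square mult_ac)
  qed
  define \<sigma> where "\<sigma> z = (\<Sum>c\<in>s ` B. ?e c * complex_of_real (indicator (cell c) z))" for z
  have \<sigma>B: "\<sigma> z = ?e (s z)" if "z \<in> B" for z
  proof -
    have "\<sigma> z = (\<Sum>c\<in>s ` B. if c = s z then ?e c else 0)"
      unfolding \<sigma>_def using that by (intro sum.cong) (auto simp: cell_def indicator_def)
    then show ?thesis using that s(2) by simp
  qed
  have \<sigma>nB: "\<sigma> z = 0" if "z \<notin> B" for z
    unfolding \<sigma>_def using that by (intro sum.neutral) (auto simp: cell_def)
  have ii: "integrable (\<nu> g) (\<lambda>z. complex_of_real (indicator (cell c) z))" for c
    using cell_sets by (intro integrable_of_real \<nu>g.integrable_const_bound[of _ 1]) auto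
  have i\<sigma>: "integrable (\<nu> g) \<sigma>" unfolding \<sigma>_def by (intro Bochner_Integration.integrable_sum integrable_mult_right ii)
  have I\<sigma>: "(LINT z|\<nu> g. \<sigma> z) = (\<Sum>c\<in>s ` B. ?e c * complex_of_real (measure (\<nu> g) (cell c)))"
  proof -
    have "(LINT z|\<nu> g. \<sigma> z) = (\<Sum>c\<in>s ` B. LINT z|\<nu> g. ?e c * complex_of_real (indicator (cell c) z))"
      unfolding \<sigma>_def by (intro Bochner_Integration.integral_sum integrable_mult_right ii)
    also have "\<dots> = (\<Sum>c\<in>s ` B. ?e c * complex_of_real (measure (\<nu> g) (cell c)))"
    proof (rule sum.cong[OF refl])
      fix c
      have "(LINT z|\<nu> g. complex_of_real (indicator (cell c) z)) = complex_of_real (measure (\<nu> g) (cell c \<inter> space (\<nu> g)))"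
        by (simp only: integral_complex_of_real Bochner_Integration.integral_indicator)
      also have "cell c \<inter> space (\<nu> g) = cell c" using sets.sets_into_space[OF cell_sets[of c]] by auto
      finally show "(LINT z|\<nu> g. ?e c * complex_of_real (indicator (cell c) z)) = ?e c * complex_of_real (measure (\<nu> g) (cell c))"
        by (simp only: integral_mult_right_zero)
    qed
    finally show ?thesis .
  qed
  have e1: "cmod (exp (complex_of_real t * z)) \<le> 1" if "z \<in> Hminus" for z
    using that t by (simp add: Hminus_def mult_nonneg_nonpos)
  have ie: "integrable (\<nu> g) (\<lambda>z. exp (complex_of_real t * z))"
  proof (rule \<nu>g.integrable_const_bound[of _ 1])
    show "AE z in \<nu> g. norm (exp (complex_of_real t * z)) \<le> 1" by (intro AE_I2 e1) (simp add: space_Hminus_borel)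
  qed measurable
  have iB: "integrable (\<nu> g) (indicator B :: complex \<Rightarrow> real)" "integrable (\<nu> g) (indicator (space Hminus_borel - B) :: complex \<Rightarrow> real)"
    using B(1) by (intro \<nu>g.integrable_const_bound[of _ 1]; auto)+
  have C: "cmod ((\<Sum>c\<in>s ` B. ?e c * complex_of_real (measure (\<nu> g) (cell c))) - (LINT z|\<nu> g. exp (complex_of_real t * z)))
     \<le> \<epsilon> * t * (cL2_norm \<pi> g)\<^sup>2 + (?N - measure (\<nu> g) B)"
  proof -
    have "cmod ((\<Sum>c\<in>s ` B. ?e c * complex_of_real (measure (\<nu> g) (cell c))) - (LINT z|\<nu> g. exp (complex_of_real t * z)))
      = cmod (LINT z|\<nu> g. \<sigma> z - exp (complex_of_real t * z))" unfolding I\<sigma>[symmetric] using i\<sigma> ie by simp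
    also have "\<dots> \<le> (LINT z|\<nu> g. cmod (\<sigma> z - exp (complex_of_real t * z)))" by (rule integral_norm_bound)
    also have "\<dots> \<le> (LINT z|\<nu> g. \<epsilon> * t * indicator B z + indicator (space Hminus_borel - B) z)"
    proof (rule integral_mono)
      fix z assume z: "z \<in> space (\<nu> g)"
      then have zH: "z \<in> Hminus" by (simp add: space_Hminus_borel)
      show "cmod (\<sigma> z - exp (complex_of_real t * z)) \<le> \<epsilon> * t * indicator B z + indicator (space Hminus_borel - B) z"
      proof (cases "z \<in> B")
        case True
        have "cmod (exp (s z * complex_of_real t) - exp (complex_of_real t * z)) \<le> cmod (s z * complex_of_real t - complex_of_real t * z)"
          using Re_s[OF True] zH t by (intro exp_lipschitz_left_half_plane) (auto simp: Hminus_def mult_nonpos_nonneg mult_nonneg_nonpos)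
        also have "s z * complex_of_real t - complex_of_real t * z = complex_of_real t * (s z - z)" by (simp add: algebra_simps)
        also have "cmod (complex_of_real t * (s z - z)) \<le> t * \<epsilon>"
          using close[OF True] t by (simp add: norm_mult norm_minus_commute)
        finally show ?thesis using True by (simp add: \<sigma>B mult.commute)
      next
        case False
        then show ?thesis using e1[OF zH] zH by (simp add: \<sigma>nB space_Hminus_borel)
      qed
    qed (use i\<sigma> ie iB in auto)
    also have "\<dots> = \<epsilon> * t * measure (\<nu> g) B + measure (\<nu> g) (space Hminus_borel - B)"
    proof -
      have "B \<inter> space (\<nu> g) = B" "(space Hminus_borel - B) \<inter> space (\<nu> g) = space Hminus_borel - B" using sets.sets_into_space[OF B(1)] by auto
      then show ?thesis using iB by simp
    qed
    also have "measure (\<nu> g) (space Hminus_borel - B) = ?N - measure (\<nu> g) B" using \<nu>g.finite_measure_compl[of B] B(1) by simp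
    also have "\<epsilon> * t * measure (\<nu> g) B \<le> \<epsilon> * t * (cL2_norm \<pi> g)\<^sup>2"
      using \<nu>g.bounded_measure[of B] measure_\<nu>_space[OF g] \<epsilon> t by (intro mult_left_mono) auto
    finally show ?thesis by simp
  qed
  show ?thesis
    using norm_triangle_ineq[of "cL2_inner \<pi> (T t g) g - cL2_inner \<pi> (T t ?f) g" "cL2_inner \<pi> (T t ?f) g - (LINT z|\<nu> g. exp (complex_of_real t * z))"]
      norm_triangle_ineq[of "cL2_inner \<pi> (T t ?f) g - (\<Sum>c\<in>s ` B. ?e c * complex_of_real (measure (\<nu> g) (cell c)))"
        "(\<Sum>c\<in>s ` B. ?e c * complex_of_real (measure (\<nu> g) (cell c))) - (LINT z|\<nu> g. exp (complex_of_real t * z))"] A Bd C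
    by simp
qed

end

end

section \<open>The spectral formula for the covariance\<close>

text \<open>
  Rounding down in both coordinates. It keeps the left half-plane invariant.
\<close>

definition grid_point :: "real \<Rightarrow> complex \<Rightarrow> complex" where
  "grid_point \<delta> z = Complex (\<delta> * of_int \<lfloor>Re z / \<delta>\<rfloor>) (\<delta> * of_int \<lfloor>Im z / \<delta>\<rfloor>)"

lemma grid_point_measurable[measurable]: "grid_point \<delta> \<in> borel_measurable borel"
  unfolding grid_point_def[abs_def] Complex_eq by measurable

lemma grid_coordinate:
  fixes x :: real assumes "\<delta> > 0" shows "\<delta> * of_int \<lfloor>x / \<delta>\<rfloor> \<le> x" "x \<le> \<delta> * of_int \<lfloor>x / \<delta>\<rfloor> + \<delta>"
proof -
  have "of_int \<lfloor>x / \<delta>\<rfloor> \<le> x / \<delta>" "x / \<delta> \<le> of_int \<lfloor>x / \<delta>\<rfloor> + 1" by linarith+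
  then show "\<delta> * of_int \<lfloor>x / \<delta>\<rfloor> \<le> x" "x \<le> \<delta> * of_int \<lfloor>x / \<delta>\<rfloor> + \<delta>"
    using assms mult_left_mono[of "of_int \<lfloor>x / \<delta>\<rfloor>" "x / \<delta>" \<delta>] mult_left_mono[of "x / \<delta>" "of_int \<lfloor>x / \<delta>\<rfloor> + 1" \<delta>]
    by (simp_all add: distrib_left)
qed

lemma grid_point_close:
  assumes "\<delta> > 0" shows "cmod (z - grid_point \<delta> z) \<le> 2 * \<delta>"
proof -
  have "cmod (z - grid_point \<delta> z) \<le> \<bar>Re (z - grid_point \<delta> z)\<bar> + \<bar>Im (z - grid_point \<delta> z)\<bar>" by (rule cmod_le)
  then show ?thesis using grid_coordinate[OF assms, of "Re z"] grid_coordinate[OF assms, of "Im z"]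
    by (simp add: grid_point_def abs_le_iff)
qed

lemma finite_grid_points:
  assumes \<delta>: "\<delta> > 0" and S: "S \<subseteq> cball 0 K" shows "finite (grid_point \<delta> ` S)"
proof (rule finite_subset)
  let ?I = "{\<lfloor>- K / \<delta>\<rfloor>..\<lfloor>K / \<delta>\<rfloor>}"
  show "grid_point \<delta> ` S \<subseteq> (\<lambda>(i, j). Complex (\<delta> * of_int i) (\<delta> * of_int j)) ` (?I \<times> ?I)"
  proof
    fix w assume "w \<in> grid_point \<delta> ` S"
    then obtain z where z: "z \<in> S" "w = grid_point \<delta> z" by auto
    have "cmod z \<le> K" using z S by auto
    then have "\<bar>Re z\<bar> \<le> K" "\<bar>Im z\<bar> \<le> K" using abs_Re_le_cmod[of z] abs_Im_le_cmod[of z] by linarith+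
    then have "- K \<le> Re z" "- K \<le> Im z" "Re z \<le> K" "Im z \<le> K" by linarith+
    then have "\<lfloor>Re z / \<delta>\<rfloor> \<in> ?I" "\<lfloor>Im z / \<delta>\<rfloor> \<in> ?I"
      unfolding atLeastAtMost_iff using \<delta> by (intro conjI floor_mono divide_right_mono; simp)+
    then show "w \<in> (\<lambda>(i, j). Complex (\<delta> * of_int i) (\<delta> * of_int j)) ` (?I \<times> ?I)"
      unfolding z grid_point_def by force
  qed
qed simp

context markov_spectral begin

text \<open>
  The error bound with the half-disc of radius \<open>n\<close> and cells of side \<open>1 / (n + 1)\<close>.
\<close>

lemma semigroup_spectral_formula:
  assumes g: "g \<in> cL2 \<pi>" and t: "t \<ge> 0"
  shows "cL2_inner \<pi> (T t g) g = (LINT z|\<nu> g. exp (complex_of_real t * z))"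
proof (cases "t = 0")
  case True
  interpret \<nu>g: finite_measure "\<nu> g" by (rule finite_\<nu>[OF g])
  have "cL2_inner \<pi> (T 0 g) g = cL2_inner \<pi> g g"
    using T_zero_time[OF g] by (intro cL2_inner_cong_left) (auto intro: T_cL2 g)
  then show ?thesis using True measure_\<nu>_space[OF g] by (simp add: cL2_inner_self scaleR_conv_of_real)
next
  case False
  then have t: "t > 0" using t by simp
  interpret \<nu>g: finite_measure "\<nu> g" by (rule finite_\<nu>[OF g])
  let ?d = "cmod (cL2_inner \<pi> (T t g) g - (LINT z|\<nu> g. exp (complex_of_real t * z)))"
  define B where "B n = Hminus \<inter> cball 0 (real n)" for n
  define rest where "rest n = measure (\<nu> g) (space Hminus_borel) - measure (\<nu> g) (B n)" for n
  have Bs: "B n \<in> sets Hminus_borel" for n unfolding B_def Hminus_borel_def sets_restrict_space by auto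
  have rest: "rest \<longlonglongrightarrow> 0"
  proof -
    have "(\<lambda>n. measure (\<nu> g) (B n)) \<longlonglongrightarrow> measure (\<nu> g) (\<Union>n. B n)"
      by (rule \<nu>g.finite_Lim_measure_incseq) (auto simp: Bs[unfolded B_def] incseq_def B_def)
    moreover have "(\<Union>n. B n) = space Hminus_borel"
      unfolding B_def space_Hminus_borel by (auto intro: real_arch_simple)
    ultimately have "(\<lambda>n. measure (\<nu> g) (B n)) \<longlonglongrightarrow> measure (\<nu> g) (space Hminus_borel)" by simp
    from tendsto_diff[OF tendsto_const this, of "measure (\<nu> g) (space Hminus_borel)"] show ?thesis
      unfolding rest_def by simp
  qed
  have bound: "?d \<le> cL2_norm \<pi> g * sqrt (rest n) + 3 * (2 / real (Suc n)) * t * (cL2_norm \<pi> g)\<^sup>2 + rest n" for n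
  proof -
    define \<delta> where "\<delta> = 1 / real (Suc n)"
    have \<delta>: "\<delta> > 0" by (simp add: \<delta>_def)
    have sm: "grid_point \<delta> \<in> borel_measurable Hminus_borel"
      unfolding Hminus_borel_def by (rule measurable_restrict_space1) simp
    have sub: "B n \<subseteq> cball 0 (real n)" by (auto simp: B_def)
    have "?d \<le> cL2_norm \<pi> g * sqrt (rest n) + 3 * (2 * \<delta>) * t * (cL2_norm \<pi> g)\<^sup>2 + rest n"
      unfolding rest_def
    proof (rule spectral_error[OF g Bs sub sm finite_grid_points[OF \<delta> sub] grid_point_close[OF \<delta>] _ _ t])
      show "Re (grid_point \<delta> z) \<le> 0" if "z \<in> B n" for z
        using that grid_coordinate(1)[OF \<delta>, of "Re z"] by (simp add: B_def Hminus_def grid_point_def)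
    qed (use \<delta> in simp)
    then show ?thesis by (simp add: \<delta>_def)
  qed
  have "(\<lambda>n. cL2_norm \<pi> g * sqrt (rest n) + 3 * (2 / real (Suc n)) * t * (cL2_norm \<pi> g)\<^sup>2 + rest n) \<longlonglongrightarrow>
    cL2_norm \<pi> g * sqrt 0 + 3 * 0 * t * (cL2_norm \<pi> g)\<^sup>2 + 0"
    by (intro tendsto_add tendsto_mult tendsto_const tendsto_real_sqrt rest LIMSEQ_Suc[OF lim_const_over_n])
  then have "?d \<le> 0"
    by (intro tendsto_lowerbound[of "\<lambda>n. cL2_norm \<pi> g * sqrt (rest n) + 3 * (2 / real (Suc n)) * t * (cL2_norm \<pi> g)\<^sup>2 + rest n" 0 sequentially])
      (use bound in \<open>auto intro: always_eventually\<close>)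
  then show ?thesis by simp
qed

end

section \<open>The variance of an integral over time\<close>

text \<open>
  The square of an integral is a double integral, and Fubini's theorem applies because the
  second moments are bounded.
\<close>

lemma (in prob_space) integral_process_moments:
  fixes X :: "'t \<Rightarrow> 'a \<Rightarrow> real"
  assumes L: "finite_measure L" and X: "(\<lambda>(s, \<omega>). X s \<omega>) \<in> borel_measurable (L \<Otimes>\<^sub>M M)"
    and sq: "\<And>s. s \<in> space L \<Longrightarrow> integrable M (\<lambda>\<omega>. (X s \<omega>)\<^sup>2)"
    and bd: "\<And>s. s \<in> space L \<Longrightarrow> expectation (\<lambda>\<omega>. (X s \<omega>)\<^sup>2) \<le> C"
  shows "expectation (\<lambda>\<omega>. LINT s|L. X s \<omega>) = (LINT s|L. expectation (X s))"
    and "expectation (\<lambda>\<omega>. (LINT s|L. X s \<omega>)\<^sup>2) = (LINT p|(L \<Otimes>\<^sub>M L). expectation (\<lambda>\<omega>. X (fst p) \<omega> * X (snd p) \<omega>))"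
proof -
  interpret L: finite_measure L by (rule L)
  interpret LL: pair_sigma_finite L L ..
  interpret LLf: finite_measure "L \<Otimes>\<^sub>M L" by (rule finite_measure_pair_measure) (rule L)+
  interpret LM: pair_sigma_finite L M ..
  interpret LLM: pair_sigma_finite "L \<Otimes>\<^sub>M L" M ..
  have Xs[measurable]: "X s \<in> borel_measurable M" if "s \<in> space L" for s
    using measurable_Pair2[OF X that] by simp
  have prod: "integrable M (\<lambda>\<omega>. X s \<omega> * X r \<omega>)" "expectation (\<lambda>\<omega>. \<bar>X s \<omega> * X r \<omega>\<bar>) \<le> C"
    if s: "s \<in> space L" and r: "r \<in> space L" for s r
  proof -
    have i: "integrable M (\<lambda>\<omega>. (X s \<omega>)\<^sup>2 / 2 + (X r \<omega>)\<^sup>2 / 2)" using sq s r by auto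
    have le: "\<bar>X s \<omega> * X r \<omega>\<bar> \<le> (X s \<omega>)\<^sup>2 / 2 + (X r \<omega>)\<^sup>2 / 2" for \<omega>
      using sum_squares_bound[of "\<bar>X s \<omega>\<bar>" "\<bar>X r \<omega>\<bar>"] by (simp add: abs_mult)
    show ip: "integrable M (\<lambda>\<omega>. X s \<omega> * X r \<omega>)"
      by (rule Bochner_Integration.integrable_bound[OF i]) (use s r order_trans[OF le abs_ge_self] in auto)
    have "expectation (\<lambda>\<omega>. \<bar>X s \<omega> * X r \<omega>\<bar>) \<le> expectation (\<lambda>\<omega>. (X s \<omega>)\<^sup>2 / 2 + (X r \<omega>)\<^sup>2 / 2)"
      by (rule integral_mono[OF integrable_abs[OF ip] i le])
    also have "\<dots> \<le> C" using bd[OF s] bd[OF r] sq[OF s] sq[OF r] by simp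
    finally show "expectation (\<lambda>\<omega>. \<bar>X s \<omega> * X r \<omega>\<bar>) \<le> C" .
  qed
  have one: "integrable M (X s)" "expectation (\<lambda>\<omega>. \<bar>X s \<omega>\<bar>) \<le> 1 + C" if s: "s \<in> space L" for s
  proof -
    have i: "integrable M (\<lambda>\<omega>. 1 + (X s \<omega>)\<^sup>2)" using sq s by auto
    have le: "\<bar>X s \<omega>\<bar> \<le> 1 + (X s \<omega>)\<^sup>2" for \<omega>
      using sum_squares_bound[of "\<bar>X s \<omega>\<bar>" 1] abs_ge_zero[of "X s \<omega>"] unfolding power2_abs one_power2 mult_1_right by linarith
    show ip: "integrable M (X s)"
      by (rule Bochner_Integration.integrable_bound[OF i]) (use s order_trans[OF le abs_ge_self] in auto)
    have "expectation (\<lambda>\<omega>. \<bar>X s \<omega>\<bar>) \<le> expectation (\<lambda>\<omega>. 1 + (X s \<omega>)\<^sup>2)"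
      by (rule integral_mono[OF integrable_abs[OF ip] i le])
    also have "\<dots> \<le> 1 + C" using bd[OF s] sq[OF s] by (simp add: prob_space)
    finally show "expectation (\<lambda>\<omega>. \<bar>X s \<omega>\<bar>) \<le> 1 + C" .
  qed
  have i1: "integrable (L \<Otimes>\<^sub>M M) (\<lambda>(s, \<omega>). X s \<omega>)"
  proof (rule LM.Fubini_integrable[OF X])
    have "(\<lambda>s. expectation (\<lambda>\<omega>. norm (case (s, \<omega>) of (s, \<omega>) \<Rightarrow> X s \<omega>))) \<in> borel_measurable L"
      using X by measurable
    then show "integrable L (\<lambda>s. expectation (\<lambda>\<omega>. norm (case (s, \<omega>) of (s, \<omega>) \<Rightarrow> X s \<omega>)))"
      using one by (intro L.integrable_const_bound[of _ "1 + C"]) (auto intro!: AE_I2)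
  qed (use one in auto)
  show "expectation (\<lambda>\<omega>. LINT s|L. X s \<omega>) = (LINT s|L. expectation (X s))"
    using LM.Fubini_integral[OF i1] by simp
  let ?f = "\<lambda>(p, \<omega>). X (fst p) \<omega> * X (snd p) \<omega>"
  have fm: "?f \<in> borel_measurable ((L \<Otimes>\<^sub>M L) \<Otimes>\<^sub>M M)"
  proof -
    have "(\<lambda>q. X (fst (fst q)) (snd q)) \<in> borel_measurable ((L \<Otimes>\<^sub>M L) \<Otimes>\<^sub>M M)"
      "(\<lambda>q. X (snd (fst q)) (snd q)) \<in> borel_measurable ((L \<Otimes>\<^sub>M L) \<Otimes>\<^sub>M M)"
      using measurable_compose[OF _ X, of "\<lambda>q. (fst (fst q), snd q)" "(L \<Otimes>\<^sub>M L) \<Otimes>\<^sub>M M"]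
        measurable_compose[OF _ X, of "\<lambda>q. (snd (fst q), snd q)" "(L \<Otimes>\<^sub>M L) \<Otimes>\<^sub>M M"] by simp_all
    then show ?thesis by (simp add: case_prod_beta)
  qed
  have i2: "integrable ((L \<Otimes>\<^sub>M L) \<Otimes>\<^sub>M M) ?f"
  proof (rule LLM.Fubini_integrable[OF fm])
    have "(\<lambda>p. expectation (\<lambda>\<omega>. norm (?f (p, \<omega>)))) \<in> borel_measurable (L \<Otimes>\<^sub>M L)"
      using fm by measurable
    then show "integrable (L \<Otimes>\<^sub>M L) (\<lambda>p. expectation (\<lambda>\<omega>. norm (?f (p, \<omega>))))"
      using prod by (intro LLf.integrable_const_bound[of _ C]) (auto intro!: AE_I2 simp: space_pair_measure)
  qed (use prod in \<open>auto simp: space_pair_measure\<close>)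
  have "AE \<omega> in M. (LINT p|(L \<Otimes>\<^sub>M L). ?f (p, \<omega>)) = (LINT s|L. X s \<omega>)\<^sup>2"
    using LLM.AE_integrable_snd[of "\<lambda>p \<omega>. ?f (p, \<omega>)"] i2
  proof (simp, elim eventually_mono)
    fix \<omega> assume "integrable (L \<Otimes>\<^sub>M L) (\<lambda>p. X (fst p) \<omega> * X (snd p) \<omega>)"
    from LL.integral_fst'[OF this, symmetric]
    show "(LINT p|(L \<Otimes>\<^sub>M L). X (fst p) \<omega> * X (snd p) \<omega>) = (LINT s|L. X s \<omega>)\<^sup>2"
      by (simp add: power2_eq_square)
  qed
  moreover have "(\<lambda>\<omega>. LINT p|(L \<Otimes>\<^sub>M L). ?f (p, \<omega>)) \<in> borel_measurable M" using fm by measurable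
  moreover have "(\<lambda>\<omega>. (LINT s|L. X s \<omega>)\<^sup>2) \<in> borel_measurable M" using X by measurable
  ultimately have "expectation (\<lambda>\<omega>. (LINT s|L. X s \<omega>)\<^sup>2) = expectation (\<lambda>\<omega>. LINT p|(L \<Otimes>\<^sub>M L). ?f (p, \<omega>))"
    by (intro integral_cong_AE) auto
  also have "\<dots> = (LINT p|(L \<Otimes>\<^sub>M L). expectation (\<lambda>\<omega>. X (fst p) \<omega> * X (snd p) \<omega>))"
    using LLM.Fubini_integral[OF i2] by simp
  finally show "expectation (\<lambda>\<omega>. (LINT s|L. X s \<omega>)\<^sup>2) = (LINT p|(L \<Otimes>\<^sub>M L). expectation (\<lambda>\<omega>. X (fst p) \<omega> * X (snd p) \<omega>))" .
qed

abbreviation time_interval :: "real \<Rightarrow> real measure" where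
  "time_interval T \<equiv> restrict_space lborel {0..T}"

lemma finite_time_interval: "finite_measure (time_interval T)"
  by (rule finite_measureI) (simp add: emeasure_restrict_space space_restrict_space emeasure_lborel_Icc_eq)

text \<open>
  By the addition theorem the double integral is the sum of the squares of the integrals of
  cosine and sine.
\<close>

lemma integral_cos_difference:
  assumes T: "T \<ge> 0"
  shows "(LINT p|(time_interval T \<Otimes>\<^sub>M time_interval T). cos (y * (fst p - snd p))) = fejer T y"
proof -
  interpret L: finite_measure "time_interval T" by (rule finite_time_interval)
  interpret LL: pair_sigma_finite "time_interval T" "time_interval T" ..
  interpret LLf: finite_measure "time_interval T \<Otimes>\<^sub>M time_interval T" by (rule finite_measure_pair_measure) (rule finite_time_interval)+
  have m[measurable]: "(\<lambda>x. x) \<in> borel_measurable (time_interval T)" by (rule measurable_restrict_space1) simp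
  have i: "integrable (time_interval T) (\<lambda>s. cos (y * s))" "integrable (time_interval T) (\<lambda>s. sin (y * s))"
    by (intro L.integrable_const_bound[of _ 1]; auto)+
  have "integrable (time_interval T \<Otimes>\<^sub>M time_interval T) (\<lambda>p. cos (y * (fst p - snd p)))"
    by (intro LLf.integrable_const_bound[of _ 1]) auto
  from LL.integral_fst'[OF this, symmetric]
  have "(LINT p|(time_interval T \<Otimes>\<^sub>M time_interval T). cos (y * (fst p - snd p))) =
    (LINT s|time_interval T. LINT r|time_interval T. cos (y * s) * cos (y * r) + sin (y * s) * sin (y * r))"
    by (simp add: right_diff_distrib cos_diff)
  also have "\<dots> = (LINT s|time_interval T. cos (y * s))\<^sup>2 + (LINT s|time_interval T. sin (y * s))\<^sup>2"
    using i by (simp add: power2_eq_square)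
  also have "\<dots> = fejer T y"
  proof (cases "y = 0")
    case True
    then show ?thesis using T by (simp add: fejer_def measure_restrict_space space_restrict_space)
  next
    case False
    have "(LINT s|time_interval T. cos (y * s)) = (LINT s|lborel. indicator {0..T} s *\<^sub>R cos (y * s))"
      by (rule integral_restrict_space) simp
    also have "\<dots> = sin (y * T) / y - sin (y * 0) / y"
      using T False by (intro integral_FTC_Icc) (auto intro!: derivative_eq_intros continuous_intros simp: has_real_derivative_iff_has_vector_derivative[symmetric])
    finally have c: "(LINT s|time_interval T. cos (y * s)) = sin (y * T) / y" by simp
    have "(LINT s|time_interval T. sin (y * s)) = (LINT s|lborel. indicator {0..T} s *\<^sub>R sin (y * s))"
      by (rule integral_restrict_space) simp
    also have "\<dots> = - cos (y * T) / y - (- cos (y * 0) / y)"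
      using T False by (intro integral_FTC_Icc) (auto intro!: derivative_eq_intros continuous_intros simp: has_real_derivative_iff_has_vector_derivative[symmetric])
    finally have s: "(LINT s|time_interval T. sin (y * s)) = (1 - cos (y * T)) / y" by (simp add: diff_divide_distrib)
    have "(sin (y * T))\<^sup>2 + (1 - cos (y * T))\<^sup>2 = 2 * (1 - cos (y * T))"
      using sin_cos_squared_add[of "y * T"] by (simp add: power2_eq_square algebra_simps)
    then show ?thesis unfolding c s power_divide add_divide_distrib[symmetric] using False by (simp add: fejer_def)
  qed
  finally show ?thesis .
qed

lemma (in spectral_measure_on_line) integral_covariance:
  assumes T: "T \<ge> 0"
  shows "(LINT p|(time_interval T \<Otimes>\<^sub>M time_interval T). LINT y|\<mu>. cos (y * (fst p - snd p))) = fejer_transform T"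
proof -
  interpret L: finite_measure "time_interval T" by (rule finite_time_interval)
  interpret LLf: finite_measure "time_interval T \<Otimes>\<^sub>M time_interval T" by (rule finite_measure_pair_measure) (rule finite_time_interval)+
  interpret P: pair_sigma_finite "time_interval T \<Otimes>\<^sub>M time_interval T" \<mu> ..
  interpret Pf: finite_measure "(time_interval T \<Otimes>\<^sub>M time_interval T) \<Otimes>\<^sub>M \<mu>" by (intro finite_measure_pair_measure LLf.finite_measure_axioms finite_measure_axioms)
  have m[measurable]: "(\<lambda>x. x) \<in> borel_measurable (time_interval T)" by (rule measurable_restrict_space1) simp
  have "integrable ((time_interval T \<Otimes>\<^sub>M time_interval T) \<Otimes>\<^sub>M \<mu>) (\<lambda>(p, y). cos (y * (fst p - snd p)))"
    by (intro Pf.integrable_const_bound[of _ 1]) (auto simp: case_prod_beta)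
  from P.Fubini_integral[OF this] show ?thesis
    by (simp add: fejer_transform_def integral_cos_difference[OF T])
qed

context stationary_markov_process begin

text \<open>
  Progressive measurability at the final time.
\<close>

lemma jointly_measurable:
  assumes g: "g \<in> borel_measurable \<pi>" and U: "U \<ge> 0"
  shows "(\<lambda>(s, \<omega>). g (\<xi> s \<omega>)) \<in> borel_measurable (time_interval U \<Otimes>\<^sub>M M)"
proof -
  have "(\<lambda>p. p) \<in> measurable (restrict_space borel {0..U} \<Otimes>\<^sub>M M) (restrict_space borel {0..U} \<Otimes>\<^sub>M F U)"
    using measurable_compose[OF measurable_snd measurable_from_subalg[OF sub[OF U] measurable_ident_sets[OF refl]]]
    by (intro measurable_pair) (auto simp: comp_def)
  then have "(\<lambda>(s, \<omega>). \<xi> s \<omega>) \<in> measurable (restrict_space borel {0..U} \<Otimes>\<^sub>M M) \<pi>"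
    using measurable_compose[OF _ progressive[OF U]] by blast
  moreover have "sets (time_interval U) = sets (restrict_space borel {0..U})" by (intro sets_restrict_space_cong) simp
  ultimately have "(\<lambda>(s, \<omega>). \<xi> s \<omega>) \<in> measurable (time_interval U \<Otimes>\<^sub>M M) \<pi>"
    by (simp cong: measurable_cong_sets sets_pair_measure_cong)
  from measurable_compose[OF this g] show ?thesis by (simp add: case_prod_beta)
qed

lemma covariance_stationary:
  fixes g :: "'s \<Rightarrow> real"
  assumes g[measurable]: "g \<in> borel_measurable \<pi>" and s: "s \<ge> 0" and t: "t \<ge> 0"
  shows "expectation (\<lambda>\<omega>. g (\<xi> s \<omega>) * g (\<xi> (s + t) \<omega>)) = expectation (\<lambda>\<omega>. g (\<xi> 0 \<omega>) * g (\<xi> t \<omega>))"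
proof -
  let ?N = "Pi\<^sub>M {0, t} (\<lambda>_. \<pi>)" and ?f = "\<lambda>x. g (x 0) * g (x t)"
  have f: "?f \<in> borel_measurable ?N" by measurable
  have m: "(\<lambda>\<omega>. \<lambda>u\<in>{0, t}. \<xi> (r + u) \<omega>) \<in> measurable M ?N" if "r \<ge> 0" for r
    using t that by (intro measurable_restrict rv) auto
  have "expectation (\<lambda>\<omega>. ?f (\<lambda>u\<in>{0, t}. \<xi> (s + u) \<omega>)) = (LINT x|distr M ?N (\<lambda>\<omega>. \<lambda>u\<in>{0, t}. \<xi> (s + u) \<omega>). ?f x)"
    by (rule integral_distr[OF m[OF s] f, symmetric])
  also have "\<dots> = (LINT x|distr M ?N (\<lambda>\<omega>. \<lambda>u\<in>{0, t}. \<xi> u \<omega>). ?f x)"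
    using stationary[of "{0, t}" s] s t by simp
  also have "\<dots> = expectation (\<lambda>\<omega>. ?f (\<lambda>u\<in>{0, t}. \<xi> u \<omega>))"
    using m[of 0] f by (intro integral_distr) simp_all
  finally show ?thesis by simp
qed

text \<open>
  The mean vanishes since \<open>g\<close> is centred, so the variance is the double integral of the
  covariance function.
\<close>

lemma variance_occupation_integral:
  fixes g :: "'s \<Rightarrow> real"
  assumes g: "g \<in> L2_0 \<pi>" and U: "U \<ge> 0" and \<mu>: "spectral_measure_on_line \<mu>"
    and cov: "\<And>t. t \<ge> 0 \<Longrightarrow> expectation (\<lambda>\<omega>. g (\<xi> 0 \<omega>) * g (\<xi> t \<omega>)) = (LINT y|\<mu>. cos (y * t))"
  shows "variance (occupation_integral \<xi> g U) = spectral_measure_on_line.fejer_transform \<mu> U"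
proof -
  interpret \<mu>: spectral_measure_on_line \<mu> by (rule \<mu>)
  have gm[measurable]: "g \<in> borel_measurable \<pi>" and g2: "integrable \<pi> (\<lambda>x. (g x)\<^sup>2)" and g0: "(LINT x|\<pi>. g x) = 0"
    using g by (auto simp: L2_0_def)
  have S: "occupation_integral \<xi> g U \<omega> = (LINT s|time_interval U. g (\<xi> s \<omega>))" for \<omega>
    unfolding occupation_integral_def set_lebesgue_integral_def by (rule integral_restrict_space[symmetric]) simp
  have spT: "s \<in> space (time_interval U) \<longleftrightarrow> 0 \<le> s \<and> s \<le> U" for s by (simp add: space_restrict_space)
  note mom = integral_process_moments[OF finite_time_interval jointly_measurable[OF gm U], of "LINT x|\<pi>. (g x)\<^sup>2"]
  have sq: "integrable M (\<lambda>\<omega>. (g (\<xi> s \<omega>))\<^sup>2)" "expectation (\<lambda>\<omega>. (g (\<xi> s \<omega>))\<^sup>2) = (LINT x|\<pi>. (g x)\<^sup>2)" if "0 \<le> s" for s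
    using comp_integrable_iff[OF that, of "\<lambda>x. (g x)\<^sup>2"] comp_integral[OF that, of "\<lambda>x. (g x)\<^sup>2"] g2 by simp_all
  have "expectation (occupation_integral \<xi> g U) = (LINT s|time_interval U. expectation (\<lambda>\<omega>. g (\<xi> s \<omega>)))"
    unfolding S by (rule mom) (simp_all add: sq spT)
  also have "\<dots> = (LINT s|time_interval U. 0)"
    by (intro Bochner_Integration.integral_cong) (auto simp: spT comp_integral g0)
  finally have mean: "expectation (occupation_integral \<xi> g U) = 0" by simp
  have cov': "expectation (\<lambda>\<omega>. g (\<xi> s \<omega>) * g (\<xi> r \<omega>)) = (LINT y|\<mu>. cos (y * (s - r)))" if "0 \<le> s" "0 \<le> r" for s r
    using that
  proof (induction s r rule: linorder_wlog)
    case (le s r)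
    have "expectation (\<lambda>\<omega>. g (\<xi> s \<omega>) * g (\<xi> r \<omega>)) = (LINT y|\<mu>. cos (y * (r - s)))"
      using covariance_stationary[OF gm, of s "r - s"] cov[of "r - s"] le by simp
    also have "\<dots> = (LINT y|\<mu>. cos (y * (s - r)))"
      by (intro Bochner_Integration.integral_cong refl) (metis cos_minus minus_diff_eq mult_minus_right)
    finally show ?case .
  next
    case (sym s r)
    have "(LINT y|\<mu>. cos (y * (r - s))) = (LINT y|\<mu>. cos (y * (s - r)))"
      by (intro Bochner_Integration.integral_cong refl) (metis cos_minus minus_diff_eq mult_minus_right)
    then show ?case using sym by (simp add: mult.commute)
  qed
  have "variance (occupation_integral \<xi> g U) = expectation (\<lambda>\<omega>. (LINT s|time_interval U. g (\<xi> s \<omega>))\<^sup>2)"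
    unfolding mean by (simp add: S)
  also have "\<dots> = (LINT p|(time_interval U \<Otimes>\<^sub>M time_interval U). expectation (\<lambda>\<omega>. g (\<xi> (fst p) \<omega>) * g (\<xi> (snd p) \<omega>)))"
    by (rule mom) (simp_all add: sq spT)
  also have "\<dots> = (LINT p|(time_interval U \<Otimes>\<^sub>M time_interval U). LINT y|\<mu>. cos (y * (fst p - snd p)))"
    by (intro Bochner_Integration.integral_cong refl cov') (auto simp: space_pair_measure spT)
  also have "\<dots> = \<mu>.fejer_transform U" by (rule \<mu>.integral_covariance[OF U])
  finally show ?thesis .
qed

end

section \<open>The equivalence\<close>

lemma scale_measure_eq_density: "scale_measure c \<mu> = density \<mu> (\<lambda>_. c)"
  by (rule measure_eqI) (simp_all add: emeasure_density nn_integral_cmult_indicator)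

theorem theorem14:
  fixes M :: "'a measure" and F :: "real \<Rightarrow> 'a measure"
    and \<pi> :: "'s measure" and \<xi> :: "real \<Rightarrow> 'a \<Rightarrow> 's"
    and g :: "'s \<Rightarrow> real" and \<nu> :: "complex measure"
    and P :: "'b measure" and W :: "real \<Rightarrow> 'b \<Rightarrow> complex" and Z :: "'b \<Rightarrow> complex"
    and \<alpha> :: real and h :: "real \<Rightarrow> real"
  assumes "stationary_markov_process M F \<pi> \<xi>"
    and "strongly_continuous \<pi> (transition_op M \<pi> \<xi>)"
    and "normal_graph \<pi> (generator \<pi> (transition_op M \<pi> \<xi>))"
    and "g \<in> L2_0 \<pi>" and "\<not> (AE x in \<pi>. g x = 0)"
    and "transition_spectral_measure \<pi> (generator \<pi> (transition_op M \<pi> \<xi>)) g \<nu>"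
    and "planar_brownian_motion P W"
    and "Z \<in> measurable P Hminus_borel"
    and "distr P Hminus_borel Z = scale_measure (inverse (emeasure \<nu> Hminus)) \<nu>"
    and "prob_space.indep_set P (sets (vimage_algebra (space P) Z Hminus_borel)) (process_events P W)"
    and "0 < \<alpha>" and "\<alpha> < 2" and "slowly_varying h"
  shows "((\<lambda>T. prob_space.variance M (occupation_integral \<xi> g T)) \<sim>[at_top] (\<lambda>T. T powr \<alpha> * h T))
    \<longleftrightarrow>
    ((\<lambda>x. measure P {\<omega> \<in> space P. exits_through Hminus (\<lambda>t. Z \<omega> + W t \<omega>) (imag_segment x)})
      \<sim>[at_right 0]
     (\<lambda>x. Cconst \<alpha> * x powr (2 - \<alpha>) * h (1 / x) / measure \<nu> Hminus))"
proof -
  obtain E where E: "spectral_resolution \<pi> Hminus_borel (generator \<pi> (transition_op M \<pi> \<xi>)) E"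
    and \<nu>: "\<nu> = pvm_measure \<pi> Hminus_borel E (\<lambda>x. complex_of_real (g x))"
    using assms(6) by (auto simp: transition_spectral_measure_def)
  interpret process: markov_spectral M F \<pi> \<xi> E
    using assms(1,3) E by (simp add: markov_spectral_def markov_spectral_axioms_def normal_graph_def)
  interpret P: prob_space P using assms(7) by (auto simp: planar_brownian_motion_def brownian_motion_def)
  interpret exit: planar_exit P W Z by unfold_locales (use assms in auto)
  let ?g = "\<lambda>x. complex_of_real (g x)"
  have gm[measurable]: "g \<in> borel_measurable \<pi>" and g2: "integrable \<pi> (\<lambda>x. (g x)\<^sup>2)" using assms(4) by (auto simp: L2_0_def)
  have gL: "?g \<in> cL2 \<pi>" using g2 by (simp add: cL2_def)
  define N where "N = measure \<nu> Hminus"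
  have fin: "finite_measure \<nu>" unfolding \<nu> by (rule process.finite_\<nu>[OF gL])
  interpret \<nu>: finite_measure \<nu> by (rule fin)
  have N: "N > 0"
  proof -
    have "N = (cL2_norm \<pi> ?g)\<^sup>2" unfolding N_def \<nu> using process.measure_\<nu>_space[OF gL] by (simp add: space_Hminus_borel)
    moreover have "cL2_norm \<pi> ?g \<noteq> 0" using cL2_norm_eq_0_iff[OF gL] assms(5) by simp
    ultimately show ?thesis by simp
  qed
  have eN: "emeasure \<nu> Hminus = ennreal N" unfolding N_def by (rule \<nu>.emeasure_eq_measure)
  have sets\<nu>[measurable_cong]: "sets \<nu> = sets Hminus_borel" unfolding \<nu> by simp
  have transform: "(LINT \<omega>|P. exp (complex_of_real r * Z \<omega>)) = (LINT z|\<nu>. exp (complex_of_real r * z)) / complex_of_real N" for r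
  proof -
    have em[measurable]: "(\<lambda>z. exp (complex_of_real r * z)) \<in> borel_measurable Hminus_borel"
      unfolding Hminus_borel_def by (rule measurable_restrict_space1) simp
    have "(LINT \<omega>|P. exp (complex_of_real r * Z \<omega>)) = (LINT z|distr P Hminus_borel Z. exp (complex_of_real r * z))"
      by (rule integral_distr[OF assms(8) em, symmetric])
    also have "\<dots> = (LINT z|density \<nu> (\<lambda>_. ennreal (inverse N)). exp (complex_of_real r * z))"
      unfolding assms(9) eN using N by (simp add: inverse_ennreal scale_measure_eq_density)
    also have "\<dots> = (LINT z|\<nu>. inverse N *\<^sub>R exp (complex_of_real r * z))"
      using N by (intro integral_density) auto
    finally show ?thesis by (simp add: scaleR_conv_of_real field_simps)
  qed
  \<comment> \<open>The sweeping of \<open>\<nu>\<close> onto the imaginary axis, with the same total mass.\<close>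
  define \<mu> where "\<mu> = density (distr P borel exit.height) (\<lambda>_. ennreal N)"
  have hm[measurable]: "exit.height \<in> borel_measurable P" by (rule exit.height_measurable)
  have \<mu>: "spectral_measure_on_line \<mu>"
  proof (intro spectral_measure_on_line.intro spectral_measure_on_line_axioms.intro finite_measureI)
    have "emeasure \<mu> (space \<mu>) = ennreal N * emeasure P (space P)" unfolding \<mu>_def
      by (simp add: emeasure_density emeasure_distr)
    then show "emeasure \<mu> (space \<mu>) \<noteq> \<infinity>" by (simp add: P.emeasure_space_1)
  qed (simp add: \<mu>_def)
  interpret \<mu>: spectral_measure_on_line \<mu> by (rule \<mu>)
  have int\<mu>: "(LINT y|\<mu>. f y) = N * (LINT \<omega>|P. f (exit.height \<omega>))" if f[measurable]: "f \<in> borel_measurable borel" for f :: "real \<Rightarrow> real"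
    unfolding \<mu>_def using N by (subst integral_density) (simp_all add: integral_distr)
  \<comment> \<open>The exit law and the spectral formula have the same transform, so the real covariance is an integral of cosines.\<close>
  have cov: "process.expectation (\<lambda>\<omega>. g (\<xi> 0 \<omega>) * g (\<xi> t \<omega>)) = (LINT y|\<mu>. cos (y * t))" if t: "t \<ge> 0" for t
  proof -
    have ih: "integrable P (\<lambda>\<omega>. exp (\<i> * complex_of_real (t * exit.height \<omega>)))"
      by (intro P.integrable_const_bound[of _ 1]) auto
    have "complex_of_real (process.expectation (\<lambda>\<omega>. g (\<xi> 0 \<omega>) * g (\<xi> t \<omega>))) = cL2_inner M (\<lambda>\<omega>. ?g (\<xi> t \<omega>)) (\<lambda>\<omega>. ?g (\<xi> 0 \<omega>))"
      unfolding cL2_inner_def integral_complex_of_real[symmetric] by (simp add: mult.commute)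
    also have "\<dots> = cL2_inner \<pi> (transition_op M \<pi> \<xi> t ?g) ?g" by (rule process.T_inner[OF t gL gL, symmetric])
    also have "\<dots> = (LINT z|\<nu>. exp (complex_of_real t * z))" unfolding \<nu> by (rule process.semigroup_spectral_formula[OF gL t])
    also have "\<dots> = complex_of_real N * (LINT \<omega>|P. exp (\<i> * complex_of_real (t * exit.height \<omega>)))"
      unfolding exit.exit_char[OF t] transform using N by simp
    finally have "process.expectation (\<lambda>\<omega>. g (\<xi> 0 \<omega>) * g (\<xi> t \<omega>)) = Re (complex_of_real N * (LINT \<omega>|P. exp (\<i> * complex_of_real (t * exit.height \<omega>))))"
      by (metis Re_complex_of_real)
    also have "\<dots> = N * (LINT \<omega>|P. Re (exp (\<i> * complex_of_real (t * exit.height \<omega>))))"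
      by (simp only: times_complex.sel Re_complex_of_real Im_complex_of_real mult_zero_left diff_0_right integral_Re[OF ih])
    also have "\<dots> = N * (LINT \<omega>|P. cos (exit.height \<omega> * t))" by (simp add: Re_exp mult.commute)
    finally show ?thesis by (simp add: int\<mu>)
  qed
  have V: "process.variance (occupation_integral \<xi> g T) = \<mu>.fejer_transform T" if "T \<ge> 0" for T
    by (rule process.variance_occupation_integral[OF assms(4) that \<mu> cov])
  have G: "P.prob {\<omega> \<in> space P. exits_through Hminus (\<lambda>t. Z \<omega> + W t \<omega>) (imag_segment x)} = \<mu>.central_mass x / N" for x
  proof -
    have A: "{y::real. \<bar>y\<bar> < x} \<in> sets borel" by measurable
    have "emeasure \<mu> {y. \<bar>y\<bar> < x} = ennreal N * emeasure P {\<omega> \<in> space P. \<bar>exit.height \<omega>\<bar> < x}"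
      unfolding \<mu>_def using A by (simp add: emeasure_density nn_integral_cmult_indicator emeasure_distr vimage_def Int_def conj_commute)
    then have "\<mu>.central_mass x = N * P.prob {\<omega> \<in> space P. \<bar>exit.height \<omega>\<bar> < x}"
      unfolding \<mu>.central_mass_def measure_def using N by (simp add: enn2real_mult)
    then show ?thesis unfolding exit.exit_probability using N by simp
  qed
  have "((\<lambda>T. process.variance (occupation_integral \<xi> g T)) \<sim>[at_top] (\<lambda>T. T powr \<alpha> * h T)) \<longleftrightarrow> (\<mu>.fejer_transform \<sim>[at_top] (\<lambda>T. T powr \<alpha> * h T))"
    by (rule asymp_equiv_cong) (auto intro!: eventually_mono[OF eventually_ge_at_top[of "0::real"]] V)
  also have "\<dots> \<longleftrightarrow> (\<mu>.central_mass \<sim>[at_right 0] (\<lambda>x. Cconst \<alpha> * x powr (2 - \<alpha>) * h (1 / x)))"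
    by (rule \<mu>.fejer_transform_tauberian[OF assms(13,11,12)])
  also have "\<dots> \<longleftrightarrow> ((\<lambda>x. \<mu>.central_mass x / N) \<sim>[at_right 0] (\<lambda>x. Cconst \<alpha> * x powr (2 - \<alpha>) * h (1 / x) / N))"
  proof
    assume "(\<lambda>x. \<mu>.central_mass x / N) \<sim>[at_right 0] (\<lambda>x. Cconst \<alpha> * x powr (2 - \<alpha>) * h (1 / x) / N)"
    from asymp_equiv_mult[OF this asymp_equiv_refl[of "\<lambda>_. N"]] N
    show "\<mu>.central_mass \<sim>[at_right 0] (\<lambda>x. Cconst \<alpha> * x powr (2 - \<alpha>) * h (1 / x))" by simp
  qed (intro asymp_equiv_divide asymp_equiv_refl)
  finally show ?thesis unfolding G N_def .
qed

end
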